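(* Let $K$ be an infinite field and let $G$ be a graph on $[n]$, with complementary graph $\overline G$ and flag complex $\mathcal F(G)$. The following conditions are equivalent: (i) $|\mathrm{Trans}(J_{\mathcal F(G)})|=1$; (ii) $|\mathrm{Gins}(J_{\mathcal F(G)})|=1$; (iii) $|\mathrm{Gins}(J_G)|=1$; (iv) $|\mathrm{Trans}(J_G)|=1$; (v) neither $G$ nor $\overline G$ contains any of the graphs $(a)$, $(b)$, $(c)$ as an induced subgraph; (vi) $G$ is, for some $k\ge 0$, a $k$-near cone of a semi-complete bipartite graph or of a disjoint union of two semi-complete graphs.
   Context: $K$ is an infinite field, $V$ is an $n$-dimensional $K$-vector space with basis $e_1,\dots,e_n$, and $E=\bigoplus_{k=0}^n\bigwedge^kV$ is its exterior algebra. For $S=\{i_1<\dots<i_k\}\subset[n]=\{1,\dots,n\}$, $e_S=e_{i_1}\wedge\cdots\wedge e_{i_k}$ is a monomial of degree $k$. $GL_n(K)$ acts on $E$ by graded algebra automorphisms, $\varphi=(a_{ij})$ acting by $\varphi(e_i)=\sum_k a_{ki}e_k$. For a term order $\sigma$ and a homogeneous ideal $J\subset E$, $\mathrm{in}_\sigma(J)$ is the initial ideal, and $\mathrm{Gin}_\sigma(J)$ is the generic initial ideal, i.e. the constant value of $\mathrm{in}_\sigma(\varphi(J))$ for $\varphi$ in a suitable nonempty Zariski open subset of $GL_n(K)$. Set $\mathrm{Gins}(J)=\{\mathrm{Gin}_\sigma(J):\sigma$ a term order with $e_1>_\sigma\cdots>_\sigma e_n\}$. A monomial ideal $J\subset E$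 is strongly stable if $e_S\in J$ implies $e_{(S\setminus\{j\})\cup\{i\}}\in J$ for all $j\in S$, $i\notin S$ with $i<j$. $\mathrm{Trans}(J)$ is the set of all strongly stable ideals $J'\subset E$ (transformed strongly stable ideals of $J$) of the form $J'=\mathrm{in}_{\sigma_k}(\varphi_k(\cdots\mathrm{in}_{\sigma_2}(\varphi_2(\mathrm{in}_{\sigma_1}(\varphi_1(J))))\cdots))$ for some $\varphi_1,\dots,\varphi_k\in GL_n(K)$ and term orders $\sigma_1,\dots,\sigma_k$. A simplicial complex $\Gamma$ on $[n]$ is a collection of subsets of $[n]$ closed under taking subsets and containing all $\{j\}$, $j\in[n]$. Its exterior face ideal $J_\Gamma\subset E$ is generated by all $e_S$ with $S\notin\Gamma$. A graph on $[n]$ is a $1$-dimensional simplicial complex on $[n]$; the notation and notions below are also used for the induced subgraphs obtained by deleting vertices and for complementary graphs (which may have no edges). The flag complex of $G$ is $\mathcal F(G)=\{S\subset[n]:\{i,j\}\in G$ for all $\{i,j\}\subset S\}$. The complementary graph $\overline G$ has vertex set $[n]$ and as edges the pairs that are not edges of $G$. The graph $(a)$ has vertices $1,2,3,4$ and edges $\{1,2\},\{1,3\},\{3,4\}$ (a path with three edges). The graph $(b)$ has vertices $1,\dots,5$ and edges $\{1,2\},\{3,4\},\{3,5\}$. The graph $(c)$ has vertices $1,\dots,6$ and edges $\{1,2\},\{3,4\},\{5,6\}$. Containing one of them as an induced subgraph means up to isomorphism. A simplicial complex $\Gamma$ is a near cone with respect to a vertex $v$ if $(S\setminus\{j\})\cup\{v\}\in\Gamma$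 for all $S\in\Gamma$ and $j\in S$. (For a graph $G$: every vertex $t\neq v$ of positive degree is adjacent to $v$.) $G-v$ is the graph obtained by deleting the vertex $v$. $G$ is a $k$-near cone of $G'$ if there are vertices $v_1,\dots,v_k\in[n]$ such that $G-\{v_1,\dots,v_{t-1}\}$ is a near cone with respect to $v_t$ for $t=1,\dots,k$ and $G'=G-\{v_1,\dots,v_k\}$, a graph on $[n]\setminus\{v_1,\dots,v_k\}$. A graph is semi-complete (resp. semi-complete bipartite) if a complete graph (resp. a complete bipartite graph) can be obtained from it by deleting isolated vertices, i.e. it is a union of a complete graph (resp. complete bipartite graph) and isolated vertices. *)

theory Defs
  imports "Jordan_Normal_Form.Matrix"
begin

section \<open>The exterior algebra\<close>

text \<open>
  An element of the exterior algebra of a vector space with basis \<open>e\<^sub>1, \<dots>, e\<^sub>n\<close> is represented by its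
  coordinates with respect to the monomials \<open>e\<^sub>S\<close>, i.e. by a function \<open>nat set \<Rightarrow> 'k\<close> supported on the
  subsets of \<open>{1..n}\<close>.
\<close>

type_synonym 'k ext = "nat set \<Rightarrow> 'k"

definition ext_algebra :: "nat \<Rightarrow> 'k::field ext set" where
  "ext_algebra n = {x. \<forall>S. x S \<noteq> 0 \<longrightarrow> S \<subseteq> {1..n}}"

definition monom_ext :: "nat set \<Rightarrow> 'k::field ext" where
  "monom_ext S = (\<lambda>T. if T = S then 1 else 0)"

text \<open>
  For disjoint \<open>T\<close> and \<open>U\<close> one has \<open>e\<^sub>T \<and> e\<^sub>U = \<plusminus> e\<^sub>S\<close> with \<open>S = T \<union> U\<close>; the sign is that of the
  permutation sorting the elements of \<open>T\<close> followed by those of \<open>U\<close>, each in increasing order.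
\<close>

definition wedge_sign :: "nat set \<Rightarrow> nat set \<Rightarrow> 'k::field" where
  "wedge_sign T U = (- 1) ^ card {(t, u). t \<in> T \<and> u \<in> U \<and> u < t}"

definition wedge :: "'k::field ext \<Rightarrow> 'k ext \<Rightarrow> 'k ext" where
  "wedge x y = (\<lambda>S. \<Sum>T\<in>Pow S. wedge_sign T (S - T) * x T * y (S - T))"

definition wedge_list :: "'k::field ext list \<Rightarrow> 'k ext" where
  "wedge_list xs = foldr wedge xs (monom_ext {})"

definition ext_ideal :: "nat \<Rightarrow> 'k::field ext set \<Rightarrow> bool" where
  "ext_ideal n J \<longleftrightarrow>
     J \<subseteq> ext_algebra n \<and> (\<lambda>S. 0) \<in> J \<and>
     (\<forall>x\<in>J. \<forall>y\<in>J. (\<lambda>S. x S + y S) \<in> J) \<and>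
     (\<forall>x\<in>J. \<forall>a\<in>ext_algebra n. wedge a x \<in> J \<and> wedge x a \<in> J)"

definition ideal_gen :: "nat \<Rightarrow> 'k::field ext set \<Rightarrow> 'k ext set" where
  "ideal_gen n X = \<Inter>{J. ext_ideal n J \<and> X \<subseteq> J}"

definition monomial_ideal :: "nat \<Rightarrow> 'k::field ext set \<Rightarrow> bool" where
  "monomial_ideal n J \<longleftrightarrow> (\<exists>M \<subseteq> Pow {1..n}. J = ideal_gen n (monom_ext ` M))"

definition strongly_stable :: "nat \<Rightarrow> 'k::field ext set \<Rightarrow> bool" where
  "strongly_stable n J \<longleftrightarrow>
     monomial_ideal n J \<and>
     (\<forall>S \<subseteq> {1..n}. \<forall>j\<in>S. \<forall>i\<in>{1..n} - S. i < j \<longrightarrow> monom_ext S \<in> J \<longrightarrow>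
        monom_ext ((S - {j}) \<union> {i}) \<in> J)"


section \<open>The action of the general linear group\<close>

definition GL :: "nat \<Rightarrow> 'k::field mat set" where
  "GL n = {A \<in> carrier_mat n n. invertible_mat A}"

text \<open>
  Matrix indices start at 0, whereas the basis vectors are \<open>e\<^sub>1, \<dots>, e\<^sub>n\<close>.
\<close>

definition gl_basis :: "nat \<Rightarrow> 'k::field mat \<Rightarrow> nat \<Rightarrow> 'k ext" where
  "gl_basis n A i = (\<lambda>S. \<Sum>k\<in>{1..n}. A $$ (k - 1, i - 1) * monom_ext {k} S)"

definition gl_act :: "nat \<Rightarrow> 'k::field mat \<Rightarrow> 'k ext \<Rightarrow> 'k ext" where
  "gl_act n A x =
     (\<lambda>T. \<Sum>S\<in>Pow {1..n}. x S * wedge_list (map (gl_basis n A) (sorted_list_of_set S)) T)"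

inductive_set poly_fun :: "nat \<Rightarrow> ('k::field mat \<Rightarrow> 'k) set" for n where
  const: "(\<lambda>A. c) \<in> poly_fun n"
| entry: "i < n \<Longrightarrow> j < n \<Longrightarrow> (\<lambda>A. A $$ (i, j)) \<in> poly_fun n"
| add: "f \<in> poly_fun n \<Longrightarrow> g \<in> poly_fun n \<Longrightarrow> (\<lambda>A. f A + g A) \<in> poly_fun n"
| mult: "f \<in> poly_fun n \<Longrightarrow> g \<in> poly_fun n \<Longrightarrow> (\<lambda>A. f A * g A) \<in> poly_fun n"

definition zariski_open_GL :: "nat \<Rightarrow> 'k::field mat set \<Rightarrow> bool" where
  "zariski_open_GL n U \<longleftrightarrow> (\<exists>F \<subseteq> poly_fun n. U = {A \<in> GL n. \<exists>f\<in>F. f A \<noteq> 0})"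


section \<open>Term orders and (generic) initial ideals\<close>

text \<open>
  Monomials \<open>e\<^sub>S\<close> are compared through their index sets; \<open>(S, T) \<in> \<sigma>\<close> means \<open>e\<^sub>S \<le> e\<^sub>T\<close>. Compatibility
  with multiplication is required for nonzero products only: \<open>e\<^sub>S \<and> e\<^sub>U \<noteq> 0\<close> iff \<open>S \<inter> U = {}\<close>.
\<close>

definition term_order :: "nat \<Rightarrow> nat set rel \<Rightarrow> bool" where
  "term_order n \<sigma> \<longleftrightarrow>
     linear_order_on (Pow {1..n}) \<sigma> \<and>
     (\<forall>S \<subseteq> {1..n}. ({}, S) \<in> \<sigma>) \<and>
     (\<forall>S T U. U \<subseteq> {1..n} \<longrightarrow> (S, T) \<in> \<sigma> \<longrightarrow> S \<inter> U = {} \<longrightarrow> T \<inter> U = {} \<longrightarrow>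
        (S \<union> U, T \<union> U) \<in> \<sigma>)"

definition standard_term_order :: "nat \<Rightarrow> nat set rel \<Rightarrow> bool" where
  "standard_term_order n \<sigma> \<longleftrightarrow>
     term_order n \<sigma> \<and> (\<forall>i\<in>{1..n}. \<forall>j\<in>{1..n}. i < j \<longrightarrow> ({j}, {i}) \<in> \<sigma>)"

definition leading :: "nat set rel \<Rightarrow> 'k::field ext \<Rightarrow> nat set \<Rightarrow> bool" where
  "leading \<sigma> x S \<longleftrightarrow> x S \<noteq> 0 \<and> (\<forall>T. x T \<noteq> 0 \<longrightarrow> (T, S) \<in> \<sigma>)"

definition initial_ideal :: "nat \<Rightarrow> nat set rel \<Rightarrow> 'k::field ext set \<Rightarrow> 'k ext set" where
  "initial_ideal n \<sigma> J = ideal_gen n {monom_ext S | S. \<exists>x\<in>J. leading \<sigma> x S}"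

text \<open>
  Over an infinite field two nonempty Zariski open subsets of \<open>GL n\<close> meet, so there is at most one
  ideal as described below.
\<close>

definition Gin :: "nat \<Rightarrow> nat set rel \<Rightarrow> 'k::field ext set \<Rightarrow> 'k ext set" where
  "Gin n \<sigma> J = (THE I. \<exists>U. zariski_open_GL n U \<and> U \<noteq> {} \<and>
     (\<forall>A\<in>U. initial_ideal n \<sigma> (gl_act n A ` J) = I))"

definition Gins :: "nat \<Rightarrow> 'k::field ext set \<Rightarrow> 'k ext set set" where
  "Gins n J = {Gin n \<sigma> J | \<sigma>. standard_term_order n \<sigma>}"

inductive_set iterated_initials :: "nat \<Rightarrow> 'k::field ext set \<Rightarrow> 'k ext set set" for n J where
  first: "A \<in> GL n \<Longrightarrow> term_order n \<sigma> \<Longrightarrow>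
    initial_ideal n \<sigma> (gl_act n A ` J) \<in> iterated_initials n J"
| further: "I \<in> iterated_initials n J \<Longrightarrow> A \<in> GL n \<Longrightarrow> term_order n \<sigma> \<Longrightarrow>
    initial_ideal n \<sigma> (gl_act n A ` I) \<in> iterated_initials n J"

definition Trans :: "nat \<Rightarrow> 'k::field ext set \<Rightarrow> 'k ext set set" where
  "Trans n J = {I \<in> iterated_initials n J. strongly_stable n I}"


section \<open>Simplicial complexes and graphs\<close>

definition simplicial_complex :: "nat \<Rightarrow> nat set set \<Rightarrow> bool" where
  "simplicial_complex n \<Gamma> \<longleftrightarrow>
     \<Gamma> \<subseteq> Pow {1..n} \<and> (\<forall>S\<in>\<Gamma>. \<forall>T \<subseteq> S. T \<in> \<Gamma>) \<and> (\<forall>j\<in>{1..n}. {j} \<in> \<Gamma>)"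

definition face_ideal :: "nat \<Rightarrow> nat set set \<Rightarrow> 'k::field ext set" where
  "face_ideal n \<Gamma> = ideal_gen n {monom_ext S | S. S \<subseteq> {1..n} \<and> S \<notin> \<Gamma>}"

text \<open>
  A graph is a simplicial complex of dimension exactly 1, so it has at least one edge. The
  operations below are also applied to complexes of smaller dimension. Since a complex contains
  all its vertices as singletons, its vertex set is its union.
\<close>

definition graph_on :: "nat \<Rightarrow> nat set set \<Rightarrow> bool" where
  "graph_on n G \<longleftrightarrow>
     simplicial_complex n G \<and> (\<forall>S\<in>G. card S \<le> 2) \<and> (\<exists>S\<in>G. card S = 2)"

definition verts :: "nat set set \<Rightarrow> nat set" where
  "verts \<Gamma> = \<Union>\<Gamma>"

definition mk_graph :: "nat set \<Rightarrow> nat set set \<Rightarrow> nat set set" where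
  "mk_graph W E = {{}} \<union> {{v} | v. v \<in> W} \<union> E"

definition flag_complex :: "nat set set \<Rightarrow> nat set set" where
  "flag_complex G = {S. S \<subseteq> verts G \<and> (\<forall>i\<in>S. \<forall>j\<in>S. i \<noteq> j \<longrightarrow> {i, j} \<in> G)}"

definition complement_graph :: "nat set set \<Rightarrow> nat set set" where
  "complement_graph G =
     mk_graph (verts G) {{i, j} | i j. i \<in> verts G \<and> j \<in> verts G \<and> i \<noteq> j \<and> {i, j} \<notin> G}"

definition contains_induced :: "nat set set \<Rightarrow> nat set set \<Rightarrow> bool" where
  "contains_induced G H \<longleftrightarrow>
     (\<exists>W \<subseteq> verts G. \<exists>f. bij_betw f (verts H) W \<and> (\<lambda>S. f ` S) ` H = {S \<in> G. S \<subseteq> W})"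

definition graph_a :: "nat set set" where
  "graph_a = mk_graph {1..4} {{1, 2}, {1, 3}, {3, 4}}"

definition graph_b :: "nat set set" where
  "graph_b = mk_graph {1..5} {{1, 2}, {3, 4}, {3, 5}}"

definition graph_c :: "nat set set" where
  "graph_c = mk_graph {1..6} {{1, 2}, {3, 4}, {5, 6}}"

definition delete_verts :: "nat set set \<Rightarrow> nat set \<Rightarrow> nat set set" where
  "delete_verts \<Gamma> W = {S \<in> \<Gamma>. S \<inter> W = {}}"

definition near_cone :: "nat set set \<Rightarrow> nat \<Rightarrow> bool" where
  "near_cone \<Gamma> v \<longleftrightarrow> v \<in> verts \<Gamma> \<and> (\<forall>S\<in>\<Gamma>. \<forall>j\<in>S. (S - {j}) \<union> {v} \<in> \<Gamma>)"

definition k_near_cone :: "nat \<Rightarrow> nat set set \<Rightarrow> nat set set \<Rightarrow> bool" where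
  "k_near_cone k G G' \<longleftrightarrow>
     (\<exists>v :: nat \<Rightarrow> nat. (\<forall>t\<in>{1..k}. near_cone (delete_verts G (v ` {1..<t})) (v t)) \<and>
        G' = delete_verts G (v ` {1..k}))"

definition isolated_vertex :: "nat set set \<Rightarrow> nat \<Rightarrow> bool" where
  "isolated_vertex G v \<longleftrightarrow> v \<in> verts G \<and> (\<forall>S\<in>G. v \<in> S \<longrightarrow> S = {v})"

definition complete_graph :: "nat set \<Rightarrow> nat set set" where
  "complete_graph W = mk_graph W {{i, j} | i j. i \<in> W \<and> j \<in> W \<and> i \<noteq> j}"

definition complete_bipartite_graph :: "nat set \<Rightarrow> nat set \<Rightarrow> nat set set" where
  "complete_bipartite_graph A B = mk_graph (A \<union> B) {{a, b} | a b. a \<in> A \<and> b \<in> B}"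

definition semi_complete :: "nat set set \<Rightarrow> bool" where
  "semi_complete G \<longleftrightarrow>
     (\<exists>I W. (\<forall>v\<in>I. isolated_vertex G v) \<and> delete_verts G I = complete_graph W)"

definition semi_complete_bipartite :: "nat set set \<Rightarrow> bool" where
  "semi_complete_bipartite G \<longleftrightarrow>
     (\<exists>I A B. (\<forall>v\<in>I. isolated_vertex G v) \<and> A \<inter> B = {} \<and>
        delete_verts G I = complete_bipartite_graph A B)"

definition disjoint_union_two_semi_complete :: "nat set set \<Rightarrow> bool" where
  "disjoint_union_two_semi_complete G \<longleftrightarrow>
     (\<exists>G1 G2. semi_complete G1 \<and> semi_complete G2 \<and> verts G1 \<inter> verts G2 = {} \<and> G = G1 \<union> G2)"

end

theory Submission
 imports Defs "HOL-Library.Function_Algebras" "HOL-Library.Nat_Bijection"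
  "Jordan_Normal_Form.Determinant" "HOL-Computational_Algebra.Polynomial"
begin

text \<open>
 Only the degree 2 part of the ideals matters: a graph, whose edges are the nonedges of \<open>G\<close>. If it
 arises from a complete bipartite graph or a disjoint union of two complete graphs by adding isolated
 vertices and universal vertices (adjacent to all others), then the leading terms of its image in any
 coordinates form a graph of the same kind with the same parameters. A strongly stable graph is
 determined by these parameters; together with the Hilbert function they determine every strongly
 stable ideal that is reached, so there is only one.

 Conversely, a common generic initial ideal for the lexicographic and the reverse lexicographic order
 survives the removal of universal and of isolated vertices. If none is left and the graph is not
 of the above form, coordinates adapted to the components of the graph or of its complement show that
 the lexicographic generic initial ideal contains a pair which the reverse lexicographic one cannot
 contain. Seinsche's theorem turns the recursive description of the graphs into forbidden induced
 subgraphs.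
\<close>

subsection \<open>Leading terms\<close>

text \<open>The members of \<open>Trans\<close> come from arbitrary coordinates, so genericity is of
  no help for them. Inclusion plus counting takes its place: a family of the required type is
  exhibited among the leading terms, and as their number is fixed, these are all of them. The
  delicate case is that of two complementary subspaces whose leading indices overlap; the overlaps
  are the origin of the rules \<open>pq_step\<close> and \<open>pp_step\<close>. Degree 2 alone does
  not determine an initial ideal of the flag complex, since new cubic generators can appear. They
  are controlled by a vertex set \<open>U\<close> all of whose triples lie in the ideal; taking for
  \<open>U\<close> all vertices treats the ideal of the graph itself. For the converse, a common
  generic initial ideal is weakened to the inequalities \<open>dominates\<close>, which pass to
  smaller vertex sets. The lexicographic order counts pairs meeting an initial segment, the reverse
  lexicographic one pairs inside it; orthogonal complements exchange a graph with its complement and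
  reverse the order.\<close>

declare plus_fun_apply [simp del] zero_fun_apply [simp del]

text \<open>Polymorphic in the index: over \<open>nat\<close> these functions are vectors, over
  \<open>nat set\<close> they are elements of the exterior algebra, and the facts on leading terms
  serve both.\<close>

definition fscale :: "'k::field => ('i => 'k) => 'i => 'k" where
 "fscale c x = (\<lambda>i. c * x i)"

lemma fscale_apply: "fscale c x i = c * x i"
 by (simp add: fscale_def)

lemmas fun_apply = plus_fun_apply zero_fun_apply fscale_apply

interpretation fvs: vector_space "fscale :: 'k::field => ('i => 'k) => 'i => 'k"
 by unfold_locales (auto simp: fun_eq_iff algebra_simps fun_apply)

definition fsupp :: "'i set => ('i => 'k::zero) set" where
 "fsupp X = {x. \<forall>i. x i ~= 0 --> i \<in> X}"

definition unitf :: "'i => 'i => 'k::zero_neq_one" where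
 "unitf i = (\<lambda>j. if j = i then 1 else 0)"

text \<open>The order enters as a rank with values in \<open>nat\<close>, which permits induction on
  ranks. That ranks do not tie is a separate hypothesis \<open>inj_on rk X\<close> where it
  matters.\<close>

definition ld :: "('i => nat) => ('i => 'k::zero) => 'i => bool" where
 "ld rk x i \<longleftrightarrow> x i ~= 0 \<and> (\<forall>j. x j ~= 0 --> rk j \<le> rk i)"

definition leads :: "('i => nat) => ('i => 'k::zero) set => 'i set" where
 "leads rk J = {i. \<exists>x\<in>J. ld rk x i}"

lemma subspace_fsupp: "fvs.subspace (fsupp X)"
 by (auto simp: fvs.subspace_def fsupp_def fun_apply; metis add.right_neutral)

lemma fsuppD: "x \<in> fsupp X ==> x i ~= 0 ==> i \<in> X"
 by (simp add: fsupp_def)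

lemma span_fsupp: "B \<subseteq> fsupp X ==> fvs.span B \<subseteq> fsupp X"
 by (rule fvs.span_minimal[OF _ subspace_fsupp])

lemma leads_mono: "J \<subseteq> J' ==> leads rk J \<subseteq> leads rk J'"
 by (auto simp: leads_def)

lemma leads_subset: "J \<subseteq> fsupp X ==> leads rk J \<subseteq> X"
 by (auto simp: leads_def ld_def fsupp_def)

lemma leadsI: "x \<in> J ==> ld rk x i ==> i \<in> leads rk J"
 by (auto simp: leads_def)

lemma ld_unitf: "ld rk (unitf i :: 'i => 'k::zero_neq_one) i"
 by (auto simp: ld_def unitf_def)

lemma ld_exists:
 assumes "finite X" "x \<in> fsupp X" "x ~= 0"
 obtains i where "i \<in> X" "ld rk x i"
proof -
 let ?S = "{i. x i ~= 0}"
 have S: "?S \<subseteq> X" "?S ~= {}" using assms by (auto simp: fsupp_def fun_eq_iff fun_apply)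
 then have "finite ?S" using assms(1) finite_subset by blast
 then have "Max (rk ` ?S) \<in> rk ` ?S" using S(2) by (intro Max_in) auto
 then obtain i where "i \<in> ?S" "Max (rk ` ?S) = rk i" by blast
 moreover have "rk j \<le> Max (rk ` ?S)" if "j \<in> ?S" for j
  using that \<open>finite ?S\<close> by (intro Max_ge) auto
 ultimately show thesis using that[of i] S by (auto simp: ld_def)
qed

lemma ld_fscale: "c ~= 0 ==> ld rk (fscale c x) i \<longleftrightarrow> ld rk x i"
 by (simp add: ld_def fun_apply)

lemma ld_add_less:
 fixes x y :: "'i => 'k::field"
 assumes "ld rk x i" "\<And>j. y j ~= 0 ==> rk j < rk i"
 shows "ld rk (x + y) i"
proof -
 have "y i = 0" using assms(2) by fastforce
 moreover have "rk j \<le> rk i" if "(x + y) j ~= 0" for j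
  using that assms unfolding ld_def by (metis add.right_neutral less_imp_le plus_fun_apply)
 ultimately show ?thesis using assms(1) by (simp add: ld_def plus_fun_apply)
qed

lemma ld_sub_cancel:
 fixes x y :: "'i => 'k::field"
 assumes "finite X" "inj_on rk X" "x \<in> fsupp X" "y \<in> fsupp X" "ld rk x i" "ld rk y i"
  "z = x - fscale (x i / y i) y" "z j ~= 0"
 shows "rk j < rk i"
proof -
 have "z i = 0" using assms by (simp add: ld_def fun_apply)
 then have "j ~= i" using assms(8) by metis
 have "x j ~= 0 \<or> y j ~= 0" using assms(7,8) by (auto simp: fun_apply)
 then have "j \<in> X" "rk j \<le> rk i" using assms by (auto simp: ld_def fsupp_def)
 moreover have "i \<in> X" using assms by (auto simp: ld_def fsupp_def)
 ultimately show ?thesis using assms(2) \<open>j ~= i\<close> by (metis inj_onD le_neq_implies_less)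
qed

text \<open>Echelon form: the indices are traversed by increasing rank, and all vectors already
  treated vanish at the new leading index, so the new vector lies outside their span.\<close>

lemma leads_independent:
 fixes x :: "'i => 'i => 'k::field"
 assumes "finite I" "inj_on rk I" "\<And>i. i \<in> I ==> ld rk (x i) i"
 shows "fvs.independent (x ` I) \<and> inj_on x I"
 using assms
proof (induction I rule: finite_ranking_induct[where f = rk])
 case empty
 then show ?case using fvs.independent_empty by auto
next
 case (insert i I)
 show ?case
 proof (cases "i \<in> I")
  case True
  then show ?thesis using insert by (simp add: insert_absorb)
 next
  case False
  have ih: "fvs.independent (x ` I)" "inj_on x I" using insert by (auto simp: inj_on_insert)
  have "x ` I \<subseteq> {y. y i = 0}"
  proof clarify
   fix j assume j: "j \<in> I"
   then have "rk j < rk i" using insert.hyps(2) insert.prems(1) False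
    by (metis inj_onD insertI1 insertI2 le_neq_implies_less)
   then show "x j i = 0" using insert.prems(2)[of j] j unfolding ld_def by fastforce
  qed
  then have "fvs.span (x ` I) \<subseteq> {y. y i = 0}"
   by (rule fvs.span_minimal) (auto simp: fvs.subspace_def fun_apply)
  moreover have "x i i ~= 0" using insert.prems(2)[of i] by (simp add: ld_def)
  ultimately have n: "x i \<notin> fvs.span (x ` I)" by auto
  then have "x i \<notin> x ` I" using fvs.span_base by blast
  then show ?thesis using ih n fvs.independent_insertI[OF n ih(1)] False by auto
 qed
qed

text \<open>Instead of dimensions, sizes of spanning sets are compared with the number of leading
  indices; \<open>subspace_span_leads\<close> supplies the opposite inequality.\<close>

lemma card_leads_le:
 fixes J :: "('i => 'k::field) set"
 assumes "finite B" "J \<subseteq> fvs.span B" "finite X" "inj_on rk X" "J \<subseteq> fsupp X"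
 shows "card (leads rk J) \<le> card B"
proof -
 define x where "x i = (SOME x. x \<in> J \<and> ld rk x i)" for i
 have x: "x i \<in> J \<and> ld rk (x i) i" if "i \<in> leads rk J" for i
  using that someI_ex[of "\<lambda>x. x \<in> J \<and> ld rk x i"] by (auto simp: leads_def x_def)
 have L: "leads rk J \<subseteq> X" by (rule leads_subset[OF assms(5)])
 have "fvs.independent (x ` leads rk J) \<and> inj_on x (leads rk J)"
  by (rule leads_independent[where rk = rk])
   (use L assms x in \<open>auto intro: finite_subset inj_on_subset\<close>)
 moreover have "x ` leads rk J \<subseteq> fvs.span B" using x assms(2) by blast
 ultimately have "card (x ` leads rk J) \<le> card B"
  using fvs.independent_span_bound[OF assms(1)] by blast
 then show ?thesis
  using \<open>_ \<and> inj_on x (leads rk J)\<close> by (simp add: card_image)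
qed

text \<open>Gaussian reduction: cancelling the leading term against the chosen representative lowers
  the rank, so the representatives span \<open>J\<close>.\<close>

lemma subspace_span_leads:
 fixes J :: "('i => 'k::field) set"
 assumes "finite X" "inj_on rk X" "J \<subseteq> fsupp X" "fvs.subspace J"
 obtains B where "finite B" "card B \<le> card (leads rk J)" "J \<subseteq> fvs.span B"
proof -
 define x where "x i = (SOME x. x \<in> J \<and> ld rk x i)" for i
 have x: "x i \<in> J \<and> ld rk (x i) i" if "i \<in> leads rk J" for i
  using that someI_ex[of "\<lambda>x. x \<in> J \<and> ld rk x i"] by (auto simp: leads_def x_def)
 have L: "leads rk J \<subseteq> X" by (rule leads_subset[OF assms(3)])
 have "y \<in> fvs.span (x ` leads rk J)" if "y \<in> J" "\<And>j. y j ~= 0 ==> rk j < m" for y m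
  using that
 proof (induction m arbitrary: y)
  case 0
  then have "y = 0" by (auto simp: fun_eq_iff fun_apply)
  then show ?case by (simp add: fvs.span_zero)
 next
  case (Suc m)
  show ?case
  proof (cases "y = 0")
   case True
   then show ?thesis by (simp add: fvs.span_zero)
  next
   case False
   obtain i where i: "i \<in> X" "ld rk y i"
    using ld_exists[OF assms(1) _ False, of rk] Suc.prems assms(3) by blast
   have iL: "i \<in> leads rk J" using i Suc.prems by (auto intro: leadsI)
   define z where "z = y - fscale (y i / x i i) (x i)"
   have "z \<in> J" unfolding z_def using x[OF iL] Suc.prems assms(4)
    by (simp add: fvs.subspace_diff fvs.subspace_scale)
   moreover have "rk j < m" if "z j ~= 0" for j
   proof -
    have "rk j < rk i"
     by (rule ld_sub_cancel[OF assms(1,2) _ _ i(2) _ z_def that])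
      (use x[OF iL] Suc.prems assms(3) in auto)
    moreover have "rk i < Suc m" using Suc.prems(2) i by (auto simp: ld_def)
    ultimately show ?thesis by simp
   qed
   ultimately have "z \<in> fvs.span (x ` leads rk J)" using Suc.IH by blast
   moreover have "y = z + fscale (y i / x i i) (x i)" by (simp add: z_def fun_eq_iff fun_apply)
   moreover have "fscale (y i / x i i) (x i) \<in> fvs.span (x ` leads rk J)"
    by (rule fvs.span_scale[OF fvs.span_base]) (use iL in simp)
   ultimately show ?thesis by (metis fvs.span_add)
  qed
 qed
 \<comment> \<open>The sum of all ranks bounds each of them, so a single \<open>m\<close> serves
   every vector of \<open>J\<close>.\<close>
 moreover have "rk j < Suc (\<Sum>i\<in>X. rk i)" if "y \<in> J" "y j ~= 0" for y j
  using that assms(1,3) member_le_sum[of j X rk] by (force simp: fsupp_def)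
 ultimately have "J \<subseteq> fvs.span (x ` leads rk J)" by blast
 moreover have "finite (leads rk J)" using L assms(1) finite_subset by blast
 ultimately show thesis using that[of "x ` leads rk J"] card_image_le by auto
qed

lemma card_le_leads:
 fixes J :: "('i => 'k::field) set"
 assumes "finite X" "inj_on rk X" "J \<subseteq> fsupp X" "fvs.subspace J" "fvs.independent B" "B \<subseteq> J"
 shows "card B \<le> card (leads rk J)"
proof -
 obtain C where "finite C" "card C \<le> card (leads rk J)" "J \<subseteq> fvs.span C"
  using subspace_span_leads[OF assms(1-4)] by blast
 then show ?thesis using fvs.independent_span_bound[of C B] assms by force
qed

text \<open>Independence of the family is implicit in its spanning all unit vectors with
  \<open>card I = card X\<close>. For the lower bound, a small spanning set of the subfamily,
  completed by the remaining members, would span all unit vectors and so has at least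
  \<open>card X\<close> elements.\<close>

lemma card_leads_family:
 fixes b :: "'j => 'i => 'k::field"
 assumes "finite X" "inj_on rk X" "finite I" "card I = card X" "b ` I \<subseteq> fsupp X"
  and span: "\<And>i. i \<in> X ==> unitf i \<in> fvs.span (b ` I)" and "I' \<subseteq> I"
 shows "card (leads rk (fvs.span (b ` I'))) = card I'"
proof (rule antisym)
 have s: "fvs.span (b ` I') \<subseteq> fsupp X" by (rule span_fsupp) (use assms in auto)
 have f: "finite I'" using assms finite_subset by blast
 have "card (leads rk (fvs.span (b ` I'))) \<le> card (b ` I')"
  by (rule card_leads_le[OF _ _ assms(1,2) s]) (use f in auto)
 then show "card (leads rk (fvs.span (b ` I'))) \<le> card I'" using card_image_le[OF f] le_trans by blast
 obtain B where B: "finite B" "card B \<le> card (leads rk (fvs.span (b ` I')))"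
  "fvs.span (b ` I') \<subseteq> fvs.span B"
  using subspace_span_leads[OF assms(1,2) s fvs.subspace_span] by blast
 have "b ` I \<subseteq> fvs.span (B \<union> b ` (I - I'))"
 proof
  fix y assume "y \<in> b ` I"
  then consider "y \<in> b ` I'" | "y \<in> b ` (I - I')" by auto
  then show "y \<in> fvs.span (B \<union> b ` (I - I'))"
  proof cases
   case 1
   then have "y \<in> fvs.span B" using B(3) fvs.span_base by blast
   then show ?thesis using fvs.span_mono[of B "B \<union> b ` (I - I')"] by blast
  qed (auto intro: fvs.span_base)
 qed
 then have sp: "fvs.span (b ` I) \<subseteq> fvs.span (B \<union> b ` (I - I'))"
  by (rule fvs.span_minimal) simp
 have ind0: "fvs.independent ((unitf :: 'i => 'i => 'k) ` X) \<and> inj_on (unitf :: 'i => 'i => 'k) X"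
  by (rule leads_independent[OF assms(1,2)]) (rule ld_unitf)
 note ind = conjunct1[OF ind0] conjunct2[OF ind0]
 have "unitf ` X \<subseteq> fvs.span (B \<union> b ` (I - I'))" using span sp by blast
 then have "card ((unitf :: 'i => 'i => 'k) ` X) \<le> card (B \<union> b ` (I - I'))"
  by (intro conjunct2[OF fvs.independent_span_bound[OF _ ind(1)]]) (use B(1) assms(3) in auto)
 moreover have "card (b ` (I - I')) \<le> card (I - I')" by (rule card_image_le) (use assms(3) in simp)
 ultimately have "card X \<le> card B + card (I - I')"
  using card_image[OF ind(2)] card_Un_le[of B "b ` (I - I')"] by linarith
 moreover have "card (I - I') = card I - card I'" using assms f by (auto simp: card_Diff_subset)
 moreover have "card I' \<le> card I" by (rule card_mono) (use assms in auto)
 ultimately show "card I' \<le> card (leads rk (fvs.span (b ` I')))" using B(2) assms(4) by linarith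
qed

subsection \<open>Products of vectors\<close>

text \<open>The sign in the product of \<open>e_i\<close> with the monomial of
  \<open>S - {i}\<close>: the factor \<open>e_i\<close> has to pass the elements below
  \<open>i\<close>.\<close>

definition lsgn :: "nat => nat set => 'k::field" where
 "lsgn i S = (- 1) ^ card {u \<in> S. u < i}"

text \<open>\<open>lv v z\<close> is the product of the vector \<open>v\<close>, a function of the index of its coordinates, with \<open>z\<close>.\<close>

definition lv :: "(nat => 'k::field) => 'k ext => 'k ext" where
 "lv v z = (\<lambda>S. \<Sum>i\<in>S. lsgn i S * v i * z (S - {i}))"

lemma lsgn_nonzero [simp]: "lsgn i S ~= (0 :: 'k::field)"
 by (simp add: lsgn_def)

lemma lv_add_left: "lv (v + w) z = lv v z + lv w z"
 by (auto simp: lv_def fun_eq_iff plus_fun_apply algebra_simps sum.distrib)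

lemma lv_add_right: "lv v (z + w) = lv v z + lv v w"
 by (auto simp: lv_def fun_eq_iff plus_fun_apply algebra_simps sum.distrib)

lemma lv_scale_left: "lv (fscale c v) z = fscale c (lv v z)"
 by (auto simp: lv_def fun_eq_iff fscale_apply sum_distrib_left mult_ac intro!: sum.cong)

lemma lv_scale_right: "lv v (fscale c z) = fscale c (lv v z)"
 by (auto simp: lv_def fun_eq_iff fscale_apply sum_distrib_left mult_ac intro!: sum.cong)

lemma lv_zero_left: "lv 0 z = 0"
 by (auto simp: lv_def fun_eq_iff zero_fun_apply)

lemma lv_zero_right: "lv v 0 = 0"
 by (auto simp: lv_def fun_eq_iff zero_fun_apply)

lemma uminus_fscale: "- x = fscale (- 1 :: 'k::field) x"
 by (auto simp: fun_eq_iff fscale_apply)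

lemma minus_fscale: "x - y = x + fscale (- 1 :: 'k::field) y"
 by (auto simp: fun_eq_iff fun_apply)

lemma lv_diff_left: "lv (v - w) z = lv v z - lv w z"
 by (simp only: minus_fscale lv_add_left lv_scale_left)

lemma lv_diff_right: "lv v (z - w) = lv v z - lv v w"
 by (simp only: minus_fscale lv_add_right lv_scale_right)

lemma lv_span:
 assumes "a \<in> fvs.span A" "z \<in> fvs.span B" "\<And>a z. a \<in> A ==> z \<in> B ==> lv a z \<in> fvs.span D"
 shows "lv a z \<in> fvs.span D"
proof -
 have 1: "lv a z \<in> fvs.span D" if "a \<in> A" for a
  using assms(2)
 proof (induction z rule: fvs.span_induct_alt)
  case base
  then show ?case by (simp add: lv_zero_right fvs.span_zero)
 next
  case (step c x y)
  then show ?case unfolding lv_add_right lv_scale_right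
   using assms(3)[OF that] by (metis fvs.span_add fvs.span_scale)
 qed
 show ?thesis using assms(1)
 proof (induction a rule: fvs.span_induct_alt)
  case base
  then show ?case by (simp add: lv_zero_left fvs.span_zero)
 next
  case (step c x y)
  then show ?case unfolding lv_add_left lv_scale_left
   using 1 by (metis fvs.span_add fvs.span_scale)
 qed
qed

text \<open>Exactly one of the two removals shifts a count: for \<open>i < j\<close>, deleting
  \<open>i\<close> lowers the number of elements below \<open>j\<close> by one, while deleting
  \<open>j\<close> leaves the elements below \<open>i\<close> alone.\<close>

lemma lsgn_swap:
 assumes "finite S" "i \<in> S" "j \<in> S" "i ~= j"
 shows "lsgn i S * lsgn j (S - {i}) = (- (lsgn j S * lsgn i (S - {j})) :: 'k::field)"
proof -
 have *: "lsgn i S * lsgn j (S - {i}) = (- (lsgn j S * lsgn i (S - {j})) :: 'k::field)"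
  if "i < j" "i \<in> S" "j \<in> S" for i j
 proof -
  have "{u \<in> S - {i}. u < j} = {u \<in> S. u < j} - {i}" "{u \<in> S - {j}. u < i} = {u \<in> S. u < i}"
   using that by auto
  moreover have "card {u \<in> S. u < j} = Suc (card ({u \<in> S. u < j} - {i}))"
   by (rule card.remove) (use that assms(1) in auto)
  ultimately show ?thesis by (simp add: lsgn_def)
 qed
 show ?thesis using *[of i j] *[of j i] assms by (cases "i < j") auto
qed

text \<open>The diagonal is assumed to vanish separately, because in characteristic 2 antisymmetry
  does not imply it.\<close>

lemma sum_antisym:
 fixes a :: "'i => 'i => 'k::ab_group_add"
 assumes "finite S" "\<And>i. i \<in> S ==> a i i = 0" "\<And>i j. i \<in> S ==> j \<in> S ==> a i j = - a j i"
 shows "(\<Sum>i\<in>S. \<Sum>j\<in>S. a i j) = 0"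
 using assms
proof (induction S rule: finite_induct)
 case empty
 show ?case by simp
next
 case (insert x S)
 have "(\<Sum>j\<in>S. a x j) = - (\<Sum>i\<in>S. a i x)"
  unfolding sum_negf[symmetric] by (rule sum.cong[OF refl]) (rule insert.prems(2); simp)
 moreover have "(\<Sum>i\<in>S. \<Sum>j\<in>S. a i j) = 0"
  by (rule insert.IH) (rule insert.prems; simp)+
 moreover have "a x x = 0" by (rule insert.prems) simp
 ultimately show ?case using insert.hyps by (simp add: sum.distrib)
qed

lemma lv_lv:
 assumes "finite S"
 shows "lv v (lv u z) S = (\<Sum>i\<in>S. \<Sum>j\<in>S. if i = j then 0 else
  lsgn i S * lsgn j (S - {i}) * v i * u j * z (S - {i} - {j}))"
proof -
 have "lsgn i S * v i * (\<Sum>j\<in>S - {i}. lsgn j (S - {i}) * u j * z (S - {i} - {j})) =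
  (\<Sum>j\<in>S. if i = j then 0 else lsgn i S * lsgn j (S - {i}) * v i * u j * z (S - {i} - {j}))"
  if "i \<in> S" for i
  using sum.remove[OF assms that, of "\<lambda>j. if i = j then 0 else lsgn i S * lsgn j (S - {i}) * v i * u j * z (S - {i} - {j})"]
  by (auto simp: sum_distrib_left mult_ac intro!: sum.cong)
 then show ?thesis unfolding lv_def by (intro sum.cong) auto
qed

lemma lv_infinite: "infinite S ==> lv v z S = 0"
 by (simp add: lv_def)

lemma lv_self: "lv v (lv v z) = 0"
proof
 fix S
 show "lv v (lv v z) S = 0 S"
 proof (cases "finite S")
  case True
  show ?thesis unfolding lv_lv[OF True] zero_fun_apply
  proof (rule sum_antisym[OF True])
   fix i j assume ij: "i \<in> S" "j \<in> S"
   have "S - {i} - {j} = S - {j} - {i}" by auto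
   then show "(if i = j then 0 else lsgn i S * lsgn j (S - {i}) * v i * v j * z (S - {i} - {j})) =
    - (if j = i then 0 else lsgn j S * lsgn i (S - {j}) * v j * v i * z (S - {j} - {i}))"
    using lsgn_swap[OF True ij, where 'k = 'a] by (simp add: mult_ac)
  qed simp
 qed (simp add: lv_infinite zero_fun_apply)
qed

text \<open>Polarization of \<open>lv_self\<close> at \<open>v + u\<close>.\<close>

lemma lv_anticomm: "lv v (lv u z) = - lv u (lv v z)"
proof -
 have "lv (v + u) (lv (v + u) z) = lv v (lv u z) + lv u (lv v z)"
  by (simp only: lv_add_left lv_add_right lv_self) simp
 then show ?thesis by (simp add: lv_self eq_neg_iff_add_eq_0)
qed

abbreviation e0 :: "'k::field ext" where "e0 \<equiv> unitf {}"

definition vmul :: "(nat => nat => 'k::field) => nat list => 'k ext" where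
 "vmul v xs = foldr (\<lambda>x. lv (v x)) xs e0"

definition vm :: "(nat => nat => 'k::field) => nat set => 'k ext" where
 "vm v S = vmul v (sorted_list_of_set S)"

lemma vmul_simps [simp]: "vmul v [] = e0" "vmul v (x # xs) = lv (v x) (vmul v xs)"
 by (simp_all add: vmul_def)

text \<open>Only a nonzero scalar is recorded instead of the sign: spans and leading terms do not
  see it. This frees products over sorted lists from the order of their factors.\<close>

lemma vmul_insort:
 "\<exists>s. s ~= 0 \<and> lv (v x) (vmul v ys) = fscale (s :: 'k::field) (vmul v (insort x ys))"
proof (induction ys)
 case Nil
 then show ?case by (intro exI[of _ 1]) (simp add: fvs.scale_one)
next
 case (Cons y ys)
 then obtain s where s: "s ~= 0" "lv (v x) (vmul v ys) = fscale s (vmul v (insort x ys))" by blast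
 have "lv (v x) (lv (v y) (vmul v ys)) = fscale (- s) (lv (v y) (vmul v (insort x ys)))"
  by (subst lv_anticomm) (simp add: s lv_scale_right)
 then show ?case using s(1) by (cases "x \<le> y") (auto intro: exI[of _ 1] exI[of _ "- s"] simp: fvs.scale_one)
qed

lemma vmul_repeat: "x \<in> set ys ==> lv (v x) (vmul v ys) = 0"
proof (induction ys)
 case (Cons y ys)
 then show ?case
  by (cases "x = y") (auto simp: lv_self lv_zero_right lv_anticomm[of "v x" "v y"])
qed simp

lemma vm_empty [simp]: "vm v {} = e0"
 by (simp add: vm_def)

lemma lv_vm_insert:
 assumes "finite S" "x \<notin> S"
 obtains s where "s ~= 0" "lv (v x) (vm v S) = fscale (s :: 'k::field) (vm v (insert x S))"
 using vmul_insort[of v x "sorted_list_of_set S"] assms by (auto simp: vm_def)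

lemma vm_insert:
 assumes "finite S" "x \<notin> S"
 obtains s where "s ~= 0" "vm v (insert x S) = fscale (s :: 'k::field) (lv (v x) (vm v S))"
proof -
 obtain s where "s ~= 0" "lv (v x) (vm v S) = fscale s (vm v (insert x S))"
  by (rule lv_vm_insert[OF assms])
 then show thesis using that[of "1 / s"] by (simp add: fvs.scale_scale fvs.scale_one)
qed

lemma lv_vm_mem: "finite S ==> x \<in> S ==> lv (v x) (vm v S) = 0"
 by (simp add: vm_def vmul_repeat)

definition nsub :: "nat => nat set => nat set set" where
 "nsub d X = {S. S \<subseteq> X \<and> card S = d}"

lemma finite_nsub [simp]: "finite X ==> finite (nsub d X)"
 by (simp add: nsub_def)

lemma card_nsub: "finite X ==> card (nsub d X) = card X choose d"
 unfolding nsub_def by (rule n_subsets)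

lemma pair_in_nsub [simp]: "{x, y} \<in> nsub 2 X \<longleftrightarrow> x \<in> X \<and> y \<in> X \<and> x ~= y"
 by (auto simp: nsub_def card_insert_if)

lemma nsub2E:
 assumes "S \<in> nsub 2 X"
 obtains x y where "S = {x, y}" "x \<in> X" "y \<in> X" "x ~= y"
 using assms by (auto simp: nsub_def card_2_iff)

lemma nsub_mono: "X \<subseteq> Y ==> nsub d X \<subseteq> nsub d Y"
 by (auto simp: nsub_def)

lemma lv_fsupp:
 assumes "v \<in> fsupp C" "z \<in> fsupp (nsub d C)" "finite C"
 shows "lv v z \<in> fsupp (nsub (Suc d) C)"
 unfolding fsupp_def
proof clarify
 fix S assume S: "lv v z S ~= 0"
 then obtain i where i: "i \<in> S" "v i ~= 0" "z (S - {i}) ~= 0"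
  unfolding lv_def by (metis (no_types, lifting) mult_eq_0_iff sum.neutral)
 then have "i \<in> C" "S - {i} \<in> nsub d C" using assms(1,2) by (auto simp: fsupp_def)
 moreover from S have "finite S" using lv_infinite by blast
 then have "card S = Suc (card (S - {i}))" using i(1) by (intro card.remove) auto
 ultimately show "S \<in> nsub (Suc d) C" by (auto simp: nsub_def)
qed

lemma vm_fsupp:
 assumes "\<And>x. x \<in> S ==> v x \<in> fsupp C" "finite C" "finite S"
 shows "vm v S \<in> fsupp (nsub (card S) C)"
 using assms(3,1)
proof (induction S rule: finite_induct)
 case empty
 then show ?case by (auto simp: fsupp_def nsub_def unitf_def)
next
 case (insert x S)
 obtain s where s: "s ~= 0" "vm v (insert x S) = fscale s (lv (v x) (vm v S))"
  by (rule vm_insert[OF insert.hyps])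
 have "lv (v x) (vm v S) \<in> fsupp (nsub (Suc (card S)) C)"
  by (rule lv_fsupp) (use insert assms in auto)
 then show ?case using insert by (simp add: s(2) fvs.subspace_scale[OF subspace_fsupp])
qed

text \<open>Numerical form of a term order on the subsets of \<open>N\<close>. It does not demand
  that the empty set come first, so a reversed order is again of this kind, which the duality
  argument relies on.\<close>

definition mono_rank :: "nat set => (nat set => nat) => bool" where
 "mono_rank N rk \<longleftrightarrow> finite N \<and> inj_on rk (Pow N) \<and>
   (\<forall>S T U. S \<subseteq> N --> T \<subseteq> N --> U \<subseteq> N --> S \<inter> U = {} --> T \<inter> U = {} --> rk S < rk T -->
    rk (S \<union> U) < rk (T \<union> U))"

lemma mono_rank_less:
 "mono_rank N rk ==> S \<subseteq> N ==> T \<subseteq> N ==> U \<subseteq> N ==> S \<inter> U = {} ==> T \<inter> U = {} ==>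
  rk S < rk T ==> rk (S \<union> U) < rk (T \<union> U)"
 by (simp add: mono_rank_def)

lemma mono_rank_inj: "mono_rank N rk ==> S \<subseteq> N ==> T \<subseteq> N ==> rk S = rk T ==> S = T"
 by (auto simp: mono_rank_def inj_on_def)

lemma mono_rank_le:
 assumes "mono_rank N rk" "S \<subseteq> N" "T \<subseteq> N" "U \<subseteq> N" "S \<inter> U = {}" "T \<inter> U = {}" "rk S \<le> rk T"
 shows "rk (S \<union> U) \<le> rk (T \<union> U)"
 using mono_rank_less[OF assms(1-6)] mono_rank_inj[OF assms(1-3)] assms(7)
 by (metis le_less)

lemma mono_rank_insert_less:
 assumes "mono_rank N rk" "T \<subseteq> N" "i \<in> N" "a \<in> N" "i \<notin> T" "a \<notin> T" "rk {i} < rk {a}"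
 shows "rk (insert i T) < rk (insert a T)"
 using mono_rank_less[OF assms(1), of "{i}" "{a}" T] assms by simp

lemma mono_rank_insert_le:
 assumes "mono_rank N rk" "T \<subseteq> N" "i \<in> N" "a \<in> N" "i \<notin> T" "a \<notin> T" "rk {i} \<le> rk {a}"
 shows "rk (insert i T) \<le> rk (insert a T)"
 using mono_rank_le[OF assms(1), of "{i}" "{a}" T] assms by simp

lemma mono_rank_insert2_le:
 assumes "mono_rank N rk" "T \<subseteq> N" "S \<subseteq> N" "a \<in> N" "a \<notin> T" "a \<notin> S" "rk T \<le> rk S"
 shows "rk (insert a T) \<le> rk (insert a S)"
 using mono_rank_le[OF assms(1), of T S "{a}"] assms by simp

abbreviation rk1 :: "(nat set => nat) => nat => nat" where "rk1 rk \<equiv> (\<lambda>i. rk {i})"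

text \<open>At \<open>insert a S\<close> only the summand with \<open>i = a\<close> survives: any
  other contributing \<open>i\<close> ranks below \<open>a\<close>, and putting \<open>a\<close> in
  its place would give \<open>z\<close> a monomial above \<open>S\<close>. All other monomials of
  the product are bounded by two exchanges.\<close>

lemma ld_lv:
 assumes mr: "mono_rank N rk" and v: "v \<in> fsupp N" and z: "z \<in> fsupp (Pow N)"
  and la: "ld (rk1 rk) v a" and lS: "ld rk z S" and "a \<notin> S"
 shows "ld rk (lv v z) (insert a S)"
proof -
 have aN: "a \<in> N" and SN: "S \<subseteq> N" using la lS v z by (auto simp: ld_def fsupp_def)
 have fin: "finite S" using SN mr finite_subset by (auto simp: mono_rank_def)
 have "lv v z (insert a S) = (\<Sum>i\<in>{a}. lsgn i (insert a S) * v i * z (insert a S - {i}))"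
  unfolding lv_def
 proof (rule sum.mono_neutral_right)
  show "\<forall>i\<in>insert a S - {a}. lsgn i (insert a S) * v i * z (insert a S - {i}) = 0"
  proof (rule ballI, rule ccontr)
   fix i assume i: "i \<in> insert a S - {a}" "lsgn i (insert a S) * v i * z (insert a S - {i}) ~= 0"
   then have "rk {i} \<le> rk {a}" "rk (insert a S - {i}) \<le> rk S" using la lS by (auto simp: ld_def)
   moreover have iS: "i \<in> S" "i ~= a" "i \<in> N" using i(1) SN by auto
   moreover have "rk {i} ~= rk {a}" using mono_rank_inj[OF mr, of "{i}" "{a}"] iS aN by auto
   moreover have "S - {i} \<subseteq> N" "i \<notin> S - {i}" "a \<notin> S - {i}" using SN \<open>a \<notin> S\<close> by auto
   ultimately have "rk (insert i (S - {i})) < rk (insert a (S - {i}))"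
    using aN mono_rank_insert_less[OF mr, of "S - {i}" i a] le_neq_implies_less by blast
   moreover have "insert i (S - {i}) = S" "insert a (S - {i}) = insert a S - {i}"
    using iS \<open>a \<notin> S\<close> by auto
   ultimately show False using \<open>rk (insert a S - {i}) \<le> rk S\<close> by simp
  qed
 qed (use fin in auto)
 also have "\<dots> ~= 0" using la lS \<open>a \<notin> S\<close> by (simp add: ld_def)
 finally have nz: "lv v z (insert a S) ~= 0" .
 have "rk W \<le> rk (insert a S)" if W: "lv v z W ~= 0" for W
 proof -
  obtain i where i: "i \<in> W" "v i ~= 0" "z (W - {i}) ~= 0"
   using W unfolding lv_def by (metis (no_types, lifting) mult_eq_0_iff sum.neutral)
  define T where "T = W - {i}"
  have W': "W = insert i T" "i \<notin> T" using i by (auto simp: T_def)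
  have iT: "rk {i} \<le> rk {a}" "rk T \<le> rk S" "i \<in> N" "T \<subseteq> N"
   using i la lS v z by (auto simp: ld_def fsupp_def T_def)
  show ?thesis
  proof (cases "a \<in> T")
   case False
   have "rk (insert i T) \<le> rk (insert a T)"
    using mono_rank_insert_le[OF mr, of T i a] iT W' False aN by blast
   also have "\<dots> \<le> rk (insert a S)"
    using mono_rank_insert2_le[OF mr, of T S a] iT False aN SN \<open>a \<notin> S\<close> by blast
   finally show ?thesis using W' by simp
  next
   case True
   \<comment> \<open>Multiplication by \<open>a\<close> is impossible while \<open>a\<close> occurs
     in \<open>T\<close>. It is split off, \<open>i\<close> is compared with \<open>a\<close> over
     \<open>T0\<close>, and \<open>a\<close> is multiplied back at the end.\<close>
   define T0 where "T0 = T - {a}"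
   have T0: "T = insert a T0" "a \<notin> T0" "i \<notin> T0" "i ~= a" "T0 \<subseteq> N"
    using True W' iT by (auto simp: T0_def)
   have "rk (insert i T0) \<le> rk (insert a T0)"
    using mono_rank_insert_le[OF mr, of T0 i a] iT T0 aN by blast
   then have "rk (insert i T0) \<le> rk S" using iT T0 by simp
   then have "rk (insert a (insert i T0)) \<le> rk (insert a S)"
    using mono_rank_insert2_le[OF mr, of "insert i T0" S a] iT T0 aN SN \<open>a \<notin> S\<close> by blast
   then show ?thesis using W' T0 by (simp add: insert_commute)
  qed
 qed
 then show ?thesis using nz by (simp add: ld_def)
qed

lemma lv_unitf:
 assumes "finite T" "j \<notin> T"
 shows "lv (unitf j) (unitf T :: 'k::field ext) = fscale (lsgn j (insert j T)) (unitf (insert j T))"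
proof
 fix S
 have "lsgn i S * unitf j i * unitf T (S - {i}) =
  (if i = j then (if S = insert j T then lsgn j (insert j T) else 0) else (0::'k))" if "i \<in> S" for i
  using that assms(2) by (auto simp: unitf_def)
 then have "lv (unitf j) (unitf T :: 'k ext) S =
  (\<Sum>i\<in>S. if i = j then (if S = insert j T then lsgn j (insert j T) else 0) else (0::'k))"
  unfolding lv_def by (intro sum.cong) auto
 also have "\<dots> = (if S = insert j T then lsgn j (insert j T) else 0)"
  using assms by (cases "finite S") auto
 finally have eq: "lv (unitf j) (unitf T) S = (if S = insert j T then lsgn j (insert j T) else (0 :: 'k))" .
 show "lv (unitf j) (unitf T) S = fscale (lsgn j (insert j T)) (unitf (insert j T) :: 'k ext) S"
  unfolding eq unfolding fscale_apply unitf_def by simp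
qed

lemma lv_span_vm:
 assumes "a \<in> fvs.span (v ` X)" "z \<in> fvs.span (vm v ` nsub d X)" "finite X"
 shows "lv a z \<in> fvs.span (vm v ` nsub (Suc d) X)"
proof (rule lv_span[OF assms(1,2)])
 fix a z assume "a \<in> v ` X" "z \<in> vm v ` nsub d X"
 then obtain x S where x: "x \<in> X" "a = v x" "S \<in> nsub d X" "z = vm v S" by blast
 have fS: "finite S" using x assms(3) finite_subset by (auto simp: nsub_def)
 show "lv a z \<in> fvs.span (vm v ` nsub (Suc d) X)"
 proof (cases "x \<in> S")
  case True
  then show ?thesis using x fS by (simp add: lv_vm_mem fvs.span_zero)
 next
  case False
  then obtain s where "lv a z = fscale s (vm v (insert x S))"
   using lv_vm_insert[OF fS False, of v] x by metis
  moreover have "insert x S \<in> nsub (Suc d) X" using x False fS by (auto simp: nsub_def)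
  ultimately show ?thesis by (auto intro: fvs.span_scale fvs.span_base)
 qed
qed

lemma unitf_span_vm:
 assumes "\<And>j. j \<in> C ==> unitf j \<in> fvs.span (v ` X)" "finite X" "finite T" "T \<subseteq> C"
 shows "(unitf T :: 'k::field ext) \<in> fvs.span (vm v ` nsub (card T) X)"
 using assms(3,4)
proof (induction T rule: finite_induct)
 case empty
 then show ?case using assms(2) by (auto intro!: fvs.span_base image_eqI[of _ _ "{}"] simp: nsub_def)
next
 case (insert j T)
 have "lv (unitf j) (unitf T) \<in> fvs.span (vm v ` nsub (Suc (card T)) X)"
  by (rule lv_span_vm) (use insert assms in auto)
 then have "fscale (1 / lsgn j (insert j T)) (lv (unitf j) (unitf T)) \<in> fvs.span (vm v ` nsub (Suc (card T)) X)"
  by (rule fvs.span_scale)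
 then show ?case using insert by (simp add: lv_unitf fvs.scale_scale fvs.scale_one)
qed

section \<open>Columns of a matrix and its action on the exterior algebra\<close>

definition colv :: "nat => 'k::field mat => nat => nat => 'k" where
 "colv n A i k = (if k \<in> {1..n} then A $$ (k - 1, i - 1) else 0)"

lemma gl_basis_colv: "gl_basis n A i S = (if \<exists>k. S = {k} then colv n A i (the_elem S) else 0)"
proof (cases "\<exists>k. S = {k}")
 case True
 then obtain k where S: "S = {k}" by blast
 have "gl_basis n A i S = (\<Sum>k'\<in>{1..n}. if k' = k then A $$ (k' - 1, i - 1) else 0)"
  unfolding gl_basis_def by (intro sum.cong) (auto simp: monom_ext_def S)
 then show ?thesis using S by (auto simp: colv_def)
next
 case False
 then show ?thesis by (auto simp: gl_basis_def monom_ext_def intro!: sum.neutral)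
qed

text \<open>Only singletons contribute as left factors, and the inversion sign of a singleton
  against the rest is \<open>lsgn\<close>.\<close>

lemma wedge_gl_basis: "wedge (gl_basis n A i) z = lv (colv n A i) z"
proof
 fix S
 show "wedge (gl_basis n A i) z S = lv (colv n A i) z S"
 proof (cases "finite S")
  case True
  have "wedge (gl_basis n A i) z S = (\<Sum>T\<in>(\<lambda>t. {t}) ` S. wedge_sign T (S - T) * gl_basis n A i T * z (S - T))"
   unfolding wedge_def
  proof (rule sum.mono_neutral_right)
   show "\<forall>T\<in>Pow S - (\<lambda>t. {t}) ` S. wedge_sign T (S - T) * gl_basis n A i T * z (S - T) = 0"
    by (auto simp: gl_basis_colv)
  qed (use True in auto)
  also have "\<dots> = (\<Sum>t\<in>S. wedge_sign {t} (S - {t}) * gl_basis n A i {t} * z (S - {t}))"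
   by (subst sum.reindex) (auto simp: inj_on_def)
  also have "\<dots> = (\<Sum>t\<in>S. lsgn t S * colv n A i t * z (S - {t}))"
  proof (rule sum.cong[OF refl])
   fix t assume "t \<in> S"
   have "{(s, u). s \<in> {t} \<and> u \<in> S - {t} \<and> u < s} = Pair t ` {u \<in> S. u < t}" by auto
   then have "(wedge_sign {t} (S - {t}) :: 'a) = lsgn t S"
    by (simp add: wedge_sign_def lsgn_def card_image inj_on_def)
   then show "wedge_sign {t} (S - {t}) * gl_basis n A i {t} * z (S - {t}) = lsgn t S * colv n A i t * z (S - {t})"
    by (simp add: gl_basis_colv)
  qed
  finally show ?thesis by (simp add: lv_def)
 qed (simp add: wedge_def lv_def)
qed

lemma gl_act_vm: "gl_act n A x = (\<lambda>T. \<Sum>S\<in>Pow {1..n}. x S * vm (colv n A) S T)"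
proof -
 have "wedge_list (map (gl_basis n A) xs) = vmul (colv n A) xs" for xs
 proof (induction xs)
  case Nil
  then show ?case by (simp add: wedge_list_def monom_ext_def unitf_def)
 next
  case (Cons a xs)
  then show ?case by (simp add: wedge_list_def wedge_gl_basis)
 qed
 then show ?thesis by (simp add: gl_act_def vm_def)
qed

subsection \<open>Types of graphs\<close>

definition univ :: "nat set => nat set set => nat => bool" where
 "univ X M k \<longleftrightarrow> k \<in> X \<and> (\<forall>x\<in>X - {k}. {k, x} \<in> M)"

definition isol :: "nat set => nat set set => nat => bool" where
 "isol X M h \<longleftrightarrow> h \<in> X \<and> (\<forall>S\<in>M. h \<notin> S)"

definition del :: "nat set set => nat => nat set set" where
 "del M k = {S \<in> M. k \<notin> S}"

definition star :: "nat set => nat => nat set set" where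
 "star X k = (\<lambda>x. {k, x}) ` (X - {k})"

definition prods :: "nat set => nat set => nat set set" where
 "prods A B = {{a, b} | a b. a \<in> A \<and> b \<in> B}"

text \<open>
 \<open>Al\<close> and \<open>Be\<close> stand for adding a universal and an isolated vertex. A graph can have several types,
 but a stable graph is determined by any of them.
\<close>

datatype gtype = Al gtype | Be gtype | PQ nat nat | PP nat nat

text \<open>The rules \<open>pq_step\<close> and \<open>pp_step\<close> make types stable under
  degeneration: special coordinates can split one vertex off each part, which then appear as a
  universal and an isolated vertex. The order of the two constructors matters: the split pair is
  itself an edge for \<open>PQ\<close> and a nonedge for \<open>PP\<close>.\<close>

inductive has_type :: "nat set => nat set set => gtype => bool" where
 al: "M \<subseteq> nsub 2 X ==> univ X M k ==> has_type (X - {k}) (del M k) \<tau> ==> has_type X M (Al \<tau>)"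
| be: "isol X M h ==> has_type (X - {h}) M \<tau> ==> has_type X M (Be \<tau>)"
| pq: "finite A ==> finite B ==> A \<inter> B = {} ==>
  has_type (A \<union> B) (prods A B) (PQ (card A) (card B))"
| pq_step: "has_type X M (Al (Be (PQ a b))) ==> has_type X M (PQ (Suc a) (Suc b))"
| pp: "finite A ==> finite B ==> A \<inter> B = {} ==>
  has_type (A \<union> B) (nsub 2 A \<union> nsub 2 B) (PP (card A) (card B))"
| pp_step: "has_type X M (Be (Al (PP a b))) ==> has_type X M (PP (Suc a) (Suc b))"

primrec tsize :: "gtype => nat" where
 "tsize (Al \<tau>) = Suc (tsize \<tau>)"
| "tsize (Be \<tau>) = Suc (tsize \<tau>)"
| "tsize (PQ a b) = a + b"
| "tsize (PP a b) = a + b"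

primrec tedges :: "gtype => nat" where
 "tedges (Al \<tau>) = tsize \<tau> + tedges \<tau>"
| "tedges (Be \<tau>) = tedges \<tau>"
| "tedges (PQ a b) = a * b"
| "tedges (PP a b) = (a choose 2) + (b choose 2)"

lemma univ_decomp:
 assumes "M \<subseteq> nsub 2 X" "univ X M k"
 shows "M = star X k \<union> del M k"
proof
 show "M \<subseteq> star X k \<union> del M k"
 proof
  fix S assume S: "S \<in> M"
  then obtain x y where xy: "S = {x, y}" "x \<in> X" "y \<in> X" "x ~= y" using assms(1) nsub2E by blast
  show "S \<in> star X k \<union> del M k"
  proof (cases "k \<in> S")
   case True
   then obtain z where "S = {k, z}" "z \<in> X" "z ~= k" using xy by auto
   then show ?thesis by (auto simp: star_def)
  qed (use S in \<open>simp add: del_def\<close>)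
 qed
 show "star X k \<union> del M k \<subseteq> M" using assms(2) by (auto simp: star_def del_def univ_def)
qed

lemma card_star: "finite X ==> k \<in> X ==> card (star X k) = card X - 1"
 unfolding star_def by (subst card_image) (auto simp: inj_on_def doubleton_eq_iff)

lemma star_del_disjoint: "star X k \<inter> del M k = {}"
 by (auto simp: star_def del_def)

lemma star_subset: "k \<in> X ==> star X k \<subseteq> nsub 2 X"
 by (auto simp: star_def)

lemma del_subset: "M \<subseteq> nsub 2 X ==> del M k \<subseteq> nsub 2 (X - {k})"
 by (auto simp: del_def nsub_def)

lemma del_isol: "isol X M h ==> del M h = M"
 by (auto simp: isol_def del_def)

lemma del_Un: "del (M \<union> M') k = del M k \<union> del M' k"
 by (auto simp: del_def)

lemma card_prods:
 assumes "finite A" "finite B" "A \<inter> B = {}"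
 shows "card (prods A B) = card A * card B"
proof -
 have "prods A B = (\<lambda>(a, b). {a, b}) ` (A \<times> B)" by (auto simp: prods_def)
 moreover have "inj_on (\<lambda>(a, b). {a, b}) (A \<times> B)"
  using assms(3) by (auto simp: inj_on_def doubleton_eq_iff)
 ultimately show ?thesis by (simp add: card_image card_cartesian_product)
qed

lemma card_nsub2_Un:
 assumes "finite A" "finite B" "A \<inter> B = {}"
 shows "card (nsub 2 A \<union> nsub 2 B) = (card A choose 2) + (card B choose 2)"
proof -
 have "nsub 2 A \<inter> nsub 2 B = {}"
  using assms(3) by (auto simp: nsub_def card_2_iff)
 then show ?thesis using assms by (simp add: card_Un_disjoint card_nsub)
qed

text \<open>The step rules are numerically consistent:
  \<open>(a + 1) * (b + 1) = (a + b + 1) + a * b\<close>, and the two binomials for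
  \<open>PP\<close> grow together by \<open>a + b\<close>.\<close>

lemma has_type_basic:
 "has_type X M \<tau> ==> finite X \<and> M \<subseteq> nsub 2 X \<and> card X = tsize \<tau> \<and> card M = tedges \<tau>"
proof (induction rule: has_type.induct)
 case (al M X k \<tau>)
 then have k: "k \<in> X" "finite X" by (auto simp: univ_def)
 have "card M = card (star X k) + card (del M k)"
  using univ_decomp[OF al(1,2)] star_del_disjoint[of X k M] al.hyps(1) k
  by (metis card_Un_disjoint finite_Un finite_nsub finite_subset)
 moreover have "card X = Suc (card (X - {k}))" using card.remove[OF k(2,1)] .
 ultimately show ?case using al k by (simp add: card_star)
next
 case (be X M h \<tau>)
 then have h: "h \<in> X" "finite X" by (auto simp: isol_def)
 have "card X = Suc (card (X - {h}))" using card.remove[OF h(2,1)] .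
 then show ?case using be h nsub_mono[of "X - {h}" X 2] by auto
next
 case (pq A B)
 then show ?case by (auto simp: card_prods card_Un_disjoint) (auto simp: prods_def)
next
 case (pp A B)
 then show ?case
  using nsub_mono[of A "A \<union> B" 2] nsub_mono[of B "A \<union> B" 2] by (auto simp: card_nsub2_Un card_Un_disjoint)
next
 case (pp_step X M a b)
 then show ?case by (simp add: numeral_2_eq_2)
qed auto

section \<open>Tournaments and matched pairs\<close>

lemma tournament_max:
 assumes "finite D" "D ~= {}"
  and tot: "\<And>k l. k \<in> D ==> l \<in> D ==> k ~= l ==> win k l \<or> win l k"
  and trans: "\<And>k l m. k \<in> D ==> l \<in> D ==> m \<in> D ==> k ~= l ==> l ~= m ==> k ~= m ==>
   win k l ==> win l m ==> win k m"
 shows "\<exists>k\<in>D. \<forall>l\<in>D - {k}. win k l"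
 using assms
proof (induction D rule: finite_ne_induct)
 case (singleton x)
 show ?case by auto
next
 case (insert x D)
 have "\<exists>k\<in>D. \<forall>l\<in>D - {k}. win k l"
 proof (rule insert.IH)
  show "win k l \<or> win l k" if "k \<in> D" "l \<in> D" "k ~= l" for k l
   using insert.prems(1) that by blast
  show "win k m" if "k \<in> D" "l \<in> D" "m \<in> D" "k ~= l" "l ~= m" "k ~= m" "win k l" "win l m" for k l m
   using insert.prems(2)[of k l m] that by blast
 qed
 then obtain k where k: "k \<in> D" "\<And>l. l \<in> D - {k} ==> win k l" by blast
 then have "k ~= x" using insert.hyps by auto
 show ?case
 proof (cases "win k x")
  case True
  then show ?thesis using k by (intro bexI[of _ k]) auto
 next
  case False
  then have "win x k" using insert.prems(1)[of k x] k \<open>k ~= x\<close> by auto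
  then have "win x l" if "l \<in> D" for l
   using insert.prems(2)[of x k l] k that \<open>k ~= x\<close> insert.hyps by (cases "l = k") auto
  then show ?thesis by (intro bexI[of _ x]) auto
 qed
qed

text \<open>The leading pairs that involve the set \<open>D\<close> of leading indices shared by two
  subspaces; \<open>i k\<close> is the additional index that belongs to \<open>k\<close>, and
  \<open>Z\<close> holds the unshared ones. Of \<open>{k, i l}\<close> and \<open>{l, i k}\<close>
  the one containing the winner itself is kept.\<close>

definition mixed_pairs :: "(nat => nat => bool) => nat set => nat set => (nat => nat) => nat set set" where
 "mixed_pairs win Z D i = prods D Z \<union> nsub 2 D \<union> {{k, i l} | k l. k \<in> D \<and> l \<in> D \<and> k ~= l \<and> win k l}"

lemma mixed_pairs_empty [simp]: "mixed_pairs win Z {} i = {}"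
 by (auto simp: mixed_pairs_def prods_def nsub_def)

locale matching =
 fixes win :: "nat => nat => bool" and A B :: "nat set" and i :: "nat => nat"
 assumes finite: "finite A" "finite B" and disj: "A \<inter> B = {}"
begin

lemma del_mixed_pairs:
 assumes k: "k \<in> D" "\<And>l. l \<in> D - {k} ==> win k l" "\<And>l. l \<in> D - {k} ==> \<not> win l k"
  and "D \<inter> Z = {}" "i ` D \<inter> D = {}" "inj_on i D"
 shows "del (mixed_pairs win Z D i) k = mixed_pairs win Z (D - {k}) i"
proof -
 have 1: "del (prods D Z) k = prods (D - {k}) Z" using assms by (auto simp: del_def prods_def)
 have 2: "del (nsub 2 D) k = nsub 2 (D - {k})" by (auto simp: del_def nsub_def)
 have 3: "del {{k, i l} | k l. k \<in> D \<and> l \<in> D \<and> k ~= l \<and> win k l} k =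
   {{k', i l} | k' l. k' \<in> D - {k} \<and> l \<in> D - {k} \<and> k' ~= l \<and> win k' l}" (is "?L = ?R")
 proof
  show "?L \<subseteq> ?R"
  proof
   fix S assume "S \<in> ?L"
   then obtain k' l where S: "S = {k', i l}" "k' \<in> D" "l \<in> D" "k' ~= l" "win k' l" "k \<notin> S"
    unfolding del_def by blast
   then have "k' ~= k" by blast
   then have "l ~= k" using k(3)[of k'] S(2,5) by blast
   show "S \<in> ?R" using S(1-5) \<open>k' ~= k\<close> \<open>l ~= k\<close> by blast
  qed
  show "?R \<subseteq> ?L" 
  proof
   fix S assume "S \<in> ?R"
   then obtain k' l where S: "S = {k', i l}" "k' \<in> D" "l \<in> D" "k' ~= l" "win k' l" "k ~= k'" by blast
   moreover have "i l ~= k" using assms(5) S(3) k(1) by blast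
   ultimately show "S \<in> ?L" unfolding del_def by blast
  qed
 qed
 show ?thesis
  unfolding mixed_pairs_def del_Un 1 2 3 ..
qed

lemma isol_mixed_pairs:
 assumes "k \<in> D'" "D \<subseteq> D'" "\<And>l. l \<in> D - {k} ==> \<not> win l k"
  "i ` D' \<inter> Z = {}" "i ` D' \<inter> D' = {}" "inj_on i D'" "S \<in> mixed_pairs win Z D i"
 shows "i k \<notin> S"
proof
 assume iS: "i k \<in> S"
 have ni: "i k \<notin> D" "i k \<notin> Z" using assms by auto
 then have "S \<in> {{k, i l} | k l. k \<in> D \<and> l \<in> D \<and> k ~= l \<and> win k l}"
  using assms(7) iS by (auto simp: mixed_pairs_def prods_def nsub_def)
 then obtain k' l where S: "S = {k', i l}" "k' \<in> D" "l \<in> D" "k' ~= l" "win k' l" by auto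
 then have "i k = i l" using iS ni by auto
 then have "k = l" using assms S by (meson inj_onD subsetD)
 then show False using S assms(3) by auto
qed

text \<open>The overall winner \<open>k\<close> is adjacent to everything, its partner included.
  After its deletion \<open>i k\<close> is isolated, since nobody beats \<open>k\<close>. The two
  deletions are read backwards as \<open>pq_step\<close>.\<close>

lemma has_type_pq_matching:
 assumes "finite D" "D \<inter> (A \<union> B) = {}" "i ` D \<inter> (A \<union> B) = {}" "i ` D \<inter> D = {}" "inj_on i D"
  and tot: "\<And>k l. k \<in> D ==> l \<in> D ==> k ~= l ==> win k l \<longleftrightarrow> \<not> win l k"
  and trans: "\<And>k l m. k \<in> D ==> l \<in> D ==> m \<in> D ==> k ~= l ==> l ~= m ==> k ~= m ==>
   win k l ==> win l m ==> win k m"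
 shows "has_type (A \<union> B \<union> D \<union> i ` D)
  (prods A B \<union> mixed_pairs win (A \<union> B) D i \<union> (\<lambda>k. {k, i k}) ` D) (PQ (card A + card D) (card B + card D))"
 using assms
proof (induction "card D" arbitrary: D)
 case 0
 have "D = {}" using 0(1,2) by simp
 then show ?case using pq[OF finite disj] by simp
next
 case (Suc d)
 let ?Z = "A \<union> B"
 let ?M = "\<lambda>D. prods A B \<union> mixed_pairs win ?Z D i \<union> (\<lambda>k. {k, i k}) ` D"
 let ?X = "\<lambda>D. A \<union> B \<union> D \<union> i ` D"
 have "\<exists>k\<in>D. \<forall>l\<in>D - {k}. win k l"
 proof (rule tournament_max[OF Suc.prems(1)])
  show "D ~= {}" using Suc.hyps(2) by auto
  show "win k l \<or> win l k" if "k \<in> D" "l \<in> D" "k ~= l" for k l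
   using Suc.prems(6) that by blast
 qed (rule Suc.prems(7))
 then obtain k where k: "k \<in> D" "\<And>l. l \<in> D - {k} ==> win k l" by blast
 have k': "\<not> win l k" if "l \<in> D - {k}" for l using k that Suc.prems(6)[of k l] by auto
 have ik: "i k \<in> i ` D" using k by auto
 have "has_type (?X (D - {k})) (?M (D - {k})) (PQ (card A + card (D - {k})) (card B + card (D - {k})))"
 proof (rule Suc.hyps(1))
  show "d = card (D - {k})" using Suc.hyps(2) Suc.prems(1) k(1) by simp
  show "inj_on i (D - {k})" using Suc.prems(5) by (rule inj_on_diff)
  show "win k' l \<longleftrightarrow> \<not> win l k'" if "k' \<in> D - {k}" "l \<in> D - {k}" "k' ~= l" for k' l
   using Suc.prems(6) that by blast
  show "win k' m" if "k' \<in> D - {k}" "l \<in> D - {k}" "m \<in> D - {k}" "k' ~= l" "l ~= m" "k' ~= m"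
   "win k' l" "win l m" for k' l m
   using Suc.prems(7)[of k' l m] that by blast
 qed (use Suc.prems(1-4) in blast)+
 moreover have "card D = Suc (card (D - {k}))" by (rule card.remove[OF Suc.prems(1) k(1)])
 moreover have X: "?X D - {k} - {i k} = ?X (D - {k})"
 proof -
  have "i ` (D - {k}) = i ` D - {i k}"
   using inj_on_image_set_diff[OF Suc.prems(5), of D "{k}"] k(1) by simp
  then show ?thesis using Suc.prems(2-4) k(1) by blast
 qed
 moreover have d: "del (?M D) k = ?M (D - {k})"
 proof -
  have "del (mixed_pairs win ?Z D i) k = mixed_pairs win ?Z (D - {k}) i"
   by (rule del_mixed_pairs) (use k k' Suc.prems(2-5) in blast)+
  moreover have "del (prods A B) k = prods A B"
   using Suc.prems(2) k(1) unfolding del_def prods_def by blast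
  moreover have "del ((\<lambda>k. {k, i k}) ` D) k = (\<lambda>k. {k, i k}) ` (D - {k})"
   using Suc.prems(4) k(1) unfolding del_def by blast
  ultimately show ?thesis by (simp only: del_Un)
 qed
 moreover have "isol (?X D - {k}) (?M (D - {k})) (i k)"
  unfolding isol_def
 proof (intro conjI ballI)
  show "i k \<in> ?X D - {k}" using ik Suc.prems(4) k(1) by auto
  fix S assume S: "S \<in> ?M (D - {k})"
  have "i k \<notin> S" if "S \<in> mixed_pairs win ?Z (D - {k}) i"
   by (rule isol_mixed_pairs[OF k(1) _ _ _ _ _ that]) (use Suc.prems(2-5) k' in blast)+
  moreover have "i k \<notin> S" if "S \<in> prods A B" using that Suc.prems(3) ik by (auto simp: prods_def)
  moreover have "i k \<notin> S" if "S \<in> (\<lambda>k. {k, i k}) ` (D - {k})"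
   using that Suc.prems(4,5) k(1) by (auto simp: inj_on_def)
  ultimately show "i k \<notin> S" using S by blast
 qed
 moreover have "univ (?X D) (?M D) k"
 proof -
  have "{k, x} \<in> ?M D" if x: "x \<in> ?X D - {k}" for x
  proof -
   have "{k, i l} \<in> ?M D" if "l \<in> D" for l
    using that k unfolding mixed_pairs_def by (cases "l = k") blast+
   moreover have "{k, x} \<in> ?M D" if "x \<in> A \<union> B"
    using that k(1) unfolding mixed_pairs_def prods_def by blast
   moreover have "{k, x} \<in> ?M D" if "x \<in> D"
   proof -
    have "{k, x} \<in> nsub 2 D" using that k(1) x by simp
    then show ?thesis unfolding mixed_pairs_def by blast
   qed
   ultimately show ?thesis using x by blast
  qed
  then show ?thesis using k(1) by (auto simp: univ_def)
 qed
 moreover have "?M D \<subseteq> nsub 2 (?X D)"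
 proof -
  have "i l ~= k" "k ~= i l" if "k \<in> D" "l \<in> D" for k l using Suc.prems(4) that by blast+
  then show ?thesis
   using disj Suc.prems(2,3) by (auto simp: mixed_pairs_def prods_def nsub_def card_insert_if)
 qed
 ultimately have "has_type (?X D) (?M D) (Al (Be (PQ (card A + card (D - {k})) (card B + card (D - {k})))))"
  by (auto intro!: al be simp del: Un_iff)
 then have "has_type (?X D) (?M D) (PQ (Suc (card A + card (D - {k}))) (Suc (card B + card (D - {k}))))"
  by (rule pq_step)
 then show ?case using \<open>card D = Suc (card (D - {k}))\<close> by simp
qed

text \<open>Here \<open>{k, i k}\<close> is not an edge, so the partner of the winner is isolated
  from the start and leaves first; only then is the winner universal. This is the reverse of the
  order for \<open>PQ\<close>.\<close>

lemma has_type_pp_matching: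
 assumes "finite D" "D \<inter> (A \<union> B) = {}" "i ` D \<inter> (A \<union> B) = {}" "i ` D \<inter> D = {}" "inj_on i D"
  and tot: "\<And>k l. k \<in> D ==> l \<in> D ==> k ~= l ==> win k l \<longleftrightarrow> \<not> win l k"
  and trans: "\<And>k l m. k \<in> D ==> l \<in> D ==> m \<in> D ==> k ~= l ==> l ~= m ==> k ~= m ==>
   win k l ==> win l m ==> win k m"
 shows "has_type (A \<union> B \<union> D \<union> i ` D)
  (nsub 2 A \<union> nsub 2 B \<union> mixed_pairs win (A \<union> B) D i) (PP (card A + card D) (card B + card D))"
 using assms
proof (induction "card D" arbitrary: D)
 case 0
 have "D = {}" using 0(1,2) by simp
 then show ?case using pp[OF finite disj] by simp
next
 case (Suc d)
 let ?Z = "A \<union> B"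
 let ?M = "\<lambda>D. nsub 2 A \<union> nsub 2 B \<union> mixed_pairs win ?Z D i"
 let ?X = "\<lambda>D. A \<union> B \<union> D \<union> i ` D"
 have "\<exists>k\<in>D. \<forall>l\<in>D - {k}. win k l"
 proof (rule tournament_max[OF Suc.prems(1)])
  show "D ~= {}" using Suc.hyps(2) by auto
  show "win k l \<or> win l k" if "k \<in> D" "l \<in> D" "k ~= l" for k l
   using Suc.prems(6) that by blast
 qed (rule Suc.prems(7))
 then obtain k where k: "k \<in> D" "\<And>l. l \<in> D - {k} ==> win k l" by blast
 have k': "\<not> win l k" if "l \<in> D - {k}" for l using k that Suc.prems(6)[of k l] by auto
 have ik: "i k \<in> i ` D" using k by auto
 have "has_type (?X (D - {k})) (?M (D - {k})) (PP (card A + card (D - {k})) (card B + card (D - {k})))"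
 proof (rule Suc.hyps(1))
  show "d = card (D - {k})" using Suc.hyps(2) Suc.prems(1) k(1) by simp
  show "inj_on i (D - {k})" using Suc.prems(5) by (rule inj_on_diff)
  show "win k' l \<longleftrightarrow> \<not> win l k'" if "k' \<in> D - {k}" "l \<in> D - {k}" "k' ~= l" for k' l
   using Suc.prems(6) that by blast
  show "win k' m" if "k' \<in> D - {k}" "l \<in> D - {k}" "m \<in> D - {k}" "k' ~= l" "l ~= m" "k' ~= m"
   "win k' l" "win l m" for k' l m
   using Suc.prems(7)[of k' l m] that by blast
 qed (use Suc.prems(1-4) in blast)+
 moreover have "card D = Suc (card (D - {k}))" by (rule card.remove[OF Suc.prems(1) k(1)])
 moreover have X: "?X D - {i k} - {k} = ?X (D - {k})"
 proof -
  have "i ` (D - {k}) = i ` D - {i k}"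
   using inj_on_image_set_diff[OF Suc.prems(5), of D "{k}"] k(1) by simp
  then show ?thesis using Suc.prems(2-4) k(1) by blast
 qed
 moreover have d: "del (?M D) k = ?M (D - {k})"
 proof -
  have "del (mixed_pairs win ?Z D i) k = mixed_pairs win ?Z (D - {k}) i"
   by (rule del_mixed_pairs) (use k k' Suc.prems(2-5) in blast)+
  moreover have "del (nsub 2 A) k = nsub 2 A" "del (nsub 2 B) k = nsub 2 B"
   using Suc.prems(2) k(1) unfolding del_def nsub_def by blast+
  ultimately show ?thesis by (simp only: del_Un)
 qed
 moreover have iso: "isol (?X D) (?M D) (i k)"
  unfolding isol_def
 proof (intro conjI ballI)
  show "i k \<in> ?X D" using ik by auto
  fix S assume S: "S \<in> ?M D"
  have "i k \<notin> S" if "S \<in> mixed_pairs win ?Z D i"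
   by (rule isol_mixed_pairs[OF k(1) _ _ _ _ _ that]) (use Suc.prems(2-5) k' in blast)+
  moreover have "i k \<notin> S" if "S \<in> nsub 2 A \<union> nsub 2 B" using that Suc.prems(3) ik by (auto simp: nsub_def)
  ultimately show "i k \<notin> S" using S by blast
 qed
 moreover have "univ (?X D - {i k}) (?M D) k"
 proof -
  have "{k, x} \<in> ?M D" if x: "x \<in> ?X D - {i k} - {k}" for x
  proof -
   have "{k, i l} \<in> ?M D" if "l \<in> D" "i l ~= i k" for l
    using that k unfolding mixed_pairs_def by (cases "l = k") blast+
   moreover have "{k, x} \<in> ?M D" if "x \<in> A \<union> B"
    using that k(1) unfolding mixed_pairs_def prods_def by blast
   moreover have "{k, x} \<in> ?M D" if "x \<in> D"
   proof -
    have "{k, x} \<in> nsub 2 D" using that k(1) x by simp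
    then show ?thesis unfolding mixed_pairs_def by blast
   qed
   ultimately show ?thesis using x by blast
  qed
  moreover have "k ~= i k" using Suc.prems(4) k(1) by auto
  ultimately show ?thesis using k(1) by (auto simp: univ_def)
 qed
 moreover have "?M D \<subseteq> nsub 2 (?X D - {i k})"
 proof -
  have "i l ~= k" "k ~= i l" if "k \<in> D" "l \<in> D" for k l using Suc.prems(4) that by blast+
  then have "?M D \<subseteq> nsub 2 (?X D)"
   using disj Suc.prems(2,3) by (auto simp: mixed_pairs_def prods_def nsub_def card_insert_if)
  then show ?thesis using iso unfolding isol_def nsub_def by blast
 qed
 ultimately have "has_type (?X D) (?M D) (Be (Al (PP (card A + card (D - {k})) (card B + card (D - {k})))))"
  by (auto intro!: al be simp del: Un_iff)
 then have "has_type (?X D) (?M D) (PP (Suc (card A + card (D - {k}))) (Suc (card B + card (D - {k}))))"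
  by (rule pp_step)
 then show ?case using \<open>card D = Suc (card (D - {k}))\<close> by simp
qed

end

subsection \<open>Dual bases\<close>

definition wd :: "(nat => 'k::field) => (nat => 'k) => 'k ext" where
 "wd a b = lv a (lv b e0)"

lemma wd_self: "wd a a = 0"
 by (simp add: wd_def lv_self)

lemma wd_anticomm: "wd a b = - wd b a"
 unfolding wd_def by (rule lv_anticomm)

lemma wd_diff_left: "wd (a - b) c = wd a c - wd b c"
 by (simp only: wd_def lv_diff_left)

lemma wd_diff_right: "wd a (b - c) = wd a b - wd a c"
 by (simp only: wd_def lv_diff_left lv_diff_right)

lemma wd_scale_left: "wd (fscale c a) b = fscale c (wd a b)"
 by (simp only: wd_def lv_scale_left)

lemma wd_scale_right: "wd a (fscale c b) = fscale c (wd a b)"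
 by (simp only: wd_def lv_scale_left lv_scale_right)

lemma lv_span_left:
 assumes "a \<in> fvs.span A"
 shows "lv a z \<in> fvs.span ((\<lambda>a. lv a z) ` A)"
proof (rule lv_span[of a A z "{z}"])
 show "a \<in> fvs.span A" by (rule assms)
 show "z \<in> fvs.span {z}" by (rule fvs.span_base) simp
qed (auto intro: fvs.span_base)

lemma wd_span:
 assumes "a \<in> fvs.span A" "b \<in> fvs.span B"
  "\<And>a b. a \<in> A ==> b \<in> B ==> wd a b \<in> fvs.span D"
 shows "wd a b \<in> fvs.span D"
 unfolding wd_def
 by (rule lv_span[OF assms(1) lv_span_left[OF assms(2)]]) (use assms(3) in \<open>auto simp: wd_def\<close>)

lemma vm_pair:
 assumes "x ~= y"
 obtains s where "s ~= 0" "vm v {x, y} = fscale (s :: 'k::field) (wd (v x) (v y))"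
proof -
 obtain s where s: "s ~= 0" "vm v {y} = fscale s (lv (v y) e0)"
  using vm_insert[of "{}" y v] by auto
 obtain t where t: "t ~= 0" "vm v {x, y} = fscale t (lv (v x) (vm v {y}))"
  using vm_insert[of "{y}" x v] assms by auto
 have "vm v {x, y} = fscale (t * s) (wd (v x) (v y))"
  by (simp only: t(2) s(2) lv_scale_right fvs.scale_scale wd_def)
 then show thesis using that s(1) t(1) by (metis mult_eq_0_iff)
qed

lemma wd_in_span_vm:
 assumes "{x, y} \<in> M" "x ~= y"
 shows "wd (v x) (v y) \<in> fvs.span (vm v ` M)"
proof -
 obtain s where s: "s ~= 0" "vm v {x, y} = fscale s (wd (v x) (v y))" by (rule vm_pair[OF assms(2)])
 have "fscale (1 / s) (vm v {x, y}) \<in> fvs.span (vm v ` M)"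
  by (rule fvs.span_scale[OF fvs.span_base]) (use assms in auto)
 then show ?thesis using s by (simp add: fvs.scale_scale fvs.scale_one)
qed

lemma span_vm_subset:
 assumes "M \<subseteq> nsub 2 X" "fvs.subspace W"
  "\<And>x y. {x, y} \<in> M ==> x ~= y ==> wd (v x) (v y) \<in> W"
 shows "fvs.span (vm v ` M) \<subseteq> W"
proof (rule fvs.span_minimal[OF _ assms(2)])
 show "vm v ` M \<subseteq> W"
 proof (rule image_subsetI)
  fix S assume "S \<in> M"
  then obtain x y where S: "S = {x, y}" "x ~= y" using assms(1) nsub2E by blast
  obtain s where "vm v {x, y} = fscale s (wd (v x) (v y))" by (rule vm_pair[OF S(2)])
  then show "vm v S \<in> W"
   using assms(3)[of x y] \<open>S \<in> M\<close> S fvs.subspace_scale[OF assms(2)] by metis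
 qed
qed

lemma wd_fsupp:
 assumes "a \<in> fsupp C" "b \<in> fsupp C" "finite C"
 shows "wd a b \<in> fsupp (nsub 2 C)"
proof -
 have "e0 \<in> fsupp (nsub 0 C)" by (auto simp: fsupp_def unitf_def nsub_def)
 then show ?thesis using lv_fsupp[OF assms(1) lv_fsupp[OF assms(2)] assms(3)] assms(3)
  by (simp add: wd_def numeral_2_eq_2)
qed

lemma ld_wd:
 assumes mr: "mono_rank N rk" and ab: "a \<in> fsupp N" "b \<in> fsupp N"
  and l: "ld (rk1 rk) a i" "ld (rk1 rk) b j" "i ~= j"
 shows "ld rk (wd a b) {i, j}"
proof -
 have fN: "finite N" using mr by (simp add: mono_rank_def)
 have e: "e0 \<in> fsupp (Pow N)" by (auto simp: fsupp_def unitf_def)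
 have e': "e0 \<in> fsupp (nsub 0 N)" by (auto simp: fsupp_def unitf_def nsub_def)
 have 1: "ld rk (lv b e0) {j}" by (rule ld_lv[OF mr ab(2) e l(2) ld_unitf]) simp
 have "lv b e0 \<in> fsupp (nsub (Suc 0) N)" by (rule lv_fsupp[OF ab(2) e' fN])
 then have 2: "lv b e0 \<in> fsupp (Pow N)" by (auto simp: fsupp_def nsub_def)
 show ?thesis unfolding wd_def by (rule ld_lv[OF mr ab(1) 2 l(1) 1]) (use l in simp)
qed

text \<open>A basis of the vectors on \<open>C\<close> together with its dual. Both inverse
  identities are carried along, so that changing coordinates never requires inverting a matrix.
  Vertices \<open>X\<close> and coordinates \<open>C\<close> are kept apart because a deleted vertex
  and the coordinate deleted with it are in general different numbers.\<close>

definition dual_bases :: "nat set => nat set => (nat => nat => 'k::field) => (nat => nat => 'k) => bool" where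
 "dual_bases C X v w \<longleftrightarrow> finite C \<and> finite X \<and> card X = card C \<and> (\<forall>x\<in>X. v x \<in> fsupp C) \<and>
   (\<forall>x\<in>X. \<forall>y\<in>X. (\<Sum>a\<in>C. w x a * v y a) = (if x = y then 1 else 0)) \<and>
   (\<forall>a\<in>C. \<forall>b\<in>C. (\<Sum>x\<in>X. v x a * w x b) = (if a = b then 1 else 0))"

lemma sum_fun_apply: "(\<Sum>x\<in>A. f x) i = (\<Sum>x\<in>A. f x i)"
 by (induction A rule: infinite_finite_induct) (simp_all add: fun_apply)

lemma dual_bases_expand:
 assumes "dual_bases C X v w" "p \<in> fsupp C"
 shows "p = (\<Sum>x\<in>X. fscale (\<Sum>b\<in>C. w x b * p b) (v x))"
proof
 fix a
 show "p a = (\<Sum>x\<in>X. fscale (\<Sum>b\<in>C. w x b * p b) (v x)) a"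
 proof (cases "a \<in> C")
  case True
  have "(\<Sum>x\<in>X. (\<Sum>b\<in>C. w x b * p b) * v x a) = (\<Sum>b\<in>C. (\<Sum>x\<in>X. v x a * w x b) * p b)"
   unfolding sum_distrib_right by (subst sum.swap) (simp add: mult_ac)
  also have "\<dots> = (\<Sum>b\<in>C. if b = a then p b else 0)"
   using assms(1) True by (intro sum.cong) (auto simp: dual_bases_def)
  also have "\<dots> = p a" using True assms(1) by (simp add: dual_bases_def)
  finally show ?thesis by (simp add: sum_fun_apply fscale_apply)
 next
  case False
  then have "p a = 0" "\<And>x. x \<in> X ==> v x a = 0"
   using assms by (auto simp: dual_bases_def fsupp_def)
  then show ?thesis by (simp add: sum_fun_apply fscale_apply)
 qed
qed

lemma dual_bases_span:
 assumes "dual_bases C X v w" "p \<in> fsupp C"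
 shows "p \<in> fvs.span (v ` X)"
 by (subst dual_bases_expand[OF assms]) (intro fvs.span_sum fvs.span_scale, rule fvs.span_base, simp)

lemma unitf_fsupp [simp]: "unitf i \<in> fsupp X \<longleftrightarrow> i \<in> X"
 by (auto simp: fsupp_def unitf_def)

text \<open>The products over all \<open>d\<close>-subsets of \<open>X\<close> span the monomials of
  degree \<open>d\<close> and are as numerous as these, so \<open>card_leads_family\<close>
  applies.\<close>

lemma card_leads_vm:
 assumes "dual_bases C X v w" "mono_rank N rk" "C \<subseteq> N" "M \<subseteq> nsub d X"
 shows "card (leads rk (fvs.span (vm v ` M))) = card M"
  and "leads rk (fvs.span (vm v ` M)) \<subseteq> nsub d C"
proof -
 have f: "finite C" "finite X" "card X = card C" using assms(1) by (auto simp: dual_bases_def)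
 have s: "vm v ` nsub d X \<subseteq> fsupp (nsub d C)"
 proof clarify
  fix S assume S: "S \<in> nsub d X"
  then have "vm v S \<in> fsupp (nsub (card S) C)"
   by (intro vm_fsupp) (use assms(1) f finite_subset in \<open>auto simp: dual_bases_def nsub_def\<close>)
  then show "vm v S \<in> fsupp (nsub d C)" using S by (simp add: nsub_def)
 qed
 show "card (leads rk (fvs.span (vm v ` M))) = card M"
 proof (rule card_leads_family[where X = "nsub d C" and I = "nsub d X"])
  show "inj_on rk (nsub d C)" using assms(2,3) by (auto simp: mono_rank_def nsub_def intro: inj_on_subset)
  show "unitf T \<in> fvs.span (vm v ` nsub d X)" if "T \<in> nsub d C" for T
   using unitf_span_vm[of C v X T] that f dual_bases_span[OF assms(1)] finite_subset
   by (auto simp: nsub_def)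
 qed (use f s assms(4) in \<open>auto simp: card_nsub\<close>)
 show "leads rk (fvs.span (vm v ` M)) \<subseteq> nsub d C"
  by (rule leads_subset[OF span_fsupp]) (use s assms(4) in auto)
qed

lemma card_leads_vec:
 assumes "dual_bases C X v w" "mono_rank N rk" "C \<subseteq> N" "A \<subseteq> X"
 shows "card (leads (rk1 rk) (fvs.span (v ` A))) = card A"
  and "leads (rk1 rk) (fvs.span (v ` A)) \<subseteq> C"
proof -
 have f: "finite C" "finite X" "card X = card C" "v ` X \<subseteq> fsupp C" using assms(1) by (auto simp: dual_bases_def)
 show "card (leads (rk1 rk) (fvs.span (v ` A))) = card A"
 proof (rule card_leads_family[where X = C and I = X])
  show "inj_on (rk1 rk) C"
  proof (rule inj_onI)
   fix x y assume "x \<in> C" "y \<in> C" "rk {x} = rk {y}"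
   then show "x = y" using mono_rank_inj[OF assms(2), of "{x}" "{y}"] assms(3) by auto
  qed
 qed (use f assms(4) dual_bases_span[OF assms(1)] in auto)
 show "leads (rk1 rk) (fvs.span (v ` A)) \<subseteq> C"
  by (rule leads_subset[OF span_fsupp]) (use f assms(4) in auto)
qed

text \<open>Elimination with pivot \<open>v k\<close> in coordinate \<open>i\<close>. The dual
  vectors can be kept: all new vectors vanish at \<open>i\<close> and the one belonging to
  \<open>k\<close> becomes zero, so the corresponding terms drop out of both identities.\<close>

lemma dual_bases_eliminate:
 assumes b: "dual_bases C X v w" and k: "k \<in> X" "v k i ~= 0"
 shows "dual_bases (C - {i}) (X - {k}) (\<lambda>x. v x - fscale (v x i / v k i) (v k)) w"
  (is "dual_bases _ _ ?v _")
proof -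
 have f: "finite C" "finite X" "card X = card C" using b by (auto simp: dual_bases_def)
 have i: "i \<in> C" using b k by (auto simp: dual_bases_def fsupp_def)
 have v: "?v x a = v x a - v x i / v k i * v k a" for x a by (simp add: fscale_apply)
 have vi: "?v x i = 0" for x using k by (simp add: fscale_apply)
 have vk: "?v k a = 0" for a using k by (simp add: fun_apply)
 show ?thesis unfolding dual_bases_def
 proof (intro conjI ballI)
  fix x assume x: "x \<in> X - {k}"
  have "?v x \<in> fsupp C" using b x k
   by (auto simp: dual_bases_def intro!: fvs.subspace_diff[OF subspace_fsupp] fvs.subspace_scale[OF subspace_fsupp])
  then show "?v x \<in> fsupp (C - {i})" using vi[of x] by (auto simp: fsupp_def)
  fix y assume y: "y \<in> X - {k}"
  have "(\<Sum>a\<in>C - {i}. w x a * ?v y a) = (\<Sum>a\<in>C. w x a * ?v y a)"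
   using f vi by (intro sum.mono_neutral_left) auto
  also have "\<dots> = (\<Sum>a\<in>C. w x a * v y a) - v y i / v k i * (\<Sum>a\<in>C. w x a * v k a)"
   by (simp add: fscale_apply algebra_simps sum_subtractf sum_distrib_left)
  also have "\<dots> = (if x = y then 1 else 0)" using b x y k by (auto simp: dual_bases_def)
  finally show "(\<Sum>a\<in>C - {i}. w x a * ?v y a) = (if x = y then 1 else 0)" .
 next
  fix a b' assume ab: "a \<in> C - {i}" "b' \<in> C - {i}"
  have "(\<Sum>x\<in>X - {k}. ?v x a * w x b') = (\<Sum>x\<in>X. ?v x a * w x b')"
   using f vk by (intro sum.mono_neutral_left) auto
  also have "\<dots> = (\<Sum>x\<in>X. v x a * w x b') - v k a / v k i * (\<Sum>x\<in>X. v x i * w x b')"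
   by (simp add: fscale_apply algebra_simps sum_subtractf sum_distrib_left)
  also have "\<dots> = (if a = b' then 1 else 0)" using b ab i by (auto simp: dual_bases_def)
  finally show "(\<Sum>x\<in>X - {k}. ?v x a * w x b') = (if a = b' then 1 else 0)" .
 qed (use f k i in auto)
qed

text \<open>The mirror image of \<open>dual_bases_eliminate\<close>: the elimination takes place
  among the dual vectors, while the vectors themselves merely forget coordinate
  \<open>i\<close>.\<close>

lemma dual_bases_project:
 assumes b: "dual_bases C X v w" and h: "h \<in> X" "i \<in> C" "w h i ~= 0"
 shows "dual_bases (C - {i}) (X - {h}) (\<lambda>x. (v x)(i := 0)) (\<lambda>x. w x - fscale (w x i / w h i) (w h))"
  (is "dual_bases _ _ ?v ?w")
proof -
 have f: "finite C" "finite X" "card X = card C" using b by (auto simp: dual_bases_def)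
 have w: "?w x a = w x a - w x i / w h i * w h a" for x a by (simp add: fscale_apply)
 have wi: "?w x i = 0" for x using h by (simp add: fscale_apply)
 have wh: "?w h a = 0" for a using h by (simp add: fun_apply)
 show ?thesis unfolding dual_bases_def
 proof (intro conjI ballI)
  fix x assume x: "x \<in> X - {h}"
  then show "(v x)(i := 0) \<in> fsupp (C - {i})" using b by (auto simp: fsupp_def dual_bases_def)
  fix y assume y: "y \<in> X - {h}"
  have "(\<Sum>a\<in>C - {i}. ?w x a * ((v y)(i := 0)) a) = (\<Sum>a\<in>C - {i}. ?w x a * v y a)"
   by (intro sum.cong) auto
  also have "\<dots> = (\<Sum>a\<in>C. ?w x a * v y a)"
   using f wi by (intro sum.mono_neutral_left) auto
  also have "\<dots> = (\<Sum>a\<in>C. w x a * v y a) - w x i / w h i * (\<Sum>a\<in>C. w h a * v y a)"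
   by (simp add: fscale_apply algebra_simps sum_subtractf sum_distrib_left)
  also have "\<dots> = (if x = y then 1 else 0)" using b x y h by (auto simp: dual_bases_def)
  finally show "(\<Sum>a\<in>C - {i}. ?w x a * ((v y)(i := 0)) a) = (if x = y then 1 else 0)" .
 next
  fix a b' assume ab: "a \<in> C - {i}" "b' \<in> C - {i}"
  have "(\<Sum>x\<in>X - {h}. ((v x)(i := 0)) a * ?w x b') = (\<Sum>x\<in>X - {h}. v x a * ?w x b')"
   using ab by (intro sum.cong) auto
  also have "\<dots> = (\<Sum>x\<in>X. v x a * ?w x b')"
   using f wh by (intro sum.mono_neutral_left) auto
  also have "\<dots> = (\<Sum>x\<in>X. v x a * w x b') - w h b' / w h i * (\<Sum>x\<in>X. v x a * w x i)"
   by (simp add: fscale_apply algebra_simps sum_subtractf sum_distrib_left)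
  also have "\<dots> = (if a = b' then 1 else 0)" using b ab h by (auto simp: dual_bases_def)
  finally show "(\<Sum>x\<in>X - {h}. ((v x)(i := 0)) a * ?w x b') = (if a = b' then 1 else 0)" .
 qed (use f h in auto)
qed

text \<open>The span contains the product of \<open>v k\<close> with every vector; with unit vectors
  these products lead with the star of \<open>i\<close>. Modulo them each \<open>v x\<close> may be
  replaced by its reduction, which no longer involves \<open>i\<close>.\<close>

lemma leads_universal:
 assumes mr: "mono_rank N rk" "C \<subseteq> N" and b: "dual_bases C X v w"
  and M: "M \<subseteq> nsub 2 X" "univ X M k" and i: "ld (rk1 rk) (v k) i"
 shows "star C i \<union> leads rk (fvs.span (vm (\<lambda>x. v x - fscale (v x i / v k i) (v k)) ` del M k))
  \<subseteq> leads rk (fvs.span (vm v ` M))"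
proof -
 let ?v = "\<lambda>x. v x - fscale (v x i / v k i) (v k)"
 let ?W = "fvs.span (vm v ` M)"
 have kX: "k \<in> X" using M by (simp add: univ_def)
 have vs: "v x \<in> fsupp N" if "x \<in> X" for x using b mr(2) that by (auto simp: dual_bases_def fsupp_def)
 have kx: "wd (v k) (v x) \<in> ?W" if "x \<in> X" for x
 proof (cases "x = k")
  case True
  then show ?thesis by (simp add: wd_self fvs.span_zero)
 next
  case False
  then show ?thesis using M that by (intro wd_in_span_vm) (auto simp: univ_def)
 qed
 have "{i, j} \<in> leads rk ?W" if j: "j \<in> C" "j ~= i" for j
 proof (rule leadsI)
  show "wd (v k) (unitf j) \<in> ?W"
  proof (rule wd_span[of _ "{v k}" _ "v ` X"])
   show "v k \<in> fvs.span {v k}" by (rule fvs.span_base) simp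
   show "unitf j \<in> fvs.span (v ` X)" by (rule dual_bases_span[OF b]) (use j in simp)
  qed (use kx in auto)
  show "ld rk (wd (v k) (unitf j)) {i, j}"
   by (rule ld_wd[OF mr(1) vs[OF kX] _ i ld_unitf]) (use j mr in auto)
 qed
 then have "star C i \<subseteq> leads rk ?W" by (auto simp: star_def)
 moreover have "leads rk (fvs.span (vm ?v ` del M k)) \<subseteq> leads rk ?W"
 proof (rule leads_mono, rule span_vm_subset)
  show "del M k \<subseteq> nsub 2 X" using M by (auto simp: del_def)
  fix x y assume xy: "{x, y} \<in> del M k" "x ~= y"
  then have xyX: "x \<in> X" "y \<in> X" using M by (auto simp: del_def)
  let ?c = "v x i / v k i" and ?d = "v y i / v k i"
  have "wd (?v x) (?v y) = wd (v x) (v y) - fscale ?d (wd (v x) (v k)) - fscale ?c (wd (v k) (v y))"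
   by (simp only: wd_diff_left wd_diff_right wd_scale_left wd_scale_right wd_self) (simp add: fvs.scale_zero_right)
  also have "wd (v x) (v k) = fscale (- 1) (wd (v k) (v x))"
   by (subst wd_anticomm) (rule uminus_fscale)
  finally have eq: "wd (?v x) (?v y) = wd (v x) (v y) - fscale ?d (fscale (- 1) (wd (v k) (v x))) - fscale ?c (wd (v k) (v y))" .
  have "wd (v x) (v y) \<in> ?W" using xy by (intro wd_in_span_vm) (auto simp: del_def)
  then show "wd (?v x) (?v y) \<in> ?W" unfolding eq
   using kx xyX by (intro fvs.span_diff fvs.span_scale) auto
 qed simp
 ultimately show ?thesis by simp
qed

text \<open>The algebra homomorphism that sends \<open>e_i\<close> to zero.\<close>

definition drop_index :: "nat => 'k::field ext => 'k ext" where
 "drop_index i z = (\<lambda>S. if i \<in> S then 0 else z S)"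

lemma drop_index_lv: "drop_index i (lv a z) = lv (a(i := 0)) (drop_index i z)"
proof
 fix S
 show "drop_index i (lv a z) S = lv (a(i := 0)) (drop_index i z) S"
 proof (cases "i \<in> S")
  case True
  have "(\<Sum>j\<in>S. lsgn j S * (a(i := 0)) j * drop_index i z (S - {j})) = 0"
   by (rule sum.neutral) (use True in \<open>auto simp: drop_index_def\<close>)
  then have "lv (a(i := 0)) (drop_index i z) S = 0" by (simp only: lv_def)
  moreover have "drop_index i (lv a z) S = 0" using True by (simp add: drop_index_def)
  ultimately show ?thesis by simp
 next
  case False
  then show ?thesis by (auto simp: drop_index_def lv_def intro!: sum.cong)
 qed
qed

lemma drop_index_vm: "drop_index i (vm v S) = vm (\<lambda>x. (v x)(i := 0)) S"
proof -
 have "drop_index i (vmul v xs) = vmul (\<lambda>x. (v x)(i := 0)) xs" for xs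
 proof (induction xs)
  case Nil
  then show ?case by (auto simp: drop_index_def unitf_def)
 next
  case (Cons x xs)
  then show ?case by (simp only: vmul_simps drop_index_lv)
 qed
 then show ?thesis by (simp add: vm_def)
qed

lemma drop_index_span: "fvs.span (drop_index i ` B) \<subseteq> drop_index i ` fvs.span B"
proof (rule fvs.span_minimal)
 show "drop_index i ` B \<subseteq> drop_index i ` fvs.span B" by (auto intro: fvs.span_base)
 show "fvs.subspace (drop_index i ` fvs.span B)"
  unfolding fvs.subspace_def
 proof (intro conjI ballI allI)
  show "0 \<in> drop_index i ` fvs.span B"
   by (rule image_eqI[of _ _ 0]) (auto simp: drop_index_def fun_eq_iff zero_fun_apply fvs.span_zero)
  show "x + y \<in> drop_index i ` fvs.span B" if xy: "x \<in> drop_index i ` fvs.span B" "y \<in> drop_index i ` fvs.span B" for x y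
  proof -
   obtain x' y' where "x = drop_index i x'" "y = drop_index i y'" "x' \<in> fvs.span B" "y' \<in> fvs.span B"
    using xy by blast
   then show ?thesis
    by (intro image_eqI[of _ _ "x' + y'"]) (auto simp: drop_index_def fun_eq_iff fun_apply fvs.span_add)
  qed
  show "fscale c x \<in> drop_index i ` fvs.span B" if x: "x \<in> drop_index i ` fvs.span B" for c x
  proof -
   obtain x' where "x = drop_index i x'" "x' \<in> fvs.span B" using x by blast
   then show ?thesis
    by (intro image_eqI[of _ _ "fscale c x'"]) (auto simp: drop_index_def fun_eq_iff fun_apply fvs.span_scale)
  qed
 qed
qed

text \<open>Antisymmetric coefficients of degree 2, so that contraction with a covector is a plain
  sum without distinguishing the order of the indices.\<close>

definition coef2 :: "'k::field ext => nat => nat => 'k" where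
 "coef2 z a b = (if a < b then z {a, b} else if b < a then - z {a, b} else 0)"

lemma coef2_nonzero: "a ~= b ==> coef2 z a b ~= 0 \<longleftrightarrow> z {a, b} ~= 0"
 by (auto simp: coef2_def)

lemma wd_pair:
 assumes "i < j"
 shows "wd a b {i, j} = a i * b j - a j * b i"
proof -
 have e: "lv b e0 {k} = b k" for k
 proof -
  have 0: "{u \<in> {k}. u < k} = {}" by auto
  have "lsgn k {k} = (1 :: 'a)" unfolding lsgn_def 0 by simp
  then show ?thesis by (simp add: lv_def unitf_def)
 qed
 have 1: "{u \<in> {i, j}. u < i} = {}" "{u \<in> {i, j}. u < j} = {i}" using assms by auto
 have 2: "lsgn i {i, j} = (1 :: 'a)" "lsgn j {i, j} = (- 1 :: 'a)" unfolding lsgn_def 1 by simp_all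
 have "{i, j} - {i} = {j}" "{i, j} - {j} = {i}" using assms by auto
 then show ?thesis using assms
  by (simp add: wd_def lv_def[of a] 2 e del: insert_Diff_if)
qed

lemma coef2_wd: "coef2 (wd a b) i j = a i * b j - a j * b i"
proof (cases "i < j")
 case False
 then show ?thesis using wd_pair[of j i a b] by (auto simp: coef2_def insert_commute not_less_iff_gr_or_eq)
qed (simp add: coef2_def wd_pair)

lemma coef2_add: "coef2 (x + y) i j = coef2 x i j + coef2 y i j"
 by (simp add: coef2_def plus_fun_apply)

lemma coef2_scale: "coef2 (fscale c x) i j = c * coef2 x i j"
 by (simp add: coef2_def fscale_apply)

lemma coef2_zero: "coef2 0 i j = 0"
 by (simp add: coef2_def zero_fun_apply)

text \<open>As \<open>h\<close> occurs in no edge, contraction with the covector \<open>w h\<close>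
  kills the whole span. With \<open>i\<close> of least rank in the support of \<open>w h\<close>, a
  leading pair \<open>{i, j}\<close> would need another pair \<open>{c, j}\<close> of higher rank to
  cancel its contraction. Hence no leading term contains \<open>i\<close>, and forgetting this
  coordinate creates no new leading terms.\<close>

lemma leads_isolated:
 assumes mr: "mono_rank N rk" "C \<subseteq> N" and b: "dual_bases C X v w"
  and M: "M \<subseteq> nsub 2 X" "isol X M h"
  and i: "i \<in> C" "w h i ~= 0" "\<And>c. c \<in> C ==> w h c ~= 0 ==> rk {i} \<le> rk {c}"
 shows "leads rk (fvs.span (vm (\<lambda>x. (v x)(i := 0)) ` M)) \<subseteq> leads rk (fvs.span (vm v ` M))"
proof
 let ?W = "fvs.span (vm v ` M)"
 have f: "finite C" using b by (simp add: dual_bases_def)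
 \<comment> \<open>The sum is the coefficient at \<open>j\<close> of the contraction of
   \<open>z\<close> with \<open>w h\<close>.\<close>
 have ann: "?W \<subseteq> {z. \<forall>j. (\<Sum>c\<in>C. w h c * coef2 z c j) = 0}" (is "_ \<subseteq> ?K")
 proof (rule span_vm_subset[OF M(1)])
  have "(\<Sum>c\<in>C. w h c * coef2 (x + y) c j) = (\<Sum>c\<in>C. w h c * coef2 x c j) + (\<Sum>c\<in>C. w h c * coef2 y c j)"
   "(\<Sum>c\<in>C. w h c * coef2 (fscale k x) c j) = k * (\<Sum>c\<in>C. w h c * coef2 x c j)" for x y k j
   by (simp_all add: coef2_add coef2_scale distrib_left sum.distrib sum_distrib_left mult_ac)
  then show "fvs.subspace ?K"
   by (simp add: fvs.subspace_def coef2_zero)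
  fix x y assume xy: "{x, y} \<in> M" "x ~= y"
  then have "x \<in> X" "y \<in> X" "x ~= h" "y ~= h" "h \<in> X" using M by (auto simp: isol_def)
  then have 0: "(\<Sum>c\<in>C. w h c * v x c) = 0" "(\<Sum>c\<in>C. w h c * v y c) = 0"
   using b by (auto simp: dual_bases_def)
  have "(\<Sum>c\<in>C. w h c * coef2 (wd (v x) (v y)) c j) =
   (\<Sum>c\<in>C. w h c * v x c) * v y j - (\<Sum>c\<in>C. w h c * v y c) * v x j" for j
   by (simp add: coef2_wd algebra_simps sum_subtractf sum_distrib_left)
  then show "wd (v x) (v y) \<in> ?K" by (simp add: 0)
 qed
 have vs: "vm v ` M \<subseteq> fsupp (nsub 2 C)"
 proof clarify
  fix S assume S: "S \<in> M"
  then obtain x y where "S = {x, y}" "x \<in> X" "y \<in> X" "x ~= y" using M nsub2E by blast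
  moreover have "vm v S \<in> fsupp (nsub (card S) C)"
   by (rule vm_fsupp) (use b calculation in \<open>auto simp: dual_bases_def\<close>)
  ultimately show "vm v S \<in> fsupp (nsub 2 C)" by (simp add: numeral_2_eq_2)
 qed
 have lead: "i \<notin> S" if z: "z \<in> ?W" "ld rk z S" for z S
 proof
  assume "i \<in> S"
  have zs: "z \<in> fsupp (nsub 2 C)" using z(1) span_fsupp[OF vs] by blast
  then have "S \<in> nsub 2 C" using z(2) by (auto simp: ld_def fsupp_def)
  then obtain j where j: "S = {i, j}" "j \<in> C" "j ~= i"
   using \<open>i \<in> S\<close> by (auto elim!: nsub2E)
  have "(\<Sum>c\<in>C. w h c * coef2 z c j) = 0" using ann z(1) by blast
  then have "w h i * coef2 z i j + (\<Sum>c\<in>C - {i}. w h c * coef2 z c j) = 0"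
   using sum.remove[OF f i(1), of "\<lambda>c. w h c * coef2 z c j"] by simp
  moreover have "w h i * coef2 z i j ~= 0"
   using i z(2) j by (simp add: ld_def coef2_nonzero)
  ultimately have "(\<Sum>c\<in>C - {i}. w h c * coef2 z c j) ~= 0" by auto
  then obtain c where "c \<in> C - {i}" "w h c * coef2 z c j ~= 0"
   by (rule sum.not_neutral_contains_not_neutral)
  then have c: "c \<in> C" "c ~= i" "w h c ~= 0" "coef2 z c j ~= 0" by auto
  then have "c ~= j" by (auto simp: coef2_def)
  then have "z {c, j} ~= 0" using c coef2_nonzero by metis
  then have "rk {c, j} \<le> rk {i, j}" using z(2) j by (simp add: ld_def)
  moreover have "rk {i} < rk {c}"
   using i(3)[OF c(1,3)] mono_rank_inj[OF mr(1), of "{i}" "{c}"] c i(1) mr(2)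
   by (metis empty_subsetI insert_subset le_neq_implies_less singleton_inject subsetD)
  then have "rk (insert i {j}) < rk (insert c {j})"
   using mono_rank_insert_less[OF mr(1), of "{j}" i c] c i(1) j \<open>c ~= j\<close> mr(2) by blast
  ultimately show False by simp
 qed
 fix S assume "S \<in> leads rk (fvs.span (vm (\<lambda>x. (v x)(i := 0)) ` M))"
 then obtain y where y: "y \<in> fvs.span (vm (\<lambda>x. (v x)(i := 0)) ` M)" "ld rk y S"
  by (auto simp: leads_def)
 have "vm (\<lambda>x. (v x)(i := 0)) ` M = drop_index i ` vm v ` M"
  by (simp add: image_image drop_index_vm)
 then obtain z where z: "z \<in> ?W" "y = drop_index i z"
  using y(1) drop_index_span[of i "vm v ` M"] by auto
 have yz: "y T = (if i \<in> T then 0 else z T)" for T using z(2) by (simp add: drop_index_def)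
 have S: "i \<notin> S" "z S ~= 0" using y(2) yz[of S] by (auto simp: ld_def split: if_splits)
 then have "z ~= 0" by (auto simp: zero_fun_apply)
 moreover have "z \<in> fsupp (nsub 2 C)" using z(1) span_fsupp[OF vs] by blast
 ultimately obtain S' where S': "ld rk z S'"
  using ld_exists[of "nsub 2 C" z rk] f by (metis finite_nsub)
 have "i \<notin> S'" by (rule lead[OF z(1) S'])
 then have "rk S' \<le> rk S" using S' y(2) yz[of S'] by (simp add: ld_def)
 then have "ld rk z S" using S' S unfolding ld_def using le_trans by blast
 then show "S \<in> leads rk ?W" using z(1) by (rule leadsI[rotated])
qed

section \<open>Leading terms of two complementary subspaces\<close>

lemma ld_add_dominated:
 fixes x y :: "'i => 'k::field"
 assumes "ld rk x i" "ld rk y j" "rk j < rk i"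
 shows "ld rk (x + y) i"
 by (rule ld_add_less[OF assms(1)]) (use assms(2,3) in \<open>auto simp: ld_def\<close>)

text \<open>The two parts of a complete bipartite graph, or of two disjoint cliques, span
  complementary subspaces \<open>P\<close> and \<open>Q\<close>. In generic position their leading
  indices may overlap; \<open>D\<close> measures the overlap.\<close>

locale split_basis =
 fixes N C A B :: "nat set" and rk :: "nat set => nat" and v w :: "nat => nat => 'k::field"
 assumes mr: "mono_rank N rk" and CN: "C \<subseteq> N" and db: "dual_bases C (A \<union> B) v w" and AB: "A \<inter> B = {}"
begin

definition "P = fvs.span (v ` A)"
definition "Q = fvs.span (v ` B)"
definition "LP = leads (rk1 rk) P"
definition "LQ = leads (rk1 rk) Q"
definition "D = LP \<inter> LQ"

lemma finites: "finite C" "finite A" "finite B" "finite N"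
 using db mr by (auto simp: dual_bases_def mono_rank_def)

lemma PQ_fsupp: "P \<subseteq> fsupp C" "Q \<subseteq> fsupp C"
 unfolding P_def Q_def by (rule span_fsupp; use db in \<open>auto simp: dual_bases_def\<close>)+

lemma fsupp_CN: "x \<in> fsupp C ==> x \<in> fsupp N"
 using CN by (auto simp: fsupp_def)

lemma inj_rk1: "inj_on (rk1 rk) C"
proof (rule inj_onI)
 fix x y assume "x \<in> C" "y \<in> C" "rk {x} = rk {y}"
 then show "x = y" using mono_rank_inj[OF mr, of "{x}" "{y}"] CN by auto
qed

lemma P_Q_zero:
 assumes "p \<in> P" "p \<in> Q"
 shows "p = 0"
proof -
 have kill: "fvs.span (v ` Y) \<subseteq> {p. (\<Sum>b\<in>C. w x b * p b) = 0}"
  if "Y \<subseteq> A \<union> B" "x \<in> A \<union> B" "x \<notin> Y" for Y x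
 proof (rule fvs.span_minimal)
  have "(\<Sum>b\<in>C. w x b * v y b) = 0" if "y \<in> Y" for y
   using db that \<open>Y \<subseteq> A \<union> B\<close> \<open>x \<in> A \<union> B\<close> \<open>x \<notin> Y\<close> unfolding dual_bases_def
   by (metis subsetD)
  then show "v ` Y \<subseteq> {p. (\<Sum>b\<in>C. w x b * p b) = 0}" by auto
  have "(\<Sum>b\<in>C. w x b * (c * p b)) = c * (\<Sum>b\<in>C. w x b * p b)" for c p
   by (simp add: sum_distrib_left mult_ac)
  then show "fvs.subspace {p. (\<Sum>b\<in>C. w x b * p b) = 0}"
   by (auto simp: fvs.subspace_def fun_apply distrib_left sum.distrib)
 qed
 have "p \<in> fsupp C" using assms PQ_fsupp by auto
 moreover have "(\<Sum>b\<in>C. w x b * p b) = 0" if "x \<in> A \<union> B" for x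
  using kill[of A x] kill[of B x] that AB assms by (auto simp: P_def Q_def)
 then have "(\<Sum>x\<in>A \<union> B. fscale (\<Sum>b\<in>C. w x b * p b) (v x)) = 0"
  by (intro sum.neutral) simp
 ultimately show ?thesis using dual_bases_expand[OF db, of p] by simp
qed

lemma P_subspace: "fvs.subspace P" and Q_subspace: "fvs.subspace Q"
 by (simp_all add: P_def Q_def)

text \<open>
 Among the pairs of vectors with a common leading term \<open>k\<close> choose one whose difference has the
 smallest possible leading term; minimality forces these leading terms to be new and distinct.
\<close>

definition cand :: "nat => (nat => 'k) \<times> (nat => 'k) \<times> nat => bool" where
 "cand k = (\<lambda>(p, q, i). p \<in> P \<and> q \<in> Q \<and> ld (rk1 rk) p k \<and> ld (rk1 rk) q k \<and> p k = q k \<and> ld (rk1 rk) (p - q) i)"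

lemma cand_exists:
 assumes "p \<in> P" "q \<in> Q" "ld (rk1 rk) p k" "ld (rk1 rk) q k" "p k = q k"
 obtains i where "cand k (p, q, i)" "i \<in> C"
proof -
 have "p - q ~= 0"
 proof
  assume "p - q = 0"
  then have "p = q" by simp
  then have "p = 0" using P_Q_zero assms by blast
  then show False using assms(3) by (simp add: ld_def zero_fun_apply)
 qed
 moreover have "p - q \<in> fsupp C"
  using assms(1,2) PQ_fsupp by (intro fvs.subspace_diff[OF subspace_fsupp]) auto
 ultimately obtain i where "i \<in> C" "ld (rk1 rk) (p - q) i" using ld_exists[OF finites(1)] by blast
 then show thesis using that assms by (simp add: cand_def)
qed

lemma cand_rank:
 assumes "cand k (p, q, i)"
 shows "i \<in> C" "rk {i} < rk {k}"
proof -
 have pq: "p \<in> fsupp C" "q \<in> fsupp C" "k \<in> C"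
  using assms PQ_fsupp by (auto simp: cand_def ld_def fsupp_def)
 have "(p - q) i ~= 0" using assms by (auto simp: cand_def ld_def)
 then have "p i ~= 0 \<or> q i ~= 0" by auto
 then have "rk {i} \<le> rk {k}" "i \<in> C" using assms pq by (auto simp: cand_def ld_def fsupp_def)
 moreover have "i ~= k" using assms by (auto simp: cand_def ld_def)
 ultimately show "i \<in> C" "rk {i} < rk {k}"
  using inj_rk1 pq(3) by (auto simp: inj_on_def le_less)
qed

lemma ld_add_smaller:
 fixes x y :: "nat => 'k"
 assumes "ld (rk1 rk) x k" "ld (rk1 rk) y i" "rk {i} < rk {k}"
 shows "ld (rk1 rk) (x - fscale c y) k \<and> (x - fscale c y) k = x k"
proof -
 have "y k = 0" using assms by (auto simp: ld_def)
 moreover have "ld (rk1 rk) (x + fscale (- c) y) k"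
  by (rule ld_add_less[OF assms(1)]) (use assms in \<open>auto simp: ld_def fscale_apply\<close>)
 moreover have "x + fscale (- c) y = x - fscale c y" by (auto simp: fun_eq_iff fun_apply)
 ultimately show ?thesis by (auto simp: fscale_apply)
qed

text \<open>The descent behind the minimal choice: a vector with leading index \<open>i\<close> that
  can be absorbed into the pair cancels the leading term of \<open>p - q\<close>.\<close>

lemma cand_descend:
 assumes c: "cand k (p, q, i)" and y: "y \<in> fsupp C" "ld (rk1 rk) y i"
  and p': "p' \<in> P" "q' \<in> Q" "ld (rk1 rk) p' k" "ld (rk1 rk) q' k" "p' k = q' k"
  and d: "p' - q' = (p - q) - fscale ((p - q) i / y i) y"
 obtains j where "cand k (p', q', j)" "rk {j} < rk {i}"
proof -
 obtain j where j: "cand k (p', q', j)" using cand_exists[OF p'] by blast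
 have "p - q \<in> fsupp C"
  using c PQ_fsupp by (intro fvs.subspace_diff[OF subspace_fsupp]) (auto simp: cand_def)
 moreover have "(p' - q') j ~= 0" using j by (auto simp: cand_def ld_def)
 moreover have "ld (rk1 rk) (p - q) i" using c by (simp add: cand_def)
 ultimately have "rk {j} < rk {i}" using ld_sub_cancel[OF finites(1) inj_rk1 _ y(1) _ y(2) d, of j] by blast
 then show thesis using j that by blast
qed

text \<open>The three claims on \<open>i k\<close> exclude the three ways of lowering the leading
  index of the difference: correcting \<open>p k\<close> within \<open>P\<close>, correcting
  \<open>q k\<close> within \<open>Q\<close>, and subtracting a multiple of the pair that belongs to
  another index.\<close>

lemma matched:
 obtains p q i where
  "\<And>k. k \<in> D ==> p k \<in> P \<and> q k \<in> Q \<and> ld (rk1 rk) (p k) k \<and> ld (rk1 rk) (q k) k \<and>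
    ld (rk1 rk) (p k - q k) (i k) \<and> i k \<in> C \<and> i k \<notin> LP \<and> i k \<notin> LQ \<and> rk {i k} < rk {k}"
  "inj_on i D"
proof -
 have "\<exists>t. cand k t \<and> (\<forall>t'. cand k t' --> rk {snd (snd t)} \<le> rk {snd (snd t')})" if k: "k \<in> D" for k
 proof -
  obtain p q where pq: "p \<in> P" "q \<in> Q" "ld (rk1 rk) p k" "ld (rk1 rk) q k"
   using k by (auto simp: D_def LP_def LQ_def leads_def)
  let ?q = "fscale (p k / q k) q"
  have nz: "p k ~= 0" "q k ~= 0" using pq by (auto simp: ld_def)
  have "?q \<in> Q" using pq Q_subspace by (simp add: fvs.subspace_scale)
  moreover have "ld (rk1 rk) ?q k" using pq nz by (simp add: ld_fscale)
  moreover have "p k = ?q k" using nz by (simp add: fscale_apply)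
  ultimately obtain i where "cand k (p, ?q, i)" using cand_exists[OF pq(1) _ pq(3)] by blast
  then show ?thesis using ex_has_least_nat[of "cand k" _ "\<lambda>t. rk {snd (snd t)}"] by blast
 qed
 then obtain t where t: "\<And>k. k \<in> D ==> cand k (t k)"
  "\<And>k t'. k \<in> D ==> cand k t' ==> rk {snd (snd (t k))} \<le> rk {snd (snd t')}"
  by metis
 define p q i where "p k = fst (t k)" and "q k = fst (snd (t k))" and "i k = snd (snd (t k))" for k
 have c: "cand k (p k, q k, i k)" if "k \<in> D" for k using t(1)[OF that] by (simp add: p_def q_def i_def)
 have min: "rk {i k} \<le> rk {j}" if "k \<in> D" "cand k (p', q', j)" for k p' q' j
  using t(2)[OF that] by (simp add: i_def)
 have pq: "p k \<in> P" "q k \<in> Q" "ld (rk1 rk) (p k) k" "ld (rk1 rk) (q k) k" "p k k = q k k"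
  "ld (rk1 rk) (p k - q k) (i k)" if "k \<in> D" for k
  using c[OF that] by (auto simp: cand_def)
 have rank: "i k \<in> C" "rk {i k} < rk {k}" if "k \<in> D" for k using cand_rank[OF c[OF that]] by auto
 have nP: "i k \<notin> LP" if k: "k \<in> D" for k
 proof
  assume "i k \<in> LP"
  then obtain y where y: "y \<in> P" "ld (rk1 rk) y (i k)" by (auto simp: LP_def leads_def)
  let ?c = "(p k - q k) (i k) / y (i k)"
  have "p k - fscale ?c y \<in> P" using pq[OF k] y P_subspace
   by (simp add: fvs.subspace_diff fvs.subspace_scale)
  moreover have "ld (rk1 rk) (p k - fscale ?c y) k \<and> (p k - fscale ?c y) k = p k k"
   by (rule ld_add_smaller[OF pq(3)[OF k] y(2) rank(2)[OF k]])
  moreover have "(p k - fscale ?c y) - q k = (p k - q k) - fscale ?c y" by (simp add: algebra_simps)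
  ultimately obtain j where "cand k (p k - fscale ?c y, q k, j)" "rk {j} < rk {i k}"
   using cand_descend[OF c[OF k] _ y(2) _ pq(2)[OF k] _ pq(4)[OF k]] pq(5)[OF k] y(1) PQ_fsupp by auto
  then show False using min[OF k] by fastforce
 qed
 have nQ: "i k \<notin> LQ" if k: "k \<in> D" for k
 proof
  assume "i k \<in> LQ"
  then obtain y where y: "y \<in> Q" "ld (rk1 rk) y (i k)" by (auto simp: LQ_def leads_def)
  let ?c = "(p k - q k) (i k) / y (i k)"
  have 1: "q k - fscale (- ?c) y \<in> Q" using pq[OF k] y Q_subspace
   by (intro fvs.subspace_diff fvs.subspace_scale) auto
  have 2: "ld (rk1 rk) (q k - fscale (- ?c) y) k \<and> (q k - fscale (- ?c) y) k = q k k"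
   by (rule ld_add_smaller[OF pq(4)[OF k] y(2) rank(2)[OF k]])
  have 3: "p k k = (q k - fscale (- ?c) y) k" by (rule trans[OF pq(5)[OF k] conjunct2[OF 2, symmetric]])
  have 4: "p k - (q k - fscale (- c) y) = (p k - q k) - fscale c y" for c
   by (auto simp: fun_eq_iff fun_apply)
  have 5: "y \<in> fsupp C" using y(1) PQ_fsupp by blast
  obtain j where "cand k (p k, q k - fscale (- ?c) y, j)" "rk {j} < rk {i k}"
   using cand_descend[OF c[OF k] 5 y(2) pq(1)[OF k] 1 pq(3)[OF k] conjunct1[OF 2] 3 4] by blast
  then show False using min[OF k] by fastforce
 qed
 \<comment> \<open>Only the pair with the higher index \<open>l\<close> is modified; the vectors
   belonging to \<open>k\<close> are too low to disturb its leading terms.\<close>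
 have ne: "i k ~= i l" if kl: "k \<in> D" "l \<in> D" "rk {k} < rk {l}" for k l
 proof
  assume eq: "i k = i l"
  let ?y = "p k - q k"
  let ?c = "(p l - q l) (i l) / ?y (i l)"
  have "p l - fscale ?c (p k) \<in> P" "q l - fscale ?c (q k) \<in> Q"
   using pq[OF kl(1)] pq[OF kl(2)] P_subspace Q_subspace
   by (auto intro!: fvs.subspace_diff fvs.subspace_scale)
  moreover have "ld (rk1 rk) (p l - fscale ?c (p k)) l \<and> (p l - fscale ?c (p k)) l = p l l"
   by (rule ld_add_smaller[OF pq(3)[OF kl(2)] pq(3)[OF kl(1)] kl(3)])
  moreover have "ld (rk1 rk) (q l - fscale ?c (q k)) l \<and> (q l - fscale ?c (q k)) l = q l l"
   by (rule ld_add_smaller[OF pq(4)[OF kl(2)] pq(4)[OF kl(1)] kl(3)])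
  moreover have "(p l - fscale ?c (p k)) - (q l - fscale ?c (q k)) = (p l - q l) - fscale ?c ?y"
   by (auto simp: fun_eq_iff fscale_apply algebra_simps)
  moreover have "?y \<in> fsupp C"
   using pq[OF kl(1)] PQ_fsupp by (intro fvs.subspace_diff[OF subspace_fsupp]) auto
  moreover have "ld (rk1 rk) ?y (i l)" using pq(6)[OF kl(1)] eq by simp
  ultimately obtain j where "cand l (p l - fscale ?c (p k), q l - fscale ?c (q k), j)" "rk {j} < rk {i l}"
   using cand_descend[OF c[OF kl(2)], of ?y "p l - fscale ?c (p k)" "q l - fscale ?c (q k)"] pq(5)[OF kl(2)] by auto
  then show False using min[OF kl(2)] by fastforce
 qed
 have "inj_on i D"
 proof (rule inj_onI, rule ccontr)
  fix k l assume kl: "k \<in> D" "l \<in> D" "i k = i l" "k ~= l"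
  have "D \<subseteq> C" using leads_subset[OF PQ_fsupp(1)] by (auto simp: D_def LP_def)
  then have "rk {k} ~= rk {l}" using kl inj_rk1 by (auto simp: inj_on_def)
  then show False using ne[of k l] ne[of l k] kl by (metis linorder_neqE_nat)
 qed
 then show thesis using that[of p q i] pq rank nP nQ by blast
qed

text \<open>Outside \<open>D\<close> representatives of leading indices are multiplied directly. For
  \<open>k\<close> and \<open>l\<close> in \<open>D\<close> several products share the leading pair
  \<open>{k, l}\<close>; combinations in which it cancels reveal a pair of a shared index with the
  partner of another, and \<open>win\<close> says which of the two candidates leads.\<close>

lemma base_leads:
 shows "\<exists>M. has_type C M (PQ (card A) (card B)) \<and> M \<subseteq> leads rk (fvs.span (vm v ` prods A B))"
  and "\<exists>M. has_type C M (PP (card A) (card B)) \<and> M \<subseteq> leads rk (fvs.span (vm v ` (nsub 2 A \<union> nsub 2 B)))"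
proof -
 obtain p q i where m:
  "\<And>k. k \<in> D ==> p k \<in> P \<and> q k \<in> Q \<and> ld (rk1 rk) (p k) k \<and> ld (rk1 rk) (q k) k \<and>
    ld (rk1 rk) (p k - q k) (i k) \<and> i k \<in> C \<and> i k \<notin> LP \<and> i k \<notin> LQ \<and> rk {i k} < rk {k}"
  and inj: "inj_on i D" using matched by blast
 define A0 B0 where "A0 = LP - D" and "B0 = LQ - D"
 define win where "win k l \<longleftrightarrow> rk {l, i k} < rk {k, i l}" for k l
 have L: "LP \<subseteq> C" "LQ \<subseteq> C" "card LP = card A" "card LQ = card B"
  using card_leads_vec[OF db mr CN, of A] card_leads_vec[OF db mr CN, of B]
  by (auto simp: LP_def LQ_def P_def Q_def)
 have fin: "finite LP" "finite LQ" using L finites(1) finite_subset by blast+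
 have sub: "A0 \<subseteq> C" "B0 \<subseteq> C" "D \<subseteq> C" "i ` D \<subseteq> C" using L m by (auto simp: A0_def B0_def D_def)
 have f0: "finite A0" "finite B0" "finite D" using fin by (auto simp: A0_def B0_def D_def)
 have cA: "card A0 + card D = card A" "card B0 + card D = card B"
  using L fin card_Int_Diff[of LP LQ] card_Int_Diff[of LQ LP]
  by (simp_all add: A0_def B0_def D_def Diff_Int Int_commute)
 have dj: "A0 \<inter> B0 = {}" "D \<inter> (A0 \<union> B0) = {}" "i ` D \<inter> (A0 \<union> B0) = {}" "i ` D \<inter> D = {}"
  using m by (auto simp: A0_def B0_def D_def)
 \<comment> \<open>The partners stand in for the overlap that was counted twice, so the disjoint
   pieces together have as many elements as \<open>C\<close>.\<close>
 have "card (A0 \<union> B0 \<union> D \<union> i ` D) = card A0 + card B0 + card D + card (i ` D)"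
  using dj f0 by (subst card_Un_disjoint; (subst card_Un_disjoint)?; (subst card_Un_disjoint)?; auto)
 also have "\<dots> = card (A \<union> B)" using cA card_image[OF inj] AB finites by (simp add: card_Un_disjoint)
 also have "\<dots> = card C" using db by (simp add: dual_bases_def)
 finally have X: "A0 \<union> B0 \<union> D \<union> i ` D = C"
  using sub finites(1) by (intro card_subset_eq) auto
 have N: "x \<in> N" if "x \<in> C" for x using that CN by auto
 have neq: "i k ~= l" "l ~= i k" if "k \<in> D" "l \<in> D" for k l using dj(4) that by blast+
 have ineq: "i k ~= i l" if "k \<in> D" "l \<in> D" "k ~= l" for k l using inj that by (auto simp: inj_on_def)
 have DN: "k \<in> N" "i k \<in> N" if "k \<in> D" for k using that sub N by auto
 have tot: "win k l \<longleftrightarrow> \<not> win l k" if "k \<in> D" "l \<in> D" "k ~= l" for k l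
 proof -
  have "{l, i k} ~= {k, i l}" using that neq[of l l] by (auto simp: doubleton_eq_iff)
  then have "rk {l, i k} ~= rk {k, i l}"
   using mono_rank_inj[OF mr, of "{l, i k}" "{k, i l}"] DN that by auto
  then show ?thesis by (auto simp: win_def)
 qed
 \<comment> \<open>The three comparisons, multiplied by \<open>i l\<close>, \<open>i n\<close> and
   \<open>i k\<close>, would close up into a strict cycle of monomials of degree 3.\<close>
 have trans: "win k n" if d: "k \<in> D" "l \<in> D" "n \<in> D" "k ~= l" "l ~= n" "k ~= n" and w: "win k l" "win l n" for k l n
 proof (rule ccontr)
  assume "\<not> win k n"
  then have "rk {k, i n} \<le> rk {n, i k}" by (simp add: win_def)
  then have 1: "rk (insert (i l) {k, i n}) \<le> rk (insert (i l) {n, i k})"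
   using d neq ineq DN by (intro mono_rank_insert2_le[OF mr]) auto
  have 2: "rk ({l, i k} \<union> {i n}) < rk ({k, i l} \<union> {i n})"
   using w(1) d neq ineq DN by (intro mono_rank_less[OF mr]) (auto simp: win_def)
  have 3: "rk ({n, i l} \<union> {i k}) < rk ({l, i n} \<union> {i k})"
   using w(2) d neq ineq DN by (intro mono_rank_less[OF mr]) (auto simp: win_def)
  show False using 1 2 3 by (simp add: insert_commute)
 qed
 interpret mt: matching win A0 B0 i by unfold_locales (use f0 dj in auto)
 have fs: "x \<in> fsupp N" if "x \<in> P \<or> x \<in> Q" for x using that PQ_fsupp fsupp_CN by blast
 have dfs: "p k - q k \<in> fsupp N" if "k \<in> D" for k
  using fs m[OF that] by (intro fvs.subspace_diff[OF subspace_fsupp]) auto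
 define pl ql where "pl a = (SOME x. x \<in> P \<and> ld (rk1 rk) x a)" and "ql a = (SOME x. x \<in> Q \<and> ld (rk1 rk) x a)" for a
 have pl: "pl a \<in> P \<and> ld (rk1 rk) (pl a) a" if "a \<in> LP" for a
  using that someI_ex[of "\<lambda>x. x \<in> P \<and> ld (rk1 rk) x a"] by (auto simp: pl_def LP_def leads_def)
 have ql: "ql a \<in> Q \<and> ld (rk1 rk) (ql a) a" if "a \<in> LQ" for a
  using that someI_ex[of "\<lambda>x. x \<in> Q \<and> ld (rk1 rk) x a"] by (auto simp: ql_def LQ_def leads_def)
 have lw: "ld rk (wd a b) {x, y}" if "a \<in> P \<or> a \<in> Q" "b \<in> P \<or> b \<in> Q" "ld (rk1 rk) a x" "ld (rk1 rk) b y" "x ~= y" for a b x y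
  by (rule ld_wd[OF mr fs[OF that(1)] fs[OF that(2)] that(3-5)])
 have neA: "a ~= b" if "a \<in> A0" "b \<in> B0" for a b using that dj by blast
 have DL: "k \<in> LP" "k \<in> LQ" if "k \<in> D" for k using that by (auto simp: D_def)
 have dq: "ld rk (wd (p k - q k) (q l)) {i k, l}" if "k \<in> D" "l \<in> D" for k l
  by (rule ld_wd[OF mr dfs[OF that(1)] fs]) (use m that neq in auto)
 have qd: "ld rk (wd (q k) (p l - q l)) {k, i l}" if "k \<in> D" "l \<in> D" for k l
  by (rule ld_wd[OF mr fs dfs[OF that(2)]]) (use m that neq in auto)
 have dd: "ld rk (wd (p k - q k) (p l - q l)) {i k, i l}" if "k \<in> D" "l \<in> D" "k ~= l" for k l
  by (rule ld_wd[OF mr dfs[OF that(1)] dfs[OF that(2)]]) (use m that ineq in auto)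
 let ?WQ = "fvs.span (vm v ` prods A B)"
 have WQ: "wd x y \<in> ?WQ" if "x \<in> P" "y \<in> Q" for x y
 proof (rule wd_span[of x "v ` A" y "v ` B"])
  fix a b assume "a \<in> v ` A" "b \<in> v ` B"
  then show "wd a b \<in> ?WQ" using AB by (auto intro!: wd_in_span_vm simp: prods_def)
 qed (use that in \<open>auto simp: P_def Q_def\<close>)
 have LQ': "{x, y} \<in> leads rk ?WQ"
  if "a \<in> P" "ld (rk1 rk) a x" "b \<in> Q" "ld (rk1 rk) b y" "x ~= y" for a b x y
  by (rule leadsI[OF WQ[OF that(1,3)] lw]) (simp_all add: that)
 have "prods A0 B0 \<union> mixed_pairs win (A0 \<union> B0) D i \<union> (\<lambda>k. {k, i k}) ` D \<subseteq> leads rk ?WQ"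
 proof
  fix S assume "S \<in> prods A0 B0 \<union> mixed_pairs win (A0 \<union> B0) D i \<union> (\<lambda>k. {k, i k}) ` D"
  then consider a b where "a \<in> A0" "b \<in> B0" "S = {a, b}"
   | k a where "k \<in> D" "a \<in> A0" "S = {a, k}" | k b where "k \<in> D" "b \<in> B0" "S = {k, b}"
   | k l where "k \<in> D" "l \<in> D" "k ~= l" "S = {k, l}" | k where "k \<in> D" "S = {i k, k}"
   | k l where "k \<in> D" "l \<in> D" "k ~= l" "win k l" "S = {i l, k}"
   unfolding mixed_pairs_def prods_def by (auto elim!: nsub2E simp: insert_commute)
  then show "S \<in> leads rk ?WQ"
  proof cases
   case 1
   then have "a \<in> LP" "b \<in> LQ" by (auto simp: A0_def B0_def)
   then show ?thesis using LQ'[of "pl a" a "ql b" b] pl[of a] ql[of b] neA[OF 1(1,2)] 1(3) by blast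
  next
   case 2
   then have "a \<in> LP" "a ~= k" using dj by (auto simp: A0_def)
   then show ?thesis using LQ'[of "pl a" a "q k" k] pl[of a] m[OF 2(1)] 2(3) by blast
  next
   case 3
   then have "b \<in> LQ" "k ~= b" using dj by (auto simp: B0_def)
   then show ?thesis using LQ'[of "p k" k "ql b" b] ql[of b] m[OF 3(1)] 3(3) by blast
  next
   case 4
   then show ?thesis using LQ'[of "p k" k "q l" l] m[OF 4(1)] m[OF 4(2)] by blast
  next
   case 5
   \<comment> \<open>Both factors lead with \<open>k\<close>; subtracting the vanishing square of
     \<open>q k\<close> lowers the first one to \<open>i k\<close>.\<close>
   have "wd (p k) (q k) = wd (p k - q k) (q k)" by (simp add: wd_diff_left wd_self)
   then show ?thesis using dq[OF 5(1,1)] WQ[of "p k" "q k"] m[OF 5(1)] 5(2) by (auto intro: leadsI)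
  next
   case 6
   \<comment> \<open>The products of \<open>q l\<close> and \<open>q k\<close> cancel by
     antisymmetry, and of the two remaining leading pairs \<open>win\<close> selects the
     larger.\<close>
   have "wd (p k) (q l) + wd (p l) (q k) = wd (p l - q l) (q k) + wd (p k - q k) (q l)"
    using wd_anticomm[of "q l" "q k"] by (simp add: wd_diff_left)
   moreover have "ld rk (wd (p l - q l) (q k) + wd (p k - q k) (q l)) {i l, k}"
    by (rule ld_add_dominated[OF dq[OF 6(2,1)] dq[OF 6(1,2)]]) (use 6 in \<open>simp add: win_def insert_commute\<close>)
   moreover have "wd (p k) (q l) + wd (p l) (q k) \<in> ?WQ"
    using WQ m[OF 6(1)] m[OF 6(2)] by (intro fvs.span_add) auto
   ultimately show ?thesis using 6(5) by (auto intro: leadsI)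
  qed
 qed
 moreover have "has_type C (prods A0 B0 \<union> mixed_pairs win (A0 \<union> B0) D i \<union> (\<lambda>k. {k, i k}) ` D) (PQ (card A) (card B))"
  using mt.has_type_pq_matching[OF f0(3) dj(2-4) inj tot trans] unfolding X cA .
 ultimately show "\<exists>M. has_type C M (PQ (card A) (card B)) \<and> M \<subseteq> leads rk ?WQ" by blast
 let ?WP = "fvs.span (vm v ` (nsub 2 A \<union> nsub 2 B))"
 have WP: "wd x y \<in> ?WP" if "x \<in> fvs.span (v ` Y)" "y \<in> fvs.span (v ` Y)" "Y = A \<or> Y = B" for x y Y
 proof (rule wd_span[OF that(1,2)])
  fix a b assume "a \<in> v ` Y" "b \<in> v ` Y"
  then obtain s t where st: "s \<in> Y" "t \<in> Y" "a = v s" "b = v t" by blast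
  show "wd a b \<in> ?WP"
  proof (cases "s = t")
   case True
   then show ?thesis using st by (simp add: wd_self fvs.span_zero)
  next
   case False
   then show ?thesis using st that(3) by (auto intro!: wd_in_span_vm)
  qed
 qed
 have WPP: "wd x y \<in> ?WP" if "x \<in> P" "y \<in> P" for x y using WP[of x A y] that by (simp add: P_def)
 have WPQ: "wd x y \<in> ?WP" if "x \<in> Q" "y \<in> Q" for x y using WP[of x B y] that by (simp add: Q_def)
 have LPP: "{x, y} \<in> leads rk ?WP"
  if "a \<in> P" "ld (rk1 rk) a x" "b \<in> P" "ld (rk1 rk) b y" "x ~= y" for a b x y
  by (rule leadsI[OF WPP[OF that(1,3)] lw]) (simp_all add: that)
 have LQQ: "{x, y} \<in> leads rk ?WP"
  if "a \<in> Q" "ld (rk1 rk) a x" "b \<in> Q" "ld (rk1 rk) b y" "x ~= y" for a b x y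
  by (rule leadsI[OF WPQ[OF that(1,3)] lw]) (simp_all add: that)
 have "nsub 2 A0 \<union> nsub 2 B0 \<union> mixed_pairs win (A0 \<union> B0) D i \<subseteq> leads rk ?WP"
 proof
  fix S assume "S \<in> nsub 2 A0 \<union> nsub 2 B0 \<union> mixed_pairs win (A0 \<union> B0) D i"
  then consider a b where "a \<in> A0" "b \<in> A0" "a ~= b" "S = {a, b}"
   | a b where "a \<in> B0" "b \<in> B0" "a ~= b" "S = {a, b}"
   | k a where "k \<in> D" "a \<in> A0" "S = {a, k}" | k b where "k \<in> D" "b \<in> B0" "S = {b, k}"
   | k l where "k \<in> D" "l \<in> D" "k ~= l" "S = {k, l}"
   | k l where "k \<in> D" "l \<in> D" "k ~= l" "win k l" "S = {k, i l}"
   unfolding mixed_pairs_def prods_def by (auto elim!: nsub2E simp: insert_commute)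
  then show "S \<in> leads rk ?WP"
  proof cases
   case 1
   then have "a \<in> LP" "b \<in> LP" by (auto simp: A0_def)
   then show ?thesis using LPP[of "pl a" a "pl b" b] pl[of a] pl[of b] 1(3,4) by blast
  next
   case 2
   then have "a \<in> LQ" "b \<in> LQ" by (auto simp: B0_def)
   then show ?thesis using LQQ[of "ql a" a "ql b" b] ql[of a] ql[of b] 2(3,4) by blast
  next
   case 3
   then have "a \<in> LP" "a ~= k" using dj by (auto simp: A0_def)
   then show ?thesis using LPP[of "pl a" a "p k" k] pl[of a] m[OF 3(1)] 3(3) by blast
  next
   case 4
   then have "b \<in> LQ" "b ~= k" using dj by (auto simp: B0_def)
   then show ?thesis using LQQ[of "ql b" b "q k" k] ql[of b] m[OF 4(1)] 4(3) by blast
  next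
   case 5
   then show ?thesis using LPP[of "p k" k "p l" l] m[OF 5(1)] m[OF 5(2)] by blast
  next
   case 6
   let ?d = "\<lambda>k. p k - q k"
   \<comment> \<open>Each \<open>p\<close> is expanded as \<open>q\<close> plus the difference. The
     product of the two differences is negligible because \<open>i k\<close> ranks below
     \<open>k\<close>.\<close>
   have "wd (p k) (p l) - wd (q k) (q l) = wd (q k) (?d l) + wd (?d k) (q l) + wd (?d k) (?d l)"
    by (simp add: wd_diff_left wd_diff_right)
   moreover have "ld rk (wd (q k) (?d l) + wd (?d k) (q l) + wd (?d k) (?d l)) {k, i l}"
   proof (rule ld_add_dominated[OF ld_add_dominated[OF qd[OF 6(1,2)] dq[OF 6(1,2)]] dd[OF 6(1-3)]])
    show "rk {i k, l} < rk {k, i l}" using 6(4) by (simp add: win_def insert_commute)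
    show "rk {i k, i l} < rk {k, i l}"
     using mono_rank_insert_less[OF mr, of "{i l}" "i k" k] m[OF 6(1)] 6 neq ineq DN by simp
   qed
   moreover have "wd (p k) (p l) - wd (q k) (q l) \<in> ?WP"
    using WPP WPQ m[OF 6(1)] m[OF 6(2)] by (intro fvs.span_diff) auto
   ultimately show ?thesis using 6(5) by (auto intro: leadsI)
  qed
 qed
 moreover have "has_type C (nsub 2 A0 \<union> nsub 2 B0 \<union> mixed_pairs win (A0 \<union> B0) D i) (PP (card A) (card B))"
  using mt.has_type_pp_matching[OF f0(3) dj(2-4) inj tot trans] unfolding X cA .
 ultimately show "\<exists>M. has_type C M (PP (card A) (card B)) \<and> M \<subseteq> leads rk ?WP" by blast
qed

end

text \<open>Each peeling rule removes one vertex and one coordinate: for a universal vertex the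
  leading index of its vector, for an isolated one the least index in the support of its dual
  vector. Only an inclusion is carried through the induction; \<open>has_type_leads\<close> turns it
  into equality by counting edges.\<close>

lemma has_type_leads_subset:
 assumes mr: "mono_rank N rk"
 shows "has_type X M \<tau> ==> C \<subseteq> N ==> dual_bases C X v (w :: nat => nat => 'k::field) ==>
  \<exists>M'. has_type C M' \<tau> \<and> M' \<subseteq> leads rk (fvs.span (vm v ` M))"
proof (induction arbitrary: C v w rule: has_type.induct)
 case (al M X k \<tau>)
 have kX: "k \<in> X" and fC: "finite C" using al by (auto simp: univ_def dual_bases_def)
 have vk: "v k \<in> fsupp C" using al.prems kX by (auto simp: dual_bases_def)
 have "v k ~= 0"
 proof
  assume "v k = 0"
  then have "(\<Sum>a\<in>C. w k a * v k a) = 0" by (simp add: zero_fun_apply)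
  moreover have "(\<Sum>a\<in>C. w k a * v k a) = 1" using al.prems(2) kX unfolding dual_bases_def by simp
  ultimately show False by simp
 qed
 then obtain i where i: "i \<in> C" "ld (rk1 rk) (v k) i" using ld_exists[OF fC vk, of "rk1 rk"] by blast
 let ?v = "\<lambda>x. v x - fscale (v x i / v k i) (v k)"
 have "dual_bases (C - {i}) (X - {k}) ?v w"
  by (rule dual_bases_eliminate[OF al.prems(2) kX]) (use i in \<open>simp add: ld_def\<close>)
 then obtain M' where M': "has_type (C - {i}) M' \<tau>" "M' \<subseteq> leads rk (fvs.span (vm ?v ` del M k))"
  using al.IH[of "C - {i}" ?v w] al.prems(1) by blast
 have s: "M' \<subseteq> nsub 2 (C - {i})" using has_type_basic[OF M'(1)] by blast
 have d: "del (star C i \<union> M') i = M'"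
  using s by (auto simp: del_def star_def nsub_def)
 have "has_type C (star C i \<union> M') (Al \<tau>)"
 proof (rule has_type.al)
  show "star C i \<union> M' \<subseteq> nsub 2 C" using star_subset[OF i(1)] s nsub_mono[of "C - {i}" C 2] by auto
  show "univ C (star C i \<union> M') i" using i by (auto simp: univ_def star_def)
  show "has_type (C - {i}) (del (star C i \<union> M') i) \<tau>" using M' d by simp
 qed
 moreover have "star C i \<union> M' \<subseteq> leads rk (fvs.span (vm v ` M))"
  using leads_universal[OF mr al.prems al.hyps(1,2) i(2)] M'(2) by blast
 ultimately show ?case by blast
next
 case (be X M h \<tau>)
 have hX: "h \<in> X" and fC: "finite C" using be by (auto simp: isol_def dual_bases_def)
 have M: "M \<subseteq> nsub 2 X" using has_type_basic[OF be.hyps(2)] nsub_mono[of "X - {h}" X 2] by auto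
 have "(\<Sum>a\<in>C. w h a * v h a) ~= 0" using be.prems(2) hX by (simp add: dual_bases_def)
 then obtain c where "c \<in> C" "w h c * v h c ~= 0" by (rule sum.not_neutral_contains_not_neutral)
 then have "\<exists>c. c \<in> C \<and> w h c ~= 0" by auto
 then obtain i where i: "i \<in> C" "w h i ~= 0" "\<And>c. c \<in> C ==> w h c ~= 0 ==> rk {i} \<le> rk {c}"
  using ex_has_least_nat[of "\<lambda>c. c \<in> C \<and> w h c ~= 0" _ "rk1 rk"] by blast
 have "dual_bases (C - {i}) (X - {h}) (\<lambda>x. (v x)(i := 0)) (\<lambda>x. w x - fscale (w x i / w h i) (w h))"
  by (rule dual_bases_project[OF be.prems(2) hX i(1,2)])
 then obtain M' where M': "has_type (C - {i}) M' \<tau>" "M' \<subseteq> leads rk (fvs.span (vm (\<lambda>x. (v x)(i := 0)) ` M))"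
  using be.IH be.prems(1) by blast
 have "M' \<subseteq> nsub 2 (C - {i})" using has_type_basic[OF M'(1)] by blast
 then have "isol C M' i" using i by (auto simp: isol_def nsub_def)
 then have "has_type C M' (Be \<tau>)" by (rule has_type.be[OF _ M'(1)])
 moreover have "M' \<subseteq> leads rk (fvs.span (vm v ` M))"
  using leads_isolated[OF mr be.prems M be.hyps(1) i] M'(2) by blast
 ultimately show ?case by blast
next
 case (pq A B)
 interpret split_basis N C A B rk v w by unfold_locales (use mr pq in auto)
 show ?case by (rule base_leads(1))
next
 case (pp A B)
 interpret split_basis N C A B rk v w by unfold_locales (use mr pp in auto)
 show ?case by (rule base_leads(2))
next
 case (pq_step X M a b)
 obtain M' where M': "has_type C M' (Al (Be (PQ a b)))" "M' \<subseteq> leads rk (fvs.span (vm v ` M))"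
  using pq_step.IH[OF pq_step.prems] by blast
 show ?case using has_type.pq_step[OF M'(1)] M'(2) by blast
next
 case (pp_step X M a b)
 obtain M' where M': "has_type C M' (Be (Al (PP a b)))" "M' \<subseteq> leads rk (fvs.span (vm v ` M))"
  using pp_step.IH[OF pp_step.prems] by blast
 show ?case using has_type.pp_step[OF M'(1)] M'(2) by blast
qed

theorem has_type_leads:
 assumes "mono_rank N rk" "has_type X M \<tau>" "C \<subseteq> N" "dual_bases C X v w"
 shows "has_type C (leads rk (fvs.span (vm v ` M))) \<tau>"
proof -
 obtain M' where M': "has_type C M' \<tau>" "M' \<subseteq> leads rk (fvs.span (vm v ` M))"
  using has_type_leads_subset[OF assms] by blast
 have M: "M \<subseteq> nsub 2 X" "card M = tedges \<tau>" using has_type_basic[OF assms(2)] by auto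
 have L: "card (leads rk (fvs.span (vm v ` M))) = card M" "leads rk (fvs.span (vm v ` M)) \<subseteq> nsub 2 C"
  using card_leads_vm[OF assms(4,1,3) M(1)] by auto
 have "finite C" using assms(4) by (simp add: dual_bases_def)
 then have "finite (leads rk (fvs.span (vm v ` M)))" using L(2) finite_subset by fastforce
 then have "M' = leads rk (fvs.span (vm v ` M))"
  using M'(2) L(1) M(2) has_type_basic[OF M'(1)] by (intro card_subset_eq) auto
 then show ?thesis using M'(1) by simp
qed

subsection \<open>Strongly stable families\<close>

definition stable :: "nat set => nat set set => bool" where
 "stable C D \<longleftrightarrow> (\<forall>S\<in>D. \<forall>j\<in>S. \<forall>i\<in>C - S. i < j --> insert i (S - {j}) \<in> D)"

lemma stableD: "stable C D ==> S \<in> D ==> j \<in> S ==> i \<in> C ==> i \<notin> S ==> i < j ==> insert i (S - {j}) \<in> D"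
 by (auto simp: stable_def)

lemma stable_pair:
 assumes "stable C D" "{x, j} \<in> D" "x ~= j" "i \<in> C" "i < j" "i ~= x"
 shows "{x, i} \<in> D"
proof -
 have "insert i ({x, j} - {j}) \<in> D" by (rule stableD[OF assms(1,2)]) (use assms in auto)
 moreover have "insert i ({x, j} - {j}) = {x, i}" using assms by auto
 ultimately show ?thesis by simp
qed

text \<open>Needed for the transpositions that move a universal or isolated vertex to an extreme
  position.\<close>

lemma has_type_image:
 "has_type X M \<tau> ==> inj_on f X ==> has_type (f ` X) ((`) f ` M) \<tau>"
proof (induction rule: has_type.induct)
 case (al M X k \<tau>)
 have k: "k \<in> X" using al by (simp add: univ_def)
 have XM: "S \<subseteq> X" if "S \<in> M" for S using al(1) that by (auto simp: nsub_def)
 have ik: "f k \<in> f ` S \<longleftrightarrow> k \<in> S" if "S \<in> M" for S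
  using inj_on_image_mem_iff[OF al.prems k XM[OF that]] .
 have d: "(`) f ` del M k = del ((`) f ` M) (f k)"
  using ik by (auto simp: del_def)
 have X: "f ` (X - {k}) = f ` X - {f k}"
  using inj_on_image_set_diff[OF al.prems, of X "{k}"] k by simp
 have c: "f ` S \<in> nsub 2 (f ` X)" if "S \<in> M" for S
 proof -
  have "inj_on f S" using XM[OF that] al.prems inj_on_subset by blast
  then show ?thesis using al(1) that XM[OF that] by (auto simp: nsub_def card_image)
 qed
 show ?case
 proof (rule has_type.al)
  show "(`) f ` M \<subseteq> nsub 2 (f ` X)" using c by blast
  have "{f k, f x} \<in> (`) f ` M" if "x \<in> X" "x ~= k" for x
  proof -
   have "{k, x} \<in> M" using al(2) that by (auto simp: univ_def)
   then show ?thesis by (rule rev_image_eqI) simp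
  qed
  then show "univ (f ` X) ((`) f ` M) (f k)" using k by (auto simp: univ_def)
  have "inj_on f (X - {k})" using al.prems by (rule inj_on_diff)
  then show "has_type (f ` X - {f k}) (del ((`) f ` M) (f k)) \<tau>"
   using al.IH d X by simp
 qed
next
 case (be X M h \<tau>)
 have h: "h \<in> X" using be by (simp add: isol_def)
 have "M \<subseteq> nsub 2 (X - {h})" using has_type_basic[OF be.hyps(2)] by blast
 then have hS: "h \<notin> S" "S \<subseteq> X" if "S \<in> M" for S using that by (auto simp: nsub_def)
 have "f h \<notin> f ` S" if "S \<in> M" for S
  using inj_on_image_mem_iff[OF be.prems h hS(2)[OF that]] hS(1)[OF that] by simp
 then have "isol (f ` X) ((`) f ` M) (f h)" using h by (auto simp: isol_def)
 moreover have "f ` (X - {h}) = f ` X - {f h}"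
  using inj_on_image_set_diff[OF be.prems, of X "{h}"] h by simp
 moreover have "inj_on f (X - {h})" using be.prems by (rule inj_on_diff)
 ultimately show ?case using be.IH by (intro has_type.be[of _ _ "f h"]) simp_all
next
 case (pq A B)
 have "(`) f ` prods A B = prods (f ` A) (f ` B)"
 proof
  show "(`) f ` prods A B \<subseteq> prods (f ` A) (f ` B)" by (auto simp: prods_def)
  show "prods (f ` A) (f ` B) \<subseteq> (`) f ` prods A B"
  proof
   fix S assume "S \<in> prods (f ` A) (f ` B)"
   then obtain x y where "S = f ` {x, y}" "{x, y} \<in> prods A B" by (auto simp: prods_def)
   then show "S \<in> (`) f ` prods A B" by blast
  qed
 qed
 moreover have "f ` A \<inter> f ` B = {}" 
  using inj_on_image_Int[OF pq.prems Un_upper1 Un_upper2] pq(3) by simp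
 moreover have "card (f ` A) = card A" "card (f ` B) = card B"
  using pq.prems by (auto intro!: card_image inj_on_subset[OF pq.prems])
 ultimately show ?case using has_type.pq[of "f ` A" "f ` B"] pq(1,2) by (simp add: image_Un)
next
 case (pp A B)
 have i: "inj_on f A" "inj_on f B" using pp.prems by (auto intro: inj_on_subset)
 have n: "(`) f ` nsub 2 Y = nsub 2 (f ` Y)" if "inj_on f Y" for Y
 proof
  show "(`) f ` nsub 2 Y \<subseteq> nsub 2 (f ` Y)"
  proof clarify
   fix S assume "S \<in> nsub 2 Y"
   then obtain x y where "S = {x, y}" "x \<in> Y" "y \<in> Y" "x ~= y" by (rule nsub2E)
   then show "f ` S \<in> nsub 2 (f ` Y)" using that by (auto simp: inj_on_def)
  qed
  show "nsub 2 (f ` Y) \<subseteq> (`) f ` nsub 2 Y"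
  proof
   fix S assume "S \<in> nsub 2 (f ` Y)"
   then obtain x y where "S = {f x, f y}" "x \<in> Y" "y \<in> Y" "f x ~= f y" by (auto elim: nsub2E)
   then show "S \<in> (`) f ` nsub 2 Y" by (intro image_eqI[of _ _ "{x, y}"]) auto
  qed
 qed
 have "f ` A \<inter> f ` B = {}" 
  using inj_on_image_Int[OF pp.prems Un_upper1 Un_upper2] pp(3) by simp
 moreover have "card (f ` A) = card A" "card (f ` B) = card B"
  using i by (auto intro!: card_image)
 ultimately show ?case using has_type.pp[of "f ` A" "f ` B"] pp(1,2) n i by (simp add: image_Un)
next
 case (pq_step X M a b)
 show ?case by (rule has_type.pq_step[OF pq_step.IH[OF pq_step.prems]])
next
 case (pp_step X M a b)
 show ?case by (rule has_type.pp_step[OF pp_step.IH[OF pp_step.prems]])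
qed

section \<open>Peeling extreme vertices off stable graphs\<close>

definition swap :: "nat => nat => nat => nat" where
 "swap k m = id(k := m, m := k)"

lemma swap_simps [simp]: "swap k m k = m" "swap k m m = k" "x ~= k ==> x ~= m ==> swap k m x = x"
 by (auto simp: swap_def)

lemma swap_swap [simp]: "swap k m (swap k m x) = x"
 by (auto simp: swap_def)

lemma inj_swap: "inj_on (swap k m) X"
 by (rule inj_on_inverseI[of _ "swap k m"]) simp

lemma swap_image_swap [simp]: "swap k m ` swap k m ` S = S"
 by (simp add: image_image)

lemma swap_image_id: "k \<notin> S ==> m \<notin> S ==> swap k m ` S = S"
proof -
 assume "k \<notin> S" "m \<notin> S"
 then have "swap k m ` S = (\<lambda>x. x) ` S" by (intro image_cong refl swap_simps(3)) auto
 then show ?thesis by simp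
qed

lemma swap_image_Diff: "k \<in> C ==> m \<in> C ==> swap k m ` (C - {k}) = C - {m}"
 by (cases "k = m") (auto simp: swap_def image_iff split: if_splits)

lemma swap_image_mem: "x \<in> swap k m ` S \<longleftrightarrow> swap k m x \<in> S"
 by (metis image_eqI imageE swap_swap)

lemma stable_del:
 assumes "stable C M" "M \<subseteq> nsub 2 C"
 shows "stable (C - {m}) (del M m)"
 using assms unfolding stable_def del_def by auto

lemma stable_isol:
 assumes "stable C M" "isol C M m"
 shows "stable (C - {m}) M"
 using assms unfolding stable_def isol_def by auto

text \<open>Every edge \<open>{x, k}\<close> at a universal vertex can be moved down to
  \<open>{x, Min C}\<close>.\<close>

lemma stable_univ_Min:
 assumes st: "stable C M" and M: "M \<subseteq> nsub 2 C" and fin: "finite C" and k: "univ C M k"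
 shows "univ C M (Min C)"
proof -
 let ?m = "Min C"
 have kC: "k \<in> C" using k by (simp add: univ_def)
 then have "C ~= {}" by auto
 then have m: "?m \<in> C" "\<And>x. x \<in> C ==> ?m \<le> x" using fin by simp_all
 show ?thesis
 proof (cases "k = ?m")
  case True
  then show ?thesis using k by simp
 next
  case False
  then have lt: "?m < k" using m(2)[OF kC] by simp
  have "{?m, x} \<in> M" if x: "x \<in> C" "x ~= ?m" for x
  proof (cases "x = k")
   case True
   then show ?thesis using k m False by (auto simp: univ_def insert_commute)
  next
   case False
   then have "{x, k} \<in> M" using k x by (auto simp: univ_def insert_commute)
   then have "{x, ?m} \<in> M" using stable_pair[OF st _ False m(1) lt] x by auto
   then show ?thesis by (simp add: insert_commute)
  qed
  then show ?thesis using m by (auto simp: univ_def)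
 qed
qed

text \<open>An edge through \<open>Max C\<close> could be moved down to an edge through
  \<open>h\<close>.\<close>

lemma stable_isol_Max:
 assumes st: "stable C M" and M: "M \<subseteq> nsub 2 C" and fin: "finite C" and h: "isol C M h"
 shows "isol C M (Max C)"
proof -
 let ?m = "Max C"
 have hC: "h \<in> C" using h by (simp add: isol_def)
 then have "C ~= {}" by auto
 then have m: "?m \<in> C" "\<And>x. x \<in> C ==> x \<le> ?m" using fin by simp_all
 have "?m \<notin> S" if S: "S \<in> M" for S
 proof
  assume "?m \<in> S"
  have hS: "h \<notin> S" using h S by (auto simp: isol_def)
  then have "h ~= ?m" using \<open>?m \<in> S\<close> by auto
  then have "h < ?m" using m(2)[OF hC] by simp
  then have "insert h (S - {?m}) \<in> M" by (intro stableD[OF st S \<open>?m \<in> S\<close> hC hS])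
  then show False using h by (auto simp: isol_def)
 qed
 then show ?thesis using m by (simp add: isol_def)
qed

lemma swap_univ:
 assumes M: "M \<subseteq> nsub 2 C" and u: "univ C M k" "univ C M m" and S: "S \<in> M"
 shows "swap k m ` S \<in> M"
proof -
 obtain x y where xy: "S = {x, y}" "x \<in> C" "y \<in> C" "x ~= y" using M S nsub2E by blast
 have km: "k \<in> C" "m \<in> C" using u by (auto simp: univ_def)
 show ?thesis
 proof (cases "k \<in> S \<or> m \<in> S")
  case False
  then show ?thesis using S swap_image_id[of k S m] by simp
 next
  case True
  have sC: "swap k m x \<in> C" "swap k m y \<in> C" using km xy by (auto simp: swap_def)
  have "swap k m x ~= swap k m y" using xy(4) by (metis swap_swap)
  moreover have "swap k m x \<in> {k, m} \<or> swap k m y \<in> {k, m}"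
   using True xy(1) by (auto simp: swap_def)
  ultimately have "{swap k m x, swap k m y} \<in> M"
   using u sC unfolding univ_def by (auto simp: insert_commute)
  then show ?thesis using xy(1) by simp
 qed
qed

text \<open>The type only promises some universal vertex. Stability makes the minimum universal too,
  and exchanging two universal vertices is an automorphism, so deleting the minimum instead leaves a
  graph of the same type.\<close>

lemma stable_al:
 assumes "has_type C M (Al \<tau>)" "stable C M"
 shows "univ C M (Min C)" "has_type (C - {Min C}) (del M (Min C)) \<tau>" "stable (C - {Min C}) (del M (Min C))"
proof -
 have b: "finite C" "M \<subseteq> nsub 2 C" using has_type_basic[OF assms(1)] by auto
 obtain k where k: "univ C M k" "has_type (C - {k}) (del M k) \<tau>"
  using assms(1) by (cases rule: has_type.cases) auto
 show u: "univ C M (Min C)" by (rule stable_univ_Min[OF assms(2) b(2,1) k(1)])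
 show "stable (C - {Min C}) (del M (Min C))" by (rule stable_del[OF assms(2) b(2)])
 let ?s = "swap k (Min C)"
 have km: "k \<in> C" "Min C \<in> C" using k u by (auto simp: univ_def)
 have im: "?s ` S \<in> M" if "S \<in> M" for S by (rule swap_univ[OF b(2) k(1) u that])
 have "(`) ?s ` del M k = del M (Min C)"
 proof
  show "(`) ?s ` del M k \<subseteq> del M (Min C)"
  proof (rule image_subsetI)
   fix S assume "S \<in> del M k"
   then show "?s ` S \<in> del M (Min C)"
    using im[of S] swap_image_mem[of "Min C" k "Min C" S] unfolding del_def by simp
  qed
  show "del M (Min C) \<subseteq> (`) ?s ` del M k"
  proof
   fix S assume S: "S \<in> del M (Min C)"
   then have "?s ` S \<in> del M k"
    using im[of S] swap_image_mem[of k k "Min C" S] unfolding del_def by simp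
   then show "S \<in> (`) ?s ` del M k" by (rule rev_image_eqI) simp
  qed
 qed
 then show "has_type (C - {Min C}) (del M (Min C)) \<tau>"
  using has_type_image[OF k(2) inj_swap[of k "Min C"]] swap_image_Diff[OF km] by simp
qed

text \<open>As in \<open>stable_al\<close>, now with the maximum; exchanging two isolated vertices
  does not touch any edge.\<close>

lemma stable_be:
 assumes "has_type C M (Be \<tau>)" "stable C M"
 shows "isol C M (Max C)" "has_type (C - {Max C}) M \<tau>" "stable (C - {Max C}) M"
proof -
 have b: "finite C" "M \<subseteq> nsub 2 C" using has_type_basic[OF assms(1)] by auto
 obtain h where h: "isol C M h" "has_type (C - {h}) M \<tau>"
  using assms(1) by (cases rule: has_type.cases) auto
 show u: "isol C M (Max C)" by (rule stable_isol_Max[OF assms(2) b(2,1) h(1)])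
 show "stable (C - {Max C}) M" by (rule stable_isol[OF assms(2) u])
 have "swap h (Max C) ` S = S" if "S \<in> M" for S
  using u h that by (intro swap_image_id) (auto simp: isol_def)
 then have "(`) (swap h (Max C)) ` M = M" by simp
 then show "has_type (C - {Max C}) M \<tau>"
  using has_type_image[OF h(2) inj_swap[of h "Max C"]] swap_image_Diff[of h C "Max C"] u h
  by (simp add: isol_def)
qed

lemma prods_commute: "prods A B = prods B A"
 unfolding prods_def by (auto simp: insert_commute)

lemma prods_singleton_type:
 assumes "finite B" "m \<notin> B" "card B = Suc b"
 shows "has_type (insert m B) (prods {m} B) (Al (Be (PQ 0 b)))" "has_type (insert m B) (prods {m} B) (Al (Be (PQ b 0)))"
proof -
 obtain h where h: "h \<in> B" using assms by fastforce
 have 1: "prods {m} B \<subseteq> nsub 2 (insert m B)" "univ (insert m B) (prods {m} B) m"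
  using assms(2) by (auto simp: prods_def univ_def)
 have 2: "insert m B - {m} = B" "del (prods {m} B) m = {}" "isol B {} h"
  using assms(2) h by (auto simp: del_def prods_def isol_def)
 have "has_type (B - {h}) {} (PQ 0 b)" "has_type (B - {h}) {} (PQ b 0)"
  using has_type.pq[of "{}" "B - {h}"] has_type.pq[of "B - {h}" "{}"] assms h by (simp_all add: prods_def)
 then have 3: "has_type B {} (Be (PQ 0 b))" "has_type B {} (Be (PQ b 0))"
  using has_type.be[OF 2(3)] by auto
 show "has_type (insert m B) (prods {m} B) (Al (Be (PQ 0 b)))"
  "has_type (insert m B) (prods {m} B) (Al (Be (PQ b 0)))"
  by (rule has_type.al[OF 1]; simp add: 2 3)+
qed

text \<open>A second vertex \<open>x\<close> of the part containing the minimum has the edge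
  \<open>{x, b}\<close>, which stability would move to an edge inside that part.\<close>

lemma stable_prods_singleton:
 assumes st: "stable (A \<union> B) (prods A B)" and "finite A" "finite B" "A \<inter> B = {}"
  and m: "Min (A \<union> B) \<in> A" and "b \<in> B"
 shows "A = {Min (A \<union> B)}"
proof -
 let ?m = "Min (A \<union> B)"
 have "x = ?m" if x: "x \<in> A" for x
 proof (rule ccontr)
  assume "x ~= ?m"
  have "{x, b} \<in> prods A B" using x assms(6) by (auto simp: prods_def)
  moreover have "?m < b" using assms by (metis Min_le UnI2 disjoint_iff finite_UnI le_neq_implies_less)
  ultimately have "{x, ?m} \<in> prods A B"
   using stable_pair[OF st, of x b ?m] x assms m \<open>x ~= ?m\<close> by auto
  then show False using x m assms(4) unfolding prods_def by (auto simp: doubleton_eq_iff)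
 qed
 then show ?thesis using m by blast
qed

text \<open>Inverts \<open>pq_step\<close> for stable graphs. A genuine complete bipartite graph
  with two nonempty parts is stable only if it is a star centred at the minimum, and a star already
  has the peeled type.\<close>

lemma stable_pq:
 assumes "has_type C M (PQ (Suc a) (Suc b))" "stable C M"
 shows "has_type C M (Al (Be (PQ a b)))"
 using assms(1)
proof (cases rule: has_type.cases)
 case (pq A B)
 obtain x y where xy: "x \<in> A" "y \<in> B" using pq by (metis all_not_in_conv card.empty nat.distinct(1))
 have fin: "finite (A \<union> B)" "A \<union> B ~= {}" using pq xy by auto
 have "Min (A \<union> B) \<in> A \<union> B" using Min_in[OF fin] .
 then consider "Min (A \<union> B) \<in> A" | "Min (A \<union> B) \<in> B" by blast
 then show ?thesis
 proof cases
  case 1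
  then have A: "A = {Min (A \<union> B)}"
   using stable_prods_singleton[of A B y] assms(2) pq xy by blast
  define m where "m = Min (A \<union> B)"
  have "A = {m}" using A m_def by simp
  then show ?thesis using prods_singleton_type(1)[of B m b] pq by auto
 next
  case 2
  then have B: "B = {Min (B \<union> A)}"
   using stable_prods_singleton[of B A x] assms(2) pq xy by (simp add: prods_commute Un_commute Int_commute)
  define m where "m = Min (B \<union> A)"
  have "B = {m}" using B m_def by simp
  then show ?thesis using prods_singleton_type(2)[of A m a] pq by (auto simp: prods_commute)
 qed
next
 case (pq_step)
 then show ?thesis by simp
qed

lemma nsub2_singleton_type:
 assumes "finite A" "h \<notin> A" "card A = Suc a"
 shows "has_type (insert h A) (nsub 2 A) (Be (Al (PP a 0)))" "has_type (insert h A) (nsub 2 A) (Be (Al (PP 0 a)))"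
proof -
 obtain k where k: "k \<in> A" using assms by fastforce
 have 1: "isol (insert h A) (nsub 2 A) h" using assms(2) by (auto simp: isol_def nsub_def)
 have 2: "insert h A - {h} = A" "del (nsub 2 A) k = nsub 2 (A - {k})" "univ A (nsub 2 A) k"
  using assms(2) k by (auto simp: del_def univ_def, auto simp: nsub_def)
 have "nsub 2 ({} :: nat set) = {}" by (auto simp: nsub_def)
 then have "has_type (A - {k}) (nsub 2 (A - {k})) (PP a 0)" "has_type (A - {k}) (nsub 2 (A - {k})) (PP 0 a)"
  using has_type.pp[of "A - {k}" "{}"] has_type.pp[of "{}" "A - {k}"] assms k by simp_all
 then have 3: "has_type A (nsub 2 A) (Al (PP a 0))" "has_type A (nsub 2 A) (Al (PP 0 a))"
  using has_type.al[OF order_refl 2(3)] 2(2) by auto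
 show "has_type (insert h A) (nsub 2 A) (Be (Al (PP a 0)))" "has_type (insert h A) (nsub 2 A) (Be (Al (PP 0 a)))"
  by (rule has_type.be[OF 1]; simp only: 2 3)+
qed

text \<open>An edge of the clique without the minimum would be moved by stability to an edge between
  the two cliques.\<close>

lemma stable_nsub2_singleton:
 assumes st: "stable (A \<union> B) (nsub 2 A \<union> nsub 2 B)" and "finite A" "finite B" "A \<inter> B = {}"
  and m: "Min (A \<union> B) \<in> A" and "b \<in> B"
 shows "B = {b}"
proof -
 let ?m = "Min (A \<union> B)"
 have "z = b" if z: "z \<in> B" for z
 proof (rule ccontr)
  assume "z ~= b"
  then have "{z, b} \<in> nsub 2 A \<union> nsub 2 B" using z assms(6) by auto
  moreover have "?m < b" using assms by (metis Min_le UnI2 disjoint_iff finite_UnI le_neq_implies_less)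
  moreover have "?m ~= z" using z m assms(4) by auto
  ultimately have "{z, ?m} \<in> nsub 2 A \<union> nsub 2 B"
   using stable_pair[OF st, of z b ?m] m \<open>z ~= b\<close> by auto
  then show False using z m assms(4) by auto
 qed
 then show ?thesis using assms(6) by blast
qed

lemma stable_pp:
 assumes "has_type C M (PP (Suc a) (Suc b))" "stable C M"
 shows "has_type C M (Be (Al (PP a b)))"
 using assms(1)
proof (cases rule: has_type.cases)
 case (pp A B)
 obtain x y where xy: "x \<in> A" "y \<in> B" using pp by (metis all_not_in_conv card.empty nat.distinct(1))
 have fin: "finite (A \<union> B)" "A \<union> B ~= {}" using pp xy by auto
 have s: "nsub 2 {z} = {}" for z :: nat by (auto simp: nsub_def card_2_iff)
 have "Min (A \<union> B) \<in> A \<union> B" using Min_in[OF fin] .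
 then consider "Min (A \<union> B) \<in> A" | "Min (A \<union> B) \<in> B" by blast
 then show ?thesis
 proof cases
  case 1
  then have B: "B = {y}"
   using stable_nsub2_singleton[of A B y] assms(2) pp xy by blast
  moreover have "y \<notin> A" using pp xy by auto
  ultimately show ?thesis using nsub2_singleton_type(1)[of A y a] pp by (auto simp: s)
 next
  case 2
  then have A: "A = {x}"
   using stable_nsub2_singleton[of B A x] assms(2) pp xy by (simp add: Un_commute Int_commute)
  moreover have "x \<notin> B" using pp xy by auto
  ultimately show ?thesis using nsub2_singleton_type(2)[of B x b] pp by (auto simp: s)
 qed
next
 case (pp_step)
 then show ?thesis by simp
qed

lemma stable_al_unique:
 assumes "has_type C M (Al \<tau>)" "stable C M" "has_type C M' (Al \<tau>)" "stable C M'"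
  "del M (Min C) = del M' (Min C)"
 shows "M = M'"
 using univ_decomp[OF _ stable_al(1)[OF assms(1,2)]] univ_decomp[OF _ stable_al(1)[OF assms(3,4)]]
  has_type_basic[OF assms(1)] has_type_basic[OF assms(3)] assms(5) by simp

text \<open>Each descent through \<open>stable_pq\<close> lowers both parameters; when one of them
  is zero, no edges are left.\<close>

lemma stable_pq_unique:
 "has_type C M (PQ a b) ==> stable C M ==> has_type C M' (PQ a b) ==> stable C M' ==> M = M'"
proof (induction a arbitrary: b C M M')
 case 0
 then have "card M = 0" "card M' = 0" "finite M" "finite M'"
  using has_type_basic finite_nsub finite_subset by (metis mult_zero_left tedges.simps(3))+
 then show ?case by simp
next
 case (Suc a)
 show ?case
 proof (cases b)
  case 0
  then have "card M = 0" "card M' = 0" "finite M" "finite M'"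
   using has_type_basic[OF Suc.prems(1)] has_type_basic[OF Suc.prems(3)]
   by (auto intro: finite_subset[OF _ finite_nsub])
  then show ?thesis by simp
 next
  case (Suc b')
  note t = stable_pq[OF Suc.prems(1)[unfolded Suc] Suc.prems(2)] stable_pq[OF Suc.prems(3)[unfolded Suc] Suc.prems(4)]
  note u = stable_al[OF t(1) Suc.prems(2)] stable_al[OF t(2) Suc.prems(4)]
  note z = stable_be[OF u(2,3)] stable_be[OF u(5,6)]
  have "del M (Min C) = del M' (Min C)" by (rule Suc.IH[OF z(2,3,5,6)])
  then show ?thesis by (rule stable_al_unique[OF t(1) Suc.prems(2) t(2) Suc.prems(4)])
 qed
qed

lemma has_type_pp_zero:
 assumes "has_type C M (PP a b)" "a = 0 \<or> b = 0"
 shows "M = nsub 2 C"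
proof -
 have b: "finite C" "M \<subseteq> nsub 2 C" "card C = a + b" "card M = (a choose 2) + (b choose 2)"
  using has_type_basic[OF assms(1)] by auto
 then have "card M = card (nsub 2 C)" using assms(2) by (auto simp: card_nsub)
 then show ?thesis using b by (intro card_subset_eq) auto
qed

lemma stable_pp_unique:
 "has_type C M (PP a b) ==> stable C M ==> has_type C M' (PP a b) ==> stable C M' ==> M = M'"
proof (induction a arbitrary: b C M M')
 case 0
 then show ?case using has_type_pp_zero by metis
next
 case (Suc a)
 show ?case
 proof (cases b)
  case 0
  then show ?thesis using Suc.prems has_type_pp_zero by metis
 next
  case (Suc b')
  note t = stable_pp[OF Suc.prems(1)[unfolded Suc] Suc.prems(2)] stable_pp[OF Suc.prems(3)[unfolded Suc] Suc.prems(4)]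
  note z = stable_be[OF t(1) Suc.prems(2)] stable_be[OF t(2) Suc.prems(4)]
  note u = stable_al[OF z(2,3)] stable_al[OF z(5,6)]
  have "del M (Min (C - {Max C})) = del M' (Min (C - {Max C}))" by (rule Suc.IH[OF u(2,3,5,6)])
  then show ?thesis by (rule stable_al_unique[OF z(2,3) z(5,6)])
 qed
qed

text \<open>In a stable graph the vertex to be peeled off may be taken to be the least or the
  greatest one, so reading the type from outside in reconstructs the edges.\<close>

theorem stable_type_unique:
 "has_type C M \<tau> ==> stable C M ==> has_type C M' \<tau> ==> stable C M' ==> M = M'"
proof (induction \<tau> arbitrary: C M M')
 case (Al \<tau>)
 note u = stable_al[OF Al.prems(1,2)] stable_al[OF Al.prems(3,4)]
 have "del M (Min C) = del M' (Min C)" by (rule Al.IH[OF u(2,3,5,6)])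
 then show ?case by (rule stable_al_unique[OF Al.prems])
next
 case (Be \<tau>)
 note z = stable_be[OF Be.prems(1,2)] stable_be[OF Be.prems(3,4)]
 show ?case by (rule Be.IH[OF z(2,3,5,6)])
next
 case (PQ a b)
 then show ?case by (rule stable_pq_unique)
next
 case (PP a b)
 then show ?case by (rule stable_pp_unique)
qed

text \<open>Two complexes in one: \<open>U = X\<close> gives a graph as a complex, and a set
  \<open>U\<close> that independent sets meet in at most two elements anyway gives the flag complex.
  The bound on \<open>S \<inter> U\<close> stands for the cubic generators which the edges of an
  initial ideal need not account for.\<close>

definition faces :: "nat set => nat set set => nat set => nat set set" where
 "faces X M U = {S. S \<subseteq> X \<and> (\<forall>T\<in>M. \<not> T \<subseteq> S) \<and> card (S \<inter> U) \<le> 2}"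

text \<open>A universal vertex contributes only its singleton, and an isolated vertex outside
  \<open>U\<close> doubles the number of faces. So \<open>c\<close> depends on the rules applied and
  not on the graph, and the count can be transferred to a stable graph. The condition
  \<open>k \<in> U \<or> U = {}\<close> has a form that the least vertex satisfies for every initial
  segment.\<close>

inductive face_count :: "nat set => nat set set => nat set => gtype => nat => bool" where
 al: "M \<subseteq> nsub 2 X ==> univ X M k ==> k \<in> U \<or> U = {} ==>
  face_count (X - {k}) (del M k) (U - {k}) \<tau> c ==> face_count X M U (Al \<tau>) (Suc c)"
| be: "isol X M h ==> h \<notin> U ==> face_count (X - {h}) M U \<tau> c ==> face_count X M U (Be \<tau>) (2 * c)"
| full: "has_type X M \<tau> ==> face_count X M X \<tau> (1 + tsize \<tau> + (tsize \<tau> choose 2) - tedges \<tau>)"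
| pq: "has_type X M (PQ a b) ==> face_count X M {} (PQ a b) (2 ^ a + 2 ^ b - 1)"

lemma face_count_basic:
 "face_count X M U \<tau> c ==> has_type X M \<tau> \<and> U \<subseteq> X"
proof (induction rule: face_count.induct)
 case (al M X k U \<tau> c)
 then show ?case by (auto intro: has_type.al simp: univ_def)
next
 case (be X M h U \<tau> c)
 then show ?case by (auto intro: has_type.be)
qed auto

lemma nsub2_finite: "M \<subseteq> nsub 2 X ==> T \<in> M ==> finite T \<and> card T = 2"
 using card.infinite[of T] by (fastforce simp: nsub_def)

lemma finite_faces: "finite X ==> finite (faces X M U)"
 by (simp add: faces_def)

lemma card_faces_univ:
 assumes "finite X" "M \<subseteq> nsub 2 X" "univ X M k"
 shows "card (faces X M U) = Suc (card (faces (X - {k}) (del M k) (U - {k})))"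
proof -
 have k: "k \<in> X" using assms by (simp add: univ_def)
 have M: "finite T \<and> card T = 2" if "T \<in> M" for T
  using nsub2_finite assms(2) that by blast
 have "faces X M U = insert {k} (faces (X - {k}) (del M k) (U - {k}))"
 proof
  show "faces X M U \<subseteq> insert {k} (faces (X - {k}) (del M k) (U - {k}))"
  proof
   fix S assume S: "S \<in> faces X M U"
   show "S \<in> insert {k} (faces (X - {k}) (del M k) (U - {k}))"
   proof (cases "k \<in> S")
    case True
    have "x = k" if "x \<in> S" for x
    proof (rule ccontr)
     assume "x ~= k"
     then have "{k, x} \<in> M" using S that assms(3) by (auto simp: faces_def univ_def)
     moreover have "{k, x} \<subseteq> S" using True that by simp
     ultimately show False using S by (auto simp: faces_def)
    qed
    then show ?thesis using True by blast
   next
    case False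
    then have "S \<inter> (U - {k}) = S \<inter> U" by blast
    then show ?thesis using S False by (auto simp: faces_def del_def)
   qed
  qed
  have "\<not> T \<subseteq> {k}" if "T \<in> M" for T
   using M[OF that] card_mono[of "{k}" T] by auto
  moreover have "card ({k} \<inter> U) \<le> 2" using card_mono[of "{k}" "{k} \<inter> U"] by simp
  ultimately have "{k} \<in> faces X M U" using k by (auto simp: faces_def)
  moreover have "S \<in> faces X M U" if S: "S \<in> faces (X - {k}) (del M k) (U - {k})" for S
  proof -
   have "k \<notin> S" using S by (auto simp: faces_def)
   then have "S \<inter> (U - {k}) = S \<inter> U" by blast
   then show ?thesis using S \<open>k \<notin> S\<close> by (auto simp: faces_def del_def)
  qed
  ultimately show "insert {k} (faces (X - {k}) (del M k) (U - {k})) \<subseteq> faces X M U" by blast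
 qed
 moreover have "{k} \<notin> faces (X - {k}) (del M k) (U - {k})" by (auto simp: faces_def)
 ultimately show ?thesis using finite_faces[of "X - {k}"] assms(1) by simp
qed

lemma card_faces_isol:
 assumes "finite X" "isol X M h" "h \<notin> U"
 shows "card (faces X M U) = 2 * card (faces (X - {h}) M U)"
proof -
 let ?F = "faces (X - {h}) M U"
 have h: "h \<in> X" using assms by (simp add: isol_def)
 have i: "T \<subseteq> insert h S \<longleftrightarrow> T \<subseteq> S" if "T \<in> M" for T S
  using assms that by (auto simp: isol_def)
 have u: "insert h S \<inter> U = S \<inter> U" for S using assms(3) by blast
 have "faces X M U = ?F \<union> insert h ` ?F"
 proof
  show "faces X M U \<subseteq> ?F \<union> insert h ` ?F"
  proof
   fix S assume S: "S \<in> faces X M U"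
   show "S \<in> ?F \<union> insert h ` ?F"
   proof (cases "h \<in> S")
    case True
    then have "S = insert h (S - {h})" "(S - {h}) \<inter> U = S \<inter> U" using assms(3) by auto
    moreover then have "S - {h} \<in> ?F" using S by (auto simp: faces_def)
    ultimately show ?thesis by blast
   qed (use S in \<open>auto simp: faces_def\<close>)
  qed
  show "?F \<union> insert h ` ?F \<subseteq> faces X M U"
   using h i u by (auto simp: faces_def)
 qed
 moreover have "?F \<inter> insert h ` ?F = {}" by (auto simp: faces_def)
 moreover have "inj_on (insert h) ?F" by (rule inj_onI) (auto simp: faces_def)
 ultimately show ?thesis using finite_faces[of "X - {h}" M U] assms(1)
  by (simp add: card_Un_disjoint card_image)
qed

lemma card_faces_full:
 assumes "finite X" "M \<subseteq> nsub 2 X"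
 shows "card (faces X M X) = 1 + card X + (card X choose 2) - card M"
proof -
 have M: "finite T \<and> card T = 2" if "T \<in> M" for T
  using nsub2_finite assms(2) that by blast
 have "faces X M X = nsub 0 X \<union> nsub 1 X \<union> (nsub 2 X - M)"
 proof
  show "faces X M X \<subseteq> nsub 0 X \<union> nsub 1 X \<union> (nsub 2 X - M)"
   by (auto simp: faces_def nsub_def Int_absorb2)
  show "nsub 0 X \<union> nsub 1 X \<union> (nsub 2 X - M) \<subseteq> faces X M X"
  proof
   fix S assume S: "S \<in> nsub 0 X \<union> nsub 1 X \<union> (nsub 2 X - M)"
   then have "S \<subseteq> X" "card S \<le> 2" "S \<notin> M" using M by (auto simp: nsub_def)
   moreover have "T = S" if "T \<in> M" "T \<subseteq> S" for T
   proof (rule card_subset_eq)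
    show fS: "finite S" using \<open>S \<subseteq> X\<close> assms(1) finite_subset by blast
    show "card T = card S" using card_mono[OF fS that(2)] M[OF that(1)] \<open>card S \<le> 2\<close> by simp
   qed (rule that(2))
   ultimately show "S \<in> faces X M X" by (auto simp: faces_def Int_absorb2)
  qed
 qed
 moreover have "nsub 0 X \<inter> nsub 1 X = {}" "(nsub 0 X \<union> nsub 1 X) \<inter> (nsub 2 X - M) = {}"
  by (auto simp: nsub_def)
 moreover have "card (nsub 2 X - M) = (card X choose 2) - card M"
  using assms(2) finite_subset[OF assms(2) finite_nsub[OF assms(1)]]
  by (simp add: card_Diff_subset card_nsub[OF assms(1)])
 moreover have "card M \<le> card X choose 2" using assms card_mono[of "nsub 2 X" M] by (simp add: card_nsub)
 ultimately show ?thesis using assms(1) by (simp add: card_Un_disjoint card_nsub)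
qed

text \<open>Independent sets lie within one part; the empty set would be counted twice.\<close>

lemma card_faces_prods:
 assumes "finite A" "finite B" "A \<inter> B = {}"
 shows "card (faces (A \<union> B) (prods A B) {}) = 2 ^ card A + 2 ^ card B - 1"
proof -
 have "faces (A \<union> B) (prods A B) {} = Pow A \<union> Pow B"
 proof
  show "faces (A \<union> B) (prods A B) {} \<subseteq> Pow A \<union> Pow B"
  proof
   fix S assume S: "S \<in> faces (A \<union> B) (prods A B) {}"
   show "S \<in> Pow A \<union> Pow B"
   proof (rule ccontr)
    assume "S \<notin> Pow A \<union> Pow B"
    then obtain x y where "x \<in> S" "y \<in> S" "x \<notin> A" "y \<notin> B" by auto
    moreover have "S \<subseteq> A \<union> B" using S by (simp add: faces_def)
    ultimately have "{y, x} \<in> prods A B" "{y, x} \<subseteq> S" unfolding prods_def by auto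
    then show False using S by (auto simp: faces_def)
   qed
  qed
  show "Pow A \<union> Pow B \<subseteq> faces (A \<union> B) (prods A B) {}"
   using assms by (auto simp: faces_def prods_def)
 qed
 moreover have "Pow A \<inter> Pow B = {{}}" using assms by auto
 moreover have "card (Pow A \<union> Pow B) + card (Pow A \<inter> Pow B) = card (Pow A) + card (Pow B)"
  using assms by (intro card_Un_Int[symmetric]) auto
 ultimately show ?thesis using assms by (simp add: card_Pow)
qed

text \<open>For a graph obtained by \<open>pq_step\<close> the two peelings give
  \<open>1 + 2 * (2 ^ a + 2 ^ b - 1)\<close>, the same formula with both exponents raised by
  one.\<close>

lemma card_faces_pq:
 "has_type X M (PQ a b) ==> card (faces X M {}) = 2 ^ a + 2 ^ b - 1"
proof (induction a arbitrary: b X M)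
 case 0
 from 0 show ?case
 proof (cases rule: has_type.cases)
  case (pq A B)
  then show ?thesis using card_faces_prods[of A B] by simp
 qed
next
 case (Suc a)
 from Suc.prems show ?case
 proof (cases rule: has_type.cases)
  case (pq A B)
  then show ?thesis using card_faces_prods by metis
 next
  case (pq_step b')
  then obtain k where k: "univ X M k" "has_type (X - {k}) (del M k) (Be (PQ a b'))" "M \<subseteq> nsub 2 X"
   by (auto elim: has_type.cases)
  then obtain h where h: "isol (X - {k}) (del M k) h" "has_type (X - {k} - {h}) (del M k) (PQ a b')"
   by (auto elim: has_type.cases)
  have fin: "finite X" using has_type_basic[OF Suc.prems] by simp
  have "card (faces X M {}) = Suc (2 * (2 ^ a + 2 ^ b' - 1))"
   using card_faces_univ[OF fin k(3,1), of "{}"] card_faces_isol[OF _ h(1), of "{}"] Suc.IH[OF h(2)] fin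
   by simp
  moreover have "(1 :: nat) \<le> 2 ^ a" by simp
  then have "Suc (2 * (2 ^ a + 2 ^ b' - 1)) = 2 ^ Suc a + 2 ^ Suc b' - (1 :: nat)"
   unfolding power_Suc by linarith
  ultimately show ?thesis using pq_step(1) by simp
 qed
qed

lemma face_count_card:
 "face_count X M U \<tau> c ==> card (faces X M U) = c"
proof (induction rule: face_count.induct)
 case (al M X k U \<tau> c)
 have "finite X" using face_count_basic[OF al.hyps(4)] has_type_basic by fastforce
 then show ?case using card_faces_univ al by simp
next
 case (be X M h U \<tau> c)
 have "finite X" using face_count_basic[OF be.hyps(3)] has_type_basic by fastforce
 then show ?case using card_faces_isol be by simp
next
 case (full X M \<tau>)
 then show ?case using has_type_basic[OF full] by (simp add: card_faces_full)
next
 case (pq X M a b)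
 then show ?case by (rule card_faces_pq)
qed

text \<open>The derivation is replayed with \<open>Min C\<close> for each universal and
  \<open>Max C\<close> for each isolated vertex. An initial segment \<open>V\<close> of the size of
  \<open>U\<close> satisfies the same side conditions at every step.\<close>

lemma face_count_stable:
 "face_count X M U \<tau> c ==> has_type C D \<tau> ==> stable C D ==> V \<subseteq> C ==> card V = card U ==>
  (\<And>i j. i \<in> C ==> j \<in> V ==> i < j ==> i \<in> V) ==> face_count C D V \<tau> c"
proof (induction arbitrary: C D V rule: face_count.induct)
 case (al M X k U \<tau> c)
 note u = stable_al[OF al.prems(1,2)]
 let ?m = "Min C"
 have fin: "finite C" and DC: "D \<subseteq> nsub 2 C" using has_type_basic[OF al.prems(1)] by auto
 have finX: "finite X" "U \<subseteq> X"
  using face_count_basic[OF face_count.al[OF al.hyps]] has_type_basic by blast+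
 then have fU: "finite U" using finite_subset by blast
 have fV: "finite V" using fin al.prems(3) finite_subset by blast
 have mC: "?m \<in> C" using u(1) by (simp add: univ_def)
 have mV: "?m \<in> V \<or> V = {}"
 proof (cases "V = {}")
  case False
  then obtain j where j: "j \<in> V" by blast
  then have "?m \<le> j" using fin al.prems(3) by auto
  then show ?thesis using al.prems(5)[OF mC j] j by (cases "?m = j") auto
 qed simp
 have "U = {} \<longleftrightarrow> V = {}" using al.prems(4) fU fV by auto
 then have c: "card (V - {?m}) = card (U - {k})"
  using al.hyps(3) mV al.prems(4) fU fV by (cases "U = {}") auto
 have "face_count (C - {?m}) (del D ?m) (V - {?m}) \<tau> c"
 proof (rule al.IH[OF u(2,3) _ c])
  fix i j assume "i \<in> C - {?m}" "j \<in> V - {?m}" "i < j"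
  then show "i \<in> V - {?m}" using al.prems(5)[of i j] by blast
 qed (use al.prems(3) in auto)
 then show ?case by (rule face_count.al[OF DC u(1) mV])
next
 case (be X M h U \<tau> c)
 note z = stable_be[OF be.prems(1,2)]
 let ?m = "Max C"
 have fin: "finite C" and cC: "card C = tsize (Be \<tau>)" using has_type_basic[OF be.prems(1)] by auto
 have X: "card X = tsize (Be \<tau>)" "finite X" "U \<subseteq> X - {h}" "h \<in> X"
  using has_type_basic face_count_basic[OF face_count.be[OF be.hyps]] be.hyps by (auto simp: isol_def)
 have mC: "?m \<in> C" using z(1) by (simp add: isol_def)
 \<comment> \<open>An initial segment containing the maximum would be all of \<open>C\<close>,
   whereas \<open>U\<close> misses \<open>h\<close>.\<close>
 have mV: "?m \<notin> V"
 proof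
  assume m: "?m \<in> V"
  have "C \<subseteq> V"
  proof
   fix x assume x: "x \<in> C"
   then have "x \<le> ?m" using fin by simp
   then show "x \<in> V" using be.prems(5)[OF x m] m by (cases "x = ?m") auto
  qed
  then have "card U = card X" using be.prems(3,4) cC X(1) by auto
  moreover have "card U < card X" using X by (intro psubset_card_mono) auto
  ultimately show False by simp
 qed
 have "face_count (C - {?m}) D V \<tau> c"
 proof (rule be.IH[OF z(2,3) _ be.prems(4)])
  fix i j assume "i \<in> C - {?m}" "j \<in> V" "i < j"
  then show "i \<in> V" using be.prems(5)[of i j] by blast
 qed (use be.prems(3) mV in auto)
 then show ?case by (rule face_count.be[OF z(1) mV])
next
 case (full X M \<tau>)
 have "V = C"
  using has_type_basic[OF full.prems(1)] has_type_basic[OF full.hyps] full.prems(3,4)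
  by (intro card_subset_eq) auto
 then show ?case using face_count.full[OF full.prems(1)] by simp
next
 case (pq X M a b)
 have "finite V" using has_type_basic[OF pq.prems(1)] pq.prems(3) finite_subset by blast
 then have "V = {}" using pq.prems(4) by simp
 then show ?case using face_count.pq[OF pq.prems(1)] by simp
qed

subsection \<open>Initial ideals\<close>

declare minus_apply [simp del] One_nat_def [simp del]

text \<open>These families are the monomial ideals: the ideal belonging to \<open>F\<close> is
  \<open>fsupp F\<close>.\<close>

definition upclosed :: "nat => nat set set => bool" where
 "upclosed n F \<longleftrightarrow> F \<subseteq> Pow {1..n} \<and> (\<forall>S\<in>F. \<forall>T. S \<subseteq> T --> T \<subseteq> {1..n} --> T \<in> F)"

lemma monom_ext_unitf: "monom_ext S = unitf S"
 by (simp add: monom_ext_def unitf_def fun_eq_iff)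

lemma monom_ext_eq: "monom_ext = unitf"
 by (rule ext) (rule monom_ext_unitf)

lemma ext_algebra_fsupp: "ext_algebra n = fsupp (Pow {1..n})"
 by (simp add: ext_algebra_def fsupp_def)

lemma fsupp_mono: "F \<subseteq> F' ==> fsupp F \<subseteq> fsupp F'"
 by (auto simp: fsupp_def)

lemma fsupp_inject: "fsupp F = (fsupp F' :: ('i => 'k::zero_neq_one) set) ==> F = F'"
 using unitf_fsupp[of _ F] unitf_fsupp[of _ F'] by blast

lemma wedge_nonzero:
 assumes "wedge a x S ~= 0"
 obtains T where "T \<subseteq> S" "a T ~= 0" "x (S - T) ~= 0"
 using assms unfolding wedge_def by (metis (no_types, lifting) PowD mult_eq_0_iff sum.neutral)

lemma ext_ideal_fsupp:
 assumes "upclosed n F"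
 shows "ext_ideal n (fsupp F :: 'k::field ext set)"
 unfolding ext_ideal_def
proof (intro conjI ballI)
 show "fsupp F \<subseteq> (ext_algebra n :: 'k ext set)"
  unfolding ext_algebra_fsupp using assms by (intro fsupp_mono) (simp add: upclosed_def)
 show "(\<lambda>S. 0) \<in> (fsupp F :: 'k ext set)" by (simp add: fsupp_def)
 show "(\<lambda>S. x S + y S) \<in> fsupp F" if "x \<in> fsupp F" "y \<in> fsupp F" for x y :: "'k ext"
  using that by (auto simp: fsupp_def; metis add.right_neutral)
 fix x a :: "'k ext" assume x: "x \<in> fsupp F" and a: "a \<in> ext_algebra n"
 have up: "S \<in> F" if "T \<in> F" "T \<subseteq> S" "S \<subseteq> {1..n}" for S T
  using assms that by (auto simp: upclosed_def)
 have F: "T \<subseteq> {1..n}" if "T \<in> F" for T using assms that by (auto simp: upclosed_def)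
 have aN: "T \<subseteq> {1..n}" if "a T ~= 0" for T using a that by (auto simp: ext_algebra_def)
 have xF: "T \<in> F" if "x T ~= 0" for T using x that by (auto simp: fsupp_def)
 show "wedge a x \<in> fsupp F"
  unfolding fsupp_def
 proof clarify
  fix S assume "wedge a x S ~= 0"
  then obtain T where T: "T \<subseteq> S" "a T ~= 0" "x (S - T) ~= 0" by (rule wedge_nonzero)
  have "S \<subseteq> {1..n}" using aN[OF T(2)] F[OF xF[OF T(3)]] by blast
  then show "S \<in> F" using up[OF xF[OF T(3)]] by blast
 qed
 show "wedge x a \<in> fsupp F"
  unfolding fsupp_def
 proof clarify
  fix S assume "wedge x a S ~= 0"
  then obtain T where T: "T \<subseteq> S" "x T ~= 0" "a (S - T) ~= 0" by (rule wedge_nonzero)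
  have "S \<subseteq> {1..n}" using aN[OF T(3)] F[OF xF[OF T(2)]] by blast
  then show "S \<in> F" using up[OF xF[OF T(2)]] T(1) by blast
 qed
qed

text \<open>\<open>ext_ideal\<close> mentions only sums and products, so closure under scalars is
  obtained by multiplying with a multiple of the unit.\<close>

lemma wedge_scalar:
 assumes "x \<in> ext_algebra n"
 shows "wedge (fscale c e0) x = fscale c x"
proof
 fix S
 show "wedge (fscale c e0) x S = fscale c x S"
 proof (cases "finite S")
  case True
  have "wedge (fscale c e0) x S = (\<Sum>T\<in>{{}}. wedge_sign T (S - T) * fscale c e0 T * x (S - T))"
   unfolding wedge_def using True
   by (intro sum.mono_neutral_right) (auto simp: fscale_apply unitf_def)
  also have "\<dots> = c * x S" by (simp add: wedge_sign_def fscale_apply unitf_def)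
  finally show ?thesis by (simp add: fscale_apply)
 next
  case False
  then have "\<not> S \<subseteq> {1..n}" using finite_subset by blast
  then have "x S = 0" using assms by (auto simp: ext_algebra_def)
  then show ?thesis using False by (simp add: wedge_def fscale_apply)
 qed
qed

lemma fsupp_eq_span:
 assumes "finite F"
 shows "fsupp F = fvs.span (unitf ` F :: ('i => 'k::field) set)"
proof
 show "fsupp F \<subseteq> fvs.span (unitf ` F :: ('i => 'k::field) set)"
 proof
  fix x :: "'i => 'k" assume x: "x \<in> fsupp F"
  have "x = (\<Sum>S\<in>F. fscale (x S) (unitf S))"
  proof
   fix T
   have "(\<Sum>S\<in>F. fscale (x S) (unitf S)) T = (\<Sum>S\<in>F. if S = T then x S else 0)"
    unfolding sum_fun_apply by (intro sum.cong) (auto simp: fscale_apply unitf_def)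
   also have "\<dots> = x T" using assms x by (auto simp: fsupp_def)
   finally show "x T = (\<Sum>S\<in>F. fscale (x S) (unitf S)) T" by simp
  qed
  then show "x \<in> fvs.span (unitf ` F)"
   using fvs.span_sum[of F "\<lambda>S. fscale (x S) (unitf S)" "unitf ` F"] by (simp add: fvs.span_scale fvs.span_base)
 qed
 show "fvs.span (unitf ` F) \<subseteq> (fsupp F :: ('i => 'k::field) set)" by (rule span_fsupp) auto
qed

lemma ideal_gen_monomials:
 assumes "upclosed n F"
 shows "ideal_gen n (unitf ` F) = (fsupp F :: 'k::field ext set)"
proof
 show "ideal_gen n (unitf ` F) \<subseteq> (fsupp F :: 'k::field ext set)"
  unfolding ideal_gen_def using ext_ideal_fsupp[OF assms] by (intro Inter_lower) auto
 have fin: "finite F" using assms finite_subset[of F "Pow {1..n}"] by (simp add: upclosed_def)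
 show "(fsupp F :: 'k ext set) \<subseteq> ideal_gen n (unitf ` F)"
  unfolding ideal_gen_def
 proof (rule Inter_greatest, clarify)
  fix J :: "'k ext set" and x :: "'k ext"
  assume J: "ext_ideal n J" "unitf ` F \<subseteq> J" and x: "x \<in> fsupp F"
  have "fvs.subspace J"
   unfolding fvs.subspace_def
  proof (intro conjI ballI allI)
   show "0 \<in> J" using J(1) by (simp add: ext_ideal_def zero_fun_def)
   show "y + z \<in> J" if "y \<in> J" "z \<in> J" for y z using J(1) that by (simp add: ext_ideal_def plus_fun_def)
   show "fscale c y \<in> J" if y: "y \<in> J" for c y
   proof -
    have yE: "y \<in> ext_algebra n" using J(1) y by (auto simp: ext_ideal_def)
    have "fscale c e0 \<in> (ext_algebra n :: 'k ext set)"
     by (auto simp: ext_algebra_def fscale_apply unitf_def)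
    then have "wedge (fscale c e0) y \<in> J" using J(1) y by (simp add: ext_ideal_def)
    then show ?thesis by (simp add: wedge_scalar[OF yE])
   qed
  qed
  then have "fvs.span (unitf ` F) \<subseteq> J" by (rule fvs.span_minimal[OF J(2)])
  then show "x \<in> J" using x fsupp_eq_span[OF fin] by blast
 qed
qed

lemma face_ideal_fsupp:
 assumes "upclosed n (Pow {1..n} - G)"
 shows "face_ideal n G = (fsupp (Pow {1..n} - G) :: 'k::field ext set)"
proof -
 have "{monom_ext S | S. S \<subseteq> {1..n} \<and> S \<notin> G} = (unitf ` (Pow {1..n} - G) :: 'k ext set)"
  by (auto simp: monom_ext_unitf)
 then show ?thesis by (simp add: face_ideal_def ideal_gen_monomials[OF assms])
qed

lemma strongly_stable_fsupp:
 assumes "upclosed n F"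
 shows "strongly_stable n (fsupp F :: 'k::field ext set) \<longleftrightarrow> stable {1..n} F"
proof -
 have "F \<subseteq> Pow {1..n}" using assms by (simp add: upclosed_def)
 then have "monomial_ideal n (fsupp F :: 'k::field ext set)"
  unfolding monomial_ideal_def
  by (intro exI[of _ F] conjI) (simp_all only: monom_ext_eq ideal_gen_monomials[OF assms])
 then show ?thesis using \<open>F \<subseteq> Pow {1..n}\<close>
  unfolding strongly_stable_def stable_def by (auto simp: monom_ext_unitf subset_iff)
qed

lemma gl_act_fsupp:
 assumes "F \<subseteq> Pow {1..n}"
 shows "gl_act n A ` fsupp F = fvs.span (vm (colv n A) ` F)"
proof -
 let ?v = "colv n A"
 have eq: "gl_act n A x = (\<Sum>S\<in>Pow {1..n}. fscale (x S) (vm ?v S))" for x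
  by (simp add: gl_act_vm fun_eq_iff sum_fun_apply fscale_apply)
 have unit: "gl_act n A (unitf S) = vm ?v S" if "S \<in> Pow {1..n}" for S
 proof -
  have "gl_act n A (unitf S) = (\<Sum>T\<in>Pow {1..n}. if T = S then vm ?v T else 0)"
   unfolding eq by (intro sum.cong) (auto simp: unitf_def fvs.scale_one fvs.scale_zero_left)
  then show ?thesis using that by simp
 qed
 show ?thesis
 proof
  show "gl_act n A ` fsupp F \<subseteq> fvs.span (vm ?v ` F)"
  proof (rule image_subsetI)
   fix x :: "'a ext" assume x: "x \<in> fsupp F"
   have "fscale (x S) (vm ?v S) \<in> fvs.span (vm ?v ` F)" for S
   proof (cases "S \<in> F")
    case True
    then show ?thesis by (intro fvs.span_scale fvs.span_base) simp
   next
    case False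
    then have "x S = 0" using x by (auto simp: fsupp_def)
    then show ?thesis by (simp add: fvs.scale_zero_left fvs.span_zero)
   qed
   then show "gl_act n A x \<in> fvs.span (vm ?v ` F)" unfolding eq by (intro fvs.span_sum)
  qed
  show "fvs.span (vm ?v ` F) \<subseteq> gl_act n A ` fsupp F"
  proof (rule fvs.span_minimal)
   show "vm ?v ` F \<subseteq> gl_act n A ` fsupp F"
   proof (rule image_subsetI)
    fix S assume "S \<in> F"
    then show "vm ?v S \<in> gl_act n A ` fsupp F"
     using unit[of S] assms by (intro image_eqI[of _ _ "unitf S"]) auto
   qed
   show "fvs.subspace (gl_act n A ` fsupp F)"
    unfolding fvs.subspace_def
   proof (intro conjI ballI allI)
    have "gl_act n A 0 = 0" by (simp add: eq zero_fun_apply fvs.scale_zero_left)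
    then show "0 \<in> gl_act n A ` fsupp F"
     using fvs.subspace_0[OF subspace_fsupp] by (metis image_eqI)
    fix x y assume "x \<in> gl_act n A ` fsupp F" "y \<in> gl_act n A ` fsupp F"
    then obtain x' y' where xy: "x = gl_act n A x'" "y = gl_act n A y'" "x' \<in> fsupp F" "y' \<in> fsupp F"
     by blast
    have "gl_act n A (x' + y') = x + y"
     by (simp add: xy eq plus_fun_apply fvs.scale_left_distrib sum.distrib)
    then show "x + y \<in> gl_act n A ` fsupp F"
     using fvs.subspace_add[OF subspace_fsupp xy(3,4)] by (metis image_eqI)
   next
    fix c x assume "x \<in> gl_act n A ` fsupp F"
    then obtain x' where x': "x = gl_act n A x'" "x' \<in> fsupp F" by blast
    have "gl_act n A (fscale c x') = fscale c x"
     by (simp add: x' eq fscale_apply fvs.scale_sum_right fvs.scale_scale)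
    then show "fscale c x \<in> gl_act n A ` fsupp F"
     using fvs.subspace_scale[OF subspace_fsupp x'(2)] by (metis image_eqI)
   qed
  qed
 qed
qed

section \<open>Invertible matrices as dual bases\<close>

lemma sum_shift_atLeast1: "(\<Sum>a\<in>{1..n}. f a) = (\<Sum>a\<in>{0..<n}. f (Suc a))"
 by (rule sum.reindex_bij_witness[of _ Suc "\<lambda>a. a - 1"]) auto

lemma GL_dual_bases:
 assumes "A \<in> GL n"
 obtains w where "dual_bases {1..n} {1..n} (colv n A) w"
proof -
 have A: "A \<in> carrier_mat n n" and "invertible_mat A" using assms by (auto simp: GL_def)
 then obtain B where B: "A * B = 1\<^sub>m n" "B * A = 1\<^sub>m (dim_row B)"
  by (auto simp: invertible_mat_def inverts_mat_def)
 have "dim_col (A * B) = n" using B(1) by simp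
 moreover have "dim_col (B * A) = dim_row B" using B(2) by simp
 ultimately have Bc: "B \<in> carrier_mat n n" using A by auto
 have BA: "B * A = 1\<^sub>m n" using B Bc by auto
 define w where "w x a = B $$ (x - 1, a - 1)" for x a
 have e: "(\<Sum>k\<in>{0..<n}. A $$ (i, k) * B $$ (k, j)) = (if i = j then 1 else 0)"
  "(\<Sum>k\<in>{0..<n}. B $$ (i, k) * A $$ (k, j)) = (if i = j then 1 else 0)" if "i < n" "j < n" for i j
 proof -
  have 1: "(\<Sum>k\<in>{0..<n}. A $$ (i, k) * B $$ (k, j)) = (A * B) $$ (i, j)"
   using A Bc that by (simp add: scalar_prod_def)
  have 2: "(\<Sum>k\<in>{0..<n}. B $$ (i, k) * A $$ (k, j)) = (B * A) $$ (i, j)"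
   using A Bc that by (simp add: scalar_prod_def)
  show "(\<Sum>k\<in>{0..<n}. A $$ (i, k) * B $$ (k, j)) = (if i = j then 1 else 0)"
   unfolding 1 B(1) using that by simp
  show "(\<Sum>k\<in>{0..<n}. B $$ (i, k) * A $$ (k, j)) = (if i = j then 1 else 0)"
   unfolding 2 BA using that by simp
 qed
 have "dual_bases {1..n} {1..n} (colv n A) w"
  unfolding dual_bases_def
 proof (intro conjI ballI)
  fix x assume x: "x \<in> {1..n}"
  show "colv n A x \<in> fsupp {1..n}" by (auto simp: fsupp_def colv_def split: if_splits)
  fix y assume y: "y \<in> {1..n}"
  have "(\<Sum>a\<in>{1..n}. w x a * colv n A y a) = (\<Sum>k\<in>{0..<n}. B $$ (x - 1, k) * A $$ (k, y - 1))"
   unfolding sum_shift_atLeast1 by (intro sum.cong) (auto simp: w_def colv_def)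
  then show "(\<Sum>a\<in>{1..n}. w x a * colv n A y a) = (if x = y then 1 else 0)"
   using e(2)[of "x - 1" "y - 1"] x y by auto
  have "(\<Sum>a\<in>{1..n}. colv n A a x * w a y) = (\<Sum>k\<in>{0..<n}. A $$ (x - 1, k) * B $$ (k, y - 1))"
   unfolding sum_shift_atLeast1 using x by (intro sum.cong) (auto simp: w_def colv_def)
  then show "(\<Sum>a\<in>{1..n}. colv n A a x * w a y) = (if x = y then 1 else 0)"
   using e(1)[of "x - 1" "y - 1"] x y by auto
 qed auto
 then show thesis by (rule that)
qed

text \<open>Realizes coordinates constructed by hand as those of an actual group element, to which
  the maximality of the generic leading terms applies.\<close>

lemma dual_bases_GL:
 assumes "dual_bases {1..n} {1..n} v w"
 obtains A where "A \<in> GL n" "\<And>x. x \<in> {1..n} ==> colv n A x = v x"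
proof -
 define A B where "A = mat n n (\<lambda>(i, j). v (Suc j) (Suc i))" and "B = mat n n (\<lambda>(i, j). w (Suc i) (Suc j))"
 have "A * B = 1\<^sub>m n"
 proof (rule eq_matI)
  fix i j assume ij: "i < dim_row (1\<^sub>m n)" "j < dim_col (1\<^sub>m n)"
  then have "(A * B) $$ (i, j) = (\<Sum>k\<in>{0..<n}. v (Suc k) (Suc i) * w (Suc k) (Suc j))"
   by (auto simp: A_def B_def scalar_prod_def intro!: sum.cong)
  also have "\<dots> = (\<Sum>k\<in>{1..n}. v k (Suc i) * w k (Suc j))" by (simp add: sum_shift_atLeast1)
  also have "\<dots> = (if Suc i = Suc j then 1 else 0)"
  proof -
   have "Suc i \<in> {1..n}" "Suc j \<in> {1..n}" using ij by auto
   then show ?thesis using assms unfolding dual_bases_def by blast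
  qed
  finally show "(A * B) $$ (i, j) = 1\<^sub>m n $$ (i, j)" using ij by auto
 qed (auto simp: A_def B_def)
 moreover have "B * A = 1\<^sub>m n"
 proof (rule eq_matI)
  fix i j assume ij: "i < dim_row (1\<^sub>m n)" "j < dim_col (1\<^sub>m n)"
  then have "(B * A) $$ (i, j) = (\<Sum>k\<in>{0..<n}. w (Suc i) (Suc k) * v (Suc j) (Suc k))"
   by (auto simp: A_def B_def scalar_prod_def intro!: sum.cong)
  also have "\<dots> = (\<Sum>k\<in>{1..n}. w (Suc i) k * v (Suc j) k)" by (simp add: sum_shift_atLeast1)
  also have "\<dots> = (if Suc i = Suc j then 1 else 0)"
  proof -
   have "Suc i \<in> {1..n}" "Suc j \<in> {1..n}" using ij by auto
   then show ?thesis using assms unfolding dual_bases_def by blast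
  qed
  finally show "(B * A) $$ (i, j) = 1\<^sub>m n $$ (i, j)" using ij by auto
 qed (auto simp: A_def B_def)
 ultimately have "A \<in> GL n"
  unfolding GL_def invertible_mat_def inverts_mat_def by (auto simp: A_def B_def intro!: exI[of _ B])
 moreover have "colv n A x = v x" if x: "x \<in> {1..n}" for x
 proof
  fix k
  show "colv n A x k = v x k"
  proof (cases "k \<in> {1..n}")
   case True
   then show ?thesis using x by (auto simp: colv_def A_def)
  next
   case False
   have "v x \<in> fsupp {1..n}" using assms x by (simp add: dual_bases_def)
   then have "v x k = 0" using False fsuppD by metis
   then show ?thesis using False by (auto simp: colv_def)
  qed
 qed
 ultimately show thesis by (rule that)
qed

section \<open>Term orders as ranks\<close>

definition term_rank :: "nat => nat set rel => nat set => nat" where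
 "term_rank n \<sigma> S = card {T. (T, S) \<in> \<sigma>}"

lemma term_rank_le:
 assumes "term_order n \<sigma>" "S \<subseteq> {1..n}" "T \<subseteq> {1..n}"
 shows "term_rank n \<sigma> S \<le> term_rank n \<sigma> T \<longleftrightarrow> (S, T) \<in> \<sigma>"
proof -
 have lo: "linear_order_on (Pow {1..n}) \<sigma>" using assms(1) by (simp add: term_order_def)
 then have "partial_order_on (Pow {1..n}) \<sigma>" by (simp add: linear_order_on_def)
 note po = partial_order_onD[OF this]
 have tot: "(S, T) \<in> \<sigma> \<or> (T, S) \<in> \<sigma>" if "S \<subseteq> {1..n}" "T \<subseteq> {1..n}" for S T
  using lo po(1) that unfolding linear_order_on_def total_on_def refl_on_def by (cases "S = T") auto
 have fin: "finite {T. (T, S) \<in> \<sigma>}" for S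
  using po(4) by (rule_tac finite_subset[of _ "Pow {1..n}"]) auto
 have le: "term_rank n \<sigma> S \<le> term_rank n \<sigma> T" if "(S, T) \<in> \<sigma>" for S T
  unfolding term_rank_def using fin po(2) that by (intro card_mono) (auto dest: transD)
 have less: "term_rank n \<sigma> S < term_rank n \<sigma> T" if "(S, T) \<in> \<sigma>" "S ~= T" "T \<subseteq> {1..n}" for S T
  unfolding term_rank_def
 proof (rule psubset_card_mono[OF fin])
  have "T \<notin> {U. (U, S) \<in> \<sigma>}" using po(3) that antisymD by fastforce
  moreover have "T \<in> {U. (U, T) \<in> \<sigma>}" using po(1) that by (auto simp: refl_on_def)
  moreover have "{U. (U, S) \<in> \<sigma>} \<subseteq> {U. (U, T) \<in> \<sigma>}" using po(2) that by (auto dest: transD)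
  ultimately show "{U. (U, S) \<in> \<sigma>} \<subset> {U. (U, T) \<in> \<sigma>}" by blast
 qed
 show ?thesis
 proof
  assume l: "term_rank n \<sigma> S \<le> term_rank n \<sigma> T"
  show "(S, T) \<in> \<sigma>"
  proof (rule ccontr)
   assume "(S, T) \<notin> \<sigma>"
   then have "(T, S) \<in> \<sigma>" "T ~= S" using tot[OF assms(2,3)] by auto
   then show False using less[of T S] l assms(2) by simp
  qed
 qed (rule le)
qed

lemma mono_rank_term_rank:
 assumes "term_order n \<sigma>"
 shows "mono_rank {1..n} (term_rank n \<sigma>)"
proof -
 have anti: "antisym \<sigma>"
  using assms partial_order_onD(3) by (auto simp: term_order_def linear_order_on_def)
 have inj: "S = T" if "S \<subseteq> {1..n}" "T \<subseteq> {1..n}" "term_rank n \<sigma> S = term_rank n \<sigma> T" for S T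
  using term_rank_le[OF assms that(1,2)] term_rank_le[OF assms that(2,1)] that(3) anti
  by (auto dest: antisymD)
 have "term_rank n \<sigma> (S \<union> U) < term_rank n \<sigma> (T \<union> U)"
  if h: "S \<subseteq> {1..n}" "T \<subseteq> {1..n}" "U \<subseteq> {1..n}" "S \<inter> U = {}" "T \<inter> U = {}" "term_rank n \<sigma> S < term_rank n \<sigma> T" for S T U
 proof -
  have "(S, T) \<in> \<sigma>" using term_rank_le[OF assms h(1,2)] h(6) by simp
  then have "(S \<union> U, T \<union> U) \<in> \<sigma>" using assms h(3-5) unfolding term_order_def by blast
  then have "term_rank n \<sigma> (S \<union> U) \<le> term_rank n \<sigma> (T \<union> U)"
   using term_rank_le[OF assms, of "S \<union> U" "T \<union> U"] h by simp
  moreover have "S \<union> U ~= T \<union> U"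
  proof
   assume "S \<union> U = T \<union> U"
   then have "S = T" using h(4,5) by blast
   then show False using h(6) by simp
  qed
  ultimately show ?thesis using inj[of "S \<union> U" "T \<union> U"] h by (metis Un_least le_neq_implies_less)
 qed
 then show ?thesis using inj unfolding mono_rank_def inj_on_def by auto
qed

lemma leading_ld:
 assumes "term_order n \<sigma>" "x \<in> fsupp (Pow {1..n})"
 shows "leading \<sigma> x S \<longleftrightarrow> ld (term_rank n \<sigma>) x S"
proof -
 have s: "T \<subseteq> {1..n}" if "x T ~= 0" for T using assms(2) that by (auto simp: fsupp_def)
 show ?thesis
  using term_rank_le[OF assms(1)] s unfolding leading_def ld_def by metis
qed

text \<open>Initial ideals at the level of index families; \<open>initial_ideal_inif\<close> gives
  the translation. Only the columns of the matrix enter.\<close>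

definition inif :: "(nat set => nat) => (nat => nat => 'k::field) => nat set set => nat set set" where
 "inif rk v F = leads rk (fvs.span (vm v ` F))"

lemma vm_fsupp_Pow:
 assumes "dual_bases {1..n} {1..n} v w" "F \<subseteq> Pow {1..n}"
 shows "vm v ` F \<subseteq> fsupp (Pow {1..n})"
proof clarify
 fix S assume S: "S \<in> F"
 then have "vm v S \<in> fsupp (nsub (card S) {1..n})"
  using assms finite_subset[of S "{1..n}"] by (intro vm_fsupp) (auto simp: dual_bases_def)
 then show "vm v S \<in> fsupp (Pow {1..n})" by (auto simp: fsupp_def nsub_def)
qed

lemma inif_subset:
 assumes "dual_bases {1..n} {1..n} v w" "F \<subseteq> Pow {1..n}"
 shows "inif rk v F \<subseteq> Pow {1..n}"
 unfolding inif_def by (rule leads_subset[OF span_fsupp[OF vm_fsupp_Pow[OF assms]]])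

lemma upclosedI:
 assumes "F \<subseteq> Pow {1..n}" "\<And>S j. S \<in> F ==> j \<in> {1..n} ==> j \<notin> S ==> insert j S \<in> F"
 shows "upclosed n F"
 unfolding upclosed_def
proof (intro conjI ballI allI impI)
 fix S T assume ST: "S \<in> F" "S \<subseteq> T" "T \<subseteq> {1..n}"
 have "finite (T - S)" using ST finite_subset by blast
 then have "T - S \<subseteq> {1..n} ==> S \<union> (T - S) \<in> F"
 proof (induction "T - S" arbitrary: T rule: finite_induct)
  case (insert x D)
  have "D = (T - {x}) - S" using insert by auto
  then have "S \<union> ((T - {x}) - S) \<in> F" using insert by (metis Diff_subset insert_subset)
  moreover have "S \<union> (T - S) = insert x (S \<union> ((T - {x}) - S))" using insert by auto
  moreover have "x \<notin> S \<union> ((T - {x}) - S)" "x \<in> {1..n}" using insert by auto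
  ultimately show ?case using assms(2) by metis
 qed (use ST in \<open>auto simp: Un_absorb2\<close>)
 moreover have "T - S \<subseteq> {1..n}" "S \<union> (T - S) = T" using ST by auto
 ultimately show "T \<in> F" by simp
qed (rule assms(1))

text \<open>Multiplication by the unit vector of \<open>j\<close> adds \<open>j\<close> to a leading
  monomial, and the span is closed under it because \<open>F\<close> is upward closed.\<close>

lemma inif_upclosed:
 assumes b: "dual_bases {1..n} {1..n} v w" and mr: "mono_rank {1..n} rk" and F: "upclosed n F"
 shows "upclosed n (inif rk v F)"
proof (rule upclosedI)
 have FP: "F \<subseteq> Pow {1..n}" using F by (simp add: upclosed_def)
 show "inif rk v F \<subseteq> Pow {1..n}" by (rule inif_subset[OF b FP])
 fix S j assume S: "S \<in> inif rk v F" "j \<in> {1..n}" "j \<notin> S"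
 then obtain x where x: "x \<in> fvs.span (vm v ` F)" "ld rk x S" by (auto simp: inif_def leads_def)
 have "lv (unitf j) x \<in> fvs.span (vm v ` F)"
 proof (rule lv_span[OF _ x(1)])
  show "unitf j \<in> fvs.span (v ` {1..n})" by (rule dual_bases_span[OF b]) (use S in simp)
  fix a z assume "a \<in> v ` {1..n}" "z \<in> vm v ` F"
  then obtain y T where yT: "y \<in> {1..n}" "a = v y" "T \<in> F" "z = vm v T" by blast
  have fT: "finite T" using yT FP finite_subset by blast
  show "lv a z \<in> fvs.span (vm v ` F)"
  proof (cases "y \<in> T")
   case True
   then show ?thesis using yT fT by (simp add: lv_vm_mem fvs.span_zero)
  next
   case False
   obtain s where "lv (v y) (vm v T) = fscale s (vm v (insert y T))"
    using lv_vm_insert[OF fT False] by metis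
   moreover have "insert y T \<subseteq> {1..n}" using yT(1,3) FP by auto
   then have "insert y T \<in> F" using F yT(3) unfolding upclosed_def by (meson subset_insertI)
   ultimately show ?thesis using yT by (simp add: fvs.span_scale fvs.span_base)
  qed
 qed
 moreover have "ld rk (lv (unitf j) x) (insert j S)"
  by (rule ld_lv[OF mr _ _ ld_unitf x(2) S(3)])
   (use S(2) x(1) span_fsupp[OF vm_fsupp_Pow[OF b FP]] in auto)
 ultimately show "insert j S \<in> inif rk v F" unfolding inif_def by (rule leadsI)
qed

lemma vm_cong: "(\<And>x. x \<in> S ==> v x = v' x) ==> finite S ==> vm v S = vm v' S"
proof -
 assume h: "\<And>x. x \<in> S ==> v x = v' x" "finite S"
 have "vmul v xs = vmul v' xs" if "set xs \<subseteq> S" for xs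
  using that by (induction xs) (auto simp: h)
 then show ?thesis using h(2) by (simp add: vm_def)
qed

lemma inif_cong:
 assumes "F \<subseteq> Pow {1..n}" "\<And>x. x \<in> {1..n} ==> v x = v' x"
 shows "inif rk v F = inif rk v' F"
proof -
 have "vm v S = vm v' S" if "S \<in> F" for S
 proof (rule vm_cong)
  have S: "S \<subseteq> {1..n}" using that assms(1) by blast
  then show "finite S" using finite_subset by blast
  show "v x = v' x" if "x \<in> S" for x using assms(2) S that by blast
 qed
 then show ?thesis unfolding inif_def by (metis image_cong)
qed

lemma initial_ideal_inif:
 assumes "upclosed n F" "A \<in> GL n" "term_order n \<sigma>"
 shows "initial_ideal n \<sigma> (gl_act n A ` fsupp F) = (fsupp (inif (term_rank n \<sigma>) (colv n A) F) :: 'k::field ext set)"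
proof -
 obtain w where b: "dual_bases {1..n} {1..n} (colv n A) w" using GL_dual_bases[OF assms(2)] .
 have FP: "F \<subseteq> Pow {1..n}" using assms(1) by (simp add: upclosed_def)
 let ?J = "gl_act n A ` fsupp F"
 have J: "?J = fvs.span (vm (colv n A) ` F)" by (rule gl_act_fsupp[OF FP])
 have "?J \<subseteq> fsupp (Pow {1..n})" unfolding J by (rule span_fsupp[OF vm_fsupp_Pow[OF b FP]])
 then have eq: "{monom_ext S | S. \<exists>x\<in>?J. leading \<sigma> x S} = unitf ` inif (term_rank n \<sigma>) (colv n A) F"
 proof -
  assume J': "?J \<subseteq> fsupp (Pow {1..n})"
  have "(\<exists>x\<in>?J. leading \<sigma> x S) \<longleftrightarrow> (\<exists>x\<in>?J. ld (term_rank n \<sigma>) x S)" for S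
   using leading_ld[OF assms(3)] J' by blast
  then show ?thesis unfolding inif_def leads_def J[symmetric] monom_ext_unitf by blast
 qed
 show ?thesis unfolding initial_ideal_def eq
  by (rule ideal_gen_monomials[OF inif_upclosed[OF b mono_rank_term_rank[OF assms(3)] assms(1)]])
qed

text \<open>Reduces statements about all iterated initial ideals to an invariant \<open>P\<close> of
  one step in arbitrary coordinates and for an arbitrary order.\<close>

lemma iterated_initials_families:
 assumes F0: "upclosed n F0" "P F0"
  and step: "\<And>F v w rk. upclosed n F ==> P F ==> dual_bases {1..n} {1..n} v (w :: nat => nat => 'k::field) ==>
   mono_rank {1..n} rk ==> P (inif rk v F)"
  and I: "I \<in> iterated_initials n (fsupp F0 :: 'k ext set)"
 shows "\<exists>F. upclosed n F \<and> P F \<and> I = fsupp F"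
proof -
 have one: "\<exists>F'. upclosed n F' \<and> P F' \<and> initial_ideal n \<sigma> (gl_act n A ` (fsupp F :: 'k ext set)) = fsupp F'"
  if h: "upclosed n F" "P F" "A \<in> GL n" "term_order n \<sigma>" for F A \<sigma>
 proof -
  obtain w where b: "dual_bases {1..n} {1..n} (colv n A) w" using GL_dual_bases[OF h(3)] .
  note m = mono_rank_term_rank[OF h(4)]
  show ?thesis
   using initial_ideal_inif[OF h(1,3,4)] inif_upclosed[OF b m h(1)] step[OF h(1,2) b m] by blast
 qed
 show ?thesis using I
 proof (induction rule: iterated_initials.induct)
  case (first A \<sigma>)
  then show ?case using one[OF F0] by blast
 next
  case (further I A \<sigma>)
  then obtain F where "upclosed n F" "P F" "I = fsupp F" by blast
  then show ?case using one[of F] further by blast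
 qed
qed

text \<open>Products of \<open>d\<close> vectors are homogeneous, so the projection
  \<open>pr\<close> to degree \<open>d\<close> maps the span into the span of the degree
  \<open>d\<close> products and keeps a leading term of that degree.\<close>

lemma inif_graded:
 assumes b: "dual_bases {1..n} {1..n} v w" and F: "F \<subseteq> Pow {1..n}"
 shows "inif rk v F \<inter> nsub d {1..n} = inif rk v (F \<inter> nsub d {1..n})"
proof
 have FN: "vm v S \<in> fsupp (nsub (card S) {1..n})" if "S \<in> F" for S
  using b that F finite_subset[of S "{1..n}"] by (intro vm_fsupp) (auto simp: dual_bases_def)
 show "inif rk v (F \<inter> nsub d {1..n}) \<subseteq> inif rk v F \<inter> nsub d {1..n}"
 proof -
  have "vm v ` (F \<inter> nsub d {1..n}) \<subseteq> fsupp (nsub d {1..n})" using FN by (auto simp: nsub_def)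
  then have "inif rk v (F \<inter> nsub d {1..n}) \<subseteq> nsub d {1..n}"
   unfolding inif_def by (intro leads_subset span_fsupp)
  moreover have "inif rk v (F \<inter> nsub d {1..n}) \<subseteq> inif rk v F"
   unfolding inif_def by (intro leads_mono fvs.span_mono) auto
  ultimately show ?thesis by blast
 qed
 define pr where "pr x = (\<lambda>T. if card T = d then x T else 0)" for x :: "'a ext"
 show "inif rk v F \<inter> nsub d {1..n} \<subseteq> inif rk v (F \<inter> nsub d {1..n})"
 proof
  fix S assume S: "S \<in> inif rk v F \<inter> nsub d {1..n}"
  then obtain x where x: "x \<in> fvs.span (vm v ` F)" "ld rk x S" by (auto simp: inif_def leads_def)
  let ?W = "fvs.span (vm v ` (F \<inter> nsub d {1..n}))"
  have "fvs.span (vm v ` F) \<subseteq> {x. pr x \<in> ?W}"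
  proof (rule fvs.span_minimal)
   show "vm v ` F \<subseteq> {x. pr x \<in> ?W}"
   proof clarify
    fix T assume T: "T \<in> F"
    show "pr (vm v T) \<in> ?W"
    proof (cases "card T = d")
     case True
     then have "pr (vm v T) = vm v T"
      using FN[OF T] by (auto simp: pr_def fun_eq_iff fsupp_def nsub_def)
     then show ?thesis using True T F by (auto intro!: fvs.span_base simp: nsub_def)
    next
     case False
     then have "pr (vm v T) = 0"
      using FN[OF T] by (auto simp: pr_def fun_eq_iff fsupp_def nsub_def zero_fun_apply)
     then show ?thesis by (simp add: fvs.span_zero)
    qed
   qed
   have "pr 0 = 0" "pr (x + y) = pr x + pr y" "pr (fscale c x) = fscale c (pr x)" for x y c
    by (auto simp: pr_def fun_eq_iff fun_apply)
   then show "fvs.subspace {x. pr x \<in> ?W}"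
    by (simp add: fvs.subspace_def fvs.span_zero fvs.span_add fvs.span_scale)
  qed
  then have "pr x \<in> ?W" using x(1) by blast
  moreover have "ld rk (pr x) S" using x(2) S by (auto simp: ld_def pr_def nsub_def)
  ultimately show "S \<in> inif rk v (F \<inter> nsub d {1..n})" unfolding inif_def by (rule leadsI)
 qed
qed

lemma card_inif:
 assumes b: "dual_bases {1..n} {1..n} v w" and mr: "mono_rank {1..n} rk" and F: "F \<subseteq> Pow {1..n}"
 shows "card (inif rk v F) = card F"
 unfolding inif_def
proof (rule card_leads_family[where X = "Pow {1..n}" and I = "Pow {1..n}"])
 show "inj_on rk (Pow {1..n})" using mr by (simp add: mono_rank_def)
 show "unitf T \<in> fvs.span (vm v ` Pow {1..n})" if T: "T \<in> Pow {1..n}" for T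
 proof -
  have "unitf T \<in> fvs.span (vm v ` nsub (card T) {1..n})"
   using T finite_subset[of T "{1..n}"] dual_bases_span[OF b] by (intro unitf_span_vm) auto
  moreover have "nsub (card T) {1..n} \<subseteq> Pow {1..n}" by (auto simp: nsub_def)
  ultimately show ?thesis using fvs.span_mono[OF image_mono] by blast
 qed
qed (use vm_fsupp_Pow[OF b] F in auto)

text \<open>The new set consists of the leading indices of the vectors spanned by those of
  \<open>U\<close>; three such vectors with distinct leading indices have a product leading with the
  triple.\<close>

lemma inif_cube:
 assumes b: "dual_bases {1..n} {1..n} v w" and mr: "mono_rank {1..n} rk"
  and U: "U \<subseteq> {1..n}" "nsub 3 U \<subseteq> F"
 shows "\<exists>U'\<subseteq>{1..n}. card U' = card U \<and> nsub 3 U' \<subseteq> inif rk v F"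
proof (intro exI conjI)
 let ?U = "leads (rk1 rk) (fvs.span (v ` U))"
 have fin: "finite U" using U finite_subset by blast
 show "?U \<subseteq> {1..n}" "card ?U = card U"
  using card_leads_vec[OF b mr order_refl U(1)] by auto
 show "nsub 3 ?U \<subseteq> inif rk v F"
 proof
  fix S assume "S \<in> nsub 3 ?U"
  then have "S \<subseteq> ?U" "card S = 3" by (auto simp: nsub_def)
  then obtain x y z where S: "S = {x, y, z}" "x ~= y" "y ~= z" "x ~= z" by (auto simp: card_3_iff)
  then obtain a c e where l: "a \<in> fvs.span (v ` U)" "ld (rk1 rk) a x" "c \<in> fvs.span (v ` U)" "ld (rk1 rk) c y"
   "e \<in> fvs.span (v ` U)" "ld (rk1 rk) e z" using \<open>S \<subseteq> ?U\<close> by (auto simp: leads_def)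
  have "e0 \<in> fvs.span (vm v ` nsub 0 U)"
   by (rule fvs.span_base) (auto simp: nsub_def intro!: image_eqI[of _ _ "{}"])
  then have "lv a (lv c (lv e e0)) \<in> fvs.span (vm v ` nsub 3 U)"
   unfolding numeral_3_eq_3 by (intro lv_span_vm l fin)
  then have W: "lv a (wd c e) \<in> fvs.span (vm v ` F)"
   using fvs.span_mono[OF image_mono[OF U(2)], of "vm v"] by (auto simp: wd_def)
  have vs: "x \<in> fsupp {1..n}" if "x \<in> fvs.span (v ` U)" for x
   using that span_fsupp[of "v ` U" "{1..n}"] b U(1) by (auto simp: dual_bases_def)
  have "wd c e \<in> fsupp (nsub 2 {1..n})" by (rule wd_fsupp) (use vs l in auto)
  then have ws: "wd c e \<in> fsupp (Pow {1..n})" by (auto simp: fsupp_def nsub_def)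
  have "ld rk (wd c e) {y, z}" by (rule ld_wd[OF mr vs[OF l(3)] vs[OF l(5)] l(4,6) S(3)])
  then have "ld rk (lv a (wd c e)) (insert x {y, z})"
   by (rule ld_lv[OF mr vs[OF l(1)] ws l(2)]) (use S in auto)
  then show "S \<in> inif rk v F" unfolding inif_def using W S(1) by (intro leadsI) auto
 qed
qed

text \<open>Compression: an element of \<open>U\<close> beyond \<open>card U\<close> is exchanged
  for a missing smaller one. Stability keeps the triples in \<open>F\<close>, and the sum of the
  elements decreases.\<close>

lemma stable_initial_cube:
 assumes st: "stable {1..n} F" and U: "U \<subseteq> {1..n}" "nsub 3 U \<subseteq> F"
 shows "nsub 3 {1..card U} \<subseteq> F"
 using U
proof (induction "\<Sum>U" arbitrary: U rule: less_induct)
 case less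
 have fin: "finite U" using less.prems(1) finite_subset by blast
 show ?case
 proof (cases "U = {1..card U}")
  case True
  then show ?thesis using less.prems by simp
 next
  case False
  have "\<not> {1..card U} \<subseteq> U"
   using False card_subset_eq[OF fin, of "{1..card U}"] by auto
  then obtain i where i: "i \<in> {1..card U}" "i \<notin> U" by blast
  have "\<not> U \<subseteq> {1..card U}"
   using False card_subset_eq[of "{1..card U}" U] by auto
  then obtain j where j: "j \<in> U" "j \<notin> {1..card U}" by blast
  then have ij: "i < j" "j \<in> {1..n}" "i \<in> {1..n}" using i less.prems(1) by auto
  let ?V = "insert i (U - {j})"
  have cV: "card ?V = card U" using i j fin by (simp add: card.remove[symmetric] card_insert_if)
  have "\<Sum>U = j + \<Sum>(U - {j})" using sum.remove[OF fin j(1), of "\<lambda>x. x"] by simp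
  moreover have "\<Sum>?V = i + \<Sum>(U - {j})" using fin i by simp
  ultimately have "\<Sum>?V < \<Sum>U" using ij by simp
  moreover have "?V \<subseteq> {1..n}" using less.prems(1) ij by auto
  moreover have "nsub 3 ?V \<subseteq> F"
  proof
   fix S assume S: "S \<in> nsub 3 ?V"
   show "S \<in> F"
   proof (cases "i \<in> S")
    case False
    then have "S \<in> nsub 3 U" using S by (auto simp: nsub_def)
    then show ?thesis using less.prems(2) by blast
   next
    case True
    have jS: "j \<notin> S" using S i j by (auto simp: nsub_def)
    have fS: "finite S" "card S = 3" using S fin finite_subset[of S ?V] by (auto simp: nsub_def)
    have "card (insert j (S - {i})) = 3" using fS True jS by (simp add: card.remove[symmetric] card_insert_if)
    then have "insert j (S - {i}) \<in> F" using S j less.prems(2) by (auto simp: nsub_def)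
    then have "insert i (insert j (S - {i}) - {j}) \<in> F"
     by (rule stableD[OF st]) (use ij in auto)
    moreover have "insert i (insert j (S - {i}) - {j}) = S" using True jS by auto
    ultimately show ?thesis by simp
   qed
  qed
  ultimately show ?thesis using less.hyps[of ?V] cV by simp
 qed
qed

text \<open>
 A monomial ideal on the way from the original ideal to a strongly stable one has the same
 Hilbert function, the same type in degree 2, and contains the third exterior power of a subspace of
 the same dimension. For strongly stable ideals this leaves only one possibility.
\<close>

theorem strongly_stable_unique:
 assumes fc: "face_count {1..n} M U \<tau> c"
  and I: "I \<in> Trans n (fsupp (Pow {1..n} - faces {1..n} M U) :: 'k::field ext set)"
  and I': "I' \<in> Trans n (fsupp (Pow {1..n} - faces {1..n} M U) :: 'k::field ext set)"
 shows "I = I'"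
proof -
 let ?N = "{1..n}"
 let ?F0 = "Pow ?N - faces ?N M U"
 have ty: "has_type ?N M \<tau>" and UN: "U \<subseteq> ?N" using face_count_basic[OF fc] by auto
 have M: "M \<subseteq> nsub 2 ?N" using has_type_basic[OF ty] by blast
 define P where "P F \<longleftrightarrow> F \<inter> nsub 0 ?N = {} \<and> F \<inter> nsub 1 ?N = {} \<and> has_type ?N (F \<inter> nsub 2 ?N) \<tau> \<and>
  (\<exists>V\<subseteq>?N. card V = card U \<and> nsub 3 V \<subseteq> F) \<and> card F = card ?F0" for F
 have up0: "upclosed n (Pow ?N - faces ?N D V)" for D V
 proof -
  have "T \<notin> faces ?N D V" if "S \<subseteq> T" "S \<notin> faces ?N D V" "T \<subseteq> ?N" for S T
  proof
   assume T: "T \<in> faces ?N D V"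
   have "finite (T \<inter> V)" using that(3) finite_subset by blast
   then have "card (S \<inter> V) \<le> card (T \<inter> V)" using that(1) by (intro card_mono) auto
   then have "S \<in> faces ?N D V" using T that(1) unfolding faces_def by fastforce
   then show False using that(2) by simp
  qed
  then show ?thesis by (auto simp: upclosed_def)
 qed
 have small: "S \<in> faces ?N M U" if "S \<subseteq> ?N" "card S \<le> 1" for S
 proof -
  have fS: "finite S" using that(1) finite_subset by blast
  have "\<not> T \<subseteq> S" if "T \<in> M" for T
   using card_mono[OF fS, of T] nsub2_finite[OF M that] \<open>card S \<le> 1\<close> by auto
  moreover have "card (S \<inter> U) \<le> card S" using fS by (intro card_mono) auto
  ultimately show ?thesis using that by (simp add: faces_def)
 qed
 have pairs: "S \<in> faces ?N M U \<longleftrightarrow> S \<notin> M" if S: "S \<in> nsub 2 ?N" for S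
 proof -
  have fS: "finite S" "card S = 2" "S \<subseteq> ?N" using S finite_subset[of S ?N] by (auto simp: nsub_def)
  have "T = S" if "T \<in> M" "T \<subseteq> S" for T
   using nsub2_finite[OF M that(1)] fS that by (intro card_subset_eq) auto
  moreover have "card (S \<inter> U) \<le> card S" using fS by (intro card_mono) auto
  ultimately show ?thesis using fS by (auto simp: faces_def)
 qed
 have P0: "P ?F0"
  unfolding P_def
 proof (intro conjI)
  show "?F0 \<inter> nsub 0 ?N = {}" "?F0 \<inter> nsub 1 ?N = {}" using small by (auto simp: nsub_def)
  have "?F0 \<inter> nsub 2 ?N = M" using pairs M by (auto simp: nsub_def)
  then show "has_type ?N (?F0 \<inter> nsub 2 ?N) \<tau>" using ty by simp
  have "nsub 3 U \<subseteq> ?F0" using UN by (auto simp: nsub_def faces_def Int_absorb2)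
  then show "\<exists>V\<subseteq>?N. card V = card U \<and> nsub 3 V \<subseteq> ?F0" using UN by blast
 qed simp
 have step: "P (inif rk v F)"
  if h: "upclosed n F" "P F" "dual_bases ?N ?N v (w :: nat => nat => 'k)" "mono_rank ?N rk" for F v w rk
 proof -
  have FP: "F \<subseteq> Pow ?N" using h(1) by (simp add: upclosed_def)
  have e: "inif rk v {} = {}" using leads_subset[of "fvs.span (vm v ` {})" "{}" rk] span_fsupp[of "vm v ` {}" "{}"]
   by (auto simp: inif_def)
  obtain V where V: "V \<subseteq> ?N" "card V = card U" "nsub 3 V \<subseteq> F" using h(2) by (auto simp: P_def)
  have "inif rk v F \<inter> nsub 0 ?N = {}" "inif rk v F \<inter> nsub 1 ?N = {}"
   using inif_graded[OF h(3) FP, of rk] h(2) e by (simp_all add: P_def)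
  moreover have "has_type ?N (inif rk v F \<inter> nsub 2 ?N) \<tau>"
   unfolding inif_graded[OF h(3) FP] unfolding inif_def
   by (rule has_type_leads[OF h(4) _ order_refl h(3)]) (use h(2) in \<open>simp add: P_def\<close>)
  ultimately show ?thesis
   using inif_cube[OF h(3,4) V(1,3)] V(2) card_inif[OF h(3,4) FP] h(2) by (auto simp: P_def)
 qed
 let ?U = "{1..card U}"
 have Un: "card U \<le> n" using card_mono[OF _ UN] by simp
 have main: "\<exists>D. has_type ?N D \<tau> \<and> stable ?N D \<and> J = fsupp (Pow ?N - faces ?N D ?U)"
  if J: "J \<in> Trans n (fsupp ?F0 :: 'k ext set)" for J
 proof -
  have J': "J \<in> iterated_initials n (fsupp ?F0)" using J by (simp add: Trans_def)
  have "\<exists>F. upclosed n F \<and> P F \<and> J = fsupp F"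
   by (rule iterated_initials_families[where P = P, OF up0 P0 _ J']) (rule step)
  then obtain F where F: "upclosed n F" "P F" "J = fsupp F" by blast
  have st: "stable ?N F" using J F strongly_stable_fsupp[OF F(1)] by (auto simp: Trans_def)
  define D where "D = F \<inter> nsub 2 ?N"
  have tD: "has_type ?N D \<tau>" using F(2) by (simp add: P_def D_def)
  have stD: "stable ?N D"
   unfolding stable_def
  proof (intro ballI impI)
   fix S j i assume h: "S \<in> D" "j \<in> S" "i \<in> ?N - S" "i < j"
   have "insert i (S - {j}) \<in> F" using st h unfolding D_def stable_def by blast
   moreover have "finite S" "card S = 2" using nsub2_finite[of D ?N S] h(1) by (auto simp: D_def)
   then have "card (insert i (S - {j})) = 2" using h by (simp add: card_insert_if)
   ultimately show "insert i (S - {j}) \<in> D" using h by (auto simp: D_def nsub_def)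
  qed
  have cube: "nsub 3 ?U \<subseteq> F" using F(2) stable_initial_cube[OF st] unfolding P_def by metis
  have "face_count ?N D ?U \<tau> c"
   by (rule face_count_stable[OF fc tD stD]) (use Un in auto)
  then have "card (faces ?N D ?U) = c" by (rule face_count_card)
  moreover have "card (faces ?N M U) = c" by (rule face_count_card[OF fc])
  ultimately have "card (Pow ?N - faces ?N D ?U) = card ?F0"
   by (subst (1 2) card_Diff_subset) (auto simp: faces_def finite_faces)
  \<comment> \<open>Every nonface is forced into \<open>F\<close> by an edge or by a triple of the
    initial segment. Equal cardinality then leaves nothing else in \<open>F\<close>.\<close>
  moreover have "Pow ?N - faces ?N D ?U \<subseteq> F"
  proof
   fix S assume S: "S \<in> Pow ?N - faces ?N D ?U"
   then consider T where "T \<in> D" "T \<subseteq> S" | "\<not> card (S \<inter> ?U) \<le> 2" by (auto simp: faces_def)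
   then show "S \<in> F"
   proof cases
    case 1
    then show ?thesis using F(1) S by (auto simp: D_def upclosed_def)
   next
    case 2
    then obtain T where "T \<subseteq> S \<inter> ?U" "card T = 3"
     using obtain_subset_with_card_n[of 3 "S \<inter> ?U"] by (metis not_less_eq_eq numeral_2_eq_2 numeral_3_eq_3)
    then have "T \<in> F" "T \<subseteq> S" using cube by (auto simp: nsub_def)
    then show ?thesis using F(1) S by (auto simp: upclosed_def)
   qed
  qed
  moreover have "finite F" using F(1) finite_subset[of F "Pow ?N"] by (simp add: upclosed_def)
  ultimately have "Pow ?N - faces ?N D ?U = F"
   using F(2) by (intro card_subset_eq) (auto simp: P_def)
  then show ?thesis using tD stD F(3) by blast
 qed
 obtain D where D: "has_type ?N D \<tau>" "stable ?N D" "I = fsupp (Pow ?N - faces ?N D ?U)"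
  using main[OF I] by blast
 obtain D' where D': "has_type ?N D' \<tau>" "stable ?N D'" "I' = fsupp (Pow ?N - faces ?N D' ?U)"
  using main[OF I'] by blast
 show ?thesis using stable_type_unique[OF D(1,2) D'(1,2)] D(3) D'(3) by simp
qed

subsection \<open>Generic initial ideals\<close>

lemma poly_fun_sum: "(\<And>i. i \<in> I ==> f i \<in> poly_fun n) ==> (\<lambda>A. \<Sum>i\<in>I. f i A) \<in> poly_fun n"
 by (induction I rule: infinite_finite_induct) (auto intro: poly_fun.intros)

lemma poly_fun_prod: "(\<And>i. i \<in> I ==> f i \<in> poly_fun n) ==> (\<lambda>A. \<Prod>i\<in>I. f i A :: 'a :: field) \<in> poly_fun n"
 by (induction I rule: infinite_finite_induct) (auto intro: poly_fun.intros)

lemma poly_fun_colv: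
 assumes "x \<in> {1..n}"
 shows "(\<lambda>A. colv n A x j) \<in> poly_fun n"
 using assms by (cases "j \<in> {1..n}") (auto simp: colv_def intro!: poly_fun.intros)

lemma poly_fun_vmul:
 assumes "set xs \<subseteq> {1..n}"
 shows "(\<lambda>A. vmul (colv n A) xs T) \<in> poly_fun n"
 using assms
proof (induction xs arbitrary: T)
 case Nil
 show ?case by (simp add: poly_fun.const)
next
 case (Cons x xs)
 then show ?case
  by (auto simp: lv_def intro!: poly_fun_sum poly_fun.mult poly_fun.const poly_fun_colv)
qed

lemma poly_fun_vm:
 assumes "S \<subseteq> {1..n}"
 shows "(\<lambda>A. vm (colv n A) S T) \<in> poly_fun n"
 unfolding vm_def by (rule poly_fun_vmul) (use assms finite_subset[OF assms] in simp)

lemma poly_fun_det: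
 assumes "\<And>i j. i < d ==> j < d ==> f i j \<in> poly_fun n"
 shows "(\<lambda>A. det (mat d d (\<lambda>(i, j). f i j A))) \<in> poly_fun n"
proof -
 have "det (mat d d (\<lambda>(i, j). f i j A)) =
  (\<Sum>p\<in>{p. p permutes {0..<d}}. signof p * (\<Prod>i\<in>{0..<d}. f i (p i) A))" for A
 proof -
  have "mat d d (\<lambda>(i, j). f i j A) $$ (i, p i) = f i (p i) A"
   if "p permutes {0..<d}" "i \<in> {0..<d}" for p i
  proof -
   have "p i \<in> {0..<d}" using that permutes_in_image[OF that(1)] by simp
   then show ?thesis using that(2) by simp
  qed
  then show ?thesis by (auto simp: det_def intro!: sum.cong prod.cong)
 qed
 moreover have "(\<lambda>A. \<Sum>p\<in>{p. p permutes {0..<d}}. signof p * (\<Prod>i\<in>{0..<d}. f i (p i) A)) \<in> poly_fun n"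
 proof (intro poly_fun_sum poly_fun.mult poly_fun.const poly_fun_prod)
  fix p i assume "p \<in> {p. p permutes {0..<d}}" "i \<in> {0..<d}"
  then show "f i (p i) \<in> poly_fun n" using permutes_in_image[of p "{0..<d}" i] by (intro assms) auto
 qed
 ultimately show ?thesis by presburger
qed

text \<open>The line through \<open>A\<close> at \<open>0\<close> and \<open>B\<close> at
  \<open>1\<close>. Along it polynomial functions become univariate, which reduces questions on
  Zariski open sets to counting roots.\<close>

definition matline :: "nat => 'k::field mat => 'k mat => 'k => 'k mat" where
 "matline n A B t = mat n n (\<lambda>(i, j). A $$ (i, j) + t * (B $$ (i, j) - A $$ (i, j)))"

lemma matline_ends: "A \<in> carrier_mat n n ==> matline n A B 0 = A" "B \<in> carrier_mat n n ==> matline n A B 1 = B"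
 by (auto simp: matline_def)

lemma poly_fun_matline:
 assumes "f \<in> poly_fun n"
 shows "\<exists>p. \<forall>t. f (matline n A B t) = poly p t"
 using assms
proof (induction rule: poly_fun.induct)
 case (const c)
 show ?case by (rule exI[of _ "[:c:]"]) simp
next
 case (entry i j)
 then show ?case
  by (intro exI[of _ "[:A $$ (i, j), B $$ (i, j) - A $$ (i, j):]"]) (simp add: matline_def)
next
 case (add f g)
 then obtain p q where "\<forall>t. f (matline n A B t) = poly p t" "\<forall>t. g (matline n A B t) = poly q t" by blast
 then show ?case by (intro exI[of _ "p + q"]) simp
next
 case (mult f g)
 then obtain p q where "\<forall>t. f (matline n A B t) = poly p t" "\<forall>t. g (matline n A B t) = poly q t" by blast
 then show ?case by (intro exI[of _ "p * q"]) simp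
qed

lemma GL_det: "A \<in> GL n \<longleftrightarrow> A \<in> carrier_mat n n \<and> det A ~= 0"
proof
 assume A: "A \<in> GL n"
 then have c: "A \<in> carrier_mat n n" by (simp add: GL_def)
 obtain B where B: "A * B = 1\<^sub>m n" "B * A = 1\<^sub>m (dim_row B)"
  using A by (auto simp: GL_def invertible_mat_def inverts_mat_def)
 have "dim_col (A * B) = n" using B(1) by simp
 moreover have "dim_col (B * A) = dim_row B" using B(2) by simp
 ultimately have Bc: "B \<in> carrier_mat n n" using c by auto
 have "det A * det B = 1" using det_mult[OF c Bc] B(1) by simp
 then show "A \<in> carrier_mat n n \<and> det A ~= 0" using c by auto
next
 assume A: "A \<in> carrier_mat n n \<and> det A ~= 0"
 then have "A \<in> Units (ring_mat TYPE('a) n ())" by (intro det_non_zero_imp_unit) auto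
 then obtain B where "B \<in> carrier_mat n n" "A * B = 1\<^sub>m n" "B * A = 1\<^sub>m n"
  by (auto simp: Units_def ring_mat_def)
 then show "A \<in> GL n" using A by (auto simp: GL_def invertible_mat_def inverts_mat_def)
qed

lemma det_matline: "\<exists>p. \<forall>t. det (matline n A B t) = poly p t"
proof -
 have "(\<lambda>M. det (mat n n (\<lambda>(i, j). M $$ (i, j)))) \<in> poly_fun n"
  by (rule poly_fun_det) (rule poly_fun.entry)
 from poly_fun_matline[OF this] obtain p where
  "\<And>t. det (mat n n (\<lambda>(i, j). matline n A B t $$ (i, j))) = poly p t" by blast
 moreover have "mat n n (\<lambda>(i, j). matline n A B t $$ (i, j)) = matline n A B t" for t
  by (rule eq_matI) (auto simp: matline_def)
 ultimately show ?thesis by metis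
qed

lemma nonroot:
 fixes p :: "'k::field poly"
 assumes "infinite (UNIV :: 'k set)" "p ~= 0"
 obtains t where "poly p t ~= 0"
proof -
 have "finite {t. poly p t = 0}" using assms(2) by (rule poly_roots_finite)
 then have "{t. poly p t = 0} ~= UNIV" using assms(1) by metis
 then show thesis using that by auto
qed

text \<open>Restricted to the line, \<open>f\<close>, \<open>g\<close> and the determinant are
  nonzero polynomials, as their values at the ends show. Over an infinite field their product has a
  nonroot.\<close>

lemma GL_meet:
 fixes A B :: "'k::field mat"
 assumes "infinite (UNIV :: 'k set)" "A \<in> GL n" "B \<in> GL n" "f \<in> poly_fun n" "g \<in> poly_fun n"
  "f A ~= 0" "g B ~= 0"
 obtains C where "C \<in> GL n" "f C ~= 0" "g C ~= 0"
proof -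
 have c: "A \<in> carrier_mat n n" "B \<in> carrier_mat n n" "det A ~= 0" using assms by (auto simp: GL_det)
 obtain p q r where pqr: "\<And>t. f (matline n A B t) = poly p t" "\<And>t. g (matline n A B t) = poly q t"
  "\<And>t. det (matline n A B t) = poly r t"
  using poly_fun_matline[OF assms(4)] poly_fun_matline[OF assms(5)] det_matline by metis
 have "poly p 0 ~= 0" "poly q 1 ~= 0" "poly r 0 ~= 0"
  using pqr(1)[of 0] pqr(2)[of 1] pqr(3)[of 0] c assms(6,7) by (auto simp: matline_ends)
 then have "p * q * r ~= 0" by auto
 then obtain t where "poly (p * q * r) t ~= 0" using nonroot[OF assms(1)] by blast
 then have "f (matline n A B t) ~= 0" "g (matline n A B t) ~= 0" "det (matline n A B t) ~= 0"
  by (auto simp: pqr)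
 moreover have "matline n A B t \<in> carrier_mat n n" by (simp add: matline_def)
 ultimately show thesis using that by (auto simp: GL_det)
qed

text \<open>A kernel vector \<open>u\<close> of the minor is a linear relation valid on the whole
  span. Tested on an element that leads with the column of least rank in the support of
  \<open>u\<close>, it reduces to a single nonzero summand.\<close>

lemma leads_minor_nonzero:
 fixes b :: "nat => 'i => 'k::field"
 assumes t: "inj_on t {..<d}" "t ` {..<d} = leads rk (fvs.span (b ` {..<d}))" "inj_on rk (t ` {..<d})"
 shows "det (mat d d (\<lambda>(i, j). b i (t j))) ~= 0"
proof
 let ?D = "mat d d (\<lambda>(i, j). b i (t j))"
 assume "det ?D = 0"
 then obtain u where u: "u \<in> carrier_vec d" "u ~= 0\<^sub>v d" "?D *\<^sub>v u = 0\<^sub>v d"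
  using det_0_iff_vec_prod_zero[of ?D d] by auto
 have 0: "(\<Sum>j<d. b i (t j) * u $ j) = 0" if "i < d" for i
 proof -
  have "(?D *\<^sub>v u) $ i = (\<Sum>j<d. b i (t j) * u $ j)"
   using that u(1) by (auto simp: scalar_prod_def lessThan_atLeast0 intro!: sum.cong)
  then show ?thesis using u(3) that by simp
 qed
 have "fvs.span (b ` {..<d}) \<subseteq> {x. (\<Sum>j<d. x (t j) * u $ j) = 0}"
 proof (rule fvs.span_minimal)
  show "b ` {..<d} \<subseteq> {x. (\<Sum>j<d. x (t j) * u $ j) = 0}" using 0 by auto
  have "(\<Sum>j<d. (c * x (t j)) * u $ j) = c * (\<Sum>j<d. x (t j) * u $ j)" for c x
   by (simp add: sum_distrib_left mult.assoc)
  then show "fvs.subspace {x. (\<Sum>j<d. x (t j) * u $ j) = 0}"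
   by (auto simp: fvs.subspace_def fun_apply distrib_right sum.distrib)
 qed
 moreover have "\<exists>j. j < d \<and> u $ j ~= 0"
 proof (rule ccontr)
  assume "\<not> (\<exists>j. j < d \<and> u $ j ~= 0)"
  then have "u = 0\<^sub>v d" using u(1) by (intro eq_vecI) auto
  then show False using u(2) by simp
 qed
 then obtain j where j: "j < d" "u $ j ~= 0" "\<And>l. l < d ==> u $ l ~= 0 ==> rk (t j) \<le> rk (t l)"
  using ex_has_least_nat[of "\<lambda>j. j < d \<and> u $ j ~= 0" _ "\<lambda>j. rk (t j)"] by blast
 have "t j \<in> leads rk (fvs.span (b ` {..<d}))" using j(1) t(2) by blast
 then obtain x where x: "x \<in> fvs.span (b ` {..<d})" "ld rk x (t j)" by (auto simp: leads_def)
 ultimately have "(\<Sum>l<d. x (t l) * u $ l) = 0" by blast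
 moreover have "(\<Sum>l<d. x (t l) * u $ l) = (\<Sum>l\<in>{j}. x (t l) * u $ l)"
 proof (rule sum.mono_neutral_right)
  show "\<forall>l\<in>{..<d} - {j}. x (t l) * u $ l = 0"
  proof (rule ballI, rule ccontr)
   fix l assume l: "l \<in> {..<d} - {j}" "x (t l) * u $ l ~= 0"
   then have "rk (t l) \<le> rk (t j)" "rk (t j) \<le> rk (t l)" using x(2) j(3)[of l] by (auto simp: ld_def)
   then have "t l = t j" using t(3) l(1) j(1) by (intro inj_onD[OF t(3)]) auto
   then show False using l(1) j(1) t(1) by (auto simp: inj_on_def)
  qed
 qed (use j in auto)
 ultimately show False using x(2) j(2) by (simp add: ld_def)
qed

lemma dual_independent:
 fixes z :: "'j => 'i => 'k::field"
 assumes "finite J" "\<And>j l. j \<in> J ==> l \<in> J ==> z j (t l) = (if j = l then 1 else 0)"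
 shows "fvs.independent (z ` J) \<and> inj_on z J"
 using assms
proof (induction J rule: finite_induct)
 case empty
 show ?case using fvs.independent_empty by auto
next
 case (insert j J)
 have ih: "fvs.independent (z ` J)" "inj_on z J" using insert by auto
 have "fvs.span (z ` J) \<subseteq> {x. x (t j) = 0}"
  by (rule fvs.span_minimal) (use insert in \<open>auto simp: fvs.subspace_def fun_apply\<close>)
 moreover have "z j (t j) = 1" using insert.prems by simp
 ultimately have n: "z j \<notin> fvs.span (z ` J)" by auto
 then have "z j \<notin> z ` J" using fvs.span_base by blast
 then show ?case using fvs.independent_insertI[OF n ih(1)] ih(2) insert.hyps by auto
qed

text \<open>Inverting the minor yields elements \<open>z j\<close> of the span dual to the columns.
  Every nonzero combination of those with column rank at least \<theta> has a nonzero coordinate of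
  such rank, hence also leads there.\<close>

lemma card_leads_ge_minor:
 fixes b :: "nat => 'i => 'k::field"
 assumes X: "finite X" "inj_on rk X" "b ` {..<d} \<subseteq> fsupp X"
  and det: "det (mat d d (\<lambda>(i, j). b i (t j))) ~= 0"
 shows "card {j \<in> {..<d}. \<theta> \<le> rk (t j)} \<le> card {S \<in> leads rk (fvs.span (b ` {..<d})). \<theta> \<le> rk S}"
proof -
 let ?D = "mat d d (\<lambda>(i, j). b i (t j))"
 let ?W = "fvs.span (b ` {..<d})"
 have "?D \<in> GL d" using det by (simp add: GL_det)
 then obtain Z where Z: "?D * Z = 1\<^sub>m d" "Z * ?D = 1\<^sub>m (dim_row Z)"
  by (auto simp: GL_def invertible_mat_def inverts_mat_def)
 have "dim_col (?D * Z) = d" using Z(1) by simp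
 moreover have "dim_col (Z * ?D) = dim_row Z" using Z(2) by simp
 ultimately have Zc: "Z \<in> carrier_mat d d" by auto
 define z where "z j = (\<Sum>i<d. fscale (Z $$ (j, i)) (b i))" for j
 have zW: "z j \<in> ?W" for j
  unfolding z_def by (intro fvs.span_sum fvs.span_scale fvs.span_base) auto
 have zt: "z j (t l) = (if j = l then 1 else 0)" if "j < d" "l < d" for j l
 proof -
  have "z j (t l) = (\<Sum>i\<in>{0..<d}. Z $$ (j, i) * b i (t l))"
   by (simp add: z_def sum_fun_apply fscale_apply lessThan_atLeast0)
  also have "\<dots> = (Z * ?D) $$ (j, l)" using Zc that by (simp add: scalar_prod_def)
  also have "\<dots> = (if j = l then 1 else 0)" using Z(2) Zc that by simp
  finally show ?thesis .
 qed
 define J where "J = {j \<in> {..<d}. \<theta> \<le> rk (t j)}"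
 let ?V = "fvs.span (z ` J)"
 have ind: "fvs.independent (z ` J) \<and> inj_on z J"
  by (rule dual_independent[where t = t]) (auto simp: J_def zt)
 have VW: "?V \<subseteq> ?W" by (rule fvs.span_minimal) (use zW in auto)
 have VX: "?V \<subseteq> fsupp X" using VW span_fsupp[OF X(3)] by blast
 have "card (z ` J) \<le> card (leads rk ?V)"
  by (rule card_le_leads[OF X(1,2) VX]) (use ind in \<open>auto intro: fvs.span_base\<close>)
 then have "card J \<le> card (leads rk ?V)" using ind by (simp add: card_image)
 also have "\<dots> \<le> card {S \<in> leads rk ?W. \<theta> \<le> rk S}"
 proof (rule card_mono)
  have "leads rk ?W \<subseteq> X" by (rule leads_subset[OF span_fsupp[OF X(3)]])
  then show "finite {S \<in> leads rk ?W. \<theta> \<le> rk S}" using X(1) finite_subset by fastforce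
  have expand: "?V \<subseteq> {x. x = (\<Sum>j\<in>J. fscale (x (t j)) (z j))}"
  proof (rule fvs.span_minimal)
   have "z l = (\<Sum>j\<in>J. fscale (z l (t j)) (z j))" if l: "l \<in> J" for l
   proof -
    have "(\<Sum>j\<in>J. fscale (z l (t j)) (z j)) = (\<Sum>j\<in>J. if j = l then z j else 0)"
     using l by (intro sum.cong) (auto simp: J_def zt fvs.scale_one fvs.scale_zero_left)
    then show ?thesis using l by (simp add: J_def)
   qed
   then show "z ` J \<subseteq> {x. x = (\<Sum>j\<in>J. fscale (x (t j)) (z j))}" by blast
   have 1: "(\<Sum>j\<in>J. fscale ((x + y) (t j)) (z j)) =
    (\<Sum>j\<in>J. fscale (x (t j)) (z j)) + (\<Sum>j\<in>J. fscale (y (t j)) (z j))" for x y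
    by (simp add: plus_fun_apply fvs.scale_left_distrib sum.distrib)
   have 2: "(\<Sum>j\<in>J. fscale (fscale c x (t j)) (z j)) = fscale c (\<Sum>j\<in>J. fscale (x (t j)) (z j))" for c x
    by (simp add: fscale_apply fvs.scale_sum_right fvs.scale_scale)
   show "fvs.subspace {x. x = (\<Sum>j\<in>J. fscale (x (t j)) (z j))}"
    unfolding fvs.subspace_def mem_Collect_eq 1 2
    by (auto simp: zero_fun_apply fvs.scale_zero_left)
  qed
  show "leads rk ?V \<subseteq> {S \<in> leads rk ?W. \<theta> \<le> rk S}"
  proof
   fix S assume "S \<in> leads rk ?V"
   then obtain x where x: "x \<in> ?V" "ld rk x S" by (auto simp: leads_def)
   have "\<exists>j\<in>J. x (t j) ~= 0"
   proof (rule ccontr)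
    assume "\<not> (\<exists>j\<in>J. x (t j) ~= 0)"
    then have "(\<Sum>j\<in>J. fscale (x (t j)) (z j)) = 0" by (intro sum.neutral) (simp add: fvs.scale_zero_left)
    then have "x = 0" using expand x(1) by auto
    then show False using x(2) by (simp add: ld_def zero_fun_apply)
   qed
   then obtain j where "j \<in> J" "x (t j) ~= 0" by blast
   then have "\<theta> \<le> rk S" using x(2) by (auto simp: J_def ld_def intro: le_trans)
   then show "S \<in> {S \<in> leads rk ?W. \<theta> \<le> rk S}" using x VW by (auto intro: leadsI)
  qed
 qed
 finally show ?thesis by (simp add: J_def)
qed

definition above :: "('i => nat) => nat => 'i set => nat" where
 "above rk \<theta> L = card {S \<in> L. \<theta> \<le> rk S}"

text \<open>The counts at the thresholds \<open>rk T\<close> and \<open>Suc (rk T)\<close> differ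
  exactly by the membership of \<open>T\<close>.\<close>

lemma above_determines:
 assumes "finite L" "finite L'" "inj_on rk (L \<union> L')"
  "\<And>T. T \<in> L \<union> L' ==> above rk (rk T) L = above rk (rk T) L'"
  "\<And>T. T \<in> L \<union> L' ==> above rk (Suc (rk T)) L = above rk (Suc (rk T)) L'"
 shows "L = L'"
proof -
 have split: "above rk (rk T) K = above rk (Suc (rk T)) K + card (K \<inter> {T})"
  if "finite K" "K \<subseteq> L \<union> L'" "T \<in> L \<union> L'" for K T
 proof -
  have "{S \<in> K. rk T \<le> rk S} = {S \<in> K. Suc (rk T) \<le> rk S} \<union> (K \<inter> {T})"
   using assms(3) that by (auto simp: inj_on_def Suc_le_eq le_less)
  moreover have "{S \<in> K. Suc (rk T) \<le> rk S} \<inter> (K \<inter> {T}) = {}" by auto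
  ultimately show ?thesis unfolding above_def using that(1) by (simp add: card_Un_disjoint)
 qed
 have c: "card (L \<inter> {T}) = card (L' \<inter> {T})" if "T \<in> L \<union> L'" for T
  using split[OF assms(1) _ that] split[OF assms(2) _ that] assms(4,5)[OF that] by simp
 have k: "card (K \<inter> {T}) = (if T \<in> K then 1 else 0)" for K and T :: 'a by auto
 have "T \<in> L \<longleftrightarrow> T \<in> L'" if T: "T \<in> L \<union> L'" for T
  using c[OF T] unfolding k by (auto split: if_splits)
 then show ?thesis by blast
qed

text \<open>\<open>L\<close> is attained on the basic open set of \<open>f\<close> and bounds the
  counts above every threshold in all coordinate systems. The second property is what later yields
  inequalities from special coordinates.\<close>

definition is_generic :: "nat => (nat set => nat) => nat set set => nat set set => 'k::field mat => ('k mat => 'k) => bool" where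
 "is_generic n rk F L A0 f \<longleftrightarrow> A0 \<in> GL n \<and> f \<in> poly_fun n \<and> f A0 ~= 0 \<and>
   (\<forall>A\<in>GL n. f A ~= 0 --> inif rk (colv n A) F = L) \<and>
   (\<forall>A\<in>GL n. \<forall>\<theta>. above rk \<theta> (inif rk (colv n (A :: 'k mat)) F) \<le> above rk \<theta> L)"

text \<open>\<open>f\<close> is the minor with rows from \<open>F\<close> and columns the leading
  terms at \<open>A0\<close>. Wherever it is nonzero, no count above a threshold can be smaller than
  at \<open>A0\<close>.\<close>

lemma minor_open:
 fixes A0 :: "'k::field mat"
 assumes mr: "mono_rank {1..n} rk" and F: "F \<subseteq> Pow {1..n}" and A0: "A0 \<in> GL n"
 obtains f where "f \<in> poly_fun n" "f A0 ~= 0"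
  "\<And>A \<theta>. A \<in> GL n ==> f A ~= 0 ==> above rk \<theta> (inif rk (colv n A0) F) \<le> above rk \<theta> (inif rk (colv n A) F)"
proof -
 let ?L = "inif rk (colv n A0) F"
 obtain w where b: "dual_bases {1..n} {1..n} (colv n A0) w" using GL_dual_bases[OF A0] .
 have fin: "finite F" "finite ?L" using F inif_subset[OF b F] finite_subset by (metis finite_Pow_iff finite_atLeastAtMost)+
 define d where "d = card F"
 have dL: "card ?L = d" using card_inif[OF b mr F] by (simp add: d_def)
 obtain s where s: "bij_betw s {..<d} F" using ex_bij_betw_nat_finite[OF fin(1)] by (auto simp: d_def lessThan_atLeast0)
 obtain t where t: "bij_betw t {..<d} ?L" using ex_bij_betw_nat_finite[OF fin(2)] dL by (auto simp: lessThan_atLeast0)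
 define f where "f A = det (mat d d (\<lambda>(i, j). vm (colv n A) (s i) (t j)))" for A :: "'k mat"
 have sF: "s i \<in> F" if "i < d" for i using s that by (auto simp: bij_betw_def)
 have im: "(\<lambda>i. vm (colv n A) (s i)) ` {..<d} = vm (colv n A) ` F" for A
  using s by (simp add: bij_betw_def image_image[symmetric])
 have inj: "inj_on rk (Pow {1..n})" using mr by (simp add: mono_rank_def)
 have "f \<in> poly_fun n"
  unfolding f_def using sF F by (intro poly_fun_det poly_fun_vm) blast
 moreover have "f A0 ~= 0"
  unfolding f_def
 proof (rule leads_minor_nonzero[where rk = rk])
  show "inj_on t {..<d}" using t by (simp add: bij_betw_def)
  show "t ` {..<d} = leads rk (fvs.span ((\<lambda>i. vm (colv n A0) (s i)) ` {..<d}))"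
   unfolding im using t by (simp add: bij_betw_def inif_def)
  show "inj_on rk (t ` {..<d})"
   using t inif_subset[OF b F] inj by (auto simp: bij_betw_def intro: inj_on_subset)
 qed
 moreover have "above rk \<theta> ?L \<le> above rk \<theta> (inif rk (colv n A) F)" if A: "A \<in> GL n" "f A ~= 0" for A \<theta>
 proof -
  obtain w' where b': "dual_bases {1..n} {1..n} (colv n A) w'" using GL_dual_bases[OF A(1)] .
  have "card {j \<in> {..<d}. \<theta> \<le> rk (t j)} \<le> above rk \<theta> (inif rk (colv n A) F)"
   using card_leads_ge_minor[OF _ inj, of "\<lambda>i. vm (colv n A) (s i)" d t \<theta>] A(2)
    vm_fsupp_Pow[OF b' F] unfolding above_def inif_def im f_def by simp
  moreover have "above rk \<theta> ?L = card {j \<in> {..<d}. \<theta> \<le> rk (t j)}"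
  proof -
   have "?L = t ` {..<d}" using t by (simp add: bij_betw_def)
   then have "{S \<in> ?L. \<theta> \<le> rk S} = t ` {j \<in> {..<d}. \<theta> \<le> rk (t j)}" by auto
   moreover have "inj_on t {j \<in> {..<d}. \<theta> \<le> rk (t j)}" using t by (auto simp: bij_betw_def intro: inj_on_subset)
   ultimately show ?thesis by (simp add: above_def card_image)
  qed
  ultimately show ?thesis by simp
 qed
 ultimately show thesis by (rule that)
qed

lemma one_in_GL: "1\<^sub>m n \<in> GL n"
 by (simp add: GL_det)

text \<open>\<open>A0\<close> maximizes the sum \<Phi> of the counts above all thresholds. On the
  open set of its minor no count drops, so maximality freezes all of them and with them the family.
  Any other matrix has an open set of its own which meets this one, and so its counts are bounded as
  well.\<close>

lemma generic_exists:
 assumes inf: "infinite (UNIV :: 'k::field set)" and mr: "mono_rank {1..n} rk" and F: "F \<subseteq> Pow {1..n}"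
 obtains L and A0 :: "'k::field mat" and f where "is_generic n rk F L A0 f"
proof -
 let ?L = "\<lambda>A :: 'k mat. inif rk (colv n A) F"
 have sub: "?L A \<subseteq> Pow {1..n}" if "A \<in> GL n" for A :: "'k mat"
  using GL_dual_bases[OF that] inif_subset[OF _ F] by metis
 \<comment> \<open>Large enough that both thresholds \<open>rk T\<close> and
   \<open>Suc (rk T)\<close> used by \<open>above_determines\<close> are below
   \<open>K\<close>.\<close>
 define K where "K = Suc (Suc (\<Sum>T\<in>Pow {1..n}. rk T))"
 have K: "Suc (rk T) < K" if "T \<in> Pow {1..n}" for T
  using member_le_sum[of T "Pow {1..n}" rk] that by (simp add: K_def less_Suc_eq_le)
 define \<Phi> where "\<Phi> A = (\<Sum>\<theta><K. above rk \<theta> (?L A))" for A :: "'k mat"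
 have bound: "above rk \<theta> (?L A) \<le> card (Pow {1..n})" if "A \<in> GL n" for A :: "'k mat" and \<theta>
  unfolding above_def using sub[OF that] by (intro card_mono) auto
 have "\<Phi> A \<le> (\<Sum>\<theta><K. card (Pow {1..n}))" if "A \<in> GL n" for A
  unfolding \<Phi>_def by (rule sum_mono) (rule bound[OF that])
 then obtain A0 :: "'k mat" where A0: "A0 \<in> GL n" "\<And>A. A \<in> GL n ==> \<Phi> A \<le> \<Phi> A0"
  using ex_has_greatest_nat[of "\<lambda>A. A \<in> GL n" "1\<^sub>m n" \<Phi> "Suc (\<Sum>\<theta><K. card (Pow {1..n}))"] one_in_GL
  by (metis le_imp_less_Suc less_imp_le)
 obtain f where f: "f \<in> poly_fun n" "f A0 ~= 0"
  "\<And>A \<theta>. A \<in> GL n ==> f A ~= 0 ==> above rk \<theta> (?L A0) \<le> above rk \<theta> (?L A)"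
  using minor_open[OF mr F A0(1)] by blast
 have same: "?L A = ?L A0" if A: "A \<in> GL n" "f A ~= 0" for A
 proof -
  have "\<forall>\<theta>\<in>{..<K}. above rk \<theta> (?L A0) = above rk \<theta> (?L A)"
  proof (rule ccontr)
   assume "\<not> ?thesis"
   then obtain \<theta> where "\<theta> \<in> {..<K}" "above rk \<theta> (?L A0) < above rk \<theta> (?L A)"
    using f(3)[OF A] by (metis le_neq_implies_less)
   then have "\<Phi> A0 < \<Phi> A" unfolding \<Phi>_def using f(3)[OF A] by (intro sum_strict_mono_ex1) auto
   then show False using A0(2)[OF A(1)] by simp
  qed
  then have eq: "above rk \<theta> (?L A) = above rk \<theta> (?L A0)" if "\<theta> < K" for \<theta> using that by simp
  show ?thesis
  proof (rule above_determines[where rk = rk])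
   have s: "?L A \<union> ?L A0 \<subseteq> Pow {1..n}" using sub[OF A(1)] sub[OF A0(1)] by blast
   show "finite (?L A)" "finite (?L A0)"
    using finite_subset[OF sub[OF A(1)]] finite_subset[OF sub[OF A0(1)]] by simp_all
   show "inj_on rk (?L A \<union> ?L A0)" 
    by (rule inj_on_subset[OF _ s]) (use mr in \<open>simp add: mono_rank_def\<close>)
   fix T assume "T \<in> ?L A \<union> ?L A0"
   then have "Suc (rk T) < K" using s K by blast
   then show "above rk (rk T) (?L A) = above rk (rk T) (?L A0)"
    "above rk (Suc (rk T)) (?L A) = above rk (Suc (rk T)) (?L A0)" using eq by simp_all
  qed
 qed
 have max: "above rk \<theta> (?L A) \<le> above rk \<theta> (?L A0)" if A: "A \<in> GL n" for A \<theta>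
 proof -
  obtain g where g: "g \<in> poly_fun n" "g A ~= 0"
   "\<And>B \<theta>. B \<in> GL n ==> g B ~= 0 ==> above rk \<theta> (?L A) \<le> above rk \<theta> (?L B)"
   using minor_open[OF mr F A] by blast
  obtain C where "C \<in> GL n" "f C ~= 0" "g C ~= 0"
   using GL_meet[OF inf A0(1) A f(1) g(1) f(2) g(2)] by blast
  then show ?thesis using g(3)[of C \<theta>] same[of C] by simp
 qed
 have "is_generic n rk F (?L A0) A0 f"
  unfolding is_generic_def using A0(1) f(1,2) same max by blast
 then show thesis by (rule that)
qed

lemma Gin_generic:
 fixes A0 :: "'k::field mat"
 assumes inf: "infinite (UNIV :: 'k set)" and \<sigma>: "term_order n \<sigma>" and F: "upclosed n F"
  and gen: "is_generic n (term_rank n \<sigma>) F L A0 f"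
 shows "Gin n \<sigma> (fsupp F :: 'k ext set) = fsupp L"
 unfolding Gin_def
proof (rule the_equality)
 have init: "initial_ideal n \<sigma> (gl_act n A ` fsupp F) = (fsupp L :: 'k ext set)" if "A \<in> GL n" "f A ~= 0" for A
  using initial_ideal_inif[OF F that(1) \<sigma>] gen that by (simp add: is_generic_def)
 have open1: "zariski_open_GL n {A \<in> GL n. \<exists>g\<in>{f}. g A ~= 0}"
  unfolding zariski_open_GL_def using gen by (intro exI[of _ "{f}"]) (simp add: is_generic_def)
 have ne: "A0 \<in> {A \<in> GL n. \<exists>g\<in>{f}. g A ~= 0}" using gen by (simp add: is_generic_def)
 show "\<exists>U. zariski_open_GL n U \<and> U ~= {} \<and> (\<forall>A\<in>U. initial_ideal n \<sigma> (gl_act n A ` fsupp F) = (fsupp L :: 'k ext set))"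
  using open1 ne init by (intro exI[of _ "{A \<in> GL n. \<exists>g\<in>{f}. g A ~= 0}"]) auto
 fix I :: "'k ext set"
 assume "\<exists>U. zariski_open_GL n U \<and> U ~= {} \<and> (\<forall>A\<in>U. initial_ideal n \<sigma> (gl_act n A ` fsupp F) = I)"
 then obtain U where U: "zariski_open_GL n U" "U ~= {}" "\<And>A. A \<in> U ==> initial_ideal n \<sigma> (gl_act n A ` fsupp F) = I"
  by blast
 then obtain H B where H: "H \<subseteq> poly_fun n" "U = {A \<in> GL n. \<exists>g\<in>H. g A ~= 0}" "B \<in> U"
  unfolding zariski_open_GL_def by blast
 then obtain g where g: "g \<in> H" "g B ~= 0" "B \<in> GL n" by blast
 obtain C where "C \<in> GL n" "f C ~= 0" "g C ~= 0"
  using GL_meet[OF inf, of A0 n B f g] gen g H(1) by (auto simp: is_generic_def)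
 then show "I = fsupp L" using U(3)[of C] init[of C] H(2) g(1) by auto
qed

text \<open>One matrix that is generic for both families, so that their generic initial ideals can
  be compared degree by degree.\<close>

lemma Gin_common:
 assumes inf: "infinite (UNIV :: 'k::field set)" and \<sigma>: "term_order n \<sigma>"
  and F: "upclosed n F" "upclosed n F'"
 obtains A :: "'k::field mat" where "A \<in> GL n"
  "Gin n \<sigma> (fsupp F :: 'k ext set) = fsupp (inif (term_rank n \<sigma>) (colv n A) F)"
  "Gin n \<sigma> (fsupp F' :: 'k ext set) = fsupp (inif (term_rank n \<sigma>) (colv n A) F')"
proof -
 note mr = mono_rank_term_rank[OF \<sigma>]
 have FP: "F \<subseteq> Pow {1..n}" "F' \<subseteq> Pow {1..n}" using F by (auto simp: upclosed_def)
 obtain L and A0 :: "'k mat" and f where g: "is_generic n (term_rank n \<sigma>) F L A0 f"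
  using generic_exists[OF inf mr FP(1)] by blast
 obtain L' and A0' :: "'k mat" and f' where g': "is_generic n (term_rank n \<sigma>) F' L' A0' f'"
  using generic_exists[OF inf mr FP(2)] by blast
 obtain C where C: "C \<in> GL n" "f C ~= 0" "f' C ~= 0"
  using GL_meet[OF inf, of A0 n A0' f f'] g g' by (auto simp: is_generic_def)
 have "inif (term_rank n \<sigma>) (colv n C) F = L" "inif (term_rank n \<sigma>) (colv n C) F' = L'"
  using g g' C by (auto simp: is_generic_def)
 then show thesis using that[OF C(1)] Gin_generic[OF inf \<sigma> F(1) g] Gin_generic[OF inf \<sigma> F(2) g'] by simp
qed

section \<open>Strong stability of generic initial ideals\<close>

lemma vmul_insort_uniform:
 "\<exists>s. s ~= 0 \<and> (\<forall>v. lv (v x) (vmul v ys) = fscale (s :: 'k::field) (vmul v (insort x ys)))"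
proof (induction ys)
 case Nil
 then show ?case by (intro exI[of _ 1]) (simp add: fvs.scale_one)
next
 case (Cons y ys)
 then obtain s :: 'k where s: "s ~= 0" "\<And>v. lv (v x) (vmul v ys) = fscale s (vmul v (insort x ys))" by blast
 have "lv (v x) (lv (v y) (vmul v ys)) = fscale (- s) (lv (v y) (vmul v (insort x ys)))" for v
  by (subst lv_anticomm) (simp add: s lv_scale_right)
 then show ?case using s(1) by (cases "x \<le> y") (auto intro: exI[of _ 1] exI[of _ "- s"] simp: fvs.scale_one)
qed

text \<open>In contrast to \<open>lv_vm_insert\<close> the scalar is chosen before \<open>v\<close>,
  so products formed from different vectors can be compared.\<close>

lemma lv_vm_uniform:
 assumes "finite S" "x \<notin> S"
 obtains s :: "'k::field" where "s ~= 0" "\<And>v. lv (v x) (vm v S) = fscale s (vm v (insert x S))"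
 using vmul_insort_uniform[of x "sorted_list_of_set S"] assms by (auto simp: vm_def)

lemma vm_unitf:
 assumes "finite T"
 shows "\<exists>c. c ~= 0 \<and> vm unitf T = fscale (c :: 'k::field) (unitf T)"
 using assms
proof (induction T rule: finite_induct)
 case empty
 show ?case by (rule exI[of _ 1]) (simp add: fvs.scale_one)
next
 case (insert x T)
 then obtain c :: 'k where c: "c ~= 0" "vm unitf T = fscale c (unitf T)" by blast
 obtain s :: 'k where s: "s ~= 0" "vm unitf (insert x T) = fscale s (lv (unitf x) (vm unitf T))"
  by (rule vm_insert[OF insert.hyps])
 have "vm unitf (insert x T) = fscale (s * c * lsgn x (insert x T)) (unitf (insert x T))"
  by (simp only: s(2) c(2) lv_scale_right lv_unitf[OF insert.hyps] fvs.scale_scale mult.assoc)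
 then show ?case using c(1) s(1) by (intro exI[of _ "s * c * lsgn x (insert x T)"]) simp
qed

text \<open>
 \<open>shear\<close> is the automorphism of the exterior algebra induced by \<open>e\<^sub>j \<mapsto> e\<^sub>j + t e\<^sub>i\<close>. Only the vanishing of
 the coefficients \<open>\<tau>\<close> matters, so their signs are never computed.
\<close>

definition shear1 :: "nat => nat => 'k::field => (nat => 'k) => nat => 'k" where
 "shear1 i j t a = a + fscale (t * a j) (unitf i)"

definition shear :: "nat => nat => (nat set => 'k::field) => 'k ext => 'k ext" where
 "shear i j \<tau> z = (\<lambda>R. z R + (if i \<in> R \<and> j \<notin> R then \<tau> (insert j (R - {i})) * z (insert j (R - {i})) else 0))"

lemma shear_add: "shear i j \<tau> (x + y) = shear i j \<tau> x + shear i j \<tau> y"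
 by (auto simp: shear_def fun_eq_iff plus_fun_apply algebra_simps)

lemma shear_scale: "shear i j \<tau> (fscale c x) = fscale c (shear i j \<tau> x)"
 by (auto simp: shear_def fun_eq_iff fscale_apply algebra_simps)

lemma shear_zero: "shear i j \<tau> 0 = 0"
 by (auto simp: shear_def fun_eq_iff zero_fun_apply)

lemma shear1_add: "shear1 i j t (x + y) = shear1 i j t x + shear1 i j t y"
 by (auto simp: shear1_def fun_eq_iff fun_apply algebra_simps)

lemma shear1_scale: "shear1 i j t (fscale c x) = fscale c (shear1 i j t x)"
 by (auto simp: shear1_def fun_eq_iff fun_apply algebra_simps)

lemma shear1_zero: "shear1 i j t 0 = 0"
 by (auto simp: shear1_def fun_eq_iff fun_apply)

lemma shear_unitf:
 assumes "i ~= j"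
 shows "shear i j \<tau> (unitf T) = unitf T +
  (if j \<in> T \<and> i \<notin> T then fscale (\<tau> T) (unitf (insert i (T - {j}))) else 0)"
proof
 fix R
 have 1: "(i \<in> R \<and> j \<notin> R \<and> insert j (R - {i}) = T) \<longleftrightarrow> (j \<in> T \<and> i \<notin> T \<and> R = insert i (T - {j}))"
  using assms by blast
 have "shear i j \<tau> (unitf T) R =
  unitf T R + (if i \<in> R \<and> j \<notin> R \<and> insert j (R - {i}) = T then \<tau> T else 0)"
  unfolding shear_def unitf_def by simp
 also have "\<dots> = (unitf T +
  (if j \<in> T \<and> i \<notin> T then fscale (\<tau> T) (unitf (insert i (T - {j}))) else 0)) R"
  unfolding 1 by (simp add: fun_apply unitf_def)
 finally show "shear i j \<tau> (unitf T) R = (unitf T +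
  (if j \<in> T \<and> i \<notin> T then fscale (\<tau> T) (unitf (insert i (T - {j}))) else 0)) R" .
qed

text \<open>\<tau> is obtained by comparing products of unit vectors with products of their images.
  If \<open>T\<close> contains \<open>j\<close> but not \<open>i\<close>, the image differs by a
  nonzero multiple of the exchanged monomial; if it contains both, the additional term repeats
  \<open>i\<close> and vanishes.\<close>

lemma shear_exists:
 assumes ij: "i ~= j" and t: "t ~= (0 :: 'k::field)"
 obtains \<tau> where "\<And>T. finite T ==> j \<in> T ==> i \<notin> T ==> \<tau> T ~= 0"
  "\<And>T. finite T ==> shear i j \<tau> (vm unitf T) = vm (\<lambda>x. shear1 i j t (unitf x)) T"
proof -
 let ?u = "\<lambda>x. shear1 i j t (unitf x)"
 have u: "?u x = unitf x" if "x ~= j" for x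
  using that by (auto simp: shear1_def unitf_def fun_eq_iff fun_apply)
 have uj: "?u j = unitf j + fscale t (unitf i)"
  by (simp add: shear1_def unitf_def[of j])
 have "\<exists>e. e ~= 0 \<and> vm ?u T = vm unitf T + fscale e (unitf (insert i (T - {j})))"
  if T: "finite T" "j \<in> T" "i \<notin> T" for T
 proof -
  let ?S = "T - {j}"
  have S: "finite ?S" "j \<notin> ?S" "i \<notin> ?S" "insert j ?S = T" using T by auto
  have vS: "vm ?u ?S = vm unitf ?S" by (rule vm_cong) (use u S in auto)
  obtain s :: 'k where s: "s ~= 0" "\<And>v. lv (v j) (vm v ?S) = fscale s (vm v T)"
   using lv_vm_uniform[OF S(1,2)] S(4) by metis
  obtain c :: 'k where c: "c ~= 0" "vm unitf ?S = fscale c (unitf ?S)" using vm_unitf[OF S(1)] by blast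
  have "fscale s (vm ?u T) = lv (?u j) (vm unitf ?S)" using s(2)[of ?u] vS by simp
  also have "\<dots> = fscale s (vm unitf T) + fscale (t * (c * lsgn i (insert i ?S))) (unitf (insert i ?S))"
   unfolding uj lv_add_left lv_scale_left s(2)
   by (simp only: c(2) lv_scale_right lv_unitf[OF S(1,3)] fvs.scale_scale)
  finally have "fscale (1 / s) (fscale s (vm ?u T)) = fscale (1 / s) (fscale s (vm unitf T) +
   fscale (t * (c * lsgn i (insert i ?S))) (unitf (insert i ?S)))" by simp
  then have "vm ?u T = vm unitf T + fscale (1 / s * (t * (c * lsgn i (insert i ?S)))) (unitf (insert i ?S))"
   using s(1) by (simp add: fvs.scale_right_distrib fvs.scale_scale fvs.scale_one)
  then show ?thesis using s(1) c(1) t by (intro exI[of _ "1 / s * (t * (c * lsgn i (insert i ?S)))"]) simp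
 qed
 then obtain e where e: "\<And>T. finite T ==> j \<in> T ==> i \<notin> T ==> e T ~= 0 \<and>
  vm ?u T = vm unitf T + fscale (e T) (unitf (insert i (T - {j})))" by metis
 obtain c :: "nat set => 'k" where c: "\<And>T. finite T ==> c T ~= 0 \<and> vm unitf T = fscale (c T) (unitf T)"
  using vm_unitf by metis
 define \<tau> where "\<tau> T = e T / c T" for T
 have "shear i j \<tau> (vm unitf T) = vm ?u T" if T: "finite T" for T
 proof -
  have sh: "shear i j \<tau> (vm unitf T) = vm unitf T +
   (if j \<in> T \<and> i \<notin> T then fscale (c T * \<tau> T) (unitf (insert i (T - {j}))) else 0)"
   using c[OF T] by (simp add: shear_scale shear_unitf[OF ij] fvs.scale_right_distrib fvs.scale_scale)
  consider "j \<in> T" "i \<notin> T" | "j \<notin> T" | "j \<in> T" "i \<in> T" by blast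
  then show ?thesis
  proof cases
   case 1
   then show ?thesis using sh e[OF T 1] c[OF T] by (simp add: \<tau>_def)
  next
   case 2
   then have "vm ?u T = vm unitf T" by (intro vm_cong T) (use u in metis)
   then show ?thesis using sh 2 by simp
  next
   case 3
   let ?S = "T - {j}"
   have S: "finite ?S" "j \<notin> ?S" "i \<in> ?S" "insert j ?S = T" using T 3 ij by auto
   have vS: "vm ?u ?S = vm unitf ?S" by (rule vm_cong) (use u S in auto)
   obtain s :: 'k where s: "s ~= 0" "\<And>v. lv (v j) (vm v ?S) = fscale s (vm v T)"
    using lv_vm_uniform[OF S(1,2)] S(4) by metis
   have "fscale s (vm ?u T) = lv (?u j) (vm unitf ?S)" using s(2)[of ?u] vS by simp
   also have "\<dots> = fscale s (vm unitf T)"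
    unfolding uj lv_add_left lv_scale_left s(2) by (simp add: lv_vm_mem[OF S(1,3)])
   finally have "vm ?u T = vm unitf T" using s(1) by simp
   then show ?thesis using sh 3 by simp
  qed
 qed
 moreover have "\<tau> T ~= 0" if "finite T" "j \<in> T" "i \<notin> T" for T
  using e[OF that] c[OF that(1)] by (simp add: \<tau>_def)
 ultimately show thesis using that by blast
qed

text \<open>The known effect on products of unit vectors makes \<open>shear\<close> multiplicative
  for unit vectors, and bilinearity extends this to all vectors supported on
  \<open>N\<close>.\<close>

lemma shear_vm:
 assumes sh: "\<And>T. finite T ==> shear i j \<tau> (vm unitf T) = vm (\<lambda>x. shear1 i j t (unitf x)) T"
  and N: "finite N" and v: "\<And>x. x \<in> S ==> v x \<in> fsupp N" and S: "finite S"
 shows "shear i j \<tau> (vm v S) = vm (\<lambda>x. shear1 i j t (v x)) (S :: nat set)"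
proof -
 let ?u = "\<lambda>x. shear1 i j t (unitf x)"
 have unit: "shear i j \<tau> (lv (unitf x) (vm unitf T)) = lv (?u x) (shear i j \<tau> (vm unitf T))" if T: "finite T" for x T
 proof (cases "x \<in> T")
  case True
  then show ?thesis using lv_vm_mem[OF T True, of "unitf :: nat => nat => 'a"] lv_vm_mem[OF T True, of ?u] T
   by (simp add: sh shear_zero)
 next
  case False
  obtain s :: 'a where s: "\<And>v. lv (v x) (vm v T) = fscale s (vm v (insert x T))"
   using lv_vm_uniform[OF T False] by blast
  show ?thesis using s[of unitf] s[of ?u] T by (simp add: shear_scale sh)
 qed
 have lin: "shear i j \<tau> (lv a z) = lv (shear1 i j t a) (shear i j \<tau> z)"
  if a: "a \<in> fvs.span (unitf ` N)" and z: "z \<in> fvs.span (vm unitf ` Pow N)" for a z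
 proof -
  have 1: "shear i j \<tau> (lv (unitf x) z) = lv (?u x) (shear i j \<tau> z)" for x
   using z
  proof (induction z rule: fvs.span_induct_alt)
   case base
   show ?case by (simp add: lv_zero_right shear_zero)
  next
   case (step c z y)
   then obtain T where "z = vm unitf T" "finite T" using N finite_subset by blast
   then show ?case using step unit[of T x] by (simp add: lv_add_right lv_scale_right shear_add shear_scale)
  qed
  show ?thesis using a
  proof (induction a rule: fvs.span_induct_alt)
   case base
   show ?case by (simp add: lv_zero_left shear_zero shear1_zero)
  next
   case (step c a y)
   then show ?case using 1 by (auto simp: lv_add_left lv_scale_left shear_add shear_scale shear1_add shear1_scale)
  qed
 qed
 show ?thesis using S v
 proof (induction S rule: finite_induct)
  case empty
  show ?case using sh[of "{}"] by simp
 next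
  case (insert x S)
  obtain s :: 'a where s: "s ~= 0" "\<And>v. lv (v x) (vm v S) = fscale s (vm v (insert x S))"
   using lv_vm_uniform[OF insert.hyps] by blast
  have a: "v x \<in> fvs.span (unitf ` N)" using insert.prems[of x] fsupp_eq_span[OF N] by auto
  have "vm v S \<in> fsupp (nsub (card S) N)" by (rule vm_fsupp) (use insert N in auto)
  then have "vm v S \<in> fsupp (Pow N)" by (auto simp: fsupp_def nsub_def)
  moreover have "fsupp (Pow N) = fvs.span (unitf ` Pow N :: 'a ext set)"
   by (rule fsupp_eq_span) (use N in simp)
  ultimately have vP: "vm v S \<in> fvs.span (unitf ` Pow N)" by simp
  have "(unitf ` Pow N :: 'a ext set) \<subseteq> fvs.span (vm unitf ` Pow N)"
  proof clarify
   fix T assume T: "T \<subseteq> N"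
   obtain c where c: "c ~= 0" "vm unitf T = fscale c (unitf T :: 'a ext)"
    using vm_unitf[of T] T N finite_subset by blast
   have "fscale (1 / c) (vm unitf T) \<in> fvs.span (vm unitf ` Pow N)"
    using T by (intro fvs.span_scale fvs.span_base) auto
   then show "(unitf T :: 'a ext) \<in> fvs.span (vm unitf ` Pow N)" using c by (simp add: fvs.scale_scale fvs.scale_one)
  qed
  then have "fvs.span (unitf ` Pow N) \<subseteq> fvs.span (vm unitf ` Pow N :: 'a ext set)"
   by (rule fvs.span_minimal) simp
  then have z: "vm v S \<in> fvs.span (vm unitf ` Pow N)" using vP by blast
  have "fscale s (shear i j \<tau> (vm v (insert x S))) = shear i j \<tau> (lv (v x) (vm v S))"
   by (simp add: s(2) shear_scale)
  also have "\<dots> = lv (shear1 i j t (v x)) (vm (\<lambda>x. shear1 i j t (v x)) S)"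
   using lin[OF a z] insert by simp
  also have "\<dots> = fscale s (vm (\<lambda>x. shear1 i j t (v x)) (insert x S))"
   using s(2)[of "\<lambda>x. shear1 i j t (v x)"] by simp
  finally show ?case using s(1) by simp
 qed
qed

text \<open>Following \<open>A0\<close> by the shear with a suitable \<open>t ~= 0\<close> gives
  again a generic matrix, hence the same family \<open>L\<close>. The shear of an element leading
  with \<open>S\<close> leads with the exchanged set. As monomials are squarefree, its coefficient
  there is a single nonzero product in every characteristic.\<close>

lemma generic_stable:
 assumes inf: "infinite (UNIV :: 'k::field set)" and mr: "mono_rank {1..n} rk" and F: "F \<subseteq> Pow {1..n}"
  and std: "\<And>i j. i \<in> {1..n} ==> j \<in> {1..n} ==> i < j ==> rk {j} < rk {i}"
  and gen: "is_generic n rk F L (A0 :: 'k mat) f"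
 shows "stable {1..n} L"
 unfolding stable_def
proof (intro ballI impI)
 fix S j i assume h: "S \<in> L" "j \<in> S" "i \<in> {1..n} - S" "i < j"
 have A0: "A0 \<in> carrier_mat n n" "det A0 ~= 0" "A0 \<in> GL n" "f \<in> poly_fun n" "f A0 ~= 0"
  using gen by (auto simp: is_generic_def GL_det)
 let ?v = "colv n A0"
 obtain w where b: "dual_bases {1..n} {1..n} ?v w" using GL_dual_bases[OF A0(3)] .
 have L: "L = inif rk ?v F" using gen A0 by (simp add: is_generic_def)
 have SN: "S \<subseteq> {1..n}" using h(1) L inif_subset[OF b F] by blast
 have ij: "i \<in> {1..n}" "j \<in> {1..n}" "i ~= j" using h SN by auto
 let ?B = "mat n n (\<lambda>(p, q). A0 $$ (p, q) + (if p = i - 1 then A0 $$ (j - 1, q) else 0))"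
 let ?A = "matline n A0 ?B"
 obtain p where p: "\<And>t. f (?A t) = poly p t" using poly_fun_matline[OF A0(4), of A0 ?B] by blast
 obtain r where r: "\<And>t. det (?A t) = poly r t" using det_matline[of n A0 ?B] by blast
 have "poly p 0 ~= 0" "poly r 0 ~= 0" using p[of 0] r[of 0] A0 by (auto simp: matline_ends)
 \<comment> \<open>The factor \<open>[:0, 1:]\<close> makes the nonroot different from zero, so that
   the shear is not the identity.\<close>
 then have "p * r * [:0, 1:] ~= 0" by auto
 then obtain t where t0: "poly (p * r * [:0, 1:]) t ~= 0" using nonroot[OF inf] by blast
 then have t: "t ~= 0" "f (?A t) ~= 0" "det (?A t) ~= 0" by (auto simp: p r)
 have GLt: "?A t \<in> GL n" using t(3) by (simp add: GL_det matline_def)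
 have Lt: "L = inif rk (colv n (?A t)) F" using gen GLt t(2) by (simp add: is_generic_def)
 have col: "colv n (?A t) x = shear1 i j t (?v x)" if x: "x \<in> {1..n}" for x
 proof
  fix k
  show "colv n (?A t) x k = shear1 i j t (?v x) k"
  proof (cases "k \<in> {1..n}")
   case True
   then have k: "k - 1 < n" "x - 1 < n" using x by auto
   have ki: "k - 1 = i - 1 \<longleftrightarrow> k = i" using True ij(1) by auto
   have "colv n (?A t) x k = A0 $$ (k - 1, x - 1) + t * (if k = i then A0 $$ (j - 1, x - 1) else 0)"
    using True k by (simp add: colv_def matline_def ki)
   moreover have "shear1 i j t (?v x) k = A0 $$ (k - 1, x - 1) + t * A0 $$ (j - 1, x - 1) * unitf i k"
    using True ij(2) by (simp add: colv_def shear1_def fun_apply)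
   ultimately show ?thesis by (simp add: unitf_def)
  next
   case False
   then show ?thesis using ij by (auto simp: colv_def shear1_def fun_apply unitf_def)
  qed
 qed
 obtain \<tau> where \<tau>: "\<And>T. finite T ==> j \<in> T ==> i \<notin> T ==> \<tau> T ~= 0"
  "\<And>T. finite T ==> shear i j \<tau> (vm unitf T) = vm (\<lambda>x. shear1 i j t (unitf x)) T"
  using shear_exists[OF ij(3) t(1)] by blast
 have shv: "shear i j \<tau> (vm ?v T) = vm (colv n (?A t)) T" if T: "T \<in> F" for T
 proof -
  have TN: "T \<subseteq> {1..n}" using T F by blast
  then have Tfin: "finite T" using finite_subset by blast
  have "shear i j \<tau> (vm ?v T) = vm (\<lambda>x. shear1 i j t (?v x)) T"
   by (rule shear_vm[OF \<tau>(2), of "{1..n}"]) (use TN Tfin b in \<open>auto simp: dual_bases_def\<close>)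
  also have "\<dots> = vm (colv n (?A t)) T" by (rule vm_cong) (use TN Tfin col in auto)
  finally show ?thesis .
 qed
 obtain x where x: "x \<in> fvs.span (vm ?v ` F)" "ld rk x S" using h(1) L by (auto simp: inif_def leads_def)
 have "fvs.span (vm ?v ` F) \<subseteq> {x. shear i j \<tau> x \<in> fvs.span (vm (colv n (?A t)) ` F)}"
  by (rule fvs.span_minimal)
   (auto simp: shv fvs.subspace_def shear_zero shear_add shear_scale
    intro: fvs.span_base fvs.span_add fvs.span_scale fvs.span_zero)
 then have sx: "shear i j \<tau> x \<in> fvs.span (vm (colv n (?A t)) ` F)" using x(1) by blast
 have xN: "T \<subseteq> {1..n}" if "x T ~= 0" for T
  using x(1) span_fsupp[OF vm_fsupp_Pow[OF b F]] that by (auto simp: fsupp_def)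
 let ?S' = "insert i (S - {j})"
 have rkSS: "rk T < rk (insert i (T - {j}))" if "T \<subseteq> {1..n}" "j \<in> T" "i \<notin> T" for T
  using mono_rank_insert_less[OF mr, of "T - {j}" j i] that ij std[OF ij(1,2) h(4)]
  by (auto simp: insert_absorb)
 have "ld rk (shear i j \<tau> x) ?S'"
  unfolding ld_def
 proof (intro conjI allI impI)
  have "rk S < rk ?S'" using rkSS[OF SN h(2)] h(3) by simp
  then have "x ?S' = 0" using x(2) unfolding ld_def by (metis not_le)
  moreover have "insert j (?S' - {i}) = S" using h by auto
  ultimately have "shear i j \<tau> x ?S' = \<tau> S * x S" using h ij(3) by (simp add: shear_def)
  then show "shear i j \<tau> x ?S' ~= 0"
   using \<tau>(1)[of S] h x(2) SN finite_subset[of S "{1..n}"] by (simp add: ld_def)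
  fix R assume R: "shear i j \<tau> x R ~= 0"
  show "rk R \<le> rk ?S'"
  proof (cases "x R ~= 0")
   case True
   then have "rk R \<le> rk S" using x(2) by (simp add: ld_def)
   then show ?thesis using \<open>rk S < rk ?S'\<close> by simp
  next
   case False
   then have R2: "i \<in> R" "j \<notin> R" "x (insert j (R - {i})) ~= 0"
    using R by (auto simp: shear_def split: if_splits)
   let ?T = "R - {i}"
   have "rk (insert j ?T) \<le> rk S" using R2 x(2) by (simp add: ld_def)
   moreover have TN: "insert j ?T \<subseteq> {1..n}" using xN[OF R2(3)] .
   ultimately have le: "rk ({j} \<union> ?T) \<le> rk S" by simp
   show ?thesis
   proof (rule ccontr)
    assume "\<not> rk R \<le> rk ?S'"
    then have "rk (insert i (S - {j})) < rk (insert i ?T)" using R2(1) by (simp add: insert_absorb)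
    then have "\<not> rk ?T \<le> rk (S - {j})"
     using mono_rank_insert2_le[OF mr, of ?T "S - {j}" i] TN SN ij h by auto
    then have "rk (S - {j} \<union> {j}) < rk (?T \<union> {j})"
     using TN SN ij R2 by (intro mono_rank_less[OF mr]) auto
    moreover have "S - {j} \<union> {j} = S" using h(2) by auto
    ultimately show False using le by (simp add: insert_commute)
   qed
  qed
 qed
 then show "?S' \<in> L" unfolding Lt inif_def using sx by (rule leadsI[rotated])
qed

lemma Gin_in_Trans:
 assumes inf: "infinite (UNIV :: 'k::field set)" and \<sigma>: "standard_term_order n \<sigma>" and F: "upclosed n F"
 shows "Gin n \<sigma> (fsupp F :: 'k ext set) \<in> Trans n (fsupp F)"
proof -
 have to: "term_order n \<sigma>" using \<sigma> by (simp add: standard_term_order_def)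
 note mr = mono_rank_term_rank[OF to]
 have FP: "F \<subseteq> Pow {1..n}" using F by (simp add: upclosed_def)
 obtain L and A0 :: "'k mat" and f where g: "is_generic n (term_rank n \<sigma>) F L A0 f"
  using generic_exists[OF inf mr FP] by blast
 have A0: "A0 \<in> GL n" "inif (term_rank n \<sigma>) (colv n A0) F = L" using g by (auto simp: is_generic_def)
 have "stable {1..n} L"
 proof (rule generic_stable[OF inf mr FP _ g])
  fix i j assume ij: "i \<in> {1..n}" "j \<in> {1..n}" "i < j"
  then have "({j}, {i}) \<in> \<sigma>" using \<sigma> unfolding standard_term_order_def by blast
  then have "term_rank n \<sigma> {j} \<le> term_rank n \<sigma> {i}" using term_rank_le[OF to, of "{j}" "{i}"] ij by auto
  moreover have "term_rank n \<sigma> {j} ~= term_rank n \<sigma> {i}"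
   using mono_rank_inj[OF mr, of "{j}" "{i}"] ij by auto
  ultimately show "term_rank n \<sigma> {j} < term_rank n \<sigma> {i}" by simp
 qed
 moreover obtain w where b: "dual_bases {1..n} {1..n} (colv n A0) w" using GL_dual_bases[OF A0(1)] .
 have "upclosed n L" using inif_upclosed[OF b mr F] A0(2) by simp
 ultimately have "strongly_stable n (fsupp L :: 'k ext set)" by (simp add: strongly_stable_fsupp)
 moreover have "initial_ideal n \<sigma> (gl_act n A0 ` fsupp F) \<in> iterated_initials n (fsupp F)"
  by (rule iterated_initials.first[OF A0(1) to])
 then have "fsupp L \<in> iterated_initials n (fsupp F :: 'k ext set)"
  using initial_ideal_inif[OF F A0(1) to] A0(2) by simp
 ultimately show ?thesis by (simp add: Trans_def Gin_generic[OF inf to F g])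
qed

subsection \<open>Recursively built graphs\<close>

text \<open>The graphs to start from: types without parameters and without the step rules, which are
  needed only for the degenerations on the way. In the application \<open>M\<close> is the set of
  nonedges of the given graph.\<close>

inductive good :: "nat set => nat set set => bool" where
 al: "M \<subseteq> nsub 2 X ==> univ X M k ==> good (X - {k}) (del M k) ==> good X M"
| be: "isol X M h ==> good (X - {h}) M ==> good X M"
| pq: "finite A ==> finite B ==> A \<inter> B = {} ==> good (A \<union> B) (prods A B)"
| pp: "finite A ==> finite B ==> A \<inter> B = {} ==> good (A \<union> B) (nsub 2 A \<union> nsub 2 B)"

lemma good_basic: "good X M ==> finite X \<and> M \<subseteq> nsub 2 X"
proof (induction rule: good.induct)
 case (be X M h)
 then show ?case using nsub_mono[of "X - {h}" X 2] by (auto simp: isol_def)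
next
 case (pq A B)
 then show ?case by (auto simp: prods_def)
next
 case (pp A B)
 then show ?case using nsub_mono[of A "A \<union> B" 2] nsub_mono[of B "A \<union> B" 2] by auto
qed (auto simp: univ_def)

lemma del_commute: "del (del M x) k = del (del M k) x"
 by (auto simp: del_def)

lemma del_prods: "x \<notin> A \<inter> B ==> del (prods A B) x = prods (A - {x}) (B - {x})"
 by (auto simp: del_def prods_def)

lemma del_nsub: "del (nsub 2 A) x = nsub 2 (A - {x})"
 by (auto simp: del_def nsub_def)

lemma minus_swap: "X - {x} - {k} = X - {k} - {x}"
 by blast

lemma good_delete: "good X M ==> good (X - {x}) (del M x)"
proof (induction rule: good.induct)
 case (al M X k)
 show ?case
 proof (cases "x = k")
  case False
  have "univ (X - {x}) (del M x) k" using al(2) False by (auto simp: univ_def del_def)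
  moreover have "del M x \<subseteq> nsub 2 (X - {x})" by (rule del_subset[OF al(1)])
  moreover have "good (X - {x} - {k}) (del (del M x) k)"
   using al.IH del_commute[of M x k] minus_swap[of X x k] by simp
  ultimately show ?thesis using good.al by blast
 qed (use al in simp)
next
 case (be X M h)
 show ?case
 proof (cases "x = h")
  case True
  then show ?thesis using be del_isol by simp
 next
  case False
  have "isol (X - {x}) (del M x) h" using be(1) False by (auto simp: isol_def del_def)
  moreover have "good (X - {x} - {h}) (del M x)"
   using be.IH minus_swap[of X x h] by simp
  ultimately show ?thesis by (rule good.be)
 qed
next
 case (pq A B)
 have "good ((A - {x}) \<union> (B - {x})) (prods (A - {x}) (B - {x}))"
  by (rule good.pq) (use pq in auto)
 moreover have "A \<union> B - {x} = (A - {x}) \<union> (B - {x})" by auto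
 ultimately show ?case using pq(3) by (simp add: del_prods)
next
 case (pp A B)
 have "good ((A - {x}) \<union> (B - {x})) (nsub 2 (A - {x}) \<union> nsub 2 (B - {x}))"
  by (rule good.pp) (use pp in auto)
 moreover have "A \<union> B - {x} = (A - {x}) \<union> (B - {x})" by auto
 ultimately show ?case by (simp add: del_Un del_nsub)
qed

lemma good_restrict:
 assumes "good X (nsub 2 X - E)" "Y \<subseteq> X"
 shows "good Y (nsub 2 Y - E)"
proof -
 have fin: "finite X" using good_basic[OF assms(1)] by simp
 have "good (X - D) (nsub 2 (X - D) - E)" if "finite D" for D
  using that
 proof (induction D rule: finite_induct)
  case (insert x D)
  have "del (nsub 2 (X - D) - E) x = nsub 2 (X - insert x D) - E" by (auto simp: del_def nsub_def)
  moreover have "X - D - {x} = X - insert x D" by auto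
  ultimately show ?case using good_delete[OF insert.IH, of x] by simp
 qed (use assms in simp)
 from this[of "X - Y"] show ?thesis using assms(2) fin by (simp add: double_diff)
qed

text \<open>A vertex on no edge of \<open>E\<close> is universal among the nonedges, so it is added
  by the rule \<open>al\<close>.\<close>

lemma good_add_isolated:
 assumes "good Y (nsub 2 Y - E)" "finite D" "\<And>x S. x \<in> D ==> S \<in> E ==> x \<notin> S"
 shows "good (Y \<union> D) (nsub 2 (Y \<union> D) - E)"
 using assms(2,3)
proof (induction D rule: finite_induct)
 case empty
 show ?case using assms(1) by simp
next
 case (insert x D)
 then have IH: "good (Y \<union> D) (nsub 2 (Y \<union> D) - E)" by simp
 show ?case
 proof (cases "x \<in> Y")
  case True
  then have "Y \<union> insert x D = Y \<union> D" by auto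
  then show ?thesis using IH by simp
 next
  case False
  let ?X = "Y \<union> insert x D"
  have "univ ?X (nsub 2 ?X - E) x" using insert.prems[of x] by (auto simp: univ_def)
  moreover have "?X - {x} = Y \<union> D" using False insert.hyps by auto
  moreover have "del (nsub 2 ?X - E) x = nsub 2 (?X - {x}) - E" by (auto simp: del_def nsub_def)
  moreover have "nsub 2 ?X - E \<subseteq> nsub 2 ?X" by blast
  ultimately show ?thesis using IH good.al[of "nsub 2 ?X - E" ?X x] by simp
 qed
qed

subsection \<open>Forbidden induced subgraphs\<close>

definition reach :: "nat set set => nat => nat => bool" where
 "reach F x y \<longleftrightarrow> (x, y) \<in> {(a, b). a ~= b \<and> {a, b} \<in> F}\<^sup>*"

lemma reach_refl [simp]: "reach F x x"
 by (simp add: reach_def)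

lemma reach_step: "reach F x y ==> {y, z} \<in> F ==> reach F x z"
 by (cases "y = z") (auto simp: reach_def intro: rtrancl_into_rtrancl)

lemma reach_trans: "reach F x y ==> reach F y z ==> reach F x z"
 unfolding reach_def by (rule rtrancl_trans)

lemma reach_sym: "reach F x y ==> reach F y x"
proof -
 have "sym {(a, b). a ~= b \<and> {a, b} \<in> F}"
  by (rule symI) (simp add: insert_commute)
 then show "reach F x y ==> reach F y x" unfolding reach_def by (rule symD[OF sym_rtrancl])
qed

lemma reach_edge: "{x, y} \<in> F ==> reach F x y"
 using reach_step[OF reach_refl] by blast

lemma reach_induct [consumes 1, case_names base step]:
 assumes "reach F x y" "P x" "\<And>y z. reach F x y ==> y ~= z ==> {y, z} \<in> F ==> P y ==> P z"
 shows "P y"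
 using assms(1) unfolding reach_def
proof (induction rule: rtrancl_induct)
 case (step y z)
 then show ?case using assms(3)[of y z] by (auto simp: reach_def)
qed (rule assms(2))

definition conn :: "nat set => nat set set => bool" where
 "conn X F \<longleftrightarrow> (\<forall>x\<in>X. \<forall>y\<in>X. reach F x y)"

lemma reach_closed: "reach F x y ==> F \<subseteq> nsub 2 X ==> x \<in> X ==> y \<in> X"
 by (induction rule: reach_induct) auto

text \<open>For a disconnected graph without isolated vertices, this is the failure to be a disjoint
  union of two cliques: there is a third component, or some component is not complete.\<close>

definition bad :: "nat set => nat set set => bool" where
 "bad X F \<longleftrightarrow> (\<forall>x\<in>X. \<exists>y. y ~= x \<and> {x, y} \<in> F) \<and> \<not> conn X F \<and>
   ((\<exists>x\<in>X. \<exists>y\<in>X. \<exists>z\<in>X. \<not> reach F x y \<and> \<not> reach F y z \<and> \<not> reach F x z) \<or>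
   (\<exists>x\<in>X. \<exists>y. reach F x y \<and> x ~= y \<and> {x, y} \<notin> F))"

lemma disconnected_not_bad:
 assumes F: "F \<subseteq> nsub 2 X" and nc: "\<not> conn X F" and nb: "\<not> bad X F"
  and ni: "\<And>x. x \<in> X ==> \<exists>y. y ~= x \<and> {x, y} \<in> F"
 obtains A B where "A \<inter> B = {}" "X = A \<union> B" "F = nsub 2 A \<union> nsub 2 B"
proof -
 obtain x y where xy: "x \<in> X" "y \<in> X" "\<not> reach F x y" using nc by (auto simp: conn_def)
 have adj: "{a, b} \<in> F" if "a \<in> X" "reach F a b" "a ~= b" for a b
  using nb nc ni that unfolding bad_def by blast
 have three: "reach F a b \<or> reach F b c \<or> reach F a c" if "a \<in> X" "b \<in> X" "c \<in> X" for a b c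
  using nb nc ni that unfolding bad_def by blast
 define A B where "A = {z \<in> X. reach F x z}" and "B = X - A"
 have B: "reach F y z" if "z \<in> B" for z
  using three[of x y z] xy that by (auto simp: A_def B_def)
 have "F = nsub 2 A \<union> nsub 2 B"
 proof
  show "F \<subseteq> nsub 2 A \<union> nsub 2 B"
  proof
   fix S assume S: "S \<in> F"
   then obtain a b where ab: "S = {a, b}" "a \<in> X" "b \<in> X" "a ~= b" using F nsub2E by blast
   then have "{a, b} \<in> F" "{b, a} \<in> F" using S by (simp_all add: insert_commute)
   then have "reach F x a \<longleftrightarrow> reach F x b" using reach_step by metis
   then show "S \<in> nsub 2 A \<union> nsub 2 B" using ab by (auto simp: A_def B_def)
  qed
  show "nsub 2 A \<union> nsub 2 B \<subseteq> F"
  proof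
   fix S assume "S \<in> nsub 2 A \<union> nsub 2 B"
   then obtain a b where ab: "S = {a, b}" "a ~= b" "a \<in> A \<and> b \<in> A \<or> a \<in> B \<and> b \<in> B"
    by (auto elim!: nsub2E)
   have "a \<in> X" using ab(3) by (auto simp: A_def B_def)
   moreover have "reach F a b"
    using ab(3)
   proof
    assume "a \<in> A \<and> b \<in> A"
    then show ?thesis using reach_trans[OF reach_sym[of F x a], of b] by (simp add: A_def)
   next
    assume "a \<in> B \<and> b \<in> B"
    then show ?thesis using reach_trans[OF reach_sym[OF B[of a]] B[of b]] by simp
   qed
   ultimately show "S \<in> F" using adj ab by blast
  qed
 qed
 moreover have "A \<inter> B = {}" "X = A \<union> B" by (auto simp: A_def B_def)
 ultimately show thesis using that by blast
qed

text \<open>An induction principle shared by the combinatorial and the algebraic characterization,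
  with \<open>pattern_free\<close> or \<open>common_gin\<close> as \<Phi>. If no universal or
  isolated vertex is left, the graph or its complement is disconnected, and not being bad makes that
  one a union of two cliques.\<close>

lemma good_criterion:
 assumes "finite X" "M \<subseteq> nsub 2 X" "\<Phi> X M"
  and u: "\<And>X M k. finite X ==> M \<subseteq> nsub 2 X ==> \<Phi> X M ==> univ X M k ==> \<Phi> (X - {k}) (del M k)"
  and i: "\<And>X M h. finite X ==> M \<subseteq> nsub 2 X ==> \<Phi> X M ==> isol X M h ==> \<Phi> (X - {h}) M"
  and c: "\<And>X M. finite X ==> M \<subseteq> nsub 2 X ==> \<Phi> X M ==> 2 \<le> card X ==> conn X M ==>
   conn X (nsub 2 X - M) ==> False"
  and b1: "\<And>X M. finite X ==> M \<subseteq> nsub 2 X ==> \<Phi> X M ==> \<not> bad X M"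
  and b2: "\<And>X M. finite X ==> M \<subseteq> nsub 2 X ==> \<Phi> X M ==> \<not> bad X (nsub 2 X - M)"
 shows "good X M"
 using assms(1-3)
proof (induction "card X" arbitrary: X M rule: less_induct)
 case less
 have small: "card (X - {k}) < card X" if "k \<in> X" for k
  by (rule card_Diff1_less[OF less.prems(1) that])
 consider k where "univ X M k" | h where "isol X M h" | "\<nexists>k. univ X M k" "\<nexists>h. isol X M h" by blast
 then show ?case
 proof cases
  case 1
  have "good (X - {k}) (del M k)"
   by (rule less.hyps) (use 1 small less.prems u del_subset in \<open>auto simp: univ_def\<close>)
  then show ?thesis by (rule good.al[OF less.prems(2) 1])
 next
  case 2
  have "M \<subseteq> nsub 2 (X - {h})" using del_subset[OF less.prems(2), of h] del_isol[OF 2] by simp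
  then have "good (X - {h}) M"
   using less.hyps[of "X - {h}" M] 2 small[of h] less.prems i by (auto simp: isol_def)
  then show ?thesis by (rule good.be[OF 2])
 next
  case 3
  show ?thesis
  proof (cases "X = {}")
   case True
   then have "M = {}" using less.prems(2) by (auto simp: nsub_def)
   then show ?thesis using good.pq[of "{}" "{}"] True by (simp add: prods_def)
  next
   case False
   then obtain x where x: "x \<in> X" by blast
   then obtain y where y: "y \<in> X" "y ~= x" using 3(1) by (auto simp: univ_def)
   have "card {x, y} \<le> card X" using x y less.prems(1) by (intro card_mono) auto
   then have c2: "2 \<le> card X" using y by simp
   let ?M = "nsub 2 X - M"
   have ni: "\<exists>y. y ~= x \<and> {x, y} \<in> M" if x: "x \<in> X" for x
   proof -
    obtain S where "S \<in> M" "x \<in> S" using 3(2) x by (auto simp: isol_def)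
    then obtain a b where "S = {a, b}" "a ~= b" "x = a \<or> x = b" "S \<in> M"
     using less.prems(2) by (auto elim!: nsub2E)
    then show ?thesis by (metis insert_commute)
   qed
   have nu: "\<exists>y. y ~= x \<and> {x, y} \<in> ?M" if "x \<in> X" for x
    using 3(1) that by (auto simp: univ_def)
   consider "\<not> conn X M" | "\<not> conn X ?M" using c[OF less.prems c2] by blast
   then show ?thesis
   proof cases
    case 1
    obtain A B where AB: "A \<inter> B = {}" "X = A \<union> B" "M = nsub 2 A \<union> nsub 2 B"
     using disconnected_not_bad[OF less.prems(2) 1 b1[OF less.prems] ni] by blast
    then show ?thesis using good.pp[of A B] less.prems(1) by simp
   next
    case 2
    obtain A B where AB: "A \<inter> B = {}" "X = A \<union> B" "?M = nsub 2 A \<union> nsub 2 B"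
     using disconnected_not_bad[OF _ 2 b2[OF less.prems] nu] by blast
    have "M = nsub 2 X - (nsub 2 A \<union> nsub 2 B)" using less.prems(2) AB(3) by blast
    also have "\<dots> = prods A B"
    proof
     show "nsub 2 X - (nsub 2 A \<union> nsub 2 B) \<subseteq> prods A B"
     proof
      fix S assume S: "S \<in> nsub 2 X - (nsub 2 A \<union> nsub 2 B)"
      then obtain a b where "S = {a, b}" "a \<in> X" "b \<in> X" "a ~= b" by (auto elim: nsub2E)
      then show "S \<in> prods A B" using S AB(1,2) by (auto simp: prods_def insert_commute)
     qed
     show "prods A B \<subseteq> nsub 2 X - (nsub 2 A \<union> nsub 2 B)"
      using AB(1,2) by (auto simp: prods_def)
    qed
    finally show ?thesis using good.pq[of A B] AB less.prems(1) by simp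
   qed
  qed
 qed
qed

text \<open>The flag \<open>s\<close> tells whether the induced copy of \<open>H\<close> lies in
  \<open>M\<close> or in its complement, so that both requirements on a graph are handled at
  once.\<close>

definition embeds :: "bool => nat set => nat set set => nat set => nat set set => bool" where
 "embeds s V H X M \<longleftrightarrow> (\<exists>f. inj_on f V \<and> f ` V \<subseteq> X \<and>
   (\<forall>x\<in>V. \<forall>y\<in>V. x ~= y --> ({f x, f y} \<in> M) = (({x, y} \<in> H) = s)))"

definition patterns :: "(nat set \<times> nat set set) set" where
 "patterns = {({1..4}, {{1, 2}, {1, 3}, {3, 4}}), ({1..5}, {{1, 2}, {3, 4}, {3, 5}}),
   ({1..6}, {{1, 2}, {3, 4}, {5, 6}})}"

definition pattern_free :: "nat set => nat set set => bool" where
 "pattern_free X M \<longleftrightarrow> (\<forall>(V, H)\<in>patterns. \<forall>s. \<not> embeds s V H X M)"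

lemma pattern_verts: "{1..4} = {1, 2, 3, 4 :: nat}" "{1..5} = {1, 2, 3, 4, 5 :: nat}" "{1..6} = {1, 2, 3, 4, 5, 6 :: nat}"
 by auto

text \<open>Each pattern vertex has both a neighbour and a nonneighbour in the pattern; therefore no
  copy passes through a universal or an isolated vertex.\<close>

lemma pattern_nontrivial:
 assumes "(V, H) \<in> patterns" "x \<in> V"
 shows "\<exists>y\<in>V. y ~= x \<and> ({x, y} \<in> H) = s"
 using assms unfolding patterns_def
 by (cases s) (auto simp: pattern_verts doubleton_eq_iff)

text \<open>The colour is the part to which a vertex is mapped: no pattern is a union of two cliques
  (\<open>s\<close> true) or complete bipartite (\<open>s\<close> false).\<close>

lemma pattern_not_bicolored:
 assumes "(V, H) \<in> patterns"
 shows "\<not> (\<forall>x\<in>V. \<forall>y\<in>V. x ~= y --> (chi x = (chi y :: bool)) = (({x, y} \<in> H) = s))"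
 using assms unfolding patterns_def
 by (cases s) (auto simp: pattern_verts doubleton_eq_iff)

lemma good_pattern_free: "good X M ==> pattern_free X M"
proof (induction rule: good.induct)
 case (al M X k)
 show ?case
  unfolding pattern_free_def
 proof (clarify)
  fix V H s assume p: "(V, H) \<in> patterns" and "embeds s V H X M"
  then obtain f where f: "inj_on f V" "f ` V \<subseteq> X"
   "\<And>x y. x \<in> V ==> y \<in> V ==> x ~= y ==> ({f x, f y} \<in> M) = (({x, y} \<in> H) = s)"
   unfolding embeds_def by blast
  have k: "k \<notin> f ` V"
  proof
   assume "k \<in> f ` V"
   then obtain x where x: "x \<in> V" "f x = k" by blast
   obtain y where y: "y \<in> V" "y ~= x" "({x, y} \<in> H) = (\<not> s)" using pattern_nontrivial[OF p x(1)] by blast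
   have "f y ~= k" using f(1) x y by (auto simp: inj_on_def)
   then have "{f x, f y} \<in> M" using al(2) x y f(2) by (auto simp: univ_def)
   then show False using f(3)[of x y] x y by auto
  qed
  have "embeds s V H (X - {k}) (del M k)"
   unfolding embeds_def
   by (rule exI[of _ f]) (use f k in \<open>auto simp: del_def\<close>)
  then show False using al.IH p unfolding pattern_free_def by blast
 qed
next
 case (be X M h)
 show ?case
  unfolding pattern_free_def
 proof (clarify)
  fix V H s assume p: "(V, H) \<in> patterns" and "embeds s V H X M"
  then obtain f where f: "inj_on f V" "f ` V \<subseteq> X"
   "\<And>x y. x \<in> V ==> y \<in> V ==> x ~= y ==> ({f x, f y} \<in> M) = (({x, y} \<in> H) = s)"
   unfolding embeds_def by blast
  have k: "h \<notin> f ` V"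
  proof
   assume "h \<in> f ` V"
   then obtain x where x: "x \<in> V" "f x = h" by blast
   obtain y where y: "y \<in> V" "y ~= x" "({x, y} \<in> H) = s" using pattern_nontrivial[OF p x(1)] by blast
   have "{f x, f y} \<notin> M" using be(1) x by (auto simp: isol_def)
   then show False using f(3)[of x y] x y by auto
  qed
  have "embeds s V H (X - {h}) M"
   unfolding embeds_def by (rule exI[of _ f]) (use f k in auto)
  then show False using be.IH p unfolding pattern_free_def by blast
 qed
next
 case (pq A B)
 show ?case
  unfolding pattern_free_def
 proof (clarify)
  fix V H s assume p: "(V, H) \<in> patterns" and "embeds s V H (A \<union> B) (prods A B)"
  then obtain f where f: "inj_on f V" "f ` V \<subseteq> A \<union> B"
   "\<And>x y. x \<in> V ==> y \<in> V ==> x ~= y ==> ({f x, f y} \<in> prods A B) = (({x, y} \<in> H) = s)"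
   unfolding embeds_def by blast
  have "((f x \<in> A) = (f y \<in> A)) = (({x, y} \<in> H) = (\<not> s))" if xy: "x \<in> V" "y \<in> V" "x ~= y" for x y
  proof -
   have "f x \<in> A \<union> B" "f y \<in> A \<union> B" using f(2) xy by auto
   then have "({f x, f y} \<in> prods A B) = ((f x \<in> A) ~= (f y \<in> A))"
    using pq(3) by (auto simp: prods_def doubleton_eq_iff)
   then show ?thesis using f(3)[OF xy] by auto
  qed
  then show False using pattern_not_bicolored[OF p, of "\<lambda>x. f x \<in> A" "\<not> s"] by blast
 qed
next
 case (pp A B)
 show ?case
  unfolding pattern_free_def
 proof (clarify)
  fix V H s assume p: "(V, H) \<in> patterns" and "embeds s V H (A \<union> B) (nsub 2 A \<union> nsub 2 B)"
  then obtain f where f: "inj_on f V" "f ` V \<subseteq> A \<union> B"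
   "\<And>x y. x \<in> V ==> y \<in> V ==> x ~= y ==> ({f x, f y} \<in> nsub 2 A \<union> nsub 2 B) = (({x, y} \<in> H) = s)"
   unfolding embeds_def by blast
  have "((f x \<in> A) = (f y \<in> A)) = (({x, y} \<in> H) = s)" if xy: "x \<in> V" "y \<in> V" "x ~= y" for x y
  proof -
   have "f x \<in> A \<union> B" "f y \<in> A \<union> B" "f x ~= f y" using f(1,2) xy by (auto simp: inj_on_def)
   then have "({f x, f y} \<in> nsub 2 A \<union> nsub 2 B) = ((f x \<in> A) = (f y \<in> A))"
    using pp(3) by auto
   then show ?thesis using f(3)[OF xy] by auto
  qed
  then show False using pattern_not_bicolored[OF p, of "\<lambda>x. f x \<in> A" s] by blast
 qed
qed

definition list_embed :: "nat list => nat => nat" where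
 "list_embed xs i = xs ! (i - 1)"

lemma embedsI_list:
 assumes "distinct xs" "set xs \<subseteq> X"
  "\<And>i j. i < length xs ==> j < i ==> ({xs ! i, xs ! j} \<in> M) = (({i + 1, j + 1} \<in> H) = s)"
 shows "embeds s {1..length xs} H X M"
 unfolding embeds_def
proof (intro exI[of _ "list_embed xs"] conjI ballI impI)
 show "inj_on (list_embed xs) {1..length xs}"
  using assms(1) by (auto simp: inj_on_def list_embed_def nth_eq_iff_index_eq)
 show "list_embed xs ` {1..length xs} \<subseteq> X"
  using assms(2) by (auto simp: list_embed_def subset_iff)
 fix x y assume xy: "x \<in> {1..length xs}" "y \<in> {1..length xs}" "x ~= y"
 show "({list_embed xs x, list_embed xs y} \<in> M) = (({x, y} \<in> H) = s)"
 proof (cases "y < x")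
  case True
  then show ?thesis using assms(3)[of "x - 1" "y - 1"] xy by (simp add: list_embed_def)
 next
  case False
  then show ?thesis using assms(3)[of "y - 1" "x - 1"] xy by (simp add: list_embed_def insert_commute)
 qed
qed

lemma not_pattern_freeI: "embeds s V H X M ==> (V, H) \<in> patterns ==> \<not> pattern_free X M"
 unfolding pattern_free_def by auto

lemma pairs_below_4:
 "j < i ==> i < (4 :: nat) ==> i = 1 \<and> j = 0 \<or> i = 2 \<and> j = 0 \<or> i = 2 \<and> j = 1 \<or> i = 3 \<and> j = 0 \<or> i = 3 \<and> j = 1 \<or> i = 3 \<and> j = 2"
 by presburger

lemma pairs_below_5:
 "j < i ==> i < (5 :: nat) ==> i < 4 \<or> i = 4 \<and> j = 0 \<or> i = 4 \<and> j = 1 \<or> i = 4 \<and> j = 2 \<or> i = 4 \<and> j = 3"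
 by presburger

lemma pairs_below_6:
 "j < i ==> i < (6 :: nat) ==> i < 5 \<or> i = 5 \<and> j = 0 \<or> i = 5 \<and> j = 1 \<or> i = 5 \<and> j = 2 \<or> i = 5 \<and> j = 3 \<or> i = 5 \<and> j = 4"
 by presburger

text \<open>On a walk from \<open>x\<close>, the first vertex that is neither \<open>x\<close> nor
  adjacent to \<open>x\<close> completes an induced path on three vertices.\<close>

lemma two_path:
 assumes "reach F x y" "x ~= y" "{x, y} \<notin> F"
 obtains a b c where "reach F x a" "{a, b} \<in> F" "{b, c} \<in> F" "{a, c} \<notin> F" "a ~= b" "b ~= c" "a ~= c"
proof -
 have "y = x \<or> {x, y} \<in> F \<or> (\<exists>a b c. reach F x a \<and> {a, b} \<in> F \<and> {b, c} \<in> F \<and> {a, c} \<notin> F \<and> a ~= b \<and> b ~= c \<and> a ~= c)"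
  using assms(1)
 proof (induction rule: reach_induct)
  case (step y z)
  consider "y = x" | "{x, y} \<in> F" "y ~= x" | "\<exists>a b c. reach F x a \<and> {a, b} \<in> F \<and> {b, c} \<in> F \<and> {a, c} \<notin> F \<and> a ~= b \<and> b ~= c \<and> a ~= c"
   using step.IH by blast
  then show ?case
  proof cases
   case 1
   then show ?thesis using step.hyps by simp
  next
   case 2
   then show ?thesis using step.hyps reach_refl[of F x] by blast
  qed blast
 qed simp
 then show thesis using assms that by blast
qed

definition signed :: "bool => nat set => nat set set => nat set set" where
 "signed s X M = (if s then M else nsub 2 X - M)"

lemma signed_mem:
 "x \<in> X ==> y \<in> X ==> x ~= y ==> {x, y} \<in> M \<longleftrightarrow> ({x, y} \<in> signed s X M) = s"
 by (auto simp: signed_def)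

lemma embedsI_signed:
 assumes "distinct xs" "set xs \<subseteq> X"
  "\<And>i j. i < length xs ==> j < i ==> ({xs ! i, xs ! j} \<in> signed s X M) = ({i + 1, j + 1} \<in> H)"
 shows "embeds s {1..length xs} H X M"
proof (rule embedsI_list[OF assms(1,2)])
 fix i j assume ij: "i < length xs" "j < i"
 have "xs ! i \<in> X" "xs ! j \<in> X" "xs ! i ~= xs ! j"
  using assms(1,2) ij by (auto simp: nth_eq_iff_index_eq subset_iff)
 then show "({xs ! i, xs ! j} \<in> M) = (({i + 1, j + 1} \<in> H) = s)"
  using signed_mem assms(3)[OF ij] by blast
qed

text \<open>Edges from three components form graph (c). An induced path on three vertices in a
  component that is not complete, together with an edge of another component, forms graph
  (b).\<close>

lemma bad_pattern:
 assumes "bad X (signed s X M)" "M \<subseteq> nsub 2 X"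
 shows "\<not> pattern_free X M"
proof -
 let ?F = "signed s X M"
 have F: "?F \<subseteq> nsub 2 X" using assms(2) by (auto simp: signed_def)
 have nb: "\<exists>y. y ~= x \<and> y \<in> X \<and> {x, y} \<in> ?F" if x: "x \<in> X" for x
 proof -
  obtain y where y: "y ~= x" "{x, y} \<in> ?F" using assms(1) x unfolding bad_def by blast
  then have "{x, y} \<in> nsub 2 X" using F by blast
  then show ?thesis using y by (auto simp: nsub_def)
 qed
 have apart: "{a, b} \<notin> ?F" "{b, a} \<notin> ?F" "a ~= b" if "\<not> reach ?F a b" for a b
  using that reach_edge[of a b ?F] by (auto simp: insert_commute)
 consider x y z where "x \<in> X" "y \<in> X" "z \<in> X" "\<not> reach ?F x y" "\<not> reach ?F y z" "\<not> reach ?F x z"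
  | x y where "x \<in> X" "reach ?F x y" "x ~= y" "{x, y} \<notin> ?F"
  using assms(1) unfolding bad_def by blast
 then show ?thesis
 proof cases
  case 1
  obtain x' y' z' where n: "x' ~= x" "x' \<in> X" "{x, x'} \<in> ?F" "y' ~= y" "y' \<in> X" "{y, y'} \<in> ?F"
   "z' ~= z" "z' \<in> X" "{z, z'} \<in> ?F" using nb[OF 1(1)] nb[OF 1(2)] nb[OF 1(3)] by blast
  have r: "\<not> reach ?F a b" if "a \<in> {x, x'} \<and> b \<in> {y, y'} \<or> a \<in> {y, y'} \<and> b \<in> {z, z'} \<or> a \<in> {x, x'} \<and> b \<in> {z, z'}" for a b
  proof
   assume ab: "reach ?F a b"
   have join: "reach ?F p q" if "reach ?F p a" "reach ?F q b" for p q
    by (rule reach_trans[OF that(1) reach_trans[OF ab reach_sym[OF that(2)]]])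
   have near: "c \<in> {x, x'} ==> reach ?F x c" "c \<in> {y, y'} ==> reach ?F y c" "c \<in> {z, z'} ==> reach ?F z c" for c
    using reach_edge[OF n(3)] reach_edge[OF n(6)] reach_edge[OF n(9)] by auto
   show False using that join near 1(4-6) by blast
  qed
  have len: "length [x, x', y, y', z, z'] = 6" by simp
  have emb: "embeds s {1..length [x, x', y, y', z, z']} {{1, 2}, {3, 4}, {5, 6}} X M"
  proof (rule embedsI_signed)
   note ap3 = apart(3)[OF r]
   show "distinct [x, x', y, y', z, z']"
   proof -
    have "x ~= y" "x ~= y'" "x ~= z" "x ~= z'" "x' ~= y" "x' ~= y'" "x' ~= z" "x' ~= z'"
     "y ~= z" "y ~= z'" "y' ~= z" "y' ~= z'"
     by ((rule ap3, blast)+)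
    then show ?thesis using n(1,4,7) by simp
   qed
   show "set [x, x', y, y', z, z'] \<subseteq> X" using 1(1-3) n(2,5,8) by simp
   fix i j assume ij: "i < length [x, x', y, y', z, z']" "j < i"
   have e: "{x', x} \<in> ?F" "{y', y} \<in> ?F" "{z', z} \<in> ?F" using n(3,6,9) by (simp_all add: insert_commute)
   have ap: "{y, x} \<notin> ?F" "{y', x} \<notin> ?F" "{z, x} \<notin> ?F" "{z', x} \<notin> ?F" "{y, x'} \<notin> ?F" "{y', x'} \<notin> ?F"
    "{z, x'} \<notin> ?F" "{z', x'} \<notin> ?F" "{z, y} \<notin> ?F" "{z', y} \<notin> ?F" "{z, y'} \<notin> ?F" "{z', y'} \<notin> ?F"
    by ((rule apart(2)[OF r], blast)+)
   from ij have i: "i < 6" by simp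
   show "({[x, x', y, y', z, z'] ! i, [x, x', y, y', z, z'] ! j} \<in> ?F) = ({i + 1, j + 1} \<in> {{1, 2}, {3, 4}, {5, 6}})"
    using pairs_below_6[OF ij(2) i]
    by (elim disjE conjE pairs_below_5[OF ij(2), THEN disjE] pairs_below_4[OF ij(2), THEN disjE]; hypsubst)
     (simp_all add: e ap doubleton_eq_iff)
  qed
  have "({1..6}, {{1, 2}, {3, 4}, {5, 6}}) \<in> patterns" by (simp add: patterns_def)
  then show ?thesis by (rule not_pattern_freeI[OF emb[unfolded len]])
 next
  case 2
  obtain a b c where p: "reach ?F x a" "{a, b} \<in> ?F" "{b, c} \<in> ?F" "{a, c} \<notin> ?F" "a ~= b" "b ~= c" "a ~= c"
   using two_path[OF 2(2-4)] by blast
  have abX: "a \<in> X" "b \<in> X" "c \<in> X" using p(2,3) F by auto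
  obtain z where z: "z \<in> X" "\<not> reach ?F z a"
  proof -
   obtain u v where "u \<in> X" "v \<in> X" "\<not> reach ?F u v" using assms(1) by (auto simp: bad_def conn_def)
   then show thesis using that by (meson reach_sym reach_trans)
  qed
  obtain w where w: "w ~= z" "w \<in> X" "{z, w} \<in> ?F" using nb[OF z(1)] by blast
  have r: "\<not> reach ?F u v" if "u \<in> {z, w}" "v \<in> {a, b, c}" for u v
  proof
   assume uv: "reach ?F u v"
   have "reach ?F z u" using that(1) reach_edge[OF w(3)] by auto
   moreover have "reach ?F v a"
    using that(2) reach_sym[OF reach_edge[OF p(2)]]
     reach_sym[OF reach_trans[OF reach_edge[OF p(2)] reach_edge[OF p(3)]]] by auto
   ultimately show False using z(2) uv reach_trans by blast
  qed
  have len: "length [z, w, b, a, c] = 5" by simp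
  have emb: "embeds s {1..length [z, w, b, a, c]} {{1, 2}, {3, 4}, {3, 5}} X M"
  proof (rule embedsI_signed)
   note ap3 = apart(3)[OF r]
   show "distinct [z, w, b, a, c]" 
   proof -
    have "z ~= a" "z ~= b" "z ~= c" "w ~= a" "w ~= b" "w ~= c"
     by ((rule ap3, blast, blast)+)
    then show ?thesis using w(1) p(5-7) by simp
   qed
   show "set [z, w, b, a, c] \<subseteq> X" using z(1) w(2) abX by simp
   fix i j assume ij: "i < length [z, w, b, a, c]" "j < i"
   have e: "{w, z} \<in> ?F" "{a, b} \<in> ?F" "{c, b} \<in> ?F" "{c, a} \<notin> ?F" using p(2-4) w(3) by (simp_all add: insert_commute)
   have ap: "{a, z} \<notin> ?F" "{b, z} \<notin> ?F" "{c, z} \<notin> ?F" "{a, w} \<notin> ?F" "{b, w} \<notin> ?F" "{c, w} \<notin> ?F"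
    by ((rule apart(2)[OF r], blast, blast)+)
   from ij have i: "i < 5" by simp
   show "({[z, w, b, a, c] ! i, [z, w, b, a, c] ! j} \<in> ?F) = ({i + 1, j + 1} \<in> {{1, 2}, {3, 4}, {3, 5}})"
    using pairs_below_5[OF ij(2) i]
    by (elim disjE conjE pairs_below_5[OF ij(2), THEN disjE] pairs_below_4[OF ij(2), THEN disjE]; hypsubst)
     (simp_all add: e ap doubleton_eq_iff)
  qed
  have "({1..5}, {{1, 2}, {3, 4}, {3, 5}}) \<in> patterns" by (simp add: patterns_def)
  then show ?thesis by (rule not_pattern_freeI[OF emb[unfolded len]])
 qed
qed

text \<open>A walk from \<open>s\<close> either avoids \<open>v\<close>, or just before its first
  visit to \<open>v\<close> it is at a neighbour of \<open>v\<close> reached without using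
  \<open>v\<close>.\<close>

lemma reach_avoiding:
 assumes "reach F s y" "s ~= v"
 shows "reach (del F v) s y \<and> y ~= v \<or> (\<exists>w. w ~= v \<and> reach (del F v) s w \<and> {w, v} \<in> F)"
 using assms
proof (induction rule: reach_induct)
 case (step y z)
 then show ?case
 proof (cases "z = v")
  case False
  then have "y ~= v ==> {y, z} \<in> del F v" using step by (auto simp: del_def)
  then show ?thesis using step False reach_step[of "del F v" s y z] by blast
 qed blast
qed simp

lemma reach_crossing:
 assumes "reach F u w" "\<not> P u" "P w"
 shows "\<exists>a b. reach F u a \<and> a ~= b \<and> {a, b} \<in> F \<and> \<not> P a \<and> P b"
 using assms(1,3)
proof (induction rule: reach_induct)
 case (step y z)
 then show ?case by (cases "P y") auto
qed (use assms(2) in simp)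

text \<open>Seinsche's theorem\<close>

lemma connected_pattern:
 assumes "finite X" "M \<subseteq> nsub 2 X" "2 \<le> card X" "conn X M" "conn X (nsub 2 X - M)"
 shows "\<not> pattern_free X M"
 using assms
proof (induction "card X" arbitrary: X M rule: less_induct)
 case less
 obtain v where v: "v \<in> X" using less.prems(3) by fastforce
 let ?X = "X - {v}"
 have fin: "finite ?X" "card ?X < card X"
  using less.prems(1) card_Diff1_less[OF less.prems(1) v] by simp_all
 have dM: "del M v \<subseteq> nsub 2 ?X" by (rule del_subset[OF less.prems(2)])
 have mono: "\<not> pattern_free X M" if nf: "\<not> pattern_free ?X (del M v)"
 proof -
  obtain V H s where p: "(V, H) \<in> patterns" "embeds s V H ?X (del M v)"
   using nf unfolding pattern_free_def by auto
  then obtain f where f: "inj_on f V" "f ` V \<subseteq> ?X"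
   "\<forall>x\<in>V. \<forall>y\<in>V. x ~= y --> ({f x, f y} \<in> del M v) = (({x, y} \<in> H) = s)" unfolding embeds_def by blast
  have "embeds s V H X M"
   unfolding embeds_def
  proof (intro exI[of _ f] conjI ballI impI)
   fix x y assume xy: "x \<in> V" "y \<in> V" "x ~= y"
   then have "f x ~= v" "f y ~= v" using f(2) by blast+
   then have "{f x, f y} \<in> del M v \<longleftrightarrow> {f x, f y} \<in> M" by (simp add: del_def)
   then show "({f x, f y} \<in> M) = (({x, y} \<in> H) = s)" using f(3) xy by simp
  qed (use f in auto)
  then show ?thesis using p(1) unfolding pattern_free_def by blast
 qed
 have conns: "conn X (signed s X M)" for s using less.prems(4,5) by (auto simp: signed_def)
 show ?case
 \<comment> \<open>If deleting \<open>v\<close> disconnects neither the graph nor its complement,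
   induction applies. Otherwise the path is found around \<open>v\<close> in the one that falls
   apart.\<close>
 proof (cases "\<exists>s. \<not> conn ?X (del (signed s X M) v)")
  case True
  then obtain s where s: "\<not> conn ?X (del (signed s X M) v)" by blast
  let ?F = "signed s X M" and ?G = "del (signed s X M) v"
  have FX: "?F \<subseteq> nsub 2 X" using less.prems(2) by (auto simp: signed_def)
  have to_v: "\<exists>w. w ~= v \<and> reach (del (signed s' X M) v) x w \<and> {w, v} \<in> signed s' X M" if x: "x \<in> ?X" for s' x
  proof -
   have "reach (signed s' X M) x v" using conns[of s'] x v by (auto simp: conn_def)
   then show ?thesis using reach_avoiding[of "signed s' X M" x v v] x by auto
  qed
  obtain a b where ab: "a \<in> ?X" "b \<in> ?X" "\<not> reach ?G a b" using s by (auto simp: conn_def)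
  \<comment> \<open>The complement is connected, so some \<open>u\<close> is not adjacent to
    \<open>v\<close>. A walk from \<open>u\<close> inside its component to a neighbour of
    \<open>v\<close> contains an edge \<open>{p, q}\<close> with only \<open>q\<close> adjacent to
    \<open>v\<close>.\<close>
  obtain u where u: "u ~= v" "{u, v} \<in> signed (\<not> s) X M" using to_v[OF ab(1), of "\<not> s"] by blast
  have uX: "u \<in> ?X" "{u, v} \<notin> ?F"
   using u less.prems(2) by (auto simp: signed_def split: if_splits)
  obtain w where w: "w ~= v" "reach ?G u w" "{w, v} \<in> ?F" using to_v[OF uX(1), of s] by blast
  obtain p q where pq: "reach ?G u p" "p ~= q" "{p, q} \<in> ?G" "{p, v} \<notin> ?F" "{q, v} \<in> ?F"
   using reach_crossing[OF w(2), of "\<lambda>x. {x, v} \<in> ?F"] uX(2) w(3) by blast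
  \<comment> \<open>Another component contains a neighbour \<open>y\<close> of \<open>v\<close>, and
    \<open>p\<close>, \<open>q\<close>, \<open>v\<close>, \<open>y\<close> is the induced
    path.\<close>
  obtain z where z: "z \<in> ?X" "\<not> reach ?G z p"
   using ab by (meson reach_sym reach_trans)
  obtain y where y: "y ~= v" "reach ?G z y" "{y, v} \<in> ?F" using to_v[OF z(1), of s] by blast
  have np: "\<not> reach ?G y p" using z(2) y(2) reach_trans by blast
  have nq: "\<not> reach ?G y q" using np reach_edge[OF pq(3)] reach_trans reach_sym by blast
  have pqv: "{p, q} \<in> ?F" "p ~= v" "q ~= v" using pq(3) by (auto simp: del_def)
  have X: "p \<in> X" "q \<in> X" "y \<in> X" using pqv(1) y(3) FX by auto
  have yp: "{y, p} \<notin> ?F" "{y, q} \<notin> ?F" "y ~= p" "y ~= q"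
   using np nq reach_edge[of y p ?G] reach_edge[of y q ?G] y(1) pqv by (auto simp: del_def)
  have len: "length [q, p, v, y] = 4" by simp
  have emb: "embeds s {1..length [q, p, v, y]} {{1, 2}, {1, 3}, {3, 4}} X M"
  proof (rule embedsI_signed)
   show "distinct [q, p, v, y]" using pq(2) pqv(2,3) y(1) yp(3,4) by auto
   show "set [q, p, v, y] \<subseteq> X" using X v by auto
   fix i j assume ij: "i < length [q, p, v, y]" "j < i"
   have e: "{p, q} \<in> ?F" "{v, q} \<in> ?F" "{v, p} \<notin> ?F" "{y, q} \<notin> ?F" "{y, p} \<notin> ?F" "{y, v} \<in> ?F"
    using pqv pq y yp by (simp_all add: insert_commute)
   from ij have i: "i < 4" by simp
   show "({[q, p, v, y] ! i, [q, p, v, y] ! j} \<in> ?F) = ({i + 1, j + 1} \<in> {{1, 2}, {1, 3}, {3, 4}})"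
    using pairs_below_4[OF ij(2) i]
    by (elim disjE conjE; hypsubst) (simp_all add: e doubleton_eq_iff)
  qed
  have "({1..4}, {{1, 2}, {1, 3}, {3, 4}}) \<in> patterns" by (simp add: patterns_def)
  then show ?thesis by (rule not_pattern_freeI[OF emb[unfolded len]])
 next
  case False
  have c1: "conn ?X (del M v)" using False by (auto simp: signed_def dest: spec[of _ True])
  have "del (nsub 2 X - M) v = nsub 2 ?X - del M v" by (auto simp: del_def nsub_def)
  then have c2: "conn ?X (nsub 2 ?X - del M v)" using False by (auto simp: signed_def dest: spec[of _ False])
  show ?thesis
  proof (cases "2 \<le> card ?X")
   case True
   then show ?thesis using less.hyps[OF fin(2,1) dM True c1 c2] mono by blast
  next
   case False
   \<comment> \<open>With two vertices their pair would have to be both an edge and a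
     nonedge.\<close>
   then have "card ?X = 1" using less.prems(3) v less.prems(1) by simp
   then obtain u where u: "?X = {u}" by (rule card_1_singletonE)
   then have uv: "X = {u, v}" "u ~= v" using v by auto
   have "{u, v} \<in> F" if F: "conn X F" "F \<subseteq> nsub 2 X" for F
   proof -
    have "reach F u v" using F uv by (auto simp: conn_def)
    then obtain a b where "a ~= b" "{a, b} \<in> F"
     using reach_crossing[of F u v "\<lambda>x. x = v"] uv(2) by blast
    moreover from this have "{a, b} \<subseteq> {u, v}" using F(2) uv by (auto simp: nsub_def)
    ultimately have "{a, b} = {u, v}" by (auto simp: doubleton_eq_iff)
    then show ?thesis using \<open>{a, b} \<in> F\<close> by simp
   qed
   then show ?thesis using less.prems by blast
  qed
 qed
qed

theorem good_iff_pattern_free: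
 assumes "finite X" "M \<subseteq> nsub 2 X"
 shows "good X M \<longleftrightarrow> pattern_free X M"
proof
 show "good X M ==> pattern_free X M" by (rule good_pattern_free)
 have mono: "pattern_free Y M'" if pf: "pattern_free X M" "Y \<subseteq> X" "\<And>S. S \<subseteq> Y ==> S \<in> M' \<longleftrightarrow> S \<in> M" for X M Y M'
  unfolding pattern_free_def
 proof clarify
  fix V H s assume p: "(V, H) \<in> patterns" "embeds s V H Y M'"
  then obtain f where f: "inj_on f V" "f ` V \<subseteq> Y"
   "\<forall>x\<in>V. \<forall>y\<in>V. x ~= y --> ({f x, f y} \<in> M') = (({x, y} \<in> H) = s)" unfolding embeds_def by blast
  have "{f x, f y} \<in> M' \<longleftrightarrow> {f x, f y} \<in> M" if "x \<in> V" "y \<in> V" for x y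
   using pf(3)[of "{f x, f y}"] f(2) that by auto
  then have "embeds s V H X M"
   unfolding embeds_def using f pf(2) by (intro exI[of _ f]) auto
  then show False using pf(1) p(1) unfolding pattern_free_def by blast
 qed
 assume "pattern_free X M"
 show "good X M"
 proof (rule good_criterion[where \<Phi> = pattern_free])
  fix X M assume h: "finite X" "M \<subseteq> nsub 2 X" "pattern_free X M"
  show "pattern_free (X - {k}) (del M k)" for k
   by (rule mono[OF h(3)]) (auto simp: del_def)
  show "pattern_free (X - {k}) M" for k by (rule mono[OF h(3)]) auto
  show False if "2 \<le> card X" "conn X M" "conn X (nsub 2 X - M)"
   using connected_pattern[OF h(1,2) that] h(3) by blast
  show "\<not> bad X M" using bad_pattern[of X True M] h by (auto simp: signed_def)
  show "\<not> bad X (nsub 2 X - M)" using bad_pattern[of X False M] h by (auto simp: signed_def)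
 qed (use assms \<open>pattern_free X M\<close> in auto)
qed

subsection \<open>Orthogonal complements\<close>

text \<open>The standard bilinear form in degree 2, for which the monomials of pairs from
  \<open>C\<close> are orthonormal.\<close>

definition pairing :: "nat set => 'k::field ext => 'k ext => 'k" where
 "pairing C z y = (\<Sum>a\<in>C. \<Sum>b\<in>C. if a < b then z {a, b} * y {a, b} else 0)"

lemma pairing_wd: "pairing C z (wd u t) = (\<Sum>a\<in>C. \<Sum>b\<in>C. u a * t b * coef2 z a b)"
proof -
 have "(\<Sum>a\<in>C. \<Sum>b\<in>C. u a * t b * coef2 z a b) =
  (\<Sum>a\<in>C. \<Sum>b\<in>C. (if a < b then u a * t b * z {a, b} else 0) + (if b < a then - (u a * t b * z {a, b}) else 0))"
  by (intro sum.cong refl) (simp add: coef2_def)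
 also have "\<dots> = (\<Sum>a\<in>C. \<Sum>b\<in>C. if a < b then u a * t b * z {a, b} else 0) +
  (\<Sum>a\<in>C. \<Sum>b\<in>C. if b < a then - (u a * t b * z {a, b}) else 0)"
  by (simp add: sum.distrib)
 also have "(\<Sum>a\<in>C. \<Sum>b\<in>C. if b < a then - (u a * t b * z {a, b}) else 0) =
  (\<Sum>a\<in>C. \<Sum>b\<in>C. if a < b then - (u b * t a * z {b, a}) else 0)"
  by (rule sum.swap)
 also have "(\<Sum>a\<in>C. \<Sum>b\<in>C. if a < b then u a * t b * z {a, b} else 0) + \<dots> =
  (\<Sum>a\<in>C. \<Sum>b\<in>C. if a < b then z {a, b} * wd u t {a, b} else 0)"
  unfolding sum.distrib [symmetric]
 proof (intro sum.cong refl)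
  fix a b
  show "(if a < b then u a * t b * z {a, b} else 0) + (if a < b then - (u b * t a * z {b, a}) else 0) =
   (if a < b then z {a, b} * wd u t {a, b} else 0)"
   by (cases "a < b") (simp_all add: insert_commute[of b a] wd_pair algebra_simps)
 qed
 finally show ?thesis by (simp add: pairing_def)
qed

lemma pairing_wd_wd:
 "pairing C (wd p q) (wd u t) =
  (\<Sum>a\<in>C. u a * p a) * (\<Sum>a\<in>C. t a * q a) - (\<Sum>a\<in>C. u a * q a) * (\<Sum>a\<in>C. t a * p a)"
proof -
 have "pairing C (wd p q) (wd u t) = (\<Sum>a\<in>C. \<Sum>b\<in>C. (u a * p a) * (t b * q b) - (u a * q a) * (t b * p b))"
  unfolding pairing_wd coef2_wd by (intro sum.cong refl) (simp add: algebra_simps)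
 then show ?thesis by (simp add: sum_subtractf sum_product)
qed

lemma pairing_linear:
 "pairing C (x + y) z = pairing C x z + pairing C y z" "pairing C (fscale c x) z = c * pairing C x z"
 "pairing C 0 z = 0"
 "pairing C z (x + y) = pairing C z x + pairing C z y" "pairing C z (fscale c x) = c * pairing C z x"
 "pairing C z 0 = 0"
 unfolding pairing_def sum_distrib_left sum.distrib [symmetric]
 by (auto intro!: sum.cong sum.neutral simp: plus_fun_apply fscale_apply zero_fun_apply algebra_simps)

text \<open>By the determinant formula \<open>pairing_wd_wd\<close>, products of two basis vectors
  and of two dual vectors are orthogonal unless they belong to the same pair.\<close>

lemma pairing_span_zero:
 assumes b: "dual_bases C X v w" and M: "M \<subseteq> nsub 2 X"
  and z: "z \<in> fvs.span (vm v ` M)" and y: "y \<in> fvs.span (vm w ` (nsub 2 X - M))"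
 shows "pairing C z y = 0"
proof -
 let ?K = "\<lambda>Y. {z. \<forall>y\<in>Y. pairing C z y = 0}"
 let ?W = "fvs.span (vm w ` (nsub 2 X - M))"
 have "fvs.span (vm v ` M) \<subseteq> ?K ?W"
 proof (rule span_vm_subset[OF M])
  show "fvs.subspace (?K ?W)" by (simp add: fvs.subspace_def pairing_linear)
  fix p q assume pq: "{p, q} \<in> M" "p ~= q"
  have "?W \<subseteq> {y. pairing C (wd (v p) (v q)) y = 0}"
  proof (rule span_vm_subset[of _ X])
   show "fvs.subspace {y. pairing C (wd (v p) (v q)) y = 0}"
    by (simp add: fvs.subspace_def pairing_linear)
   fix s t assume st: "{s, t} \<in> nsub 2 X - M" "s ~= t"
   have X: "p \<in> X" "q \<in> X" "s \<in> X" "t \<in> X" using pq st M by auto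
   have o: "(\<Sum>a\<in>C. w x a * v y a) = (if x = y then 1 else 0)" if "x \<in> X" "y \<in> X" for x y
    using b that by (simp add: dual_bases_def)
   have "\<not> (s = p \<and> t = q)" "\<not> (s = q \<and> t = p)" using pq st by (auto simp: insert_commute)
   then show "wd (w s) (w t) \<in> {y. pairing C (wd (v p) (v q)) y = 0}"
    by (auto simp: pairing_wd_wd o X)
  qed auto
  then show "wd (v p) (v q) \<in> ?K ?W" by blast
 qed
 then show ?thesis using z y by blast
qed

section \<open>Reversed orders and complementary leading terms\<close>

definition reverse_rank :: "nat set => (nat set => nat) => (nat set => nat) => bool" where
 "reverse_rank N rk rk' \<longleftrightarrow> (\<forall>S T. S \<subseteq> N --> T \<subseteq> N --> (rk' S < rk' T \<longleftrightarrow> rk T < rk S))"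

lemma reverse_rank_exists:
 assumes "mono_rank N rk"
 obtains rk' where "mono_rank N rk'" "reverse_rank N rk rk'"
proof -
 define m where "m = Max (rk ` Pow N)"
 have fin: "finite (Pow N)" using assms by (simp add: mono_rank_def)
 have le: "rk S \<le> m" if "S \<subseteq> N" for S unfolding m_def using fin that by (intro Max_ge) auto
 have "reverse_rank N rk (\<lambda>S. m - rk S)"
  unfolding reverse_rank_def
 proof (intro allI impI)
  fix S T assume "S \<subseteq> N" "T \<subseteq> N"
  then show "m - rk S < m - rk T \<longleftrightarrow> rk T < rk S" using le[of S] le[of T] by linarith
 qed
 moreover have "mono_rank N (\<lambda>S. m - rk S)"
  unfolding mono_rank_def
 proof (intro conjI allI impI)
  show "finite N" using assms by (simp add: mono_rank_def)
  show "inj_on (\<lambda>S. m - rk S) (Pow N)"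
  proof (rule inj_onI)
   fix S T assume h: "S \<in> Pow N" "T \<in> Pow N" "m - rk S = m - rk T"
   have "rk S = rk T" using h(3) le[of S] le[of T] h(1,2) by simp
   then show "S = T" using mono_rank_inj[OF assms] h by blast
  qed
  fix S T U assume h: "S \<subseteq> N" "T \<subseteq> N" "U \<subseteq> N" "S \<inter> U = {}" "T \<inter> U = {}" "m - rk S < m - rk T"
  have "rk T < rk S" using h(6) le[OF h(1)] le[OF h(2)] by linarith
  then have "rk (T \<union> U) < rk (S \<union> U)" using mono_rank_less[OF assms h(2,1,3,5,4)] by simp
  moreover have "rk (S \<union> U) \<le> m" "rk (T \<union> U) \<le> m" using h by (auto intro: le)
  ultimately show "m - rk (S \<union> U) < m - rk (T \<union> U)" by linarith
 qed
 ultimately show thesis by (rule that[rotated])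
qed

text \<open>\<open>S\<close> is at once the greatest monomial of \<open>z\<close> and the least one
  of \<open>y\<close> in the order of \<open>rk\<close>, so it is the only one they share and the
  pairing is a single nonzero product.\<close>

lemma leads_disjoint:
 assumes mr: "mono_rank N rk" "C \<subseteq> N" and rv: "reverse_rank N rk rk'"
  and z: "z \<in> fsupp (nsub 2 C)" "ld rk z S" and y: "y \<in> fsupp (nsub 2 C)" "ld rk' y S"
 shows "pairing C z y ~= (0 :: 'k::field)"
proof -
 have fin: "finite C" using mr by (auto simp: mono_rank_def intro: finite_subset)
 have SC: "S \<in> nsub 2 C" using z by (auto simp: ld_def fsupp_def)
 then obtain i j where ij: "S = {i, j}" "i \<in> C" "j \<in> C" "i < j"
  by (elim nsub2E) (metis insert_commute linorder_neqE_nat)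
 have SN: "S \<subseteq> N" using SC mr(2) by (auto simp: nsub_def)
 have only: "T = S" if T: "z T ~= 0" "y T ~= 0" for T
 proof -
  have "T \<in> nsub 2 C" using T(1) z(1) unfolding fsupp_def by blast
  then have "T \<subseteq> N" using mr(2) by (auto simp: nsub_def)
  moreover have "rk T \<le> rk S" "rk' T \<le> rk' S" using z(2) y(2) T by (simp_all add: ld_def)
  ultimately show ?thesis using rv SN mono_rank_inj[OF mr(1)] unfolding reverse_rank_def
   by (metis le_antisym not_less)
 qed
 have "(if a < b then z {a, b} * y {a, b} else 0) = (if b = j then (if a = i then z S * y S else 0) else 0)" for a b
 proof (cases "{a, b} = S \<and> a < b")
  case True
  then show ?thesis using ij by (auto simp: doubleton_eq_iff)
 next
  case False
  then have "a < b ==> z {a, b} * y {a, b} = 0" using only[of "{a, b}"] by auto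
  then show ?thesis using False ij by auto
 qed
 then have "pairing C z y = z S * y S" using ij fin by (simp add: pairing_def)
 then show ?thesis using z(2) y(2) by (simp add: ld_def)
qed

lemma dual_bases_sym:
 assumes "dual_bases C X v w" "\<And>x. x \<in> X ==> w x \<in> fsupp C"
 shows "dual_bases C X w v"
 unfolding dual_bases_def
proof (intro conjI ballI)
 have o: "(\<Sum>a\<in>C. w x a * v y a) = (if x = y then 1 else 0)" if "x \<in> X" "y \<in> X" for x y
  using assms(1) that by (simp add: dual_bases_def)
 show "(\<Sum>a\<in>C. v x a * w y a) = (if x = y then 1 else 0)" if "x \<in> X" "y \<in> X" for x y
  using o[OF that(2,1)] by (simp add: mult.commute)
 have o: "(\<Sum>x\<in>X. v x a * w x b) = (if a = b then 1 else 0)" if "a \<in> C" "b \<in> C" for a b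
  using assms(1) that by (simp add: dual_bases_def)
 show "(\<Sum>x\<in>X. w x a * v x b) = (if a = b then 1 else 0)" if "a \<in> C" "b \<in> C" for a b
  using o[OF that(2,1)] by (simp add: mult.commute)
qed (use assms in \<open>auto simp: dual_bases_def\<close>)

text \<open>Elimination in a space and, with the reversed order, in its orthogonal complement picks
  complementary pivots: the two leading sets are disjoint and their sizes add up to the number of
  pairs.\<close>

lemma leads_dual:
 fixes v w :: "nat => nat => 'k::field"
 assumes mr: "mono_rank N rk" "C \<subseteq> N" and mr': "mono_rank N rk'" and rv: "reverse_rank N rk rk'"
  and b: "dual_bases C X v w" "\<And>x. x \<in> X ==> w x \<in> fsupp C" and M: "M \<subseteq> nsub 2 X"
 shows "leads rk (fvs.span (vm v ` M)) = nsub 2 C - leads rk' (fvs.span (vm w ` (nsub 2 X - M)))"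
  (is "?A = _ - ?B")
proof -
 have fin: "finite C" "finite X" "card X = card C" using b(1) by (simp_all add: dual_bases_def)
 note b' = dual_bases_sym[OF b]
 have A: "card ?A = card M" "?A \<subseteq> nsub 2 C" using card_leads_vm[OF b(1) mr M] by simp_all
 have B: "card ?B = card (nsub 2 X - M)" "?B \<subseteq> nsub 2 C"
  using card_leads_vm[OF b' mr' mr(2), of "nsub 2 X - M" 2] by simp_all
 have sp: "fvs.span (vm u ` L) \<subseteq> fsupp (nsub 2 C)" if u: "\<And>x. x \<in> X ==> u x \<in> fsupp C" and L: "L \<subseteq> nsub 2 X"
  for u :: "nat => nat => 'k" and L
 proof (rule span_fsupp, clarify)
  fix S assume "S \<in> L"
  then have S: "S \<subseteq> X" "card S = 2" using L by (auto simp: nsub_def)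
  have "vm u S \<in> fsupp (nsub (card S) C)"
   by (rule vm_fsupp) (use S u fin finite_subset in auto)
  then show "vm u S \<in> fsupp (nsub 2 C)" using S by simp
 qed
 have vX: "\<And>x. x \<in> X ==> v x \<in> fsupp C" using b(1) by (simp add: dual_bases_def)
 have "?A \<inter> ?B = {}"
 proof (rule equals0I)
  fix S assume "S \<in> ?A \<inter> ?B"
  then obtain z y where z: "z \<in> fvs.span (vm v ` M)" "ld rk z S"
   and y: "y \<in> fvs.span (vm w ` (nsub 2 X - M))" "ld rk' y S" unfolding leads_def by blast
  have "z \<in> fsupp (nsub 2 C)" using sp[of v M] vX M z(1) by blast
  moreover have "y \<in> fsupp (nsub 2 C)" using sp[of w "nsub 2 X - M"] b(2) y(1) by blast
  ultimately show False
   using leads_disjoint[OF mr rv _ z(2) _ y(2)] pairing_span_zero[OF b(1) M z(1) y(1)] by simp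
 qed
 then have sub: "?A \<subseteq> nsub 2 C - ?B" using A(2) by blast
 have finN: "finite (nsub 2 C)" "finite ?B" using fin B(2) by (auto intro: finite_subset)
 have "card (nsub 2 C - ?B) = card (nsub 2 C) - card ?B" by (rule card_Diff_subset[OF finN(2) B(2)])
 also have "\<dots> = card (nsub 2 X) - card (nsub 2 X - M)" using fin B(1) by (simp add: card_nsub)
 also have "\<dots> = card M"
 proof -
  have fM: "finite M" using M fin(2) by (auto intro: finite_subset)
  have "card (nsub 2 X - M) = card (nsub 2 X) - card M" by (rule card_Diff_subset[OF fM M])
  moreover have "card M \<le> card (nsub 2 X)" using M fin(2) by (intro card_mono) auto
  ultimately show ?thesis by simp
 qed
 finally have "card (nsub 2 C - ?B) = card ?A" using A(1) by simp
 then show ?thesis using card_subset_eq[OF _ sub] finN by simp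
qed

lemma dual_bases_restrict:
 assumes "dual_bases C X v w"
 obtains w' where "dual_bases C X v w'" "\<And>x. w' x \<in> fsupp C"
proof
 let ?w = "\<lambda>x a. if a \<in> C then w x a else 0"
 show "dual_bases C X v ?w" using assms unfolding dual_bases_def by (auto cong: sum.cong)
 show "?w x \<in> fsupp C" for x by (simp add: fsupp_def)
qed

text \<open>For use with vectors \<open>u\<close> that are adapted to the complementary graph; their
  dual basis provides the coordinates for \<open>M\<close>.\<close>

lemma leads_complement:
 fixes u t :: "nat => nat => 'k::field"
 assumes mr: "mono_rank N rk" "C \<subseteq> N" and mr': "mono_rank N rk'" and rv: "reverse_rank N rk rk'"
  and b: "dual_bases C X u t" and M: "M \<subseteq> nsub 2 X"
 obtains v w :: "nat => nat => 'k" where "dual_bases C X v w"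
  "leads rk (fvs.span (vm v ` M)) = nsub 2 C - leads rk' (fvs.span (vm u ` (nsub 2 X - M)))"
proof -
 obtain t' where t': "dual_bases C X u t'" "\<And>x. t' x \<in> fsupp C" using dual_bases_restrict[OF b] by blast
 have uX: "\<And>x. x \<in> X ==> u x \<in> fsupp C" using b by (simp add: dual_bases_def)
 have "dual_bases C X t' u" by (rule dual_bases_sym[OF t'])
 moreover from this have "leads rk (fvs.span (vm t' ` M)) = nsub 2 C - leads rk' (fvs.span (vm u ` (nsub 2 X - M)))"
  by (rule leads_dual[OF mr mr' rv _ _ M]) (rule uX)
 ultimately show thesis by (rule that)
qed

subsection \<open>Special coordinates\<close>

text \<open>Unit vectors, to some of which the unit vector of another vertex is added. Since
  \<open>g\<close> leads out of \<open>Z\<close>, the added part has square zero, and the inverse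
  differs only by a sign.\<close>

lemma fold_bases:
 assumes c: "bij_betw c X C" and fin: "finite X" and Z: "Z \<subseteq> X" "\<And>z. z \<in> Z ==> g z \<in> X - Z"
 obtains w where "dual_bases C X (\<lambda>x. if x \<in> Z then unitf (c x) + unitf (c (g x)) else unitf (c x) :: nat => 'k::field) w"
proof -
 define d where "d = inv_into X c"
 have d: "d (c u) = u" if "u \<in> X" for u
  unfolding d_def using c that by (intro inv_into_f_f) (auto simp: bij_betw_def)
 have C: "C = c ` X" using c by (simp add: bij_betw_def)
 have inj: "c x = c y \<longleftrightarrow> x = y" if "x \<in> X" "y \<in> X" for x y
  using c that by (auto simp: bij_betw_def inj_on_def)
 let ?v = "\<lambda>x. if x \<in> Z then unitf (c x) + unitf (c (g x)) else unitf (c x) :: nat => 'k"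
 let ?w = "\<lambda>x a. (if d a = x then 1 else 0) - (if d a \<in> Z \<and> g (d a) = x then 1 else 0) :: 'k"
 have v: "?v y (c u) = (if u = y then 1 else 0) + (if y \<in> Z \<and> u = g y then 1 else 0)" if "y \<in> X" "u \<in> X" for y u
 proof -
  have "y \<in> Z ==> g y \<in> X" using Z(2) by blast
  then show ?thesis using that by (auto simp: unitf_def plus_fun_apply inj)
 qed
 have "dual_bases C X ?v ?w"
  unfolding dual_bases_def
 proof (intro conjI ballI)
  show "finite C" "finite X" "card X = card C" using fin c C by (auto simp: bij_betw_same_card)
  fix x assume x: "x \<in> X"
  have "x \<in> Z ==> c (g x) \<in> C" using Z(2) C by blast
  then show "?v x \<in> fsupp C" using x C by (auto simp: fsupp_def unitf_def plus_fun_apply split: if_splits)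
  fix y assume y: "y \<in> X"
  have "(\<Sum>a\<in>C. ?w x a * ?v y a) = (\<Sum>u\<in>X. ?w x (c u) * ?v y (c u))"
   unfolding C using c by (subst sum.reindex) (auto simp: bij_betw_def)
  also have "\<dots> = (\<Sum>u\<in>X. (if u = x then ?v y (c x) else 0) - (if u = y then (if y \<in> Z \<and> g y = x then 1 else 0) else 0))"
  proof (rule sum.cong[OF refl])
   fix u assume u: "u \<in> X"
   have "y \<in> Z ==> u = g y ==> u \<notin> Z" using Z(2) by blast
   then show "?w x (c u) * ?v y (c u) =
    (if u = x then ?v y (c x) else 0) - (if u = y then (if y \<in> Z \<and> g y = x then 1 else 0) else 0)"
    unfolding v[OF y u] v[OF y x] d[OF u] using Z(2)[of y] Z(2)[of u] by auto
  qed
  also have "\<dots> = ?v y (c x) - (if y \<in> Z \<and> g y = x then 1 else 0)"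
   using fin x y by (simp add: sum_subtractf)
  also have "\<dots> = (if x = y then 1 else 0)" unfolding v[OF y x] by auto
  finally show "(\<Sum>a\<in>C. ?w x a * ?v y a) = (if x = y then 1 else 0)" .
 next
  fix a b assume "a \<in> C" "b \<in> C"
  then obtain p q where pq: "a = c p" "b = c q" "p \<in> X" "q \<in> X" using C by blast
  have "(\<Sum>x\<in>X. ?v x a * ?w x b) =
   (\<Sum>x\<in>X. (if x = q then ?v q (c p) else 0) - (if x = g q then (if q \<in> Z \<and> p = g q then 1 else 0) else 0))"
  proof (rule sum.cong[OF refl])
   fix x assume x: "x \<in> X"
   show "?v x a * ?w x b =
    (if x = q then ?v q (c p) else 0) - (if x = g q then (if q \<in> Z \<and> p = g q then 1 else 0) else 0)"
    unfolding pq v[OF x pq(3)] v[OF pq(4,3)] d[OF pq(4)] using Z(2)[of x] Z(2)[of q] by auto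
  qed
  also have "\<dots> = ?v q (c p) - (if q \<in> Z \<and> p = g q then 1 else 0)"
  proof (cases "q \<in> Z")
   case True
   then have "g q \<in> X" using Z(2) by blast
   then show ?thesis using fin pq by (simp add: sum_subtractf)
  next
   case False
   then show ?thesis using fin pq by (simp add: sum_subtractf)
  qed
  also have "\<dots> = (if a = b then 1 else 0)" unfolding v[OF pq(4,3)] using pq inj by auto
  finally show "(\<Sum>x\<in>X. ?v x a * ?w x b) = (if a = b then 1 else 0)" .
 qed
 then show thesis by (rule that)
qed

lemma coef2_sum: "coef2 (\<Sum>b\<in>B. f b) i j = (\<Sum>b\<in>B. coef2 (f b) i j)"
 by (induction B rule: infinite_finite_induct) (simp_all add: coef2_zero coef2_add)

text \<open>A vertex of \<open>R\<close> is placed at \<open>m\<close>, and \<open>e_m\<close> is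
  added to all other vectors, so every vector has coordinate 1 at \<open>m\<close>. Summing products
  along a path from \<open>r\<close> to \<open>x\<close> telescopes: the coefficients at pairs
  through \<open>m\<close> are those of the difference of the unit vectors at \<open>c x\<close> and
  \<open>c r\<close>. One path for each vertex outside \<open>R\<close> gives independent elements,
  and \<open>top\<close> makes them lead through \<open>m\<close>.\<close>

lemma row_bases:
 fixes X :: "nat set"
 assumes mr: "mono_rank N rk" "C \<subseteq> N" and fin: "finite X" "card X = card C"
  and M: "M \<subseteq> nsub 2 X" and R: "R \<subseteq> X" "R ~= {}" "\<And>x. x \<in> X ==> \<exists>r\<in>R. reach M r x"
  and m: "m \<in> C" and top: "\<And>S T. S \<in> nsub 2 C ==> T \<in> nsub 2 C ==> m \<in> S ==> m \<notin> T ==> rk T < rk S"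
 obtains v w where "dual_bases C X v (w :: nat => nat => 'k::field)"
  "card X - card R \<le> card (leads rk (fvs.span (vm v ` M)) \<inter> {S. m \<in> S})"
proof -
 have finC: "finite C" using mr by (auto simp: mono_rank_def intro: finite_subset)
 obtain x0 where x0: "x0 \<in> R" using R(2) by blast
 then have x0X: "x0 \<in> X" using R(1) by blast
 obtain c where c: "bij_betw c X C" "c x0 = m"
 proof -
  have "card (X - {x0}) = card (C - {m})" using fin finC x0X m by (simp add: card_Diff_singleton)
  then obtain f where "bij_betw f (X - {x0}) (C - {m})"
   using finite_same_card_bij[of "X - {x0}" "C - {m}"] fin(1) finC by auto
  moreover have "bij_betw (\<lambda>_. m) {x0} {m}" by (simp add: bij_betw_def)
  ultimately have "bij_betw (\<lambda>x. if x \<in> {x0} then m else f x) ({x0} \<union> (X - {x0})) ({m} \<union> (C - {m}))"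
   by (intro bij_betw_disjoint_Un) auto
  moreover have "{x0} \<union> (X - {x0}) = X" "{m} \<union> (C - {m}) = C" using x0X m by auto
  ultimately show thesis using that[of "\<lambda>x. if x \<in> {x0} then m else f x"] by simp
 qed
 have inj: "c x = c y \<longleftrightarrow> x = y" if "x \<in> X" "y \<in> X" for x y
  using c that by (auto simp: bij_betw_def inj_on_def)
 have cX: "c x \<in> C" if "x \<in> X" for x using c that by (auto simp: bij_betw_def)
 let ?Z = "X - {x0}"
 define v where "v = (\<lambda>x. if x \<in> ?Z then unitf (c x) + unitf (c x0) else unitf (c x) :: nat => 'k)"
 obtain w where b: "dual_bases C X v w"
  using fold_bases[OF c(1) fin(1), of ?Z "\<lambda>_. x0"] x0X unfolding v_def by blast
 let ?U = "fvs.span (vm v ` M)"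
 have v1: "v x m = 1" if "x \<in> X" for x
  using that inj[OF that x0X] c(2) by (auto simp: v_def unitf_def plus_fun_apply)
 have v2: "v x j = (if j = c x then 1 else 0)" if "x \<in> X" "j ~= m" for x j
  using that c(2) by (auto simp: v_def unitf_def plus_fun_apply)
 have path: "x \<in> X \<and> (\<exists>z\<in>?U. \<forall>j. j ~= m --> coef2 z m j = (if j = c x then 1 else 0) - (if j = c r then 1 else 0))"
  if "reach M r x" "r \<in> X" for r x
  using that(1)
 proof (induction rule: reach_induct)
  case base
  show ?case using that(2) by (auto intro!: bexI[of _ 0] fvs.span_zero simp: coef2_zero)
 next
  case (step y z)
  then obtain t where t: "t \<in> ?U" "\<forall>j. j ~= m --> coef2 t m j = (if j = c y then 1 else 0) - (if j = c r then 1 else 0)"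
   by blast
  have yz: "y \<in> X" "z \<in> X" using step.hyps M by auto
  have "t + wd (v y) (v z) \<in> ?U"
   by (rule fvs.span_add[OF t(1) wd_in_span_vm[OF step.hyps(3,2)]])
  moreover have "coef2 (t + wd (v y) (v z)) m j = (if j = c z then 1 else 0) - (if j = c r then 1 else 0)"
   if "j ~= m" for j
   using t(2) that by (simp add: coef2_add coef2_wd v1[OF yz(1)] v1[OF yz(2)] v2[OF yz(1) that] v2[OF yz(2) that])
  ultimately show ?case using yz(2) by blast
 qed
 let ?Y = "X - R"
 have "\<exists>z\<in>?U. \<forall>y\<in>?Y. coef2 z m (c y) = (if y = x then 1 else 0)" if x: "x \<in> ?Y" for x
 proof -
  obtain r where r: "r \<in> R" "reach M r x" using R(3) x by blast
  have rX: "r \<in> X" using r R(1) by blast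
  obtain z where z: "z \<in> ?U" "\<forall>j. j ~= m --> coef2 z m j = (if j = c x then 1 else 0) - (if j = c r then 1 else 0)"
   using path[OF r(2) rX] by blast
  have "coef2 z m (c y) = (if y = x then 1 else 0)" if y: "y \<in> ?Y" for y
  proof -
   have "c y ~= m" "c y ~= c r" "c y = c x \<longleftrightarrow> y = x"
    using inj[of y x0] inj[of y r] inj[of y x] x0 x0X rX r(1) x y c(2) by auto
   then show ?thesis using z(2) by simp
  qed
  then show ?thesis using z(1) by blast
 qed
 then obtain z where z: "\<And>x. x \<in> ?Y ==> z x \<in> ?U"
  "\<And>x y. x \<in> ?Y ==> y \<in> ?Y ==> coef2 (z x) m (c y) = (if y = x then 1 else 0)" by metis
 have zinj: "inj_on z ?Y"
 proof (rule inj_onI)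
  fix x y assume xy: "x \<in> ?Y" "y \<in> ?Y" "z x = z y"
  then show "x = y" using z(2)[OF xy(1,1)] z(2)[OF xy(2,1)] by (simp split: if_splits)
 qed
 have finY: "finite ?Y" using fin(1) by simp
 \<comment> \<open>These coefficients recover a linear combination completely. This yields
   independence and shows that every nonzero combination has a monomial through
   \<open>m\<close>.\<close>
 have co: "coef2 (\<Sum>b\<in>z ` ?Y. fscale (u b) b) m (c y) = u (z y)" if y: "y \<in> ?Y" for u y
 proof -
  have "coef2 (\<Sum>b\<in>z ` ?Y. fscale (u b) b) m (c y) = (\<Sum>x\<in>?Y. u (z x) * coef2 (z x) m (c y))"
   by (simp add: coef2_sum coef2_scale sum.reindex[OF zinj])
  also have "\<dots> = (\<Sum>x\<in>?Y. if y = x then u (z x) else 0)"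
   by (intro sum.cong refl) (simp add: z(2)[OF _ y])
  finally show ?thesis using finY y by simp
 qed
 have ind: "fvs.independent (z ` ?Y)"
 proof
  assume "fvs.dependent (z ` ?Y)"
  then obtain u where "\<exists>b\<in>z ` ?Y. u b ~= 0" "(\<Sum>b\<in>z ` ?Y. fscale (u b) b) = 0"
   using fvs.dependent_finite[of "z ` ?Y"] finY by auto
  then show False using co[of _ u] by (auto simp: coef2_zero)
 qed
 let ?J = "fvs.span (z ` ?Y)"
 have JU: "?J \<subseteq> ?U" using z(1) by (intro fvs.span_minimal) auto
 have US: "?U \<subseteq> fsupp (nsub 2 C)"
 proof (rule span_vm_subset[OF M])
  show "fvs.subspace (fsupp (nsub 2 C) :: 'k ext set)"
   by (rule subspace_fsupp)
  fix x y assume "{x, y} \<in> M" "x ~= y"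
  then have "x \<in> X" "y \<in> X" using M by auto
  then show "wd (v x) (v y) \<in> fsupp (nsub 2 C)"
   using b finC by (intro wd_fsupp) (auto simp: dual_bases_def)
 qed
 have inj2: "inj_on rk (nsub 2 C)"
  using mr by (auto simp: mono_rank_def nsub_def intro: inj_on_subset)
 have "card (z ` ?Y) \<le> card (leads rk ?J)"
 proof (rule card_le_leads[OF _ inj2 _ fvs.subspace_span ind fvs.span_superset])
  show "finite (nsub 2 C)" using finC by simp
  show "?J \<subseteq> fsupp (nsub 2 C)" using JU US by blast
 qed
 moreover have "leads rk ?J \<subseteq> leads rk ?U \<inter> {S. m \<in> S}"
 proof
  fix S assume "S \<in> leads rk ?J"
  then obtain p where p: "p \<in> ?J" "ld rk p S" by (auto simp: leads_def)
  obtain u where u: "p = (\<Sum>b\<in>z ` ?Y. fscale (u b) b)"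
   using p(1) fvs.span_finite[of "z ` ?Y"] finY by auto
  have "\<exists>y\<in>?Y. u (z y) ~= 0"
  proof (rule ccontr)
   assume "\<not> ?thesis"
   then have "p = 0" unfolding u by (intro sum.neutral) (auto simp: fscale_def zero_fun_def)
   then show False using p(2) by (simp add: ld_def zero_fun_apply)
  qed
  then obtain y where y: "y \<in> ?Y" "u (z y) ~= 0" by blast
  have cy: "c y ~= m" using inj[of y x0] y x0 x0X c(2) by auto
  have "coef2 p m (c y) ~= 0" using co[OF y(1)] y(2) u by simp
  then have py: "p {m, c y} ~= 0" using coef2_nonzero[of m "c y" p] cy by simp
  have SU: "S \<in> leads rk ?U" using p JU by (auto simp: leads_def)
  then have "S \<in> nsub 2 C" using leads_subset[OF US] by blast
  moreover have "rk {m, c y} \<le> rk S" using p(2) py by (simp add: ld_def)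
  moreover have "{m, c y} \<in> nsub 2 C" using m cX[of y] y cy by auto
  ultimately have "m \<in> S" using top[of "{m, c y}" S] by fastforce
  then show "S \<in> leads rk ?U \<inter> {S. m \<in> S}" using SU by blast
 qed
 moreover have "finite (leads rk ?U)" by (rule finite_subset[OF leads_subset[OF US] finite_nsub[OF finC]])
 ultimately have "card (z ` ?Y) \<le> card (leads rk ?U \<inter> {S. m \<in> S})"
  by (meson card_mono finite_Int le_trans)
 moreover have "card (z ` ?Y) = card X - card R"
  using card_image[OF zinj] card_Diff_subset[of R X] R(1) fin(1) finite_subset by metis
 ultimately show thesis using that[OF b] by simp
qed

text \<open>The vertices of \<open>R\<close> are placed outside \<open>P\<close>, where ranks are
  low, and each is folded onto a vertex \<open>g r\<close> of another component, whose coordinate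
  then leads. Thus all vectors lead inside \<open>P\<close>. The conditions on \<open>g\<close> keep
  the images of distinct edges distinct, so by counting there are no other leading pairs.\<close>

lemma folded_bases:
 fixes X :: "nat set"
 assumes mr: "mono_rank N rk" "C \<subseteq> N" and fin: "finite X" "card X = card C"
  and M: "M \<subseteq> nsub 2 X" and R: "R \<subseteq> X" "\<And>r s. r \<in> R ==> s \<in> R ==> reach M r s ==> r = s"
  and g: "\<And>r. r \<in> R ==> g r \<in> X - R" "\<And>r. r \<in> R ==> \<not> reach M r (g r)"
  and cross: "\<And>r s. r \<in> R ==> s \<in> R ==> {r, g s} \<in> M ==> {s, g r} \<in> M ==> r = s"
  and P: "P \<subseteq> C" "card P = card X - card R" "\<And>a b. a \<in> C - P ==> b \<in> P ==> rk {a} < rk {b}"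
 obtains v w where "dual_bases C X v (w :: nat => nat => 'k::field)"
  "leads rk (fvs.span (vm v ` M)) \<subseteq> Pow P"
proof -
 have finC: "finite C" using mr by (auto simp: mono_rank_def intro: finite_subset)
 have finR: "finite R" using R(1) fin(1) finite_subset by blast
 have "card R \<le> card X" using R(1) fin(1) by (intro card_mono)
 then have cards: "card R = card (C - P)" "card (X - R) = card P"
  using P(1,2) fin(2) finC finR R(1) by (simp_all add: card_Diff_subset finite_subset)
 obtain f where f: "bij_betw f R (C - P)"
  using finite_same_card_bij[OF finR _ cards(1)] finC by blast
 obtain h where h: "bij_betw h (X - R) P"
  using finite_same_card_bij[OF _ _ cards(2)] fin(1) finite_subset[OF P(1) finC] by blast
 define c where "c = (\<lambda>x. if x \<in> R then f x else h x)"
 have "bij_betw c (R \<union> (X - R)) ((C - P) \<union> P)"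
  unfolding c_def using f h by (intro bij_betw_disjoint_Un) auto
 moreover have "R \<union> (X - R) = X" "(C - P) \<union> P = C" using R(1) P(1) by auto
 ultimately have c: "bij_betw c X C" by simp
 have cR: "c x \<in> C - P" if "x \<in> R" for x using f that by (auto simp: c_def bij_betw_def)
 have cP: "c x \<in> P" if "x \<in> X - R" for x using h that by (auto simp: c_def bij_betw_def)
 define v where "v = (\<lambda>x. if x \<in> R then unitf (c x) + unitf (c (g x)) else unitf (c x) :: nat => 'k)"
 obtain w where b: "dual_bases C X v w"
  using fold_bases[OF c fin(1) R(1), of g] g(1) unfolding v_def by blast
 define \<phi> where "\<phi> x = (if x \<in> R then g x else x)" for x
 have \<phi>X: "\<phi> x \<in> X - R" if "x \<in> X" for x using g(1) that by (simp add: \<phi>_def)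
 have ldv: "ld (rk1 rk) (v x) (c (\<phi> x))" if x: "x \<in> X" for x
 proof (cases "x \<in> R")
  case True
  have "rk1 rk (c x) < rk1 rk (c (g x))" using P(3)[OF cR[OF True] cP[OF g(1)[OF True]]] .
  then show ?thesis using True by (auto simp: v_def \<phi>_def ld_def unitf_def plus_fun_apply split: if_splits)
 next
  case False
  then show ?thesis using ld_unitf by (simp add: v_def \<phi>_def)
 qed
 have sep: "r \<notin> R \<or> s \<notin> R" "\<phi> r ~= \<phi> s" if "{r, s} \<in> M" "r ~= s" for r s
 proof -
  have e: "reach M r s" "reach M s r" using reach_edge[of r s M] reach_edge[of s r M] that by (simp_all add: insert_commute)
  show 1: "r \<notin> R \<or> s \<notin> R" using R(2)[OF _ _ e(1)] that(2) by blast
  show "\<phi> r ~= \<phi> s" using 1 e g(2) that(2) by (auto simp: \<phi>_def)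
 qed
 have lead: "c ` \<phi> ` S \<in> leads rk (fvs.span (vm v ` M))" if S: "S \<in> M" for S
 proof -
  obtain x y where xy: "S = {x, y}" "x \<in> X" "y \<in> X" "x ~= y" using S M by (blast elim: nsub2E)
  have "c (\<phi> x) ~= c (\<phi> y)"
   using sep(2)[of x y] xy S c \<phi>X[OF xy(2)] \<phi>X[OF xy(3)] by (auto simp: bij_betw_def inj_on_def)
  moreover have "v x \<in> fsupp N" "v y \<in> fsupp N"
   using b xy mr(2) unfolding dual_bases_def fsupp_def by blast+
  ultimately have "ld rk (wd (v x) (v y)) {c (\<phi> x), c (\<phi> y)}"
   using ld_wd[OF mr(1)] ldv xy(2,3) by blast
  then show ?thesis using wd_in_span_vm[of x y M v] S xy(1,4) by (auto intro: leadsI)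
 qed
 \<comment> \<open>A coincidence of images would identify two representatives of one component,
   connect some \<open>r\<close> with \<open>g r\<close>, or be the double fold excluded by
   \<open>cross\<close>.\<close>
 have key: "{x, y} = {x', y'}" if M1: "{x, y} \<in> M" "x ~= y" "y \<notin> R" and M2: "{x', y'} \<in> M" "x' ~= y'" "y' \<notin> R"
  and eq: "{\<phi> x, y} = {\<phi> x', y'}" for x y x' y'
 proof -
  note e1 = reach_edge[OF M1(1)] and e2 = reach_edge[OF M2(1)]
  have eq': "\<phi> x = \<phi> x' \<and> y = y' \<or> \<phi> x = y' \<and> y = \<phi> x'" using eq by (auto simp: doubleton_eq_iff)
  have far: "\<not> (x \<in> R \<and> reach M x (g x))" "\<not> (x' \<in> R \<and> reach M x' (g x'))" using g(2) by blast+
  show ?thesis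
  proof (cases "x \<in> R"; cases "x' \<in> R")
   assume R1: "x \<in> R" "x' \<in> R"
   from eq' show ?thesis
   proof
    assume "\<phi> x = \<phi> x' \<and> y = y'"
    then show ?thesis using R(2)[OF R1 reach_trans[OF e1]] reach_sym[OF e2] by simp
   next
    assume h: "\<phi> x = y' \<and> y = \<phi> x'"
    then have "{x, g x'} \<in> M" "{x', g x} \<in> M" using M1(1) M2(1) R1 by (auto simp: \<phi>_def)
    then have "x = x'" by (rule cross[OF R1])
    then show ?thesis using h R1 by (simp add: \<phi>_def)
   qed
  next
   assume R1: "x \<in> R" "x' \<notin> R"
   from eq' show ?thesis
   proof
    assume h: "\<phi> x = \<phi> x' \<and> y = y'"
    then have "reach M x (g x)" using reach_trans[OF e1] reach_sym[OF e2] R1 by (simp add: \<phi>_def)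
    then show ?thesis using far R1 by blast
   next
    assume h: "\<phi> x = y' \<and> y = \<phi> x'"
    then have "reach M x (g x)" using reach_trans[OF e1] e2 R1 by (simp add: \<phi>_def)
    then show ?thesis using far R1 by blast
   qed
  next
   assume R1: "x \<notin> R" "x' \<in> R"
   from eq' show ?thesis
   proof
    assume h: "\<phi> x = \<phi> x' \<and> y = y'"
    then have "reach M x' (g x')" using reach_trans[OF e2] reach_sym[OF e1] R1 by (simp add: \<phi>_def)
    then show ?thesis using far R1 by blast
   next
    assume h: "\<phi> x = y' \<and> y = \<phi> x'"
    then have "reach M x' (g x')" using reach_trans[OF e2] e1 R1 by (simp add: \<phi>_def)
    then show ?thesis using far R1 by blast
   qed
  next
   assume "x \<notin> R" "x' \<notin> R"
   then show ?thesis using eq by (simp add: \<phi>_def)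
  qed
 qed
 have inj\<phi>: "inj_on (\<lambda>S. \<phi> ` S) M"
 proof (rule inj_onI)
  fix S T assume S: "S \<in> M" and T: "T \<in> M" and eq: "\<phi> ` S = \<phi> ` T"
  have norm: "\<exists>x y. S = {x, y} \<and> x ~= y \<and> y \<notin> R" if S: "S \<in> M" for S
  proof -
   obtain x y where xy: "S = {x, y}" "x ~= y" using S M by (blast elim: nsub2E)
   then show ?thesis using sep(1)[of x y] S by (metis insert_commute)
  qed
  obtain x y where xy: "S = {x, y}" "x ~= y" "y \<notin> R" using norm[OF S] by blast
  obtain x' y' where xy': "T = {x', y'}" "x' ~= y'" "y' \<notin> R" using norm[OF T] by blast
  have "\<phi> y = y" "\<phi> y' = y'" using xy(3) xy'(3) by (simp_all add: \<phi>_def)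
  then have "{\<phi> x, y} = {\<phi> x', y'}" using eq xy(1) xy'(1) by simp
  then show "S = T" using key[of x y x' y'] xy xy' S T by simp
 qed
 have injc: "inj_on (\<lambda>S. c ` \<phi> ` S) M"
 proof (rule inj_onI)
  fix S T assume ST: "S \<in> M" "T \<in> M" "c ` \<phi> ` S = c ` \<phi> ` T"
  have "\<phi> ` S \<subseteq> X" "\<phi> ` T \<subseteq> X" using ST(1,2) M \<phi>X by (auto simp: nsub_def)
  then have "\<phi> ` S = \<phi> ` T" using ST(3) c inj_on_image_eq_iff[of c X] by (simp add: bij_betw_def)
  then show "S = T" using inj\<phi> ST by (auto dest: inj_onD)
 qed
 let ?L = "leads rk (fvs.span (vm v ` M))"
 note L = card_leads_vm[OF b mr M]
 have "(\<lambda>S. c ` \<phi> ` S) ` M \<subseteq> ?L" using lead by blast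
 moreover have "card ((\<lambda>S. c ` \<phi> ` S) ` M) = card ?L" using card_image[OF injc] L(1) by simp
 moreover have "finite ?L" using L(2) finC finite_subset finite_nsub by blast
 ultimately have "(\<lambda>S. c ` \<phi> ` S) ` M = ?L" by (rule card_subset_eq[rotated])
 moreover have "c ` \<phi> ` S \<subseteq> P" if "S \<in> M" for S
 proof -
  have "S \<subseteq> X" using that M by (auto simp: nsub_def)
  then show ?thesis using \<phi>X cP by blast
 qed
 ultimately have "?L \<subseteq> Pow P" using image_subsetI[of M "\<lambda>S. c ` \<phi> ` S" "Pow P"] by simp
 then show thesis by (rule that[OF b])
qed

text \<open>Take \<open>g r = \<tau> (\<pi> r)\<close>, where \<pi> moves each representative to
  another component and \<tau> picks a different vertex in the component reached. The last property
  can fail only at a 2-cycle of \<pi> both of whose members are adjacent to their \<tau>; each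
  alternative in \<open>bad\<close> offers a way to avoid this.\<close>

lemma bad_folding:
 assumes F: "F \<subseteq> nsub 2 X" and bad: "bad X F"
 obtains R g where "R \<subseteq> X" "R ~= {}" "\<And>x. x \<in> X ==> \<exists>r\<in>R. reach F r x"
  "\<And>r s. r \<in> R ==> s \<in> R ==> reach F r s ==> r = s"
  "\<And>r. r \<in> R ==> g r \<in> X - R" "\<And>r. r \<in> R ==> \<not> reach F r (g r)"
  "\<And>r s. r \<in> R ==> s \<in> R ==> {r, g s} \<in> F ==> {s, g r} \<in> F ==> r = s"
proof -
 note result = that
 have reps: "\<exists>rep. (\<forall>x\<in>X. rep x \<in> X \<and> reach F x (rep x)) \<and> (\<forall>x y. reach F x y --> rep x = rep y) \<and> rep s = s"
  if s: "s \<in> X" for s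
 proof -
  define rep where "rep x = (if reach F s x then s else SOME y. y \<in> X \<and> reach F x y)" for x
  have "rep x \<in> X \<and> reach F x (rep x)" if "x \<in> X" for x
  proof (cases "reach F s x")
   case True
   then show ?thesis using s reach_sym by (simp add: rep_def)
  next
   case False
   have "x \<in> X \<and> reach F x x" using that by simp
   then have "(SOME y. y \<in> X \<and> reach F x y) \<in> X \<and> reach F x (SOME y. y \<in> X \<and> reach F x y)" by (rule someI)
   then show ?thesis using False by (simp add: rep_def)
  qed
  moreover have "rep x = rep y" if xy: "reach F x y" for x y
  proof -
   have "reach F a x \<longleftrightarrow> reach F a y" "reach F x a \<longleftrightarrow> reach F y a" for a
    using xy reach_trans reach_sym by blast+
   then show ?thesis by (simp add: rep_def)
  qed
  moreover have "rep s = s" by (simp add: rep_def)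
  ultimately show ?thesis by blast
 qed
 have final: thesis
  if rep: "\<And>x. x \<in> X ==> rep x \<in> X" "\<And>x. x \<in> X ==> reach F x (rep x)" "\<And>x y. reach F x y ==> rep x = rep y"
   and pi: "\<And>r. r \<in> rep ` X ==> \<pi> r \<in> rep ` X" "\<And>r. r \<in> rep ` X ==> \<pi> r ~= r"
   and tau: "\<And>r. r \<in> rep ` X ==> \<tau> r \<in> X" "\<And>r. r \<in> rep ` X ==> \<tau> r ~= r" "\<And>r. r \<in> rep ` X ==> reach F r (\<tau> r)"
   and two: "\<And>r s. r \<in> rep ` X ==> s \<in> rep ` X ==> r = \<pi> s ==> s = \<pi> r ==> {r, \<tau> r} \<in> F ==> {s, \<tau> s} \<in> F ==> False"
   and ne: "X ~= {}"
  for rep \<pi> \<tau>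
 proof -
  let ?R = "rep ` X"
  have rr: "rep r = r" if r: "r \<in> ?R" for r
  proof -
   obtain x where "x \<in> X" "r = rep x" using r by blast
   then show ?thesis using rep(3)[OF rep(2)] by simp
  qed
  have uniq: "r = s" if "r \<in> ?R" "s \<in> ?R" "reach F r s" for r s
   using rep(3)[OF that(3)] rr[OF that(1)] rr[OF that(2)] by simp
  have home: "r = \<pi> s" if "r \<in> ?R" "s \<in> ?R" "reach F r (\<tau> (\<pi> s))" for r s
   by (rule uniq[OF that(1) pi(1)[OF that(2)] reach_trans[OF that(3) reach_sym[OF tau(3)[OF pi(1)[OF that(2)]]]]])
  show thesis
  proof (rule result[of ?R "\<lambda>r. \<tau> (\<pi> r)"])
   show "?R \<subseteq> X" using rep(1) by blast
   show "?R ~= {}" using ne by blast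
   show "\<exists>r\<in>?R. reach F r x" if "x \<in> X" for x using rep(2)[OF that] that reach_sym by blast
   show "r = s" if "r \<in> ?R" "s \<in> ?R" "reach F r s" for r s by (rule uniq[OF that])
   fix r assume r: "r \<in> ?R"
   have "\<tau> (\<pi> r) \<notin> ?R" using uniq[OF pi(1)[OF r], of "\<tau> (\<pi> r)"] tau(2,3)[OF pi(1)[OF r]] by metis
   then show "\<tau> (\<pi> r) \<in> X - ?R" using tau(1)[OF pi(1)[OF r]] by blast
   show "\<not> reach F r (\<tau> (\<pi> r))" using home[OF r r] pi(2)[OF r] by metis
  next
   fix r s assume rs: "r \<in> ?R" "s \<in> ?R" "{r, \<tau> (\<pi> s)} \<in> F" "{s, \<tau> (\<pi> r)} \<in> F"
   have "r = \<pi> s" "s = \<pi> r" using home[OF rs(1,2)] home[OF rs(2,1)] reach_edge rs(3,4) by blast+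
   then show "r = s" using two[OF rs(1,2)] rs(3,4) by metis
  qed
 qed
 have ex: "\<exists>y. y \<in> X \<and> y ~= x \<and> reach F x y" if "x \<in> X" for x
 proof -
  obtain y where y: "y ~= x" "{x, y} \<in> F" using bad \<open>x \<in> X\<close> unfolding bad_def by blast
  then have "{x, y} \<in> nsub 2 X" using F by blast
  then show ?thesis using y reach_edge[OF y(2)] by auto
 qed
 then obtain \<tau> where \<tau>: "\<And>x. x \<in> X ==> \<tau> x \<in> X" "\<And>x. x \<in> X ==> \<tau> x ~= x" "\<And>x. x \<in> X ==> reach F x (\<tau> x)"
  by metis
 consider x y z where "x \<in> X" "y \<in> X" "z \<in> X" "\<not> reach F x y" "\<not> reach F y z" "\<not> reach F x z"
  | s t u where "s \<in> X" "reach F s t" "s ~= t" "{s, t} \<notin> F" "u \<in> X" "\<not> reach F s u"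
 proof -
  have "\<exists>u\<in>X. \<not> reach F s u" for s
  proof -
   obtain p q where "p \<in> X" "q \<in> X" "\<not> reach F p q" using bad by (auto simp: bad_def conn_def)
   then show ?thesis using reach_trans[of F p s q] reach_sym[of F s p] by blast
  qed
  then show thesis using bad that unfolding bad_def by metis
 qed
 then show thesis
 proof cases
  case 1
  obtain rep where rep: "\<And>x. x \<in> X ==> rep x \<in> X" "\<And>x. x \<in> X ==> reach F x (rep x)" "\<And>x y. reach F x y ==> rep x = rep y"
   using reps[OF 1(1)] by blast
  have diff: "rep p ~= rep q" if "p \<in> X" "q \<in> X" "\<not> reach F p q" for p q
  proof
   assume "rep p = rep q"
   then have "reach F p (rep q)" using rep(2)[OF that(1)] by simp
   then show False using reach_trans[OF _ reach_sym[OF rep(2)[OF that(2)]]] that(3) by blast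
  qed
  have d: "rep x ~= rep y" "rep y ~= rep z" "rep x ~= rep z" using diff 1 by blast+
  show ?thesis
  \<comment> \<open>Three representatives are permuted cyclically and all others go to the first of
    them, so \<pi> has no 2-cycle.\<close>
  proof (rule final[of rep "\<lambda>r. if r = rep x then rep y else if r = rep y then rep z else rep x" \<tau>])
   show "(if r = rep x then rep y else if r = rep y then rep z else rep x) \<in> rep ` X" for r using 1(1-3) by simp
   show "(if r = rep x then rep y else if r = rep y then rep z else rep x) ~= r" for r using d by auto
   show "\<tau> r \<in> X" "\<tau> r ~= r" "reach F r (\<tau> r)" if "r \<in> rep ` X" for r using that \<tau> rep(1) by blast+
   show False if "r = (if s = rep x then rep y else if s = rep y then rep z else rep x)"
    "s = (if r = rep x then rep y else if r = rep y then rep z else rep x)" for r s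
    using that d by (metis (full_types))
  qed (use rep 1(1) in auto)
 next
  case 2
  obtain rep where rep: "\<And>x. x \<in> X ==> rep x \<in> X" "\<And>x. x \<in> X ==> reach F x (rep x)" "\<And>x y. reach F x y ==> rep x = rep y"
   "rep s = s" using reps[OF 2(1)] by blast
  have tX: "t \<in> X" by (rule reach_closed[OF 2(2) F 2(1)])
  have su: "s ~= rep u" using rep(2)[OF 2(5)] 2(6) reach_sym by metis
  have sR: "s \<in> rep ` X" using rep(4) 2(1) by (metis imageI)
  show ?thesis
  \<comment> \<open>The only 2-cycle of \<pi> consists of \<open>s\<close> and \<open>rep u\<close>;
    there \<tau> is redefined at \<open>s\<close> as the nonneighbour \<open>t\<close>.\<close>
  proof (rule final[of rep "\<lambda>r. if r = s then rep u else s" "\<tau>(s := t)"])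
   show "(if r = s then rep u else s) \<in> rep ` X" for r using sR 2(5) by simp
   show "(if r = s then rep u else s) ~= r" for r using su by auto
   show "(\<tau>(s := t)) r \<in> X" "(\<tau>(s := t)) r ~= r" "reach F r ((\<tau>(s := t)) r)" if "r \<in> rep ` X" for r
    using that \<tau> rep(1) 2(2,3) tX by auto
   show False if "p = (if q = s then rep u else s)" "q = (if p = s then rep u else s)"
    "{p, (\<tau>(s := t)) p} \<in> F" "{q, (\<tau>(s := t)) q} \<in> F" for p q
    using that 2(4) su by (auto split: if_splits)
  qed (use rep 2(1) in auto)
 qed
qed

subsection \<open>Lexicographic and reverse lexicographic orders\<close>

lemma mono_rank_sum:
 fixes u :: "nat => nat"
 assumes "inj_on (sum u) (Pow {1..n})"
 shows "mono_rank {1..n} (sum u)"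
 unfolding mono_rank_def
proof (intro conjI allI impI)
 fix S T U assume h: "S \<subseteq> {1..n}" "T \<subseteq> {1..n}" "U \<subseteq> {1..n}" "S \<inter> U = {}" "T \<inter> U = {}" "sum u S < sum u T"
 have "finite S" "finite T" "finite U" using h(1-3) finite_subset by blast+
 then show "sum u (S \<union> U) < sum u (T \<union> U)" using h by (simp add: sum.union_disjoint)
qed (use assms in simp_all)

lemma standard_term_order_sum:
 fixes u :: "nat => nat"
 assumes inj: "inj_on (sum u) (Pow {1..n})" and dec: "\<And>i j. i \<in> {1..n} ==> j \<in> {1..n} ==> i < j ==> u j < u i"
 shows "standard_term_order n {(S, T). S \<subseteq> {1..n} \<and> T \<subseteq> {1..n} \<and> sum u S \<le> sum u T}"
  (is "standard_term_order n ?\<sigma>")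
proof -
 have "linear_order_on (Pow {1..n}) ?\<sigma>"
  unfolding linear_order_on_def partial_order_on_def preorder_on_def
 proof (intro conjI)
  show "refl_on (Pow {1..n}) ?\<sigma>" by (auto simp: refl_on_def)
  show "trans ?\<sigma>" by (auto simp: trans_def)
  show "antisym ?\<sigma>" using inj by (auto simp: antisym_def inj_on_def)
  show "total_on (Pow {1..n}) ?\<sigma>" by (auto simp: total_on_def)
 qed auto
 moreover have "(S \<union> U, T \<union> U) \<in> ?\<sigma>"
  if h: "U \<subseteq> {1..n}" "(S, T) \<in> ?\<sigma>" "S \<inter> U = {}" "T \<inter> U = {}" for S T U
 proof -
  have "finite S" "finite T" "finite U" using h(1,2) finite_subset[OF _ finite_atLeastAtMost] by blast+
  then show ?thesis using h by (auto simp: sum.union_disjoint)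
 qed
 moreover have "({j}, {i}) \<in> ?\<sigma>" if "i \<in> {1..n}" "j \<in> {1..n}" "i < j" for i j
  using dec[OF that] that by simp
 ultimately show ?thesis unfolding standard_term_order_def term_order_def by auto
qed

text \<open>A set becomes a binary number whose leading digits belong to its smallest elements, so
  sums of weights order sets lexicographically and separate them.\<close>

abbreviation lexw :: "nat => nat => nat" where "lexw n \<equiv> (\<lambda>i. 2 ^ (n - i))"

text \<open>The summand \<open>2 ^ (n + 1)\<close> makes the degree decisive; among sets of equal
  size, subtracting \<open>2 ^ i\<close> puts those with large elements last, which is the reverse
  lexicographic order.\<close>

abbreviation revw :: "nat => nat => nat" where "revw n \<equiv> (\<lambda>i. 2 ^ (n + 1) - 2 ^ i)"

lemma set_encode_less: "S \<subseteq> {..<m} ==> set_encode S < 2 ^ m"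
proof -
 have "(\<Sum>i<k. 2 ^ i) < (2 ^ k :: nat)" for k by (induction k) auto
 moreover assume "S \<subseteq> {..<m}"
 then have "set_encode S \<le> (\<Sum>i<m. 2 ^ i)" unfolding set_encode_def by (intro sum_mono2) auto
 ultimately show ?thesis using le_less_trans by blast
qed

lemma sum_lexw: "S \<subseteq> {1..n} ==> sum (lexw n) S = set_encode ((\<lambda>i. n - i) ` S)"
proof -
 assume S: "S \<subseteq> {1..n}"
 have "inj_on (\<lambda>i. n - i) {1..n}" by (rule inj_onI) auto
 then have "inj_on (\<lambda>i. n - i) S" using S by (rule inj_on_subset)
 then show ?thesis unfolding set_encode_def by (simp add: sum.reindex)
qed

lemma sum_revw: "S \<subseteq> {1..n} ==> sum (revw n) S + set_encode S = card S * 2 ^ (n + 1)"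
proof -
 assume S: "S \<subseteq> {1..n}"
 have "sum (revw n) S + set_encode S = (\<Sum>i\<in>S. (2 ^ (n + 1) - 2 ^ i) + 2 ^ i)"
  by (simp add: set_encode_def sum.distrib)
 also have "\<dots> = (\<Sum>i\<in>S. 2 ^ (n + 1))"
 proof (rule sum.cong[OF refl])
  fix i assume "i \<in> S"
  then have "i \<le> n + 1" using S by auto
  then have "(2 ^ i :: nat) \<le> 2 ^ (n + 1)" by (rule power_increasing) simp
  then show "(2 ^ (n + 1) - 2 ^ i) + 2 ^ i = (2 ^ (n + 1) :: nat)" by simp
 qed
 finally show ?thesis by simp
qed

lemma inj_lexw: "inj_on (sum (lexw n)) (Pow {1..n})"
proof (rule inj_onI)
 fix S T assume h: "S \<in> Pow {1..n}" "T \<in> Pow {1..n}" "sum (lexw n) S = sum (lexw n) T"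
 have fin: "finite S" "finite T" using h(1,2) finite_subset[OF _ finite_atLeastAtMost] by blast+
 have "set_encode ((\<lambda>i. n - i) ` S) = set_encode ((\<lambda>i. n - i) ` T)"
  using h sum_lexw[of S n] sum_lexw[of T n] by simp
 then have eq: "(\<lambda>i. n - i) ` S = (\<lambda>i. n - i) ` T" using set_encode_eq[OF finite_imageI[OF fin(1)] finite_imageI[OF fin(2)]] by simp
 have "inj_on (\<lambda>i. n - i) {1..n}" by (rule inj_onI) auto
 then show "S = T" using eq h by (simp add: inj_on_image_eq_iff)
qed

lemma inj_revw: "inj_on (sum (revw n)) (Pow {1..n})"
proof (rule inj_onI)
 fix S T assume h: "S \<in> Pow {1..n}" "T \<in> Pow {1..n}" "sum (revw n) S = sum (revw n) T"
 have fin: "finite S" "finite T" using h(1,2) finite_subset[OF _ finite_atLeastAtMost] by blast+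
 have no: "\<not> card A < card B" if "A \<subseteq> {1..n}" "B \<subseteq> {1..n}" "sum (revw n) A = sum (revw n) B" for A B
 proof
  assume "card A < card B"
  then have "(card A + 1) * 2 ^ (n + 1) \<le> card B * 2 ^ (n + 1)" by (intro mult_right_mono) auto
  moreover have "set_encode B < 2 ^ (n + 1)" using that(2) by (intro set_encode_less) auto
  ultimately show False using sum_revw[OF that(1)] sum_revw[OF that(2)] that(3) by (simp add: algebra_simps)
 qed
 have "card S = card T" using no[of S T] no[of T S] h by (simp add: linorder_neq_iff)
 then have "set_encode S = set_encode T" using sum_revw[of S n] sum_revw[of T n] h by simp
 then show "S = T" using set_encode_eq[OF fin] by simp
qed

lemma lexw_less: "i \<in> {1..n} ==> j \<in> {1..n} ==> i < j ==> lexw n j < lexw n i"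
 by simp

lemma revw_less: "i \<in> {1..n} ==> j \<in> {1..n} ==> i < j ==> revw n j < revw n i"
proof -
 assume h: "i \<in> {1..n}" "j \<in> {1..n}" "i < j"
 have "(2 ^ i :: nat) < 2 ^ j" using h by simp
 moreover have "(2 ^ j :: nat) < 2 ^ (n + 1)" using h by (intro power_strict_increasing) auto
 ultimately show ?thesis by linarith
qed

section \<open>Initial segments and the pairs of highest rank\<close>

definition initial :: "nat set => nat set => bool" where
 "initial P C \<longleftrightarrow> P \<subseteq> C \<and> (\<forall>a\<in>P. \<forall>b\<in>C - P. a < b)"

lemma initial_exists:
 assumes "finite C" "k \<le> card C"
 obtains P where "initial P C" "card P = k"
proof -
 have "\<exists>P. initial P C \<and> card P = k"
  using assms
 proof (induction "card C - k" arbitrary: C)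
  case 0
  then show ?case by (intro exI[of _ C]) (auto simp: initial_def)
 next
  case (Suc m)
  then have ne: "C ~= {}" by auto
  let ?b = "Max C"
  have b: "?b \<in> C" using ne Suc.prems by simp
  then have c: "card (C - {?b}) = card C - 1" using Suc.prems by simp
  then have "m = card (C - {?b}) - k" "k \<le> card (C - {?b})" using Suc.hyps(2) Suc.prems by auto
  then obtain P where P: "initial P (C - {?b})" "card P = k" using Suc.hyps(1)[of "C - {?b}"] Suc.prems by auto
  have "x < ?b" if "x \<in> P" for x
  proof -
   have "x \<in> C" "x ~= ?b" using that P(1) by (auto simp: initial_def)
   then show ?thesis using Max_ge[OF Suc.prems(1), of x] by linarith
  qed
  then have "initial P C" using P(1) by (auto simp: initial_def)
  then show ?case using P(2) by blast
 qed
 then show thesis using that by blast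
qed

text \<open>\<open>S\<close> has an element below all of \<open>T\<close>, and its weight alone
  exceeds the sum of all lower powers of two.\<close>

lemma lex_top:
 assumes C: "C \<subseteq> {1..n}" and P: "initial P C" and S: "S \<in> nsub 2 C" "S \<inter> P ~= {}" and T: "T \<in> nsub 2 C" "T \<inter> P = {}"
 shows "sum (lexw n) T < sum (lexw n) S"
proof -
 obtain i where i: "i \<in> S" "i \<in> P" using S(2) by blast
 have ST: "S \<subseteq> {1..n}" "T \<subseteq> {1..n}" using S T C by (auto simp: nsub_def)
 have "(\<lambda>i. n - i) ` T \<subseteq> {..<n - i}"
 proof (rule image_subsetI)
  fix t assume t: "t \<in> T"
  then have "t \<in> C - P" "t \<in> {1..n}" using T ST by (auto simp: nsub_def)
  then have "i < t" "t \<le> n" using P i(2) by (auto simp: initial_def)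
  then show "n - t \<in> {..<n - i}" by simp
 qed
 then have "sum (lexw n) T < 2 ^ (n - i)" using sum_lexw[OF ST(2)] set_encode_less by simp
 also have "\<dots> \<le> sum (lexw n) S"
  using i(1) finite_subset[OF ST(1)] by (intro member_le_sum[of i S "lexw n"]) auto
 finally show ?thesis .
qed

text \<open>\<open>T\<close> has an element beyond all of \<open>S\<close>, so its binary code is
  larger, while the degrees agree.\<close>

lemma rev_top:
 assumes C: "C \<subseteq> {1..n}" and P: "initial P C" and S: "S \<in> nsub 2 C" "S \<subseteq> P" and T: "T \<in> nsub 2 C" "\<not> T \<subseteq> P"
 shows "sum (revw n) T < sum (revw n) S"
proof -
 obtain t where t: "t \<in> T" "t \<notin> P" using T(2) by blast
 have ST: "S \<subseteq> {1..n}" "T \<subseteq> {1..n}" "card S = 2" "card T = 2" "t \<in> C" using S T C t by (auto simp: nsub_def)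
 have "S \<subseteq> {..<t}" using P S(2) t(2) ST(5) by (auto simp: initial_def)
 then have "set_encode S < 2 ^ t" by (rule set_encode_less)
 also have "\<dots> \<le> set_encode T"
  unfolding set_encode_def using t(1) finite_subset[OF ST(2)] by (intro member_le_sum) auto
 finally show ?thesis using sum_revw[OF ST(1)] sum_revw[OF ST(2)] ST(3,4) by simp
qed

text \<open>What is kept of genericity: bounds valid in all coordinates, but only for the sets of
  top pairs described by \<open>lex_top\<close> and \<open>rev_top\<close>. In this form they can be
  restricted to fewer vertices.\<close>

definition dominates :: "nat => nat set => nat set set => (nat => nat => 'k::field) => nat set set => bool" where
 "dominates n C D v M \<longleftrightarrow> (\<forall>P. initial P C -->
   card (leads (sum (lexw n)) (fvs.span (vm v ` M)) \<inter> {S. S \<inter> P ~= {}}) \<le> card (D \<inter> {S. S \<inter> P ~= {}}) \<and>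
   card (leads (sum (revw n)) (fvs.span (vm v ` M)) \<inter> Pow P) \<le> card (D \<inter> Pow P))"

text \<open>\<open>D\<close> plays the part of the degree 2 component of the common generic initial
  ideal, living on the coordinates \<open>C\<close>. The type argument fixes the field, which does
  not occur among the values.\<close>

definition common_gin :: "'k::field itself => nat => nat set => nat set set => nat set => nat set set => bool" where
 "common_gin _ n X M C D \<longleftrightarrow> C \<subseteq> {1..n} \<and> card C = card X \<and> D \<subseteq> nsub 2 C \<and> card D = card M \<and>
   (\<forall>v w. dual_bases C X v (w :: nat => nat => 'k) --> dominates n C D v M)"

lemmas lex_rank = mono_rank_sum[OF inj_lexw]
lemmas rev_rank = mono_rank_sum[OF inj_revw]

lemma unit_bases:
 assumes "finite X" "finite C" "card X = card C"
 obtains v and w :: "nat => nat => 'k::field" where "dual_bases C X v w"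
proof -
 obtain c where "bij_betw c X C" using finite_same_card_bij[OF assms] by blast
 from fold_bases[OF this assms(1), of "{}" "\<lambda>x. x"] show thesis using that by blast
qed

lemma extend_bases:
 fixes v w :: "nat => nat => 'k::field"
 assumes b: "dual_bases C X v w" and new: "a \<notin> C" "k \<notin> X"
 obtains w' where "dual_bases (insert a C) (insert k X) (v(k := unitf a)) w'"
proof -
 let ?v = "v(k := unitf a)" and ?w = "\<lambda>x. if x = k then unitf a else (w x)(a := 0)"
 have fin: "finite C" "finite X" using b by (simp_all add: dual_bases_def)
 have va: "v x a = 0" if "x \<in> X" for x using b that new(1) by (auto simp: dual_bases_def fsupp_def)
 have "dual_bases (insert a C) (insert k X) ?v ?w"
  unfolding dual_bases_def
 proof (intro conjI ballI)
  show "finite (insert a C)" "finite (insert k X)" "card (insert k X) = card (insert a C)"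
   using b new by (simp_all add: dual_bases_def)
  show "?v x \<in> fsupp (insert a C)" if "x \<in> insert k X" for x
   using that b by (auto simp: dual_bases_def fsupp_def unitf_def split: if_splits)
  fix x y assume xy: "x \<in> insert k X" "y \<in> insert k X"
  have C: "(\<Sum>c\<in>C. ?w x c * ?v y c) = (if x = k \<or> y = k then 0 else \<Sum>c\<in>C. w x c * v y c)"
   using new(1) by (auto simp: unitf_def intro!: sum.neutral sum.cong)
  have "(\<Sum>c\<in>insert a C. ?w x c * ?v y c) = ?w x a * ?v y a + (if x = k \<or> y = k then 0 else \<Sum>c\<in>C. w x c * v y c)"
   using fin(1) new(1) C by simp
  also have "\<dots> = (if x = y then 1 else 0)"
   using xy b va new(2) by (auto simp: dual_bases_def unitf_def)
  finally show "(\<Sum>c\<in>insert a C. ?w x c * ?v y c) = (if x = y then 1 else 0)" .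
 next
  fix p q assume pq: "p \<in> insert a C" "q \<in> insert a C"
  have X: "(\<Sum>x\<in>X. ?v x p * ?w x q) = (if p = a \<or> q = a then 0 else \<Sum>x\<in>X. v x p * w x q)"
   using new(2) va by (auto intro!: sum.neutral sum.cong)
  have "(\<Sum>x\<in>insert k X. ?v x p * ?w x q) = unitf a p * unitf a q + (if p = a \<or> q = a then 0 else \<Sum>x\<in>X. v x p * w x q)"
   using fin(2) new(2) X by simp
  also have "\<dots> = (if p = q then 1 else 0)"
   using pq b new(1) by (auto simp: dual_bases_def unitf_def)
  finally show "(\<Sum>x\<in>insert k X. ?v x p * ?w x q) = (if p = q then 1 else 0)" .
 qed
 then show thesis by (rule that)
qed

text \<open>Bookkeeping for both orders: the star \<open>s\<close> of the removed vertex contributes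
  equally to both sides and is subtracted.\<close>

lemma count_step:
 assumes fin: "finite L" "finite D" and L: "s \<union> L0 \<subseteq> L" "L0 \<inter> s = {}" and D: "D \<subseteq> s \<union> D0"
  and AB: "A \<subseteq> B" "D0 \<inter> B \<subseteq> A" "D0 \<subseteq> D" and le: "card (L \<inter> B) \<le> card (D \<inter> B)"
 shows "card (L0 \<inter> A) \<le> card (D0 \<inter> A)"
proof -
 have f: "finite L0" "finite s" "finite D0" using L(1) fin AB(3) finite_subset by blast+
 have "card (L0 \<inter> A) + card (s \<inter> B) = card ((L0 \<inter> A) \<union> (s \<inter> B))"
  using f L(2) by (intro card_Un_disjoint[symmetric]) auto
 also have "\<dots> \<le> card (L \<inter> B)" using L(1) AB(1) fin by (intro card_mono) auto
 also have "\<dots> \<le> card (D \<inter> B)" by (rule le)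
 also have "\<dots> \<le> card ((s \<inter> B) \<union> (D0 \<inter> A))" using D AB f by (intro card_mono) auto
 also have "\<dots> \<le> card (s \<inter> B) + card (D0 \<inter> A)" by (rule card_Un_le)
 finally show ?thesis by simp
qed

lemma leads_pairs:
 assumes "dual_bases C X v w" "M \<subseteq> nsub 2 X" "C \<subseteq> {1..n}"
 shows "card (leads (sum (lexw n)) (fvs.span (vm v ` M))) = card M" "leads (sum (lexw n)) (fvs.span (vm v ` M)) \<subseteq> nsub 2 C"
  "card (leads (sum (revw n)) (fvs.span (vm v ` M))) = card M" "leads (sum (revw n)) (fvs.span (vm v ` M)) \<subseteq> nsub 2 C"
 using card_leads_vm[OF assms(1) lex_rank assms(3,2)] card_leads_vm[OF assms(1) rev_rank assms(3,2)] by blast+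

lemma initial_Min:
 assumes "finite C" "C ~= {}"
 shows "initial {Min C} C" "initial P (C - {Min C}) ==> initial (insert (Min C) P) C"
proof -
 have less: "Min C < x" if "x \<in> C" "x ~= Min C" for x
  using Min_le[OF assms(1) that(1)] that(2) by linarith
 then show "initial {Min C} C" using assms by (auto simp: initial_def)
 show "initial P (C - {Min C}) ==> initial (insert (Min C) P) C"
  using less assms by (auto simp: initial_def)
qed

lemma initial_Max:
 assumes "finite C" "C ~= {}"
 shows "initial (C - {Max C}) C" "initial P (C - {Max C}) ==> initial P C"
proof -
 have less: "x < Max C" if "x \<in> C" "x ~= Max C" for x
  using Max_ge[OF assms(1) that(1)] that(2) by linarith
 then show "initial (C - {Max C}) C" using assms by (auto simp: initial_def)
 show "initial P (C - {Max C}) ==> initial P C"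
  using less by (auto simp: initial_def)
qed

text \<open>Coordinates on the smaller set are extended by the unit vector of \<open>Min C\<close>
  for \<open>k\<close>. Then the full star of \<open>Min C\<close> leads, and domination for the
  initial segment \<open>{Min C}\<close> forces it into \<open>D\<close>; afterwards it is
  subtracted on both sides.\<close>

lemma common_gin_univ:
 assumes fin: "finite X" and M: "M \<subseteq> nsub 2 X" "univ X M k" and cg: "common_gin TYPE('k::field) n X M C D"
 shows "common_gin TYPE('k) n (X - {k}) (del M k) (C - {Min C}) (del D (Min C))"
proof -
 let ?a = "Min C"
 have C: "C \<subseteq> {1..n}" "card C = card X" "D \<subseteq> nsub 2 C" "card D = card M" using cg by (simp_all add: common_gin_def)
 have dom: "dominates n C D v M" if "dual_bases C X v w" for v w :: "nat => nat => 'k"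
  using cg that by (auto simp: common_gin_def)
 have finC: "finite C" using C(1) finite_subset by blast
 have kX: "k \<in> X" using M(2) by (simp add: univ_def)
 then have ne: "C ~= {}" using C(2) fin by (metis card_eq_0_iff empty_iff)
 have a: "?a \<in> C" using finC ne by simp
 have finD: "finite D" using C(3) finC finite_subset finite_nsub by blast
 have core: "\<exists>v w. dual_bases C X v (w :: nat => nat => 'k) \<and>
   star C ?a \<union> leads (sum (lexw n)) (fvs.span (vm v0 ` del M k)) \<subseteq> leads (sum (lexw n)) (fvs.span (vm v ` M)) \<and>
   star C ?a \<union> leads (sum (revw n)) (fvs.span (vm v0 ` del M k)) \<subseteq> leads (sum (revw n)) (fvs.span (vm v ` M))"
  if b0: "dual_bases (C - {?a}) (X - {k}) v0 w0" for v0 w0 :: "nat => nat => 'k"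
 proof -
  let ?v = "v0(k := unitf ?a)"
  obtain w where "dual_bases (insert ?a (C - {?a})) (insert k (X - {k})) ?v w"
   using extend_bases[OF b0, of ?a k] by blast
  then have b: "dual_bases C X ?v w" using a kX by (simp add: insert_absorb)
  have "vm (\<lambda>x. ?v x - fscale (?v x ?a / ?v k ?a) (?v k)) S = vm v0 S" if S: "S \<in> del M k" for S
  proof (rule vm_cong)
   have SX: "S \<subseteq> X - {k}" using S M(1) by (auto simp: del_def nsub_def)
   then show "finite S" using fin finite_subset by blast
   fix x assume "x \<in> S"
   then have x: "x \<in> X - {k}" using SX by blast
   then have "v0 x ?a = 0" using b0 by (auto simp: dual_bases_def fsupp_def)
   then show "?v x - fscale (?v x ?a / ?v k ?a) (?v k) = v0 x"
    using x by (simp add: fun_eq_iff fscale_apply minus_apply)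
  qed
  then have eq: "vm (\<lambda>x. ?v x - fscale (?v x ?a / ?v k ?a) (?v k)) ` del M k = vm v0 ` del M k"
   by (intro image_cong) auto
  have l: "ld (rk1 rk) (?v k) ?a" for rk :: "nat set => nat" using ld_unitf[of "rk1 rk" ?a] by simp
  show ?thesis
   using b leads_universal[OF lex_rank C(1) b M l] leads_universal[OF rev_rank C(1) b M l] unfolding eq by blast
 qed
 have "card (X - {k}) = card (C - {?a})" using kX a C(2) by simp
 then obtain v0 and w0 :: "nat => nat => 'k" where "dual_bases (C - {?a}) (X - {k}) v0 w0"
  using unit_bases[of "X - {k}" "C - {?a}"] fin finC by blast
 then obtain v and w :: "nat => nat => 'k" where v: "dual_bases C X v w"
  "star C ?a \<subseteq> leads (sum (lexw n)) (fvs.span (vm v ` M))" using core by blast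
 have "star C ?a \<subseteq> D"
 proof -
  let ?B = "{S. S \<inter> {?a} ~= {}}"
  have "finite (leads (sum (lexw n)) (fvs.span (vm v ` M)))"
   using leads_pairs(2)[OF v(1) M(1) C(1)] finC finite_subset finite_nsub by blast
  then have "card (star C ?a) \<le> card (leads (sum (lexw n)) (fvs.span (vm v ` M)) \<inter> ?B)"
   using v(2) by (intro card_mono) (auto simp: star_def)
  also have "\<dots> \<le> card (D \<inter> ?B)"
   using dom[OF v(1)] initial_Min(1)[OF finC ne] unfolding dominates_def by blast
  finally have "card (star C ?a) \<le> card (D \<inter> ?B)" .
  moreover have "D \<inter> ?B \<subseteq> star C ?a"
  proof
   fix S assume S: "S \<in> D \<inter> ?B"
   then obtain x y where "S = {x, y}" "x \<in> C" "y \<in> C" "x ~= y" using C(3) by (blast elim: nsub2E)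
   then show "S \<in> star C ?a" using S by (auto simp: star_def insert_commute)
  qed
  moreover have "finite (star C ?a)" using finC by (simp add: star_def)
  ultimately have "D \<inter> ?B = star C ?a" by (metis card_seteq)
  then show ?thesis by blast
 qed
 then have uD: "univ C D ?a" using a by (auto simp: univ_def star_def)
 have decD: "D = star C ?a \<union> del D ?a" by (rule univ_decomp[OF C(3) uD])
 have decM: "M = star X k \<union> del M k" by (rule univ_decomp[OF M])
 have cardD: "card D = card (star C ?a) + card (del D ?a)"
  using decD star_del_disjoint[of C ?a D] finD by (metis card_Un_disjoint finite_Un)
 have "finite M" using M(1) fin finite_subset finite_nsub by blast
 then have cardM: "card M = card (star X k) + card (del M k)"
  using decM star_del_disjoint[of X k M] by (metis card_Un_disjoint finite_Un)
 show ?thesis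
  unfolding common_gin_def
 proof (intro conjI allI impI)
  show "C - {?a} \<subseteq> {1..n}" using C(1) by blast
  show "card (C - {?a}) = card (X - {k})" using kX a C(2) by simp
  show "del D ?a \<subseteq> nsub 2 (C - {?a})" by (rule del_subset[OF C(3)])
  show "card (del D ?a) = card (del M k)"
   using cardD cardM C(2,4) card_star[OF finC a] card_star[OF fin kX] by simp
  fix v0 w0 :: "nat => nat => 'k" assume b0: "dual_bases (C - {?a}) (X - {k}) v0 w0"
  obtain v and w :: "nat => nat => 'k" where v: "dual_bases C X v w"
   "star C ?a \<union> leads (sum (lexw n)) (fvs.span (vm v0 ` del M k)) \<subseteq> leads (sum (lexw n)) (fvs.span (vm v ` M))"
   "star C ?a \<union> leads (sum (revw n)) (fvs.span (vm v0 ` del M k)) \<subseteq> leads (sum (revw n)) (fvs.span (vm v ` M))"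
   using core[OF b0] by blast
  have dM: "del M k \<subseteq> nsub 2 (X - {k})" by (rule del_subset[OF M(1)])
  have Cn: "C - {?a} \<subseteq> {1..n}" using C(1) by blast
  note L0 = leads_pairs[OF b0 dM Cn] and L = leads_pairs[OF v(1) M(1) C(1)]
  have finL: "finite (leads (sum (lexw n)) (fvs.span (vm v ` M)))" "finite (leads (sum (revw n)) (fvs.span (vm v ` M)))"
   using L(2,4) finC finite_subset finite_nsub by blast+
  have off: "A \<inter> star C ?a = {}" if "A \<subseteq> nsub 2 (C - {?a})" for A using that by (auto simp: star_def)
  have delD: "del D ?a \<subseteq> D" by (auto simp: del_def)
  have dD: "?a \<notin> S" if "S \<in> del D ?a" for S using that by (simp add: del_def)
  show "dominates n (C - {?a}) (del D ?a) v0 (del M k)"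
   unfolding dominates_def
  proof (intro allI impI conjI)
   fix P assume P: "initial P (C - {?a})"
   let ?Q = "insert ?a P"
   have d: "card (leads (sum (lexw n)) (fvs.span (vm v ` M)) \<inter> {S. S \<inter> ?Q ~= {}}) \<le> card (D \<inter> {S. S \<inter> ?Q ~= {}})"
    "card (leads (sum (revw n)) (fvs.span (vm v ` M)) \<inter> Pow ?Q) \<le> card (D \<inter> Pow ?Q)"
    using dom[OF v(1)] initial_Min(2)[OF finC ne P] unfolding dominates_def by blast+
   show "card (leads (sum (lexw n)) (fvs.span (vm v0 ` del M k)) \<inter> {S. S \<inter> P ~= {}}) \<le> card (del D ?a \<inter> {S. S \<inter> P ~= {}})"
   proof (rule count_step[OF finL(1) finD v(2) off[OF L0(2)] _ _ _ _ d(1)])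
    show "D \<subseteq> star C ?a \<union> del D ?a" using decD by blast
    show "del D ?a \<inter> {S. S \<inter> ?Q ~= {}} \<subseteq> {S. S \<inter> P ~= {}}" using dD by blast
   qed (use delD in blast)+
   show "card (leads (sum (revw n)) (fvs.span (vm v0 ` del M k)) \<inter> Pow P) \<le> card (del D ?a \<inter> Pow P)"
   proof (rule count_step[OF finL(2) finD v(3) off[OF L0(4)] _ _ _ _ d(2)])
    show "D \<subseteq> star C ?a \<union> del D ?a" using decD by blast
    show "del D ?a \<inter> Pow ?Q \<subseteq> Pow P" using dD by blast
   qed (use delD in blast)+
  qed
 qed
qed

text \<open>The coordinate \<open>Max C\<close> is given to \<open>h\<close> and occurs in no
  product. Reverse lexicographic domination for \<open>C - {Max C}\<close> then shows that
  \<open>D\<close> has no pair through \<open>Max C\<close>.\<close>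

lemma common_gin_isol:
 assumes fin: "finite X" and M: "M \<subseteq> nsub 2 X" "isol X M h" and cg: "common_gin TYPE('k::field) n X M C D"
 shows "common_gin TYPE('k) n (X - {h}) M (C - {Max C}) D"
proof -
 let ?b = "Max C"
 have C: "C \<subseteq> {1..n}" "card C = card X" "D \<subseteq> nsub 2 C" "card D = card M" using cg by (simp_all add: common_gin_def)
 have dom: "dominates n C D v M" if "dual_bases C X v w" for v w :: "nat => nat => 'k"
  using cg that by (auto simp: common_gin_def)
 have finC: "finite C" using C(1) finite_subset by blast
 have hX: "h \<in> X" using M(2) by (simp add: isol_def)
 then have ne: "C ~= {}" using C(2) fin by (metis card_eq_0_iff empty_iff)
 have b: "?b \<in> C" using finC ne by simp
 have finD: "finite D" using C(3) finC finite_subset finite_nsub by blast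
 have MX: "M \<subseteq> nsub 2 (X - {h})" using del_subset[OF M(1), of h] del_isol[OF M(2)] by simp
 have core: "dominates n C D v0 M"
  if b0: "dual_bases (C - {?b}) (X - {h}) v0 w0" for v0 w0 :: "nat => nat => 'k"
 proof -
  let ?v = "v0(h := unitf ?b)"
  obtain w where "dual_bases (insert ?b (C - {?b})) (insert h (X - {h})) ?v w"
   using extend_bases[OF b0, of ?b h] by blast
  then have "dual_bases C X ?v w" using b hX by (simp add: insert_absorb)
  moreover have "vm ?v ` M = vm v0 ` M"
  proof (rule image_cong[OF refl], rule vm_cong)
   fix S assume S: "S \<in> M"
   then have "S \<subseteq> X - {h}" using MX by (auto simp: nsub_def)
   then show "finite S" "\<And>x. x \<in> S ==> ?v x = v0 x" using fin finite_subset by auto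
  qed
  ultimately show ?thesis using dom[of ?v w] by (simp add: dominates_def)
 qed
 have "card (X - {h}) = card (C - {?b})" using hX b C(2) by simp
 then obtain v0 and w0 :: "nat => nat => 'k" where v0: "dual_bases (C - {?b}) (X - {h}) v0 w0"
  using unit_bases[of "X - {h}" "C - {?b}"] fin finC by blast
 have Cb: "C - {?b} \<subseteq> {1..n}" using C(1) by blast
 note L = leads_pairs[OF v0 MX Cb]
 have "leads (sum (revw n)) (fvs.span (vm v0 ` M)) \<inter> Pow (C - {?b}) = leads (sum (revw n)) (fvs.span (vm v0 ` M))"
  using L(4) by (auto simp: nsub_def)
 then have "card M \<le> card (D \<inter> Pow (C - {?b}))"
  using core[OF v0] initial_Max(1)[OF finC ne] L(3) unfolding dominates_def by metis
 then have "D \<inter> Pow (C - {?b}) = D" using C(4) finD by (metis card_seteq inf_le1)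
 then have D: "D \<subseteq> nsub 2 (C - {?b})" using C(3) by (auto simp: nsub_def)
 have "dominates n (C - {?b}) D v0 M" if "dual_bases (C - {?b}) (X - {h}) v0 w0" for v0 w0 :: "nat => nat => 'k"
  using core[OF that] initial_Max(2)[OF finC ne] unfolding dominates_def by blast
 then show ?thesis using Cb D C(4) hX b C(2) unfolding common_gin_def by simp
qed

subsection \<open>Graphs without a common generic initial ideal\<close>

lemma common_ginD:
 assumes "common_gin TYPE('k::field) n X M C D" "finite X"
 shows "C \<subseteq> {1..n}" "card C = card X" "D \<subseteq> nsub 2 C" "card D = card M" "finite C" "finite D"
  "\<And>v w P. dual_bases C X v (w :: nat => nat => 'k) ==> initial P C ==>
   card (leads (sum (lexw n)) (fvs.span (vm v ` M)) \<inter> {S. S \<inter> P ~= {}}) \<le> card (D \<inter> {S. S \<inter> P ~= {}})"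
  "\<And>v w P. dual_bases C X v (w :: nat => nat => 'k) ==> initial P C ==>
   card (leads (sum (revw n)) (fvs.span (vm v ` M)) \<inter> Pow P) \<le> card (D \<inter> Pow P)"
proof -
 show C: "C \<subseteq> {1..n}" "card C = card X" "D \<subseteq> nsub 2 C" "card D = card M"
  using assms(1) by (simp_all add: common_gin_def)
 show finC: "finite C" using C(1) by (rule finite_subset) simp
 show "finite D" using C(3) finC finite_subset finite_nsub by blast
 fix v w :: "nat => nat => 'k" and P assume "dual_bases C X v w" and P: "initial P C"
 then have "dominates n C D v M" using assms(1) by (auto simp: common_gin_def)
 then show "card (leads (sum (lexw n)) (fvs.span (vm v ` M)) \<inter> {S. S \<inter> P ~= {}}) \<le> card (D \<inter> {S. S \<inter> P ~= {}})"
  "card (leads (sum (revw n)) (fvs.span (vm v ` M)) \<inter> Pow P) \<le> card (D \<inter> Pow P)"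
  using P unfolding dominates_def by blast+
qed

lemma pairs_through:
 assumes "C' \<subseteq> nsub 2 C" "m \<in> C" "finite C"
 shows "C' \<inter> {S. m \<in> S} \<subseteq> star C m" "card (C' \<inter> {S. m \<in> S}) \<le> card C - 1"
proof -
 show sub: "C' \<inter> {S. m \<in> S} \<subseteq> star C m"
 proof
  fix S assume S: "S \<in> C' \<inter> {S. m \<in> S}"
  then obtain x y where "S = {x, y}" "x \<in> C" "y \<in> C" "x ~= y" using assms(1) by (blast elim: nsub2E)
  then show "S \<in> star C m" using S by (auto simp: star_def insert_commute)
 qed
 have "finite (star C m)" using assms(3) by (simp add: star_def)
 then show "card (C' \<inter> {S. m \<in> S}) \<le> card C - 1"
  using card_mono[OF _ sub] card_star[OF assms(3,2)] by simp
qed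

text \<open>\<open>row_bases\<close> for the lexicographic order with \<open>m = Min C\<close>,
  where the pairs through the minimum rank above all others.\<close>

lemma first_row:
 assumes cg: "common_gin TYPE('k::field) n X M C D" and fin: "finite X" and M: "M \<subseteq> nsub 2 X"
  and R: "R \<subseteq> X" "R ~= {}" "\<And>x. x \<in> X ==> \<exists>r\<in>R. reach M r x"
 shows "card X - card R \<le> card (D \<inter> {S. Min C \<in> S})"
proof -
 note C = common_ginD[OF cg fin]
 have ne: "C ~= {}" using C(2,5) R(1,2) fin by (metis card_eq_0_iff subset_empty)
 then have a: "Min C \<in> C" using C(5) by simp
 have i: "initial {Min C} C" by (rule initial_Min(1)[OF C(5) ne])
 have top: "sum (lexw n) T < sum (lexw n) S"
  if "S \<in> nsub 2 C" "T \<in> nsub 2 C" "Min C \<in> S" "Min C \<notin> T" for S T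
  using lex_top[OF C(1) i] that by auto
 obtain v and w :: "nat => nat => 'k" where v: "dual_bases C X v w"
  "card X - card R \<le> card (leads (sum (lexw n)) (fvs.span (vm v ` M)) \<inter> {S. Min C \<in> S})"
  using row_bases[OF lex_rank C(1) fin C(2)[symmetric] M R a top] by blast
 have "{S. S \<inter> {Min C} ~= {}} = {S. Min C \<in> S}" by auto
 then show ?thesis using C(7)[OF v(1) i] v(2) by simp
qed

text \<open>\<open>row_bases\<close> for the complementary graph and the reversed reverse
  lexicographic order, whose top pairs pass through \<open>Max C\<close>. By
  \<open>leads_complement\<close> the leading pairs of \<open>M\<close> miss at least
  \<open>card X - card R\<close> of the \<open>card X - 1\<close> pairs through the maximum. Since
  \<open>D\<close> has the same size and at least as many pairs avoiding the maximum, the bound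
  carries over.\<close>

lemma last_column:
 assumes cg: "common_gin TYPE('k::field) n X M C D" and fin: "finite X" and M: "M \<subseteq> nsub 2 X"
  and R: "R \<subseteq> X" "R ~= {}" "\<And>x. x \<in> X ==> \<exists>r\<in>R. reach (nsub 2 X - M) r x"
 shows "card (D \<inter> {S. Max C \<in> S}) \<le> card R - 1"
proof -
 note C = common_ginD[OF cg fin]
 have ne: "C ~= {}" using C(2,5) R(1,2) fin by (metis card_eq_0_iff subset_empty)
 let ?b = "Max C" and ?rk = "sum (revw n)"
 have b: "?b \<in> C" using C(5) ne by simp
 have i: "initial (C - {?b}) C" by (rule initial_Max(1)[OF C(5) ne])
 obtain rk' where rk': "mono_rank {1..n} rk'" "reverse_rank {1..n} ?rk rk'"
  using reverse_rank_exists[OF rev_rank] by blast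
 have top: "rk' T < rk' S" if h: "S \<in> nsub 2 C" "T \<in> nsub 2 C" "?b \<in> S" "?b \<notin> T" for S T
 proof -
  have "T \<subseteq> C - {?b}" "\<not> S \<subseteq> C - {?b}" using h by (auto simp: nsub_def)
  then have "?rk S < ?rk T" by (rule rev_top[OF C(1) i h(2) _ h(1)])
  moreover have "S \<subseteq> {1..n}" "T \<subseteq> {1..n}" using h(1,2) C(1) by (auto simp: nsub_def)
  ultimately show ?thesis using rk'(2) by (simp add: reverse_rank_def)
 qed
 obtain u and t :: "nat => nat => 'k" where u: "dual_bases C X u t"
  "card X - card R \<le> card (leads rk' (fvs.span (vm u ` (nsub 2 X - M))) \<inter> {S. ?b \<in> S})"
  using row_bases[OF rk'(1) C(1) fin C(2)[symmetric] Diff_subset R b top] by blast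
 obtain v and w :: "nat => nat => 'k" where v: "dual_bases C X v w"
  "leads ?rk (fvs.span (vm v ` M)) = nsub 2 C - leads rk' (fvs.span (vm u ` (nsub 2 X - M)))"
  using leads_complement[OF rev_rank C(1) rk' u(1) M] by blast
 let ?L = "leads ?rk (fvs.span (vm v ` M))" and ?L' = "leads rk' (fvs.span (vm u ` (nsub 2 X - M)))"
 have L: "card ?L = card M" "?L \<subseteq> nsub 2 C" using leads_pairs(3,4)[OF v(1) M C(1)] by simp_all
 have L': "?L' \<subseteq> nsub 2 C" using card_leads_vm(2)[OF u(1) rk'(1) C(1)] by blast
 have finL: "finite ?L" "finite ?L'" using L(2) L' C(5) finite_subset finite_nsub by blast+
 have "card ((?L \<inter> {S. ?b \<in> S}) \<union> (?L' \<inter> {S. ?b \<in> S})) \<le> card C - 1"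
  using pairs_through(2)[of "?L \<union> ?L'" C ?b] L(2) L' b C(5) by (simp add: Int_Un_distrib2)
 moreover have "card ((?L \<inter> {S. ?b \<in> S}) \<union> (?L' \<inter> {S. ?b \<in> S})) = card (?L \<inter> {S. ?b \<in> S}) + card (?L' \<inter> {S. ?b \<in> S})"
  using finL v(2) by (intro card_Un_disjoint) auto
 moreover have "card R \<le> card X" "card R ~= 0"
  using card_mono[OF fin R(1)] finite_subset[OF R(1) fin] R(2) by simp_all
 ultimately have Lb: "card (?L \<inter> {S. ?b \<in> S}) \<le> card R - 1" using u(2) C(2) by linarith
 have split: "card A = card (A \<inter> {S. ?b \<in> S}) + card (A \<inter> Pow (C - {?b}))" if "A \<subseteq> nsub 2 C" "finite A" for A
 proof -
  have "A = (A \<inter> {S. ?b \<in> S}) \<union> (A \<inter> Pow (C - {?b}))" using that(1) by (auto simp: nsub_def)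
  moreover have "card ((A \<inter> {S. ?b \<in> S}) \<union> (A \<inter> Pow (C - {?b}))) = card (A \<inter> {S. ?b \<in> S}) + card (A \<inter> Pow (C - {?b}))"
   using that(2) by (intro card_Un_disjoint) auto
  ultimately show ?thesis by simp
 qed
 show ?thesis
  using split[OF L(2) finL(1)] split[OF C(3,6)] C(8)[OF v(1) i] Lb L(1) C(4) by linarith
qed

text \<open>The first row of \<open>D\<close> would be full and the last column empty, but the pair
  of minimum and maximum belongs to both.\<close>

lemma common_gin_connected:
 assumes cg: "common_gin TYPE('k::field) n X M C D" and fin: "finite X" "2 \<le> card X" and M: "M \<subseteq> nsub 2 X"
  and conn: "conn X M" "conn X (nsub 2 X - M)"
 shows False
proof -
 note C = common_ginD[OF cg fin(1)]
 have ne: "C ~= {}" using C(2) fin(2) by auto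
 obtain x where x: "x \<in> X" using fin(2) by fastforce
 have r: "\<exists>r\<in>{x}. reach F r y" if "conn X F" "y \<in> X" for F y using that x by (auto simp: conn_def)
 have a: "Min C \<in> C" and b: "Max C \<in> C" using C(5) ne by simp_all
 have "card X - 1 \<le> card (D \<inter> {S. Min C \<in> S})" using first_row[OF cg fin(1) M, of "{x}"] r[OF conn(1)] x by simp
 moreover have "card (D \<inter> {S. Max C \<in> S}) \<le> 0" using last_column[OF cg fin(1) M, of "{x}"] r[OF conn(2)] x by simp
 then have "D \<inter> {S. Max C \<in> S} = {}" using C(6) by simp
 then have D: "D \<subseteq> nsub 2 (C - {Max C})" using C(3) by (auto simp: nsub_def)
 have "Min C ~= Max C"
 proof
  assume eq: "Min C = Max C"
  have "C \<subseteq> {Min C}"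
  proof
   fix y assume "y \<in> C"
   then show "y \<in> {Min C}" using Min_le[OF C(5), of y] Max_ge[OF C(5), of y] eq by simp
  qed
  then have "card C \<le> card {Min C}" by (intro card_mono) auto
  then show False using C(2) fin(2) by simp
 qed
 then have "card (D \<inter> {S. Min C \<in> S}) \<le> card (C - {Max C}) - 1"
  using pairs_through(2)[OF D, of "Min C"] a C(5) by simp
 moreover have "card (C - {Max C}) = card X - 1" using b C(2) by simp
 ultimately show False using fin(2) by linarith
qed

text \<open>Folding confines all reverse lexicographic leading pairs, and hence \<open>D\<close>, to
  an initial segment \<open>P\<close> of size \<open>card X - card R\<close>. By
  \<open>first_row\<close> the minimum lies on at least \<open>card P\<close> pairs of
  \<open>D\<close>, one more than \<open>P\<close> has room for.\<close>

lemma common_gin_bad: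
 assumes cg: "common_gin TYPE('k::field) n X M C D" and fin: "finite X" and M: "M \<subseteq> nsub 2 X" and bad: "bad X M"
 shows False
proof -
 note C = common_ginD[OF cg fin]
 obtain R g where R: "R \<subseteq> X" "R ~= {}" "\<And>x. x \<in> X ==> \<exists>r\<in>R. reach M r x"
  "\<And>r s. r \<in> R ==> s \<in> R ==> reach M r s ==> r = s"
  "\<And>r. r \<in> R ==> g r \<in> X - R" "\<And>r. r \<in> R ==> \<not> reach M r (g r)"
  "\<And>r s. r \<in> R ==> s \<in> R ==> {r, g s} \<in> M ==> {s, g r} \<in> M ==> r = s"
  using bad_folding[OF M bad] by blast
 have "R \<subset> X" using R(1,2,5) by blast
 then have lt: "card R < card X" using fin by (rule psubset_card_mono[rotated])
 obtain P where P: "initial P C" "card P = card X - card R"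
  using initial_exists[OF C(5), of "card X - card R"] C(2) by auto
 have PC: "P \<subseteq> C" using P(1) by (simp add: initial_def)
 have ranks: "sum (revw n) {a} < sum (revw n) {b}" if "a \<in> C - P" "b \<in> P" for a b
 proof -
  have "b < a" using that P(1) by (auto simp: initial_def)
  moreover have "a \<in> {1..n}" "b \<in> {1..n}" using that PC C(1) by blast+
  ultimately show ?thesis using revw_less[of b n a] by simp
 qed
 obtain v and w :: "nat => nat => 'k" where v: "dual_bases C X v w"
  "leads (sum (revw n)) (fvs.span (vm v ` M)) \<subseteq> Pow P"
  using folded_bases[OF rev_rank C(1) fin C(2)[symmetric] M R(1,4-7) PC P(2) ranks] by blast
 have "leads (sum (revw n)) (fvs.span (vm v ` M)) \<inter> Pow P = leads (sum (revw n)) (fvs.span (vm v ` M))"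
  using v(2) by blast
 then have "card D \<le> card (D \<inter> Pow P)" using C(4) C(8)[OF v(1) P(1)] leads_pairs(3)[OF v(1) M C(1)] by simp
 then have "D \<inter> Pow P = D" using C(6) by (metis card_seteq inf_le1)
 then have D: "D \<subseteq> nsub 2 P" using C(3) by (auto simp: nsub_def)
 have row: "card X - card R \<le> card (D \<inter> {S. Min C \<in> S})" by (rule first_row[OF cg fin M R(1-3)])
 have finP: "finite P" using PC C(5) finite_subset by blast
 show False
 proof (cases "Min C \<in> P")
  case True
  then show False using pairs_through(2)[OF D True finP] row P(2) lt by linarith
 next
  case False
  then have "D \<inter> {S. Min C \<in> S} = {}" using D by (auto simp: nsub_def)
  then show False using row lt by simp
 qed
qed

text \<open>Folding the complement away from an initial segment \<open>P\<close> of size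
  \<open>card R\<close> makes every pair meeting \<open>P\<close> a lexicographic leading pair,
  hence a member of \<open>D\<close>. So \<open>Max C\<close> lies on \<open>card R\<close> pairs of
  \<open>D\<close>, one more than \<open>last_column\<close> permits.\<close>

lemma common_gin_complement_bad:
 assumes cg: "common_gin TYPE('k::field) n X M C D" and fin: "finite X" and M: "M \<subseteq> nsub 2 X"
  and bad: "bad X (nsub 2 X - M)"
 shows False
proof -
 note C = common_ginD[OF cg fin]
 let ?F = "nsub 2 X - M" and ?rk = "sum (lexw n)"
 obtain R g where R: "R \<subseteq> X" "R ~= {}" "\<And>x. x \<in> X ==> \<exists>r\<in>R. reach ?F r x"
  "\<And>r s. r \<in> R ==> s \<in> R ==> reach ?F r s ==> r = s"
  "\<And>r. r \<in> R ==> g r \<in> X - R" "\<And>r. r \<in> R ==> \<not> reach ?F r (g r)"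
  "\<And>r s. r \<in> R ==> s \<in> R ==> {r, g s} \<in> ?F ==> {s, g r} \<in> ?F ==> r = s"
  using bad_folding[OF Diff_subset bad] by blast
 have "R \<subset> X" using R(1,2,5) by blast
 then have lt: "card R < card X" using fin by (rule psubset_card_mono[rotated])
 obtain P where P: "initial P C" "card P = card R"
  using initial_exists[OF C(5), of "card R"] C(2) lt by auto
 have PC: "P \<subseteq> C" using P(1) by (simp add: initial_def)
 have finP: "finite P" using PC C(5) finite_subset by blast
 have P': "C - P \<subseteq> C" "card (C - P) = card X - card R" using PC finP C(2) P(2) by (auto simp: card_Diff_subset)
 obtain rk' where rk': "mono_rank {1..n} rk'" "reverse_rank {1..n} ?rk rk'"
  using reverse_rank_exists[OF lex_rank] by blast
 have ranks: "rk' {a} < rk' {b}" if "a \<in> C - (C - P)" "b \<in> C - P" for a b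
 proof -
  have "a < b" using that P(1) by (auto simp: initial_def)
  moreover have ab: "a \<in> {1..n}" "b \<in> {1..n}" using that PC C(1) by blast+
  ultimately have "?rk {b} < ?rk {a}" using lexw_less[of a n b] by simp
  then show ?thesis using rk'(2) ab by (simp add: reverse_rank_def)
 qed
 obtain u and t :: "nat => nat => 'k" where u: "dual_bases C X u t"
  "leads rk' (fvs.span (vm u ` ?F)) \<subseteq> Pow (C - P)"
  using folded_bases[OF rk'(1) C(1) fin C(2)[symmetric] Diff_subset R(1,4-7) P' ranks] by blast
 obtain v and w :: "nat => nat => 'k" where v: "dual_bases C X v w"
  "leads ?rk (fvs.span (vm v ` M)) = nsub 2 C - leads rk' (fvs.span (vm u ` ?F))"
  using leads_complement[OF lex_rank C(1) rk' u(1) M] by blast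
 let ?B = "{S. S \<inter> P ~= {}}"
 have "nsub 2 C \<inter> ?B = leads ?rk (fvs.span (vm v ` M)) \<inter> ?B" using v(2) u(2) by blast
 then have "card (nsub 2 C \<inter> ?B) \<le> card (D \<inter> ?B)" using C(7)[OF v(1) P(1)] by simp
 moreover have "D \<inter> ?B \<subseteq> nsub 2 C \<inter> ?B" using C(3) by blast
 ultimately have DB: "D \<inter> ?B = nsub 2 C \<inter> ?B" using C(5) by (metis card_seteq finite_Int finite_nsub)
 have ne: "C ~= {}" using C(2) lt by auto
 let ?b = "Max C"
 have b: "?b \<in> C" using C(5) ne by simp
 have "?b \<notin> P"
 proof
  assume bP: "?b \<in> P"
  have "P ~= C" using P(2) C(2) lt by auto
  then obtain c where c: "c \<in> C - P" using PC by blast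
  then have "?b < c" using P(1) bP by (simp add: initial_def)
  then show False using Max_ge[OF C(5), of c] c by simp
 qed
 have "(\<lambda>i. {i, ?b}) ` P \<subseteq> D \<inter> {S. ?b \<in> S}"
 proof (rule image_subsetI)
  fix i assume i: "i \<in> P"
  then have "{i, ?b} \<in> nsub 2 C \<inter> ?B" using \<open>?b \<notin> P\<close> b PC by auto
  then show "{i, ?b} \<in> D \<inter> {S. ?b \<in> S}" unfolding DB[symmetric] by simp
 qed
 then have "card ((\<lambda>i. {i, ?b}) ` P) \<le> card (D \<inter> {S. ?b \<in> S})" using C(6) by (intro card_mono) auto
 moreover have "inj_on (\<lambda>i. {i, ?b}) P" by (auto simp: inj_on_def doubleton_eq_iff)
 ultimately have "card R \<le> card (D \<inter> {S. ?b \<in> S})" using P(2) by (simp add: card_image)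
 moreover have "card (D \<inter> {S. ?b \<in> S}) \<le> card R - 1" by (rule last_column[OF cg fin M R(1-3)])
 moreover have "card R ~= 0" using finite_subset[OF R(1) fin] R(2) by simp
 ultimately show False by linarith
qed

theorem common_gin_good:
 assumes "common_gin TYPE('k::field) n X M C D" "finite X" "M \<subseteq> nsub 2 X"
 shows "good X M"
proof (rule good_criterion[where \<Phi> = "\<lambda>X M. \<exists>C D. common_gin TYPE('k) n X M C D"])
 show "finite X" "M \<subseteq> nsub 2 X" "\<exists>C D. common_gin TYPE('k) n X M C D" using assms by blast+
next
 fix X M assume h: "finite X" "M \<subseteq> nsub 2 X" "\<exists>C D. common_gin TYPE('k) n X M C D"
 then obtain C D where cg: "common_gin TYPE('k) n X M C D" by blast
 show "\<exists>C D. common_gin TYPE('k) n (X - {k}) (del M k) C D" if "univ X M k" for k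
  using common_gin_univ[OF h(1,2) that cg] by blast
 show "\<exists>C D. common_gin TYPE('k) n (X - {k}) M C D" if "isol X M k" for k
  using common_gin_isol[OF h(1,2) that cg] by blast
 show False if "2 \<le> card X" "conn X M" "conn X (nsub 2 X - M)"
  by (rule common_gin_connected[OF cg h(1) that(1) h(2) that(2,3)])
 show "\<not> bad X M" using common_gin_bad[OF cg h(1,2)] by blast
 show "\<not> bad X (nsub 2 X - M)" using common_gin_complement_bad[OF cg h(1,2)] by blast
qed

subsection \<open>Generic initial ideals of graphs\<close>

definition nonfaces :: "nat => nat set set => nat set set" where
 "nonfaces n M = M \<union> {S. S \<subseteq> {1..n} \<and> 3 \<le> card S}"

lemma upclosed_nonfaces: "M \<subseteq> nsub 2 {1..n} ==> upclosed n (nonfaces n M)"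
 unfolding upclosed_def
proof (intro conjI ballI allI impI)
 assume M: "M \<subseteq> nsub 2 {1..n}"
 then show "nonfaces n M \<subseteq> Pow {1..n}" by (auto simp: nonfaces_def nsub_def)
 fix S T assume h: "S \<in> nonfaces n M" "S \<subseteq> T" "T \<subseteq> {1..n}"
 have finT: "finite T" using h(3) finite_subset by blast
 show "T \<in> nonfaces n M"
 proof (cases "S = T")
  case False
  then have "card S < card T" using h(2) finT by (intro psubset_card_mono) auto
  moreover have "2 \<le> card S" using h(1) M by (auto simp: nonfaces_def nsub_def)
  ultimately show ?thesis using h(3) by (simp add: nonfaces_def)
 qed (use h in simp)
qed

text \<open>Degrees are preserved. From degree 3 on the family contains all sets and keeps them by
  counting, so only the pairs change.\<close>

lemma inif_nonfaces:
 assumes b: "dual_bases {1..n} {1..n} v (w :: nat => nat => 'k::field)" and mr: "mono_rank {1..n} rk" and M: "M \<subseteq> nsub 2 {1..n}"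
 shows "inif rk v (nonfaces n M) = nonfaces n (inif rk v M)"
proof -
 let ?F = "nonfaces n M" and ?N = "{1..n}"
 have F: "?F \<subseteq> Pow ?N" using upclosed_nonfaces[OF M] by (simp add: upclosed_def)
 have sub: "inif rk v A \<subseteq> nsub d ?N" "card (inif rk v A) = card A" if "A \<subseteq> nsub d ?N" for A d
  using card_leads_vm[OF b mr order.refl that] by (simp_all add: inif_def)
 have deg: "inif rk v ?F \<inter> nsub d ?N = inif rk v (?F \<inter> nsub d ?N)" for d by (rule inif_graded[OF b F])
 have F2: "?F \<inter> nsub 2 ?N = M" using M by (auto simp: nonfaces_def nsub_def)
 have F3: "?F \<inter> nsub d ?N = nsub d ?N" if "3 \<le> d" for d using that by (auto simp: nonfaces_def nsub_def)
 have F0: "?F \<inter> nsub d ?N = {}" if "d < 2" for d using that M by (auto simp: nonfaces_def nsub_def)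
 have i3: "inif rk v ?F \<inter> nsub d ?N = nsub d ?N" if "3 \<le> d" for d
  using sub[of "nsub d ?N" d] deg[of d] F3[OF that] by (simp add: card_subset_eq)
 have i0: "inif rk v ?F \<inter> nsub d ?N = {}" if "d < 2" for d
  unfolding deg F0[OF that] using sub(1)[of "{}" d] sub(2)[of "{}" d] finite_subset[OF sub(1)[of "{}" d]] by simp
 show ?thesis
 proof (rule Set.set_eqI)
  fix S
  have all: "S \<in> inif rk v ?F ==> S \<subseteq> ?N" using inif_subset[OF b F] by blast
  have mem: "S \<in> inif rk v ?F \<longleftrightarrow> S \<in> inif rk v ?F \<inter> nsub (card S) ?N" using all by (auto simp: nsub_def)
  have M2: "S \<in> inif rk v M ==> S \<subseteq> ?N \<and> card S = 2" using sub(1)[OF M] by (auto simp: nsub_def)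
  consider "card S < 2" | "card S = 2" | "3 \<le> card S" by linarith
  then show "S \<in> inif rk v ?F \<longleftrightarrow> S \<in> nonfaces n (inif rk v M)"
  proof cases
   case 1
   then show ?thesis using mem i0[OF 1] M2 by (auto simp: nonfaces_def)
  next
   case 2
   then show ?thesis using mem deg[of 2] F2 M2 by (auto simp: nonfaces_def)
  next
   case 3
   then show ?thesis using mem i3[OF 3] M2 by (auto simp: nonfaces_def nsub_def)
  qed
 qed
qed

lemma leads_rank_cong:
 assumes "\<And>S T. S \<in> X ==> T \<in> X ==> rk S \<le> rk T \<longleftrightarrow> rk' S \<le> rk' T" "J \<subseteq> fsupp X"
 shows "leads rk J = leads rk' J"
proof -
 have "ld rk x i \<longleftrightarrow> ld rk' x i" if "x \<in> J" for x i
  using assms that unfolding ld_def fsupp_def by blast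
 then show ?thesis by (auto simp: leads_def)
qed

text \<open>The generic family maximizes the counts above all thresholds. \<open>T\<close> consists
  of the pairs above its own least rank, and the larger sets contribute equally in all coordinates,
  so the inequality can be read on pairs alone.\<close>

lemma generic_dominates:
 fixes u :: "nat => nat" and n :: nat
 defines "\<sigma> \<equiv> {(S, T). S \<subseteq> {1..n} \<and> T \<subseteq> {1..n} \<and> sum u S \<le> sum u T}"
 assumes \<sigma>: "term_order n \<sigma>" and M: "M \<subseteq> nsub 2 {1..n}"
  and gen: "is_generic n (term_rank n \<sigma>) (nonfaces n M) L A0 (f :: 'k::field mat => 'k)"
  and b: "dual_bases {1..n} {1..n} v (w :: nat => nat => 'k)"
  and T: "T \<subseteq> nsub 2 {1..n}" "\<And>S S'. S \<in> T ==> S' \<in> nsub 2 {1..n} - T ==> sum u S' < sum u S"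
 shows "card (leads (sum u) (fvs.span (vm v ` M)) \<inter> T) \<le> card (L \<inter> T)"
  "card (L \<inter> nsub 2 {1..n}) = card M"
proof -
 let ?N = "{1..n}" and ?rk = "term_rank n \<sigma>"
 note mr = mono_rank_term_rank[OF \<sigma>]
 have order: "?rk S \<le> ?rk S' \<longleftrightarrow> sum u S \<le> sum u S'" if "S \<subseteq> ?N" "S' \<subseteq> ?N" for S S'
  using term_rank_le[OF \<sigma> that] that by (simp add: \<sigma>_def)
 obtain w0 where b0: "dual_bases ?N ?N (colv n A0) w0"
  using GL_dual_bases[of A0 n] gen by (auto simp: is_generic_def)
 have "L = inif ?rk (colv n A0) (nonfaces n M)" using gen by (auto simp: is_generic_def)
 then have L: "L = nonfaces n (inif ?rk (colv n A0) M)" using inif_nonfaces[OF b0 mr M] by simp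
 have D: "card (inif ?rk (colv n A0) M) = card M" "inif ?rk (colv n A0) M \<subseteq> nsub 2 ?N"
  using card_leads_vm[OF b0 mr order.refl M] by (simp_all add: inif_def)
 have LD: "L \<inter> nsub 2 ?N = inif ?rk (colv n A0) M" using D(2) unfolding L by (auto simp: nonfaces_def nsub_def)
 then show "card (L \<inter> nsub 2 ?N) = card M" using D(1) by simp
 obtain A where A: "A \<in> GL n" "\<And>x. x \<in> ?N ==> colv n A x = v x" using dual_bases_GL[OF b] by blast
 have F: "nonfaces n M \<subseteq> Pow ?N" using upclosed_nonfaces[OF M] by (simp add: upclosed_def)
 have "inif ?rk (colv n A) (nonfaces n M) = nonfaces n (inif ?rk v M)"
  using inif_cong[OF F A(2)] inif_nonfaces[OF b mr M] by simp
 then have dom: "above ?rk \<theta> (nonfaces n (inif ?rk v M)) \<le> above ?rk \<theta> (nonfaces n (inif ?rk (colv n A0) M))" for \<theta>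
  using gen A(1) L unfolding is_generic_def by metis
 have E: "inif ?rk v M \<subseteq> nsub 2 ?N" using card_leads_vm(2)[OF b mr order.refl M] by (simp add: inif_def)
 have finN: "finite (nsub 2 ?N)" by simp
 have ab: "above ?rk \<theta> (nonfaces n B) = card {S \<in> B. \<theta> \<le> ?rk S} + card {S. S \<subseteq> ?N \<and> 3 \<le> card S \<and> \<theta> \<le> ?rk S}"
  if B: "B \<subseteq> nsub 2 ?N" for B \<theta>
 proof -
  have "{S \<in> nonfaces n B. \<theta> \<le> ?rk S} = {S \<in> B. \<theta> \<le> ?rk S} \<union> {S. S \<subseteq> ?N \<and> 3 \<le> card S \<and> \<theta> \<le> ?rk S}"
   by (auto simp: nonfaces_def)
  moreover have "finite {S \<in> B. \<theta> \<le> ?rk S}" using finite_subset[OF B finN] by simp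
  moreover have "finite {S. S \<subseteq> ?N \<and> 3 \<le> card S \<and> \<theta> \<le> ?rk S}"
   by (rule finite_subset[of _ "Pow ?N"]) auto
  moreover have "{S \<in> B. \<theta> \<le> ?rk S} \<inter> {S. S \<subseteq> ?N \<and> 3 \<le> card S \<and> \<theta> \<le> ?rk S} = {}" using B by (auto simp: nsub_def)
  ultimately show ?thesis unfolding above_def by (simp add: card_Un_disjoint)
 qed
 have le: "card {S \<in> inif ?rk v M. \<theta> \<le> ?rk S} \<le> card {S \<in> inif ?rk (colv n A0) M. \<theta> \<le> ?rk S}" for \<theta>
  using dom[of \<theta>] ab[OF E] ab[OF D(2)] by simp
 have "fvs.span (vm v ` M) \<subseteq> fsupp (Pow ?N)"
 proof (rule span_fsupp, clarify)
  fix S assume "S \<in> M"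
  then have S: "S \<subseteq> ?N" using M by (auto simp: nsub_def)
  have "vm v S \<in> fsupp (nsub (card S) ?N)"
   by (rule vm_fsupp) (use S b finite_subset in \<open>auto simp: dual_bases_def\<close>)
  then show "vm v S \<in> fsupp (Pow ?N)" by (auto simp: fsupp_def nsub_def)
 qed
 then have lc: "leads (sum u) (fvs.span (vm v ` M)) = inif ?rk v M"
  unfolding inif_def using order by (intro leads_rank_cong[of "Pow ?N"]) auto
 show "card (leads (sum u) (fvs.span (vm v ` M)) \<inter> T) \<le> card (L \<inter> T)"
 proof (cases "T = {}")
  case False
  have finT: "finite T" using T(1) finN finite_subset by blast
  define \<theta> where "\<theta> = Min (?rk ` T)"
  have cut: "{S \<in> B. \<theta> \<le> ?rk S} = B \<inter> T" if B: "B \<subseteq> nsub 2 ?N" for B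
  proof (intro Set.set_eqI iffI)
   fix S assume S: "S \<in> {S \<in> B. \<theta> \<le> ?rk S}"
   have "\<theta> \<in> ?rk ` T" unfolding \<theta>_def using finT False by (intro Min_in) auto
   then obtain S0 where S0: "S0 \<in> T" "\<theta> = ?rk S0" by blast
   have "S \<in> T"
   proof (rule ccontr)
    assume "S \<notin> T"
    then have "sum u S < sum u S0" using T(2)[OF S0(1)] S B by blast
    moreover have "sum u S0 \<le> sum u S"
     using order[of S0 S] S S0 B T(1) by (auto simp: nsub_def)
    ultimately show False by simp
   qed
   then show "S \<in> B \<inter> T" using S by blast
  next
   fix S assume "S \<in> B \<inter> T"
   then show "S \<in> {S \<in> B. \<theta> \<le> ?rk S}" using finT by (auto simp: \<theta>_def)
  qed
  have "L \<inter> T = inif ?rk (colv n A0) M \<inter> T" using LD T(1) by blast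
  then show ?thesis using le[of \<theta>] cut[OF E] cut[OF D(2)] lc by simp
 qed simp
qed

text \<open>The lexicographic and the reverse lexicographic generic family coincide, so the pairs in
  it inherit the bounds of both orders.\<close>

lemma Gins_single_common_gin:
 assumes inf: "infinite (UNIV :: 'k::field set)" and M: "M \<subseteq> nsub 2 {1..n}"
  and one: "card (Gins n (fsupp (nonfaces n M) :: 'k ext set)) = 1"
 shows "\<exists>D. common_gin TYPE('k) n {1..n} M {1..n} D"
proof -
 let ?N = "{1..n}" and ?F = "nonfaces n M"
 let ?\<sigma> = "\<lambda>u :: nat => nat. {(S, T). S \<subseteq> {1..n} \<and> T \<subseteq> {1..n} \<and> sum u S \<le> sum u T}"
 note up = upclosed_nonfaces[OF M]
 have F: "?F \<subseteq> Pow ?N" using up by (simp add: upclosed_def)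
 have std: "standard_term_order n (?\<sigma> (lexw n))" "standard_term_order n (?\<sigma> (revw n))"
  by (rule standard_term_order_sum[OF inj_lexw lexw_less] standard_term_order_sum[OF inj_revw revw_less]; assumption)+
 then have ord: "term_order n (?\<sigma> (lexw n))" "term_order n (?\<sigma> (revw n))" by (simp_all add: standard_term_order_def)
 obtain L and A and f :: "'k mat => 'k" where L: "is_generic n (term_rank n (?\<sigma> (lexw n))) ?F L A f"
  using generic_exists[OF inf mono_rank_term_rank[OF ord(1)] F] by blast
 obtain L' and A' and f' :: "'k mat => 'k" where L': "is_generic n (term_rank n (?\<sigma> (revw n))) ?F L' A' f'"
  using generic_exists[OF inf mono_rank_term_rank[OF ord(2)] F] by blast
 have "fsupp L \<in> Gins n (fsupp ?F :: 'k ext set)" "fsupp L' \<in> Gins n (fsupp ?F :: 'k ext set)"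
  unfolding Gins_def using std Gin_generic[OF inf ord(1) up L] Gin_generic[OF inf ord(2) up L'] by blast+
 then have "fsupp L = (fsupp L' :: 'k ext set)" using one by (auto elim!: card_1_singletonE)
 then have eq: "L' = L" using fsupp_inject by blast
 have top1: "sum (lexw n) S' < sum (lexw n) S"
  if "initial P ?N" "S \<in> nsub 2 ?N \<inter> {S. S \<inter> P ~= {}}" "S' \<in> nsub 2 ?N - nsub 2 ?N \<inter> {S. S \<inter> P ~= {}}" for P S S'
  using lex_top[OF order.refl that(1)] that(2,3) by blast
 have top2: "sum (revw n) S' < sum (revw n) S"
  if "initial P ?N" "S \<in> nsub 2 ?N \<inter> Pow P" "S' \<in> nsub 2 ?N - nsub 2 ?N \<inter> Pow P" for P S S'
  using rev_top[OF order.refl that(1)] that(2,3) by blast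
 have card: "card (L \<inter> nsub 2 ?N) = card M"
 proof -
  obtain v and w :: "nat => nat => 'k" where "dual_bases ?N ?N v w" using unit_bases[of ?N ?N] by auto
  then show ?thesis using generic_dominates(2)[OF ord(1) M L, of v w "{}"] by simp
 qed
 have "dominates n ?N (L \<inter> nsub 2 ?N) v M" if b: "dual_bases ?N ?N v w" for v w :: "nat => nat => 'k"
  unfolding dominates_def
 proof (intro allI impI conjI)
  fix P assume P: "initial P ?N"
  note L2 = leads_pairs[OF b M order.refl]
  have i: "A \<inter> (nsub 2 ?N \<inter> B) = A \<inter> B" if "A \<subseteq> nsub 2 ?N" for A B using that by blast
  show "card (leads (sum (lexw n)) (fvs.span (vm v ` M)) \<inter> {S. S \<inter> P ~= {}}) \<le> card (L \<inter> nsub 2 ?N \<inter> {S. S \<inter> P ~= {}})"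
   using generic_dominates(1)[OF ord(1) M L b, of "nsub 2 ?N \<inter> {S. S \<inter> P ~= {}}", OF Int_lower1 top1[OF P]] unfolding i[OF L2(2)] by (simp add: Int_assoc)
  show "card (leads (sum (revw n)) (fvs.span (vm v ` M)) \<inter> Pow P) \<le> card (L \<inter> nsub 2 ?N \<inter> Pow P)"
   using generic_dominates(1)[OF ord(2) M L'[unfolded eq] b, of "nsub 2 ?N \<inter> Pow P", OF Int_lower1 top2[OF P]] unfolding i[OF L2(4)] by (simp add: Int_assoc)
 qed
 then have "common_gin TYPE('k) n ?N M ?N (L \<inter> nsub 2 ?N)" using card by (auto simp: common_gin_def)
 then show ?thesis by blast
qed

theorem Gins_single_good:
 assumes "infinite (UNIV :: 'k::field set)" "M \<subseteq> nsub 2 {1..n}"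
  "card (Gins n (fsupp (nonfaces n M) :: 'k ext set)) = 1"
 shows "good {1..n} M"
 using Gins_single_common_gin[OF assms] common_gin_good[where 'k = 'k] assms(2) by blast

subsection \<open>Uniqueness for good graphs\<close>

lemma good_has_type: "good X M ==> \<exists>\<tau>. has_type X M \<tau>"
proof (induction rule: good.induct)
 case (al M X k)
 then show ?case using has_type.al by blast
next
 case (be X M h)
 then show ?case using has_type.be by blast
next
 case (pq A B)
 then show ?case using has_type.pq by blast
next
 case (pp A B)
 then show ?case using has_type.pp by blast
qed

definition indep :: "nat set set => nat set => bool" where
 "indep M S \<longleftrightarrow> (\<forall>T\<in>M. \<not> T \<subseteq> S)"

text \<open>For two cliques \<open>U\<close> is the whole vertex set, as an independent set has at
  most one vertex in each; for a complete bipartite graph it is empty. A universal vertex joins a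
  nonempty \<open>U\<close>, which is harmless because its only independent set is a
  singleton.\<close>

lemma good_face_count:
 "good X M ==> \<exists>U \<tau> c. face_count X M U \<tau> c \<and> (\<forall>S. S \<subseteq> X --> indep M S --> card (S \<inter> U) \<le> 2)"
proof (induction rule: good.induct)
 case (al M X k)
 then obtain U \<tau> c where fc: "face_count (X - {k}) (del M k) U \<tau> c"
  and ind: "\<And>S. S \<subseteq> X - {k} ==> indep (del M k) S ==> card (S \<inter> U) \<le> 2" by blast
 have UX: "U \<subseteq> X - {k}" using face_count_basic[OF fc] by simp
 define U' where "U' = (if U = {} then {} else insert k U)"
 have "U' - {k} = U" "k \<in> U' \<or> U' = {}" using UX by (auto simp: U'_def)
 then have "face_count X M U' (Al \<tau>) (Suc c)" using face_count.al[OF al(1,2), of U'] fc by simp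
 moreover have "card (S \<inter> U') \<le> 2" if S: "S \<subseteq> X" "indep M S" for S
 proof (cases "k \<in> S")
  case True
  have "S \<subseteq> {k}"
  proof
   fix x assume x: "x \<in> S"
   show "x \<in> {k}"
   proof (rule ccontr)
    assume "x \<notin> {k}"
    then have "{k, x} \<in> M" using al(2) x S(1) by (auto simp: univ_def)
    then show False using S(2) x True by (auto simp: indep_def)
   qed
  qed
  then have "card (S \<inter> U') \<le> card {k}" by (intro card_mono) auto
  then show ?thesis by simp
 next
  case False
  then have "S \<inter> U' = S \<inter> U" by (auto simp: U'_def)
  moreover have "indep (del M k) S" using S(2) by (auto simp: indep_def del_def)
  ultimately show ?thesis using ind[of S] S(1) False by auto
 qed
 ultimately show ?case by blast
next
 case (be X M h)
 then obtain U \<tau> c where fc: "face_count (X - {h}) M U \<tau> c"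
  and ind: "\<And>S. S \<subseteq> X - {h} ==> indep M S ==> card (S \<inter> U) \<le> 2" by blast
 have UX: "U \<subseteq> X - {h}" using face_count_basic[OF fc] by simp
 then have "face_count X M U (Be \<tau>) (2 * c)" using face_count.be[OF be(1) _ fc] by blast
 moreover have "card (S \<inter> U) \<le> 2" if S: "S \<subseteq> X" "indep M S" for S
 proof -
  have "S \<inter> U = (S - {h}) \<inter> U" using UX by blast
  moreover have "indep M (S - {h})" using S(2) by (auto simp: indep_def)
  ultimately show ?thesis using ind[of "S - {h}"] S(1) by auto
 qed
 ultimately show ?case by blast
next
 case (pq A B)
 then show ?case using face_count.pq[OF has_type.pq[OF pq]] by (metis card.empty inf_bot_right zero_le)
next
 case (pp A B)
 have "card (S \<inter> (A \<union> B)) \<le> 2" if S: "S \<subseteq> A \<union> B" "indep (nsub 2 A \<union> nsub 2 B) S" for S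
 proof -
  have one: "card (S \<inter> Y) \<le> 1" if "nsub 2 Y \<subseteq> nsub 2 A \<union> nsub 2 B" "finite Y" for Y
  proof (rule ccontr)
   assume "\<not> card (S \<inter> Y) \<le> 1"
   then have "\<exists>x\<in>S \<inter> Y. \<exists>y\<in>S \<inter> Y. x ~= y"
    using card_le_Suc0_iff_eq[of "S \<inter> Y"] that(2) by (auto simp: One_nat_def)
   then obtain x y where "x \<in> S \<inter> Y" "y \<in> S \<inter> Y" "x ~= y" by blast
   then have "{x, y} \<in> nsub 2 Y" "{x, y} \<subseteq> S" by auto
   moreover from this(1) have "{x, y} \<in> nsub 2 A \<union> nsub 2 B" using that(1) by blast
   ultimately show False using S(2) unfolding indep_def by blast
  qed
  have "card (S \<inter> (A \<union> B)) \<le> card (S \<inter> A) + card (S \<inter> B)" by (simp add: Int_Un_distrib card_Un_le)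
  then show ?thesis using one[of A] one[of B] pp(1,2) by simp
 qed
 then show ?case using face_count.full[OF has_type.pp[OF pp]] by blast
qed

lemma exists_standard_term_order: "\<exists>\<sigma>. standard_term_order n \<sigma>"
 using standard_term_order_sum[OF inj_lexw lexw_less] by blast

lemma Gins_facts:
 assumes inf: "infinite (UNIV :: 'k::field set)" and F: "upclosed n F"
 shows "Gins n (fsupp F :: 'k ext set) \<subseteq> Trans n (fsupp F)" "Gins n (fsupp F :: 'k ext set) ~= {}"
 using Gin_in_Trans[OF inf _ F] exists_standard_term_order[of n] by (auto simp: Gins_def)

lemma Trans_single_Gins_single:
 assumes inf: "infinite (UNIV :: 'k::field set)" and F: "upclosed n F"
  and one: "card (Trans n (fsupp F :: 'k ext set)) = 1"
 shows "card (Gins n (fsupp F :: 'k ext set)) = 1"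
proof -
 obtain I where "Trans n (fsupp F :: 'k ext set) = {I}" using one by (rule card_1_singletonE)
 then have "Gins n (fsupp F :: 'k ext set) \<subseteq> {I}" using Gins_facts(1)[OF inf F] by simp
 then have "Gins n (fsupp F :: 'k ext set) = {I}" using Gins_facts(2)[OF inf F] by (simp add: subset_singleton_iff)
 then show ?thesis by simp
qed

lemma face_count_Trans_single:
 assumes inf: "infinite (UNIV :: 'k::field set)" and fc: "face_count {1..n} M U \<tau> c"
  and F: "upclosed n (Pow {1..n} - faces {1..n} M U)"
 shows "card (Trans n (fsupp (Pow {1..n} - faces {1..n} M U) :: 'k ext set)) = 1"
proof -
 obtain I where I: "I \<in> Trans n (fsupp (Pow {1..n} - faces {1..n} M U) :: 'k ext set)"
  using Gins_facts[OF inf F] by blast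
 then have "Trans n (fsupp (Pow {1..n} - faces {1..n} M U) :: 'k ext set) = {I}"
  using strongly_stable_unique[OF fc] by blast
 then show ?thesis by simp
qed

text \<open>Both ideals have the same degree 2 part. With a matrix generic for both, so have their
  generic initial ideals, and that of the graph is determined by its pairs.\<close>

lemma Gins_single_degree_two:
 assumes inf: "infinite (UNIV :: 'k::field set)" and F: "upclosed n F" and M: "M \<subseteq> nsub 2 {1..n}"
  and F2: "F \<inter> nsub 2 {1..n} = M" and one: "card (Gins n (fsupp F :: 'k ext set)) = 1"
 shows "card (Gins n (fsupp (nonfaces n M) :: 'k ext set)) = 1"
proof -
 let ?H = "nonfaces n M"
 obtain I where I: "Gins n (fsupp F :: 'k ext set) = {I}" using one by (rule card_1_singletonE)
 have F': "F \<subseteq> Pow {1..n}" using F by (simp add: upclosed_def)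
 have step: "\<exists>L. I = fsupp L \<and> Gin n \<sigma> (fsupp ?H :: 'k ext set) = fsupp (nonfaces n (L \<inter> nsub 2 {1..n}))"
  if \<sigma>: "standard_term_order n \<sigma>" for \<sigma>
 proof -
  have ord: "term_order n \<sigma>" using \<sigma> by (simp add: standard_term_order_def)
  obtain A :: "'k mat" where A: "A \<in> GL n"
   "Gin n \<sigma> (fsupp F :: 'k ext set) = fsupp (inif (term_rank n \<sigma>) (colv n A) F)"
   "Gin n \<sigma> (fsupp ?H :: 'k ext set) = fsupp (inif (term_rank n \<sigma>) (colv n A) ?H)"
   using Gin_common[OF inf ord F upclosed_nonfaces[OF M]] by blast
  obtain w where b: "dual_bases {1..n} {1..n} (colv n A) w" using GL_dual_bases[OF A(1)] by blast
  have "Gin n \<sigma> (fsupp F :: 'k ext set) \<in> Gins n (fsupp F)" using \<sigma> by (auto simp: Gins_def)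
  then have "I = fsupp (inif (term_rank n \<sigma>) (colv n A) F)" using I A(2) by simp
  moreover have "inif (term_rank n \<sigma>) (colv n A) F \<inter> nsub 2 {1..n} = inif (term_rank n \<sigma>) (colv n A) M"
   using inif_graded[OF b F'] F2 by simp
  ultimately show ?thesis using A(3) inif_nonfaces[OF b mono_rank_term_rank[OF ord] M] by metis
 qed
 obtain \<sigma>0 where \<sigma>0: "standard_term_order n \<sigma>0" using exists_standard_term_order by blast
 obtain L where L: "I = fsupp L" using step[OF \<sigma>0] by blast
 have "Gin n \<sigma> (fsupp ?H :: 'k ext set) = fsupp (nonfaces n (L \<inter> nsub 2 {1..n}))"
  if "standard_term_order n \<sigma>" for \<sigma>
  using step[OF that] L fsupp_inject by metis
 then have "Gins n (fsupp ?H :: 'k ext set) = {fsupp (nonfaces n (L \<inter> nsub 2 {1..n}))}"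
  using \<sigma>0 by (auto simp: Gins_def)
 then show ?thesis by simp
qed

subsection \<open>Graphs as simplicial complexes\<close>

lemma verts_mk_graph: "E \<subseteq> nsub 2 W ==> verts (mk_graph W E) = W"
 by (auto simp: verts_def mk_graph_def nsub_def)

lemma mk_graph_pair: "E \<subseteq> nsub 2 W ==> x ~= y ==> {x, y} \<in> mk_graph W E \<longleftrightarrow> {x, y} \<in> E"
 by (auto simp: mk_graph_def doubleton_eq_iff)

lemma mk_graph_edges: "E \<subseteq> nsub 2 W ==> {S \<in> mk_graph W E. card S = 2} = E"
 by (auto simp: mk_graph_def nsub_def)

lemma mk_graph_eqD:
 assumes "mk_graph W E = mk_graph W' E'" "E \<subseteq> nsub 2 W" "E' \<subseteq> nsub 2 W'"
 shows "W = W'" "E = E'"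
 using verts_mk_graph[OF assms(2)] verts_mk_graph[OF assms(3)] mk_graph_edges[OF assms(2)] mk_graph_edges[OF assms(3)]
  assms(1) by simp_all

lemma graph_on_mk_graph:
 assumes "graph_on n G"
 obtains E where "E \<subseteq> nsub 2 {1..n}" "G = mk_graph {1..n} E"
proof -
 define E where "E = {S \<in> G. card S = 2}"
 have sc: "G \<subseteq> Pow {1..n}" "\<And>S T. S \<in> G ==> T \<subseteq> S ==> T \<in> G" "\<And>j. j \<in> {1..n} ==> {j} \<in> G"
  "\<And>S. S \<in> G ==> card S \<le> 2" "G ~= {}"
  using assms by (auto simp: graph_on_def simplicial_complex_def)
 have "E \<subseteq> nsub 2 {1..n}" using sc(1) by (auto simp: E_def nsub_def)
 moreover have "G = mk_graph {1..n} E"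
 proof
  show "G \<subseteq> mk_graph {1..n} E"
  proof
   fix S assume S: "S \<in> G"
   then have SN: "S \<subseteq> {1..n}" using sc(1) by blast
   then have fin: "finite S" using finite_subset by blast
   consider "card S = 0" | "card S = 1" | "card S = 2" using sc(4)[OF S] by linarith
   then show "S \<in> mk_graph {1..n} E"
   proof cases
    case 1
    then show ?thesis using fin by (simp add: mk_graph_def)
   next
    case 2
    then obtain x where "S = {x}" by (rule card_1_singletonE)
    then show ?thesis using SN by (auto simp: mk_graph_def)
   next
    case 3
    then show ?thesis using S by (simp add: mk_graph_def E_def)
   qed
  qed
  have "{} \<in> G" using sc(2,5) by blast
  then show "mk_graph {1..n} E \<subseteq> G" using sc(3) by (auto simp: mk_graph_def E_def)
 qed
 ultimately show thesis by (rule that)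
qed

lemma contains_induced_iff:
 assumes E: "E \<subseteq> nsub 2 X" and H: "H \<subseteq> nsub 2 V"
 shows "contains_induced (mk_graph X E) (mk_graph V H) \<longleftrightarrow> embeds True V H X E"
proof
 assume "contains_induced (mk_graph X E) (mk_graph V H)"
 then obtain W f where W: "W \<subseteq> X" "bij_betw f V W" "(\<lambda>S. f ` S) ` mk_graph V H = {S \<in> mk_graph X E. S \<subseteq> W}"
  unfolding contains_induced_def verts_mk_graph[OF E] verts_mk_graph[OF H] by blast
 have inj: "inj_on f V" and im: "f ` V = W" using W(2) by (auto simp: bij_betw_def)
 show "embeds True V H X E"
  unfolding embeds_def
 proof (intro exI[of _ f] conjI ballI impI)
  fix x y assume xy: "x \<in> V" "y \<in> V" "x ~= y"
  then have ne: "f x ~= f y" using inj by (auto simp: inj_on_def)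
  have "{f x, f y} \<in> E \<longleftrightarrow> {f x, f y} \<in> {S \<in> mk_graph X E. S \<subseteq> W}"
   using mk_graph_pair[OF E ne] xy im by auto
  also have "\<dots> \<longleftrightarrow> f ` {x, y} \<in> (\<lambda>S. f ` S) ` mk_graph V H" unfolding W(3) by simp
  also have "\<dots> \<longleftrightarrow> {x, y} \<in> mk_graph V H"
  proof
   assume "f ` {x, y} \<in> (\<lambda>S. f ` S) ` mk_graph V H"
   then obtain S where S: "S \<in> mk_graph V H" "f ` {x, y} = f ` S" by blast
   have "S \<subseteq> V" using S(1) verts_mk_graph[OF H] by (auto simp: verts_def)
   then have "{x, y} = S" using inj_on_image_eq_iff[OF inj, of "{x, y}" S] xy S(2) by simp
   then show "{x, y} \<in> mk_graph V H" using S(1) by simp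
  qed blast
  also have "\<dots> \<longleftrightarrow> {x, y} \<in> H" by (rule mk_graph_pair[OF H xy(3)])
  finally show "({f x, f y} \<in> E) = (({x, y} \<in> H) = True)" by simp
 qed (use inj im W(1) in auto)
next
 assume "embeds True V H X E"
 then obtain f where f: "inj_on f V" "f ` V \<subseteq> X" "\<And>x y. x \<in> V ==> y \<in> V ==> x ~= y ==> {f x, f y} \<in> E \<longleftrightarrow> {x, y} \<in> H"
  by (auto simp: embeds_def)
 have "(\<lambda>S. f ` S) ` mk_graph V H = {S \<in> mk_graph X E. S \<subseteq> f ` V}"
 proof
  show "(\<lambda>S. f ` S) ` mk_graph V H \<subseteq> {S \<in> mk_graph X E. S \<subseteq> f ` V}"
  proof (rule image_subsetI)
   fix S assume S: "S \<in> mk_graph V H"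
   consider "S = {}" | v where "S = {v}" "v \<in> V" | "S \<in> H" using S by (auto simp: mk_graph_def)
   then show "f ` S \<in> {S \<in> mk_graph X E. S \<subseteq> f ` V}"
   proof cases
    case 3
    then obtain x y where xy: "S = {x, y}" "x \<in> V" "y \<in> V" "x ~= y" using H by (blast elim: nsub2E)
    then have "{f x, f y} \<in> E" using f(3) 3 by simp
    then show ?thesis using xy by (auto simp: mk_graph_def)
   qed (use f(2) in \<open>auto simp: mk_graph_def\<close>)
  qed
  show "{S \<in> mk_graph X E. S \<subseteq> f ` V} \<subseteq> (\<lambda>S. f ` S) ` mk_graph V H"
  proof
   fix S assume S: "S \<in> {S \<in> mk_graph X E. S \<subseteq> f ` V}"
   then consider "S = {}" | v where "S = {v}" "v \<in> X" | "S \<in> E" by (auto simp: mk_graph_def)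
   then show "S \<in> (\<lambda>S. f ` S) ` mk_graph V H"
   proof cases
    case 1
    then show ?thesis by (intro image_eqI[of _ _ "{}"]) (auto simp: mk_graph_def)
   next
    case 2
    then obtain u where u: "u \<in> V" "v = f u" using S by auto
    then show ?thesis using 2 by (intro image_eqI[of _ _ "{u}"]) (auto simp: mk_graph_def)
   next
    case 3
    then obtain a b where ab: "S = {a, b}" "a ~= b" using E by (blast elim: nsub2E)
    then obtain x y where xy: "x \<in> V" "a = f x" "y \<in> V" "b = f y" using S by auto
    then have "{x, y} \<in> H" using f(3)[of x y] 3 ab by auto
    then show ?thesis using ab xy by (intro image_eqI[of _ _ "{x, y}"]) (auto simp: mk_graph_def)
   qed
  qed
 qed
 then show "contains_induced (mk_graph X E) (mk_graph V H)"
  unfolding contains_induced_def verts_mk_graph[OF E] verts_mk_graph[OF H] using f(1,2)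
  by (intro exI[of _ "f ` V"] conjI exI[of _ f]) (auto simp: bij_betw_def)
qed

lemma complement_graph_mk:
 assumes "E \<subseteq> nsub 2 X"
 shows "complement_graph (mk_graph X E) = mk_graph X (nsub 2 X - E)"
proof -
 have "{{i, j} | i j. i \<in> X \<and> j \<in> X \<and> i ~= j \<and> {i, j} \<notin> mk_graph X E} = nsub 2 X - E"
 proof
  show "{{i, j} | i j. i \<in> X \<and> j \<in> X \<and> i ~= j \<and> {i, j} \<notin> mk_graph X E} \<subseteq> nsub 2 X - E"
   by (auto simp: mk_graph_def)
  show "nsub 2 X - E \<subseteq> {{i, j} | i j. i \<in> X \<and> j \<in> X \<and> i ~= j \<and> {i, j} \<notin> mk_graph X E}"
  proof
   fix S assume S: "S \<in> nsub 2 X - E"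
   then obtain i j where "S = {i, j}" "i \<in> X" "j \<in> X" "i ~= j" by (blast elim: nsub2E)
   then show "S \<in> {{i, j} | i j. i \<in> X \<and> j \<in> X \<and> i ~= j \<and> {i, j} \<notin> mk_graph X E}"
    using S mk_graph_pair[OF assms] by blast
  qed
 qed
 then show ?thesis unfolding complement_graph_def verts_mk_graph[OF assms] by simp
qed

lemma embeds_complement:
 assumes "E \<subseteq> nsub 2 X"
 shows "embeds True V H X E \<longleftrightarrow> embeds False V H X (nsub 2 X - E)"
proof -
 have "({f x, f y} \<in> E) = (({x, y} \<in> H) = True) \<longleftrightarrow> ({f x, f y} \<in> nsub 2 X - E) = (({x, y} \<in> H) = False)"
  if "inj_on f V" "f ` V \<subseteq> X" "x \<in> V" "y \<in> V" "x ~= y" for f x y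
 proof -
  have "{f x, f y} \<in> nsub 2 X" using that by (auto simp: inj_on_def)
  then show ?thesis by auto
 qed
 then show ?thesis unfolding embeds_def by (intro ex_cong1) (metis (no_types, lifting))
qed

lemma induced_iff_good:
 assumes E: "E \<subseteq> nsub 2 X" and fin: "finite X"
 shows "(\<forall>H\<in>{graph_a, graph_b, graph_c}.
   \<not> contains_induced (mk_graph X E) H \<and> \<not> contains_induced (complement_graph (mk_graph X E)) H) \<longleftrightarrow>
  good X (nsub 2 X - E)"
proof -
 have patterns: "H \<subseteq> nsub 2 V" if "(V, H) \<in> patterns" for V H
  using that by (auto simp: patterns_def)
 have one: "\<not> contains_induced (mk_graph X E) (mk_graph V H) \<and>
   \<not> contains_induced (complement_graph (mk_graph X E)) (mk_graph V H) \<longleftrightarrow>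
   (\<forall>s. \<not> embeds s V H X (nsub 2 X - E))" if p: "(V, H) \<in> patterns" for V H
  unfolding complement_graph_mk[OF E] contains_induced_iff[OF E patterns[OF p]]
   contains_induced_iff[OF Diff_subset patterns[OF p]] embeds_complement[OF E] by (metis (full_types))
 have "(\<forall>H\<in>{graph_a, graph_b, graph_c}.
   \<not> contains_induced (mk_graph X E) H \<and> \<not> contains_induced (complement_graph (mk_graph X E)) H) \<longleftrightarrow>
  (\<forall>(V, H)\<in>patterns. \<not> contains_induced (mk_graph X E) (mk_graph V H) \<and>
   \<not> contains_induced (complement_graph (mk_graph X E)) (mk_graph V H))"
  unfolding patterns_def graph_a_def graph_b_def graph_c_def by simp
 also have "\<dots> \<longleftrightarrow> pattern_free X (nsub 2 X - E)" unfolding pattern_free_def using one by fast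
 also have "\<dots> \<longleftrightarrow> good X (nsub 2 X - E)" by (rule good_iff_pattern_free[OF fin Diff_subset, symmetric])
 finally show ?thesis .
qed

subsection \<open>Near cones\<close>

lemma delete_verts_delete_verts: "delete_verts (delete_verts G A) B = delete_verts G (A \<union> B)"
 by (auto simp: delete_verts_def)

lemma delete_verts_mk_graph:
 "E \<subseteq> nsub 2 W ==> delete_verts (mk_graph W E) D = mk_graph (W - D) {S \<in> E. S \<inter> D = {}}"
 by (auto simp: delete_verts_def mk_graph_def)

lemma k_near_cone_0: "k_near_cone 0 G G' \<longleftrightarrow> G' = G"
 by (auto simp: k_near_cone_def delete_verts_def)

text \<open>The defining sequence is indexed from 1, so splitting off the first apex shifts the
  rest; inductions on \<open>k\<close> then always delete the first apex.\<close>

lemma k_near_cone_Suc: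
 "k_near_cone (Suc k) G G' \<longleftrightarrow> (\<exists>v. near_cone G v \<and> k_near_cone k (delete_verts G {v}) G')"
proof
 assume "k_near_cone (Suc k) G G'"
 then obtain v where v: "\<And>t. t \<in> {1..Suc k} ==> near_cone (delete_verts G (v ` {1..<t})) (v t)"
  "G' = delete_verts G (v ` {1..Suc k})" unfolding k_near_cone_def by blast
 have shift: "{v 1} \<union> (\<lambda>t. v (Suc t)) ` {1..<t} = v ` {1..<Suc t}" if "1 \<le> t" for t
 proof -
  have "{1..<Suc t} = insert 1 (Suc ` {1..<t})" using that by (auto simp: image_Suc_atLeastLessThan)
  then show ?thesis by (simp del: image_Suc_atLeastLessThan add: image_image)
 qed
 have "near_cone G (v 1)" using v(1)[of 1] by (simp add: delete_verts_def)
 moreover have "k_near_cone k (delete_verts G {v 1}) G'"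
  unfolding k_near_cone_def delete_verts_delete_verts
 proof (intro exI[of _ "\<lambda>t. v (Suc t)"] conjI ballI)
  fix t assume t: "t \<in> {1..k}"
  then show "near_cone (delete_verts G ({v 1} \<union> (\<lambda>t. v (Suc t)) ` {1..<t})) (v (Suc t))"
   using v(1)[of "Suc t"] shift[of t] by simp
 next
  show "G' = delete_verts G ({v 1} \<union> (\<lambda>t. v (Suc t)) ` {1..k})"
   using v(2) shift[of "Suc k"] by (simp add: atLeastLessThanSuc_atLeastAtMost)
 qed
 ultimately show "\<exists>v. near_cone G v \<and> k_near_cone k (delete_verts G {v}) G'" by blast
next
 assume "\<exists>v. near_cone G v \<and> k_near_cone k (delete_verts G {v}) G'"
 then obtain x u where x: "near_cone G x"
  and u: "\<And>t. t \<in> {1..k} ==> near_cone (delete_verts G ({x} \<union> u ` {1..<t})) (u t)"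
   "G' = delete_verts G ({x} \<union> u ` {1..k})"
  unfolding k_near_cone_def delete_verts_delete_verts by blast
 define v where "v t = (if t = 1 then x else u (t - 1))" for t
 have shift: "{x} \<union> u ` {1..<t} = v ` {1..<Suc t}" if "1 \<le> t" for t
 proof -
  have "{1..<Suc t} = insert 1 (Suc ` {1..<t})" using that by (auto simp: image_Suc_atLeastLessThan)
  then have "v ` {1..<Suc t} = insert (v 1) ((\<lambda>s. v (Suc s)) ` {1..<t})"
   by (simp del: image_Suc_atLeastLessThan add: image_image)
  also have "v 1 = x" by (simp add: v_def)
  also have "(\<lambda>s. v (Suc s)) ` {1..<t} = u ` {1..<t}" by (intro image_cong) (auto simp: v_def)
  finally show ?thesis by simp
 qed
 show "k_near_cone (Suc k) G G'"
  unfolding k_near_cone_def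
 proof (intro exI[of _ v] conjI ballI)
  fix t assume t: "t \<in> {1..Suc k}"
  show "near_cone (delete_verts G (v ` {1..<t})) (v t)"
  proof (cases "t = 1")
   case True
   then show ?thesis using x by (simp add: v_def delete_verts_def)
  next
   case False
   then obtain s where s: "t = Suc s" "s \<in> {1..k}" using t by (cases t) auto
   then show ?thesis using u(1)[OF s(2)] shift[of s] by (simp add: v_def)
  qed
 next
  show "G' = delete_verts G (v ` {1..Suc k})"
   using u(2) shift[of "Suc k"] by (simp add: atLeastLessThanSuc_atLeastAtMost)
 qed
qed

section \<open>Near cones in terms of nonedges\<close>

lemma prods_nsub: "A \<inter> B = {} ==> prods A B \<subseteq> nsub 2 (A \<union> B)"
 by (auto simp: prods_def)

lemma nsub_minus_prods:
 assumes "A \<inter> B = {}"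
 shows "nsub 2 (A \<union> B) - prods A B = nsub 2 A \<union> nsub 2 B"
proof
 show "nsub 2 (A \<union> B) - prods A B \<subseteq> nsub 2 A \<union> nsub 2 B"
 proof
  fix S assume S: "S \<in> nsub 2 (A \<union> B) - prods A B"
  then obtain x y where xy: "S = {x, y}" "x \<in> A \<union> B" "y \<in> A \<union> B" "x ~= y" by (blast elim: nsub2E)
  have "\<not> (x \<in> A \<and> y \<in> B)" "\<not> (y \<in> A \<and> x \<in> B)" using S xy(1) unfolding prods_def by blast+
  then show "S \<in> nsub 2 A \<union> nsub 2 B" using xy by auto
 qed
 show "nsub 2 A \<union> nsub 2 B \<subseteq> nsub 2 (A \<union> B) - prods A B"
  using assms by (auto simp: prods_def nsub_def)
qed

lemma nsub_minus_nsubs: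
 assumes "A \<inter> B = {}"
 shows "nsub 2 (A \<union> B) - (nsub 2 A \<union> nsub 2 B) = prods A B"
 using nsub_minus_prods[OF assms] prods_nsub[OF assms] by blast

lemma complete_graph_mk: "complete_graph W = mk_graph W (nsub 2 W)"
proof -
 have "{{i, j} | i j. i \<in> W \<and> j \<in> W \<and> i ~= j} = nsub 2 W" by (auto elim!: nsub2E)
 then show ?thesis by (simp add: complete_graph_def)
qed

lemma complete_bipartite_graph_mk: "complete_bipartite_graph A B = mk_graph (A \<union> B) (prods A B)"
 by (simp add: complete_bipartite_graph_def prods_def)

definition base_graph :: "nat set set => bool" where
 "base_graph G \<longleftrightarrow> semi_complete_bipartite G \<or> disjoint_union_two_semi_complete G"

text \<open>Among the nonedges the two parts become cliques and the isolated vertices become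
  universal.\<close>

lemma semi_complete_bipartite_good:
 assumes E: "E \<subseteq> nsub 2 W" and fin: "finite W" and G: "semi_complete_bipartite (mk_graph W E)"
 shows "good W (nsub 2 W - E)"
proof -
 obtain I A B where IAB: "(\<forall>v\<in>I. isolated_vertex (mk_graph W E) v) \<and> A \<inter> B = {} \<and>
   delete_verts (mk_graph W E) I = mk_graph (A \<union> B) (prods A B)"
  using G unfolding semi_complete_bipartite_def complete_bipartite_graph_mk by (elim exE) (rule that)
 then have I: "\<And>v. v \<in> I ==> isolated_vertex (mk_graph W E) v" and AB: "A \<inter> B = {}"
  and d: "delete_verts (mk_graph W E) I = mk_graph (A \<union> B) (prods A B)" by simp_all
 have iso: "v \<notin> S" if v: "v \<in> I" and S: "S \<in> E" for v S
 proof
  assume "v \<in> S"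
  then have "S = {v}" using I[OF v] S by (auto simp: isolated_vertex_def mk_graph_def)
  then show False using S E by (auto simp: nsub_def)
 qed
 then have EI: "{S \<in> E. S \<inter> I = {}} = E" by blast
 have EW: "E \<subseteq> nsub 2 (W - I)" using E iso by (auto simp: nsub_def)
 have e: "W - I = A \<union> B" "E = prods A B"
  using mk_graph_eqD[OF d[unfolded delete_verts_mk_graph[OF E] EI] EW prods_nsub[OF AB]] by simp_all
 have IW: "I \<subseteq> W" using I by (auto simp: isolated_vertex_def verts_mk_graph[OF E])
 have fins: "finite A" "finite B" using e(1) fin finite_subset[of A W] finite_subset[of B W] by auto
 have "good (A \<union> B) (nsub 2 (A \<union> B) - E)"
  using good.pp[OF fins AB] nsub_minus_prods[OF AB] e(2) by simp
 then have "good ((A \<union> B) \<union> I) (nsub 2 ((A \<union> B) \<union> I) - E)"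
  by (rule good_add_isolated) (use iso IW fin finite_subset in auto)
 moreover have "(A \<union> B) \<union> I = W" using e(1) IW by blast
 ultimately show ?thesis by simp
qed

lemma semi_complete_core:
 assumes "semi_complete G"
 obtains W where "mk_graph W (nsub 2 W) \<subseteq> G" "\<And>S. S \<in> G ==> card S = 2 ==> S \<in> nsub 2 W"
proof -
 obtain I W where IW: "(\<forall>v\<in>I. isolated_vertex G v) \<and> delete_verts G I = mk_graph W (nsub 2 W)"
  using assms unfolding semi_complete_def complete_graph_mk by (elim exE) (rule that)
 then have I: "\<And>v. v \<in> I ==> isolated_vertex G v" and d: "delete_verts G I = mk_graph W (nsub 2 W)"
  by simp_all
 have "S \<in> nsub 2 W" if S: "S \<in> G" "card S = 2" for S
 proof -
  have "S \<inter> I = {}"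
  proof (rule equals0I)
   fix v assume "v \<in> S \<inter> I"
   then have "S = {v}" using I[of v] S(1) by (auto simp: isolated_vertex_def)
   then show False using S(2) by simp
  qed
  then have "S \<in> mk_graph W (nsub 2 W)" using S(1) d by (auto simp: delete_verts_def)
  then show ?thesis using mk_graph_edges[of "nsub 2 W" W] S(2) by blast
 qed
 moreover have "mk_graph W (nsub 2 W) \<subseteq> G" using d by (auto simp: delete_verts_def)
 ultimately show thesis using that by blast
qed

text \<open>The nonedges between the two cliques form a complete bipartite graph; all other vertices
  are isolated in the graph.\<close>

lemma disjoint_union_good:
 assumes E: "E \<subseteq> nsub 2 W" and fin: "finite W" and G: "disjoint_union_two_semi_complete (mk_graph W E)"
 shows "good W (nsub 2 W - E)"
proof -
 obtain G1 G2 where G12: "semi_complete G1" "semi_complete G2" "verts G1 \<inter> verts G2 = {}" "mk_graph W E = G1 \<union> G2"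
  using G unfolding disjoint_union_two_semi_complete_def by blast
 obtain A where A: "mk_graph A (nsub 2 A) \<subseteq> G1" "\<And>S. S \<in> G1 ==> card S = 2 ==> S \<in> nsub 2 A"
  using semi_complete_core[OF G12(1)] by blast
 obtain B where B: "mk_graph B (nsub 2 B) \<subseteq> G2" "\<And>S. S \<in> G2 ==> card S = 2 ==> S \<in> nsub 2 B"
  using semi_complete_core[OF G12(2)] by blast
 have mem: "x \<in> verts G'" if "mk_graph Y (nsub 2 Y) \<subseteq> G'" "x \<in> Y" for x Y G'
  using that by (auto simp: mk_graph_def verts_def)
 have AB: "A \<inter> B = {}" using mem[OF A(1)] mem[OF B(1)] G12(3) by blast
 have "verts G1 \<union> verts G2 = W" using verts_mk_graph[OF E] G12(4) by (simp add: verts_def)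
 then have sub: "A \<union> B \<subseteq> W" using mem[OF A(1)] mem[OF B(1)] by blast
 have "E = nsub 2 A \<union> nsub 2 B"
 proof
  show "E \<subseteq> nsub 2 A \<union> nsub 2 B"
  proof
   fix S assume "S \<in> E"
   then have "S \<in> G1 \<union> G2" "card S = 2" using G12(4) E by (auto simp: mk_graph_def nsub_def)
   then show "S \<in> nsub 2 A \<union> nsub 2 B" using A(2) B(2) by blast
  qed
  show "nsub 2 A \<union> nsub 2 B \<subseteq> E"
  proof
   fix S assume S: "S \<in> nsub 2 A \<union> nsub 2 B"
   then have "S \<in> mk_graph W E" "card S = 2" using G12(4) A(1) B(1) by (auto simp: mk_graph_def nsub_def)
   then show "S \<in> E" using mk_graph_edges[OF E] by blast
  qed
 qed
 moreover have "finite A" "finite B" using sub fin finite_subset by blast+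
 ultimately have "good (A \<union> B) (nsub 2 (A \<union> B) - E)" using good.pq[OF _ _ AB] nsub_minus_nsubs[OF AB] by simp
 then have "good ((A \<union> B) \<union> (W - (A \<union> B))) (nsub 2 ((A \<union> B) \<union> (W - (A \<union> B))) - E)"
 proof (rule good_add_isolated)
  show "x \<notin> S" if "x \<in> W - (A \<union> B)" "S \<in> E" for x S
   using that \<open>E = nsub 2 A \<union> nsub 2 B\<close> by (auto simp: nsub_def)
 qed (use fin in simp)
 moreover have "(A \<union> B) \<union> (W - (A \<union> B)) = W" using sub by blast
 ultimately show ?thesis by simp
qed

text \<open>The vertices of \<open>I\<close>, which are not adjacent to the apex \<open>v\<close>,
  lie on no edge at all and are universal among the nonedges. Without them \<open>v\<close> is
  adjacent to everything, that is, isolated among the nonedges.\<close>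

lemma near_cone_good:
 assumes E: "E \<subseteq> nsub 2 W" and fin: "finite W" and v: "near_cone (mk_graph W E) v"
  and good: "good (W - {v}) (nsub 2 (W - {v}) - {S \<in> E. S \<inter> {v} = {}})"
 shows "good W (nsub 2 W - E)"
proof -
 have vW: "v \<in> W" using v by (simp add: near_cone_def verts_mk_graph[OF E])
 define N where "N = {x \<in> W - {v}. {v, x} \<in> E}"
 define I where "I = W - {v} - N"
 have nc: "{v, t} \<in> E" if "{j, t} \<in> E" "t ~= v" "j ~= t" for j t
 proof -
  have "{j, t} \<in> mk_graph W E" using that(1) by (simp add: mk_graph_def)
  then have "{j, t} - {j} \<union> {v} \<in> mk_graph W E" using v unfolding near_cone_def by blast
  moreover have "{j, t} - {j} \<union> {v} = {v, t}" using that(3) by auto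
  ultimately show ?thesis using mk_graph_pair[OF E, of v t] that(2) by simp
 qed
 have iso: "x \<notin> S" if x: "x \<in> I" and S: "S \<in> E" for x S
 proof
  assume "x \<in> S"
  obtain a b where ab: "S = {a, b}" "a ~= b" using S E by (blast elim: nsub2E)
  have xv: "x ~= v" using x by (simp add: I_def)
  have "{v, x} \<in> E" using nc[of a x] nc[of b x] ab S \<open>x \<in> S\<close> xv by (auto simp: insert_commute)
  then show False using x by (auto simp: I_def N_def)
 qed
 have eq: "nsub 2 N - {S \<in> E. S \<inter> {v} = {}} = nsub 2 N - E" by (auto simp: N_def nsub_def)
 have "good N (nsub 2 N - E)" using good_restrict[OF good, of N] eq by (auto simp: N_def)
 moreover have "isol (insert v N) (nsub 2 N - E) v" by (auto simp: isol_def N_def nsub_def)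
 moreover have "insert v N - {v} = N" by (auto simp: N_def)
 ultimately have "good (insert v N) (nsub 2 N - E)" using good.be[of "insert v N" "nsub 2 N - E" v] by simp
 moreover have "nsub 2 (insert v N) - E = nsub 2 N - E"
 proof
  show "nsub 2 (insert v N) - E \<subseteq> nsub 2 N - E"
  proof
   fix S assume S: "S \<in> nsub 2 (insert v N) - E"
   then obtain a b where ab: "S = {a, b}" "a \<in> insert v N" "b \<in> insert v N" "a ~= b" by (blast elim: nsub2E)
   have "a ~= v" "b ~= v" using ab S by (auto simp: N_def insert_commute)
   then show "S \<in> nsub 2 N - E" using ab S by auto
  qed
 qed (auto simp: nsub_def)
 ultimately have g: "good (insert v N) (nsub 2 (insert v N) - E)" by metis
 have "finite I" using fin by (simp add: I_def)
 from good_add_isolated[OF g this iso] have "good (insert v N \<union> I) (nsub 2 (insert v N \<union> I) - E)" .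
 moreover have "insert v N \<union> I = W" using vW by (auto simp: I_def N_def)
 ultimately show ?thesis by simp
qed

lemma k_near_cone_good:
 assumes "k_near_cone k (mk_graph W E) G'" "base_graph G'" "E \<subseteq> nsub 2 W" "finite W"
 shows "good W (nsub 2 W - E)"
 using assms(1,3,4)
proof (induction k arbitrary: W E)
 case 0
 then show ?case
  using assms(2) semi_complete_bipartite_good disjoint_union_good by (auto simp: k_near_cone_0 base_graph_def)
next
 case (Suc k)
 then obtain v where v: "near_cone (mk_graph W E) v" "k_near_cone k (delete_verts (mk_graph W E) {v}) G'"
  by (auto simp: k_near_cone_Suc)
 have "{S \<in> E. S \<inter> {v} = {}} \<subseteq> nsub 2 (W - {v})" using Suc.prems(2) by (auto simp: nsub_def)
 then have "good (W - {v}) (nsub 2 (W - {v}) - {S \<in> E. S \<inter> {v} = {}})"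
  using Suc.IH[of "W - {v}" "{S \<in> E. S \<inter> {v} = {}}"] v(2) Suc.prems by (simp add: delete_verts_mk_graph)
 then show ?case by (rule near_cone_good[OF Suc.prems(2,3) v(1)])
qed

text \<open>\<open>W\<close> may be larger than \<open>X\<close>: a vertex universal among the
  nonedges is isolated in the graph and is left behind in the base graph, which tolerates isolated
  vertices. A vertex isolated among the nonedges becomes an apex.\<close>

lemma good_k_near_cone:
 "good X M ==> X \<subseteq> W ==> \<exists>k G'. k_near_cone k (mk_graph W (nsub 2 X - M)) G' \<and> base_graph G'"
proof (induction arbitrary: W rule: good.induct)
 case (al M X k)
 have "nsub 2 X - M = nsub 2 (X - {k}) - del M k"
 proof
  show "nsub 2 X - M \<subseteq> nsub 2 (X - {k}) - del M k"
  proof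
   fix S assume S: "S \<in> nsub 2 X - M"
   then obtain a b where ab: "S = {a, b}" "a \<in> X" "b \<in> X" "a ~= b" by (blast elim: nsub2E)
   have "a ~= k" "b ~= k" using ab S al(2) by (auto simp: univ_def insert_commute)
   then show "S \<in> nsub 2 (X - {k}) - del M k" using ab S by (auto simp: del_def)
  qed
 qed (auto simp: nsub_def del_def)
 then show ?case using al.IH[of W] al.prems by auto
next
 case (be X M h)
 let ?E = "nsub 2 X - M"
 have hX: "h \<in> X" and hM: "\<And>S. S \<in> M ==> h \<notin> S" using be(1) by (auto simp: isol_def)
 have E: "?E \<subseteq> nsub 2 W" using be.prems by (auto simp: nsub_def)
 have pair: "{y, h} \<in> ?E" if "y \<in> X" "y ~= h" for y using that hX hM[of "{y, h}"] by auto
 have "near_cone (mk_graph W ?E) h"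
  unfolding near_cone_def
 proof (intro conjI ballI)
  show "h \<in> verts (mk_graph W ?E)" using hX be.prems by (auto simp: verts_mk_graph[OF E])
  fix S j assume S: "S \<in> mk_graph W ?E" and j: "j \<in> S"
  consider w where "S = {w}" | "S \<in> ?E" using S j by (auto simp: mk_graph_def)
  then show "S - {j} \<union> {h} \<in> mk_graph W ?E"
  proof cases
   case 1
   then have "S - {j} \<union> {h} = {h}" using j by auto
   then show ?thesis using hX be.prems by (auto simp: mk_graph_def)
  next
   case 2
   then obtain y where y: "S = {j, y}" "y \<in> X" "y ~= j" using j by (auto elim!: nsub2E)
   then have "S - {j} \<union> {h} = {y, h}" by auto
   then show ?thesis using pair[of y] y(2) hX be.prems by (cases "y = h") (auto simp: mk_graph_def)
  qed
 qed
 moreover have "delete_verts (mk_graph W ?E) {h} = mk_graph (W - {h}) (nsub 2 (X - {h}) - M)"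
 proof -
  have "{S \<in> ?E. S \<inter> {h} = {}} = nsub 2 (X - {h}) - M" by (auto simp: nsub_def)
  then show ?thesis by (simp add: delete_verts_mk_graph[OF E])
 qed
 moreover obtain k G' where "k_near_cone k (mk_graph (W - {h}) (nsub 2 (X - {h}) - M)) G'" "base_graph G'"
  using be.IH[of "W - {h}"] be.prems by auto
 ultimately show ?case using k_near_cone_Suc by metis
next
 case (pq A B)
 let ?G1 = "mk_graph (W - B) (nsub 2 A)" and ?G2 = "mk_graph B (nsub 2 B)"
 have E1: "nsub 2 A \<subseteq> nsub 2 (W - B)" using pq by (intro nsub_mono) blast
 have "semi_complete ?G1"
  unfolding semi_complete_def complete_graph_mk
 proof (rule exI[of _ "W - B - A"], rule exI[of _ A], rule conjI, rule ballI)
  fix v assume "v \<in> W - B - A"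
  then show "isolated_vertex ?G1 v"
   unfolding isolated_vertex_def verts_mk_graph[OF E1] by (auto simp: mk_graph_def nsub_def)
 next
  have "W - B - (W - B - A) = A" "{S \<in> nsub 2 A. S \<inter> (W - B - A) = {}} = nsub 2 A"
   using pq by (auto simp: nsub_def)
  then show "delete_verts ?G1 (W - B - A) = mk_graph A (nsub 2 A)" by (simp add: delete_verts_mk_graph[OF E1])
 qed
 moreover have "semi_complete ?G2"
  unfolding semi_complete_def complete_graph_mk
  by (rule exI[of _ "{}"], rule exI[of _ B]) (simp add: delete_verts_def)
 moreover have "verts ?G1 \<inter> verts ?G2 = {}" unfolding verts_mk_graph[OF E1] verts_mk_graph[OF order.refl] by blast
 moreover have "mk_graph W (nsub 2 (A \<union> B) - prods A B) = ?G1 \<union> ?G2"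
  unfolding nsub_minus_prods[OF pq(3)] using pq.prems by (auto simp: mk_graph_def)
 ultimately have "base_graph (mk_graph W (nsub 2 (A \<union> B) - prods A B))"
  unfolding base_graph_def disjoint_union_two_semi_complete_def by blast
 then show ?case using k_near_cone_0 by blast
next
 case (pp A B)
 let ?G = "mk_graph W (prods A B)"
 have E: "prods A B \<subseteq> nsub 2 W"
  using prods_nsub[OF pp(3)] nsub_mono[OF pp.prems, of 2] by blast
 have "semi_complete_bipartite ?G"
  unfolding semi_complete_bipartite_def complete_bipartite_graph_mk
 proof (rule exI[of _ "W - (A \<union> B)"], rule exI[of _ A], rule exI[of _ B], intro conjI)
  show "\<forall>v\<in>W - (A \<union> B). isolated_vertex ?G v"
   unfolding isolated_vertex_def verts_mk_graph[OF E] by (auto simp: mk_graph_def prods_def)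
  have "W - (W - (A \<union> B)) = A \<union> B" "{S \<in> prods A B. S \<inter> (W - (A \<union> B)) = {}} = prods A B"
   using pp.prems by (auto simp: prods_def)
  then show "delete_verts ?G (W - (A \<union> B)) = mk_graph (A \<union> B) (prods A B)" by (simp add: delete_verts_mk_graph[OF E])
 qed (rule pp(3))
 then have "base_graph (mk_graph W (nsub 2 (A \<union> B) - (nsub 2 A \<union> nsub 2 B)))"
  unfolding nsub_minus_nsubs[OF pp(3)] base_graph_def by blast
 then show ?case using k_near_cone_0 by blast
qed

lemma near_cone_iff_good:
 assumes "E \<subseteq> nsub 2 {1..n}"
 shows "(\<exists>k G'. k_near_cone k (mk_graph {1..n} E) G' \<and>
   (semi_complete_bipartite G' \<or> disjoint_union_two_semi_complete G')) \<longleftrightarrow> good {1..n} (nsub 2 {1..n} - E)"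
 using k_near_cone_good[OF _ _ assms] good_k_near_cone[of "{1..n}" "nsub 2 {1..n} - E" "{1..n}"] assms
 unfolding base_graph_def [symmetric] by (auto simp: double_diff)

lemma graph_nonfaces:
 assumes E: "E \<subseteq> nsub 2 {1..n}"
 shows "Pow {1..n} - mk_graph {1..n} E = nonfaces n (nsub 2 {1..n} - E)"
proof (rule Set.set_eqI)
 fix S
 show "S \<in> Pow {1..n} - mk_graph {1..n} E \<longleftrightarrow> S \<in> nonfaces n (nsub 2 {1..n} - E)"
 proof (cases "S \<subseteq> {1..n}")
  case True
  then have fin: "finite S" using finite_subset by blast
  consider "card S = 0" | "card S = 1" | "card S = 2" | "3 \<le> card S" by linarith
  then show ?thesis
  proof cases
   case 1
   then show ?thesis using fin by (auto simp: mk_graph_def nonfaces_def nsub_def)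
  next
   case 2
   then obtain x where "S = {x}" by (rule card_1_singletonE)
   then show ?thesis using True by (auto simp: mk_graph_def nonfaces_def nsub_def)
  next
   case 3
   then have "S ~= {}" "\<nexists>v. S = {v}" by auto
   then show ?thesis using 3 True by (auto simp: mk_graph_def nonfaces_def nsub_def)
  next
   case 4
   then have "S ~= {}" "\<nexists>v. S = {v}" "S \<notin> E" using E by (auto simp: nsub_def)
   then show ?thesis using 4 True by (auto simp: mk_graph_def nonfaces_def)
  qed
 qed (use E in \<open>auto simp: nonfaces_def nsub_def\<close>)
qed

lemma flag_complex_mk:
 assumes E: "E \<subseteq> nsub 2 X"
 shows "flag_complex (mk_graph X E) = {S. S \<subseteq> X \<and> indep (nsub 2 X - E) S}"
proof (rule Set.set_eqI)
 fix S
 have "(\<forall>i\<in>S. \<forall>j\<in>S. i ~= j --> {i, j} \<in> mk_graph X E) \<longleftrightarrow> indep (nsub 2 X - E) S" if S: "S \<subseteq> X"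
 proof
  assume h: "\<forall>i\<in>S. \<forall>j\<in>S. i ~= j --> {i, j} \<in> mk_graph X E"
  show "indep (nsub 2 X - E) S"
   unfolding indep_def
  proof (intro ballI notI)
   fix T assume T: "T \<in> nsub 2 X - E" "T \<subseteq> S"
   then obtain i j where "T = {i, j}" "i ~= j" by (blast elim: nsub2E)
   then show False using h T mk_graph_pair[OF E] by auto
  qed
 next
  assume h: "indep (nsub 2 X - E) S"
  show "\<forall>i\<in>S. \<forall>j\<in>S. i ~= j --> {i, j} \<in> mk_graph X E"
  proof (intro ballI impI)
   fix i j assume ij: "i \<in> S" "j \<in> S" "i ~= j"
   then have "{i, j} \<in> nsub 2 X" "{i, j} \<subseteq> S" using S by auto
   then have "{i, j} \<in> E" using h unfolding indep_def by blast
   then show "{i, j} \<in> mk_graph X E" by (simp add: mk_graph_def)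
  qed
 qed
 then show "S \<in> flag_complex (mk_graph X E) \<longleftrightarrow> S \<in> {S. S \<subseteq> X \<and> indep (nsub 2 X - E) S}"
  unfolding flag_complex_def verts_mk_graph[OF E] by blast
qed

lemma upclosed_flag: "upclosed n (Pow {1..n} - {S. S \<subseteq> {1..n} \<and> indep M S})"
 unfolding upclosed_def indep_def by blast

theorem theorem1p1:
 fixes n :: nat and G :: "nat set set"
 assumes "infinite (UNIV :: 'k::field set)"
  and "graph_on n G"
 shows
  "(card (Trans n (face_ideal n (flag_complex G) :: 'k ext set)) = 1 \<longleftrightarrow>
   card (Gins n (face_ideal n (flag_complex G) :: 'k ext set)) = 1) \<and>
   (card (Gins n (face_ideal n (flag_complex G) :: 'k ext set)) = 1 \<longleftrightarrow>
   card (Gins n (face_ideal n G :: 'k ext set)) = 1) \<and>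
   (card (Gins n (face_ideal n G :: 'k ext set)) = 1 \<longleftrightarrow>
   card (Trans n (face_ideal n G :: 'k ext set)) = 1) \<and>
   (card (Trans n (face_ideal n G :: 'k ext set)) = 1 \<longleftrightarrow>
   (\<forall>H\<in>{graph_a, graph_b, graph_c}.
     \<not> contains_induced G H \<and> \<not> contains_induced (complement_graph G) H)) \<and>
   ((\<forall>H\<in>{graph_a, graph_b, graph_c}.
     \<not> contains_induced G H \<and> \<not> contains_induced (complement_graph G) H) \<longleftrightarrow>
   (\<exists>k G'. k_near_cone k G G' \<and>
     (semi_complete_bipartite G' \<or> disjoint_union_two_semi_complete G')))"
proof -
 let ?N = "{1..n}"
 obtain E where E: "E \<subseteq> nsub 2 ?N" and G: "G = mk_graph ?N E" using graph_on_mk_graph[OF assms(2)] by blast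
 define M where "M = nsub 2 ?N - E"
 have M: "M \<subseteq> nsub 2 ?N" by (auto simp: M_def)
 define F where "F = Pow ?N - {S. S \<subseteq> ?N \<and> indep M S}"
 have upF: "upclosed n F" unfolding F_def by (rule upclosed_flag)
 have flag: "flag_complex G = {S. S \<subseteq> ?N \<and> indep M S}" unfolding G M_def by (rule flag_complex_mk[OF E])
 have upG: "upclosed n (nonfaces n M)" by (rule upclosed_nonfaces[OF M])
 have compl: "Pow ?N - G = nonfaces n M" unfolding G M_def by (rule graph_nonfaces[OF E])
 have JF: "face_ideal n (flag_complex G) = (fsupp F :: 'k ext set)"
  using face_ideal_fsupp[of n "flag_complex G"] upF unfolding flag F_def by simp
 have JG: "face_ideal n G = (fsupp (nonfaces n M) :: 'k ext set)"
  using face_ideal_fsupp[of n G] upG unfolding compl by simp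
 have F2: "F \<inter> nsub 2 ?N = M"
 proof
  show "F \<inter> nsub 2 ?N \<subseteq> M"
  proof
   fix S assume S: "S \<in> F \<inter> nsub 2 ?N"
   then obtain T where T: "T \<in> M" "T \<subseteq> S" by (auto simp: F_def indep_def)
   have "finite S" "card T = card S" using S T(1) M finite_subset[of S ?N] by (auto simp: nsub_def)
   then have "T = S" using T(2) by (simp add: card_subset_eq)
   then show "S \<in> M" using T(1) by simp
  qed
  show "M \<subseteq> F \<inter> nsub 2 ?N" using M by (auto simp: F_def indep_def nsub_def)
 qed
 \<comment> \<open>For this \<open>U\<close> the bound in \<open>faces\<close> holds for every
   independent set, so \<open>faces\<close> is the flag complex.\<close>
 have good_TF: "card (Trans n (fsupp F :: 'k ext set)) = 1" if good: "good ?N M"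
 proof -
  obtain U \<tau> c where fc: "face_count ?N M U \<tau> c" and U: "\<And>S. S \<subseteq> ?N ==> indep M S ==> card (S \<inter> U) \<le> 2"
   using good_face_count[OF good] by blast
  have "faces ?N M U = {S. S \<subseteq> ?N \<and> indep M S}" using U by (auto simp: faces_def indep_def)
  then show ?thesis using face_count_Trans_single[OF assms(1) fc] upF unfolding F_def by simp
 qed
 \<comment> \<open>With all vertices in \<open>U\<close>, \<open>faces\<close> is the graph itself
   as a complex.\<close>
 have good_TG: "card (Trans n (fsupp (nonfaces n M) :: 'k ext set)) = 1" if good: "good ?N M"
 proof -
  obtain \<tau> where "has_type ?N M \<tau>" using good_has_type[OF good] by blast
  note fc = face_count.full[OF this]
  have "Pow ?N - faces ?N M ?N = nonfaces n M"
  proof (rule Set.set_eqI)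
   fix S
   have "card S = 2" "T = S" if "S \<subseteq> ?N" "T \<in> M" "T \<subseteq> S" "card S \<le> 2" for T
   proof -
    have "finite S" "card T = 2" using that M finite_subset[of S ?N] by (auto simp: nsub_def)
    then show "T = S" using that(3,4) by (simp add: card_seteq)
    then show "card S = 2" using \<open>card T = 2\<close> by simp
   qed
   then show "S \<in> Pow ?N - faces ?N M ?N \<longleftrightarrow> S \<in> nonfaces n M"
    using M by (fastforce simp: faces_def nonfaces_def nsub_def Int_absorb2)
  qed
  then show ?thesis using face_count_Trans_single[OF assms(1) fc] upG by simp
 qed
 have 1: "card (Trans n (fsupp F :: 'k ext set)) = 1 ==> card (Gins n (fsupp F :: 'k ext set)) = 1"
  by (rule Trans_single_Gins_single[OF assms(1) upF])
 have 2: "card (Gins n (fsupp F :: 'k ext set)) = 1 ==> card (Gins n (fsupp (nonfaces n M) :: 'k ext set)) = 1"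
  by (rule Gins_single_degree_two[OF assms(1) upF M F2])
 have 3: "card (Gins n (fsupp (nonfaces n M) :: 'k ext set)) = 1 ==> good ?N M"
  by (rule Gins_single_good[OF assms(1) M])
 have 4: "card (Trans n (fsupp (nonfaces n M) :: 'k ext set)) = 1 ==> card (Gins n (fsupp (nonfaces n M) :: 'k ext set)) = 1"
  by (rule Trans_single_Gins_single[OF assms(1) upG])
 have 5: "(\<forall>H\<in>{graph_a, graph_b, graph_c}. \<not> contains_induced G H \<and> \<not> contains_induced (complement_graph G) H) \<longleftrightarrow> good ?N M"
  unfolding G M_def by (rule induced_iff_good[OF E]) simp
 have 6: "(\<exists>k G'. k_near_cone k G G' \<and> (semi_complete_bipartite G' \<or> disjoint_union_two_semi_complete G')) \<longleftrightarrow> good ?N M"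
  unfolding G M_def by (rule near_cone_iff_good[OF E])
 \<comment> \<open>The implications form a cycle through \<open>Trans\<close> and
   \<open>Gins\<close> of the flag complex, \<open>Gins\<close> of the graph and
   \<open>good\<close>; \<open>Trans\<close> of the graph lies between \<open>good\<close> and
   \<open>Gins\<close> of the graph.\<close>
 show ?thesis unfolding JF JG 5 6 using good_TF good_TG 1 2 3 4 by blast
qed

end
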